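(* Assume that $J$, $\phi$, $\kappa$ satisfy all the assumptions listed in the context, let $p^\kappa$ be the heat kernel of $\mathcal{L}^\kappa$, and let $(P_t^\kappa)_{t\ge0}$ be given by $P_t^\kappa f(x)=\int_{\mathbb{R}^d}p^\kappa(t,x,y)f(y)\,dy$ for $t>0$ and $P_0^\kappa=\mathrm{Id}$. Then: (1) (Generator) Let $\varepsilon>0$. For any $f\in C_b^{2,\varepsilon}(\mathbb{R}^d)$, $$\lim_{t\downarrow0}\frac1t\big(P_t^\kappa f(x)-f(x)\big)=\mathcal{L}^\kappa f(x),$$ and the convergence is uniform in $x\in\mathbb{R}^d$. (2) (Analyticity) The semigroup $(P_t^\kappa)_{t\ge0}$ of $\mathcal{L}^\kappa$ is analytic in $L^p(\mathbb{R}^d)$ for every $p\in[1,\infty)$.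
   Context: Let $d\ge1$ be an integer. $C_b^{2,\varepsilon}(\mathbb{R}^d)$ is the space of bounded twice differentiable functions on $\mathbb{R}^d$ whose second derivatives are uniformly Hölder continuous (with exponent $\varepsilon$). Assumptions on $J$ and $\phi$. $J:(0,\infty)\to(0,\infty)$ is continuous, non-increasing and differentiable; $\phi:[0,1]\to[0,\infty)$ is continuous and strictly increasing with $\phi(0)=0$; there are constants $b>0$, $0<\beta\le1$, $a\ge1$ with $$\frac{a^{-1}}{r^d\phi(r)}\le J(r)\le\frac{a}{r^d\phi(r)}\ (0<r\le1),\qquad J(r)\le a\exp(-br^\beta)\ (r>1);$$ the map $r\mapsto -J'(r)/r$ is non-increasing on $(0,\infty)$; there exist $\alpha_1\in(0,2]$ and $a_1>0$ with $a_1(R/r)^{\alpha_1}\le \phi(R)/\phi(r)$ for $0<r\le R\le1$; and $C_0:=\int_0^1\frac{s}{\phi(s)}ds<\infty$. Assumptions on $\kappa$. $\kappa:\mathbb{R}^d\times\mathbb{R}^d\to(0,\infty)$ is Borel and there are constants $\kappa_0,\kappa_1,\kappa_2>0$ and $\delta\in(0,1)$ such that for all $x,y,z\in\mathbb{R}^d$: $\kappa_0\le\kappa(x,z)\le\kappa_1$, $\kappa(x,z)=\kappa(x,-z)$, $|\kappa(x,z)-\kappa(y,z)|\le\kappa_2|x-y|^\delta$. Operator. For $\varepsilon>0$, $\mathcal{L}^{\kappa,\varepsilon}f(x):=\int_{|z|>\varepsilon}(f(x+z)-f(x))\kappa(x,z)J(|z|)\,dz$, and $\mathcal{L}^\kappa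 f(x)=\mathcal{L}^{\kappa,0}f(x):=\lim_{\varepsilon\downarrow0}\mathcal{L}^{\kappa,\varepsilon}f(x)$. Functions. $\Phi(r):=\dfrac{r^2}{2\int_0^r\frac{s}{\phi(s)}ds}$ for $0<r\le1$, $\Phi(r):=\Phi(1)r^2$ for $r>1$; $\Phi$ is a continuous strictly increasing bijection of $(0,\infty)$ with inverse $\Phi^{-1}$. $\theta(r):=\frac1{r^d\Phi(r)}$ for $0<r\le1$; for $r>1$, $\theta(r):=\exp(-br^\beta)$ if $0<\beta<1$ and $\theta(r):=r^{-d-1}\exp(-\frac b5r)$ if $\beta=1$. $\mathscr{G}(t,x):=\frac1{t\Phi^{-1}(t)^d}\wedge\theta(|x|)$ and $\tilde{\mathscr{G}}(t,x):=\frac1{t\Phi^{-1}(t)^d}\wedge\frac1{|x|^d\Phi(|x|)}$, with $u\wedge v=\min\{u,v\}$ and second entries read as $+\infty$ at $0$. Heat kernel. $p^\kappa$ is the unique jointly continuous function on $(0,\infty)\times\mathbb{R}^d\times\mathbb{R}^d$ solving $\partial_tp^\kappa(t,x,y)=\mathcal{L}^\kappa p^\kappa(t,\cdot,y)(x)$ for $x\ne y$ and such that: (i) for every $T\ge1$ there is $c>0$ with $p^\kappa(t,x,y)\le c\,t\,\mathscr{G}(t,x-y)$ for $t\in(0,T]$, $x,y\in\mathbb{R}^d$; (ii) for $x\ne y$, $t\mapsto\mathcal{L}^\kappa p^\kappa(t,\cdot,y)(x)$ is continuous, and for every $T\ge1$ there is $c>0$ with $|\mathcal{L}^{\kappa,\varepsilon}p^\kappa(t,\cdot,y)(x)|\le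 c\,\tilde{\mathscr{G}}(t,x-y)$ for $t\in(0,T]$, $\varepsilon\in[0,1]$, $x,y\in\mathbb{R}^d$; (iii) $\lim_{t\downarrow0}\sup_x|\int p^\kappa(t,x,y)f(y)dy-f(x)|=0$ for every bounded uniformly continuous $f$. *)

theory Defs
  imports "HOL-Analysis.Analysis"
begin

section \<open>Assumptions on the jumping kernel and on the coefficient\<close>

text \<open>
  The functions \<open>J\<close> on \<open>(0,\<infinity>)\<close> and \<open>\<phi>\<close> on \<open>[0,1]\<close> are represented by total functions;
  their values outside these domains are never used.  The number \<open>d\<close> is the dimension.
\<close>

definition jump_kernel_assms ::
  "nat \<Rightarrow> (real \<Rightarrow> real) \<Rightarrow> (real \<Rightarrow> real) \<Rightarrow> real \<Rightarrow> real \<Rightarrow> real \<Rightarrow> real \<Rightarrow> real \<Rightarrow> bool"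
  where "jump_kernel_assms d J \<phi> a b \<beta> \<alpha>1 a1 \<longleftrightarrow>
    (\<forall>r>0. J r > 0) \<and> continuous_on {0<..} J \<and> antimono_on {0<..} J \<and>
    (\<forall>r>0. J differentiable (at r)) \<and>
    (\<forall>r\<in>{0..1}. \<phi> r \<ge> 0) \<and> continuous_on {0..1} \<phi> \<and> strict_mono_on {0..1} \<phi> \<and> \<phi> 0 = 0 \<and>
    b > 0 \<and> 0 < \<beta> \<and> \<beta> \<le> 1 \<and> a \<ge> 1 \<and>
    (\<forall>r. 0 < r \<and> r \<le> 1 \<longrightarrow>
       inverse a / (r ^ d * \<phi> r) \<le> J r \<and> J r \<le> a / (r ^ d * \<phi> r)) \<and>
    (\<forall>r>1. J r \<le> a * exp (- b * r powr \<beta>)) \<and>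
    antimono_on {0<..} (\<lambda>r. - deriv J r / r) \<and>
    0 < \<alpha>1 \<and> \<alpha>1 \<le> 2 \<and> a1 > 0 \<and>
    (\<forall>r R. 0 < r \<and> r \<le> R \<and> R \<le> 1 \<longrightarrow> a1 * (R / r) powr \<alpha>1 \<le> \<phi> R / \<phi> r) \<and>
    set_integrable lborel {0<..1} (\<lambda>s. s / \<phi> s)"

definition coefficient_assms ::
  "('a::euclidean_space \<Rightarrow> 'a \<Rightarrow> real) \<Rightarrow> real \<Rightarrow> real \<Rightarrow> real \<Rightarrow> real \<Rightarrow> bool"
  where "coefficient_assms \<kappa> \<kappa>0 \<kappa>1 \<kappa>2 \<delta> \<longleftrightarrow>
    (\<forall>x z. \<kappa> x z > 0) \<and> (\<lambda>(x, z). \<kappa> x z) \<in> borel_measurable borel \<and>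
    \<kappa>0 > 0 \<and> \<kappa>1 > 0 \<and> \<kappa>2 > 0 \<and> 0 < \<delta> \<and> \<delta> < 1 \<and>
    (\<forall>x z. \<kappa>0 \<le> \<kappa> x z \<and> \<kappa> x z \<le> \<kappa>1) \<and>
    (\<forall>x z. \<kappa> x z = \<kappa> x (- z)) \<and>
    (\<forall>x y z. \<bar>\<kappa> x z - \<kappa> y z\<bar> \<le> \<kappa>2 * norm (x - y) powr \<delta>)"


section \<open>The nonlocal operator\<close>

definition jump_op_trunc ::
  "('a::euclidean_space \<Rightarrow> 'a \<Rightarrow> real) \<Rightarrow> (real \<Rightarrow> real) \<Rightarrow> real \<Rightarrow> ('a \<Rightarrow> real) \<Rightarrow> 'a \<Rightarrow> real"
  where "jump_op_trunc \<kappa> J \<epsilon> f x =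
    (LINT z:{z. norm z > \<epsilon>}|lborel. (f (x + z) - f x) * \<kappa> x z * J (norm z))"

definition jump_op ::
  "('a::euclidean_space \<Rightarrow> 'a \<Rightarrow> real) \<Rightarrow> (real \<Rightarrow> real) \<Rightarrow> ('a \<Rightarrow> real) \<Rightarrow> 'a \<Rightarrow> real"
  where "jump_op \<kappa> J f x = Lim (at_right 0) (\<lambda>\<epsilon>. jump_op_trunc \<kappa> J \<epsilon> f x)"

text \<open>
  The constant \<^const>\<open>Lim\<close> is total, so the existence of the limit that defines
  \<^const>\<open>jump_op\<close> is a separate condition.
\<close>

definition jump_op_exists ::
  "('a::euclidean_space \<Rightarrow> 'a \<Rightarrow> real) \<Rightarrow> (real \<Rightarrow> real) \<Rightarrow> ('a \<Rightarrow> real) \<Rightarrow> 'a \<Rightarrow> bool"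
  where "jump_op_exists \<kappa> J f x \<longleftrightarrow>
    (\<exists>l. ((\<lambda>\<epsilon>. jump_op_trunc \<kappa> J \<epsilon> f x) \<longlongrightarrow> l) (at_right 0))"


section \<open>Scale functions\<close>

definition Phi :: "(real \<Rightarrow> real) \<Rightarrow> real \<Rightarrow> real"
  where "Phi \<phi> r =
    (let F = (\<lambda>u. u\<^sup>2 / (2 * (LINT s:{0<..u}|lborel. s / \<phi> s)))
     in if r \<le> 1 then F r else F 1 * r\<^sup>2)"

definition Phi_inv :: "(real \<Rightarrow> real) \<Rightarrow> real \<Rightarrow> real"
  where "Phi_inv \<phi> = the_inv_into {0<..} (Phi \<phi>)"

definition theta :: "nat \<Rightarrow> (real \<Rightarrow> real) \<Rightarrow> real \<Rightarrow> real \<Rightarrow> real \<Rightarrow> real"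
  where "theta d \<phi> b \<beta> r =
    (if r \<le> 1 then 1 / (r ^ d * Phi \<phi> r)
     else if \<beta> < 1 then exp (- b * r powr \<beta>)
     else exp (- (b / 5) * r) / r ^ (d + 1))"

text \<open>In the next two definitions the second entry of the minimum is \<open>+\<infinity>\<close> at the origin.\<close>

definition G_bound ::
  "(real \<Rightarrow> real) \<Rightarrow> real \<Rightarrow> real \<Rightarrow> real \<Rightarrow> 'a::euclidean_space \<Rightarrow> real"
  where "G_bound \<phi> b \<beta> t x =
    (let u = 1 / (t * Phi_inv \<phi> t ^ DIM('a))
     in if x = 0 then u else min u (theta DIM('a) \<phi> b \<beta> (norm x)))"

definition G_tilde_bound :: "(real \<Rightarrow> real) \<Rightarrow> real \<Rightarrow> 'a::euclidean_space \<Rightarrow> real"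
  where "G_tilde_bound \<phi> t x =
    (let u = 1 / (t * Phi_inv \<phi> t ^ DIM('a))
     in if x = 0 then u else min u (1 / (norm x ^ DIM('a) * Phi \<phi> (norm x))))"


section \<open>The heat kernel and its semigroup\<close>

text \<open>
  The values of \<open>p\<close> at non-positive times are unconstrained.  The bound on the operator at
  truncation levels \<open>\<epsilon> \<in> [0,1]\<close> is split into \<open>\<epsilon> \<in> (0,1]\<close> and the limit operator; as it covers
  \<open>x = y\<close>, the limit is required to exist there, too.
\<close>

definition heat_kernel ::
  "(real \<Rightarrow> real) \<Rightarrow> (real \<Rightarrow> real) \<Rightarrow> real \<Rightarrow> real \<Rightarrow> ('a::euclidean_space \<Rightarrow> 'a \<Rightarrow> real) \<Rightarrow>
    (real \<Rightarrow> 'a \<Rightarrow> 'a \<Rightarrow> real) \<Rightarrow> bool"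
  where "heat_kernel J \<phi> b \<beta> \<kappa> p \<longleftrightarrow>
    continuous_on ({0<..} \<times> UNIV \<times> UNIV) (\<lambda>(t, x, y). p t x y) \<and>
    (\<forall>t>0. \<forall>x y. jump_op_exists \<kappa> J (\<lambda>w. p t w y) x) \<and>
    (\<forall>t>0. \<forall>x y. x \<noteq> y \<longrightarrow>
       ((\<lambda>s. p s x y) has_real_derivative jump_op \<kappa> J (\<lambda>w. p t w y) x) (at t)) \<and>
    (\<forall>T\<ge>1. \<exists>c>0. \<forall>t\<in>{0<..T}. \<forall>x y. p t x y \<le> c * t * G_bound \<phi> b \<beta> t (x - y)) \<and>
    (\<forall>x y. x \<noteq> y \<longrightarrow> continuous_on {0<..} (\<lambda>t. jump_op \<kappa> J (\<lambda>w. p t w y) x)) \<and>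
    (\<forall>T\<ge>1. \<exists>c>0. \<forall>t\<in>{0<..T}. \<forall>x y.
       (\<forall>\<epsilon>\<in>{0<..1}. \<bar>jump_op_trunc \<kappa> J \<epsilon> (\<lambda>w. p t w y) x\<bar> \<le> c * G_tilde_bound \<phi> t (x - y)) \<and>
       \<bar>jump_op \<kappa> J (\<lambda>w. p t w y) x\<bar> \<le> c * G_tilde_bound \<phi> t (x - y)) \<and>
    (\<forall>f::'a \<Rightarrow> real. bounded (range f) \<and> uniformly_continuous_on UNIV f \<longrightarrow>
       uniform_limit UNIV (\<lambda>t x. LINT y|lborel. p t x y * f y) f (at_right 0))"

text \<open>
  The values of \<open>f\<close> are real or complex: analyticity of a semigroup concerns its action on
  the complex \<open>L\<^sup>q\<close> spaces.
\<close>

definition heat_semigroup ::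
  "(real \<Rightarrow> 'a::euclidean_space \<Rightarrow> 'a \<Rightarrow> real) \<Rightarrow> real \<Rightarrow>
    ('a \<Rightarrow> 'b::{banach, second_countable_topology}) \<Rightarrow> 'a \<Rightarrow> 'b"
  where "heat_semigroup p t f x = (if t = 0 then f x else (LINT y|lborel. p t x y *\<^sub>R f y))"


section \<open>Hoelder functions\<close>

definition Cb2_holder :: "real \<Rightarrow> ('a::euclidean_space \<Rightarrow> real) set"
  where "Cb2_holder \<epsilon> = {f. bounded (range f) \<and>
    (\<exists>(f' :: 'a \<Rightarrow> 'a \<Rightarrow>\<^sub>L real) (f'' :: 'a \<Rightarrow> 'a \<Rightarrow>\<^sub>L 'a \<Rightarrow>\<^sub>L real).
       (\<forall>x. (f has_derivative blinfun_apply (f' x)) (at x)) \<and>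
       (\<forall>x. (f' has_derivative blinfun_apply (f'' x)) (at x)) \<and>
       (\<exists>C. \<forall>x y. norm (f'' x - f'' y) \<le> C * norm (x - y) powr \<epsilon>))}"


section \<open>Analytic semigroups on complex \<open>L\<^sup>q\<close> spaces\<close>

text \<open>
  Elements of \<open>L\<^sup>q\<close> are represented by Borel functions; operators act on representatives, and
  equality of elements of \<open>L\<^sup>q\<close> is equality almost everywhere.
\<close>

definition Lq_space :: "real \<Rightarrow> ('a::euclidean_space \<Rightarrow> complex) set"
  where "Lq_space q =
    {f \<in> borel_measurable lborel. integrable lborel (\<lambda>x. norm (f x) powr q)}"

definition Lq_norm :: "real \<Rightarrow> ('a::euclidean_space \<Rightarrow> complex) \<Rightarrow> real"
  where "Lq_norm q f = (LINT x|lborel. norm (f x) powr q) powr (1 / q)"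

text \<open>
  Linearity and boundedness together make such an operator respect equality almost everywhere.
\<close>

definition Lq_bounded_linear ::
  "real \<Rightarrow> (('a::euclidean_space \<Rightarrow> complex) \<Rightarrow> ('a \<Rightarrow> complex)) \<Rightarrow> bool"
  where "Lq_bounded_linear q A \<longleftrightarrow>
    (\<forall>f\<in>Lq_space q. A f \<in> Lq_space q) \<and>
    (\<forall>f\<in>Lq_space q. \<forall>g\<in>Lq_space q. AE x in lborel. A (\<lambda>y. f y + g y) x = A f x + A g x) \<and>
    (\<forall>c. \<forall>f\<in>Lq_space q. AE x in lborel. A (\<lambda>y. c * f y) x = c * A f x) \<and>
    (\<exists>C. \<forall>f\<in>Lq_space q. Lq_norm q (A f) \<le> C * Lq_norm q f)"

text \<open>Complex differentiability of an operator-valued function with respect to the operator norm.\<close>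

definition Lq_op_holomorphic_on ::
  "real \<Rightarrow> (complex \<Rightarrow> ('a::euclidean_space \<Rightarrow> complex) \<Rightarrow> ('a \<Rightarrow> complex)) \<Rightarrow> complex set \<Rightarrow> bool"
  where "Lq_op_holomorphic_on q S D \<longleftrightarrow>
    (\<forall>z\<in>D. \<exists>S'. Lq_bounded_linear q S' \<and>
      (\<forall>\<eta>>0. \<forall>\<^sub>F w in at z within D. \<forall>f\<in>Lq_space q.
        Lq_norm q (\<lambda>x. (S w f x - S z f x) / (w - z) - S' f x) \<le> \<eta> * Lq_norm q f))"

definition sector :: "real \<Rightarrow> complex set"
  where "sector \<omega> = {z. z \<noteq> 0 \<and> \<bar>Arg z\<bar> < \<omega>}"

text \<open>
  A family \<open>P t\<close>, \<open>t \<ge> 0\<close>, is an analytic semigroup on \<open>L\<^sup>q\<close> if it extends to a family \<open>S z\<close> of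
  bounded operators, with \<open>z\<close> in a sector around the positive half-axis or \<open>z = 0\<close>, that is
  holomorphic in the sector, has the semigroup property, and is strongly continuous at 0.
\<close>

definition analytic_semigroup_on_Lq ::
  "real \<Rightarrow> (real \<Rightarrow> ('a::euclidean_space \<Rightarrow> complex) \<Rightarrow> ('a \<Rightarrow> complex)) \<Rightarrow> bool"
  where "analytic_semigroup_on_Lq q P \<longleftrightarrow>
    (\<exists>\<omega> S. 0 < \<omega> \<and> \<omega> \<le> pi / 2 \<and>
      (\<forall>t\<ge>0. \<forall>f\<in>Lq_space q. P t f \<in> Lq_space q \<and> (AE x in lborel. S (of_real t) f x = P t f x)) \<and>
      (\<forall>z\<in>insert 0 (sector \<omega>). Lq_bounded_linear q (S z)) \<and>
      Lq_op_holomorphic_on q S (sector \<omega>) \<and>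
      (\<forall>f\<in>Lq_space q. AE x in lborel. S 0 f x = f x) \<and>
      (\<forall>z\<in>insert 0 (sector \<omega>). \<forall>w\<in>insert 0 (sector \<omega>). \<forall>f\<in>Lq_space q.
         AE x in lborel. S (z + w) f x = S z (S w f) x) \<and>
      (\<forall>f\<in>Lq_space q.
         ((\<lambda>z. Lq_norm q (\<lambda>x. S z f x - f x)) \<longlongrightarrow> 0) (at 0 within sector \<omega>)))"

end

theory Submission
  imports Defs "HOL-Complex_Analysis.Cauchy_Integral_Formula"
begin

text \<open>
  The kernel is given only through its equation, a one-sided upper bound and its initial values.
  What makes this enough is a maximum principle on the whole space: since \<open>\<kappa>(x, \<cdot>)\<close> is even, the
  operator maps \<open>|x|\<^sup>2\<close> to a bounded function, so \<open>|x|\<^sup>2\<close> is a barrier at infinity and a bounded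
  solution never exceeds its initial values (\<open>maximum_principle\<close>).  For
  \<open>P\<^sub>t f(x) = \<integral> p(t,x,y) f(y) dy\<close> this gives positivity, total mass one and, as both sides
  solve the equation, \<open>P\<^sub>t\<^sub>+\<^sub>s = P\<^sub>t P\<^sub>s\<close>, the Chapman--Kolmogorov equation
  (\<open>p_nonneg\<close>, \<open>p_mass\<close>, \<open>chapman_kolmogorov\<close>).  For \<open>P\<^sub>t f\<close> to be defined and to solve the equation, the
  kernel has to be integrable in \<open>y\<close> although it is bounded from above only; away from the
  diagonal a lower bound follows from the bound on the time derivative (\<open>p_off_diagonal\<close>).

  For the generator, let \<open>g\<close> be the image of \<open>f\<close> under the operator.  The image is bounded and uniformly
  continuous, as \<open>f\<close> has second differences of quadratic order and \<open>\<kappa>\<close> is Hoelder continuous in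
  its first argument.  The function \<open>P\<^sub>t f - f - t P\<^sub>\<eta> g\<close> vanishes at \<open>t = 0\<close> and solves the equation up
  to an error that for small \<open>t\<close> is of the size of \<open>g - P\<^sub>\<eta> g\<close>, which for small \<open>\<eta>\<close> the initial condition makes uniformly small; the
  maximum principle turns this into the uniform convergence of the difference quotients
  (\<open>generator_estimate\<close>).

  Analyticity rests on the bound \<open>C/t\<close> for the integrals of \<open>|\<partial>\<^sub>t p(t,x,y)|\<close> in \<open>x\<close> and in \<open>y\<close>, that is, for
  the Schur norm of \<open>\<partial>\<^sub>t p(t)\<close>.  By the Chapman--Kolmogorov equation \<open>\<partial>\<^sub>t\<^sup>n p(t)\<close> is a composition of
  \<open>n\<close> factors \<open>\<partial>\<^sub>t p(t/(n+1))\<close> and one factor \<open>p(t/(n+1))\<close>, so its Schur norm is at most a constant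
  times \<open>(C(n+1)/t)\<^sup>n\<close>, and thus at most a constant times \<open>n! (eC/t)\<^sup>n\<close> (\<open>kn_schur\<close>).
  Hence the Taylor series in time converges in a sector and extends the kernel to complex times.
  The Cauchy product of two such series gives the semigroup property (\<open>kz_compose\<close>), the
  termwise derivative the holomorphy in the Schur norm (\<open>kz_difference_quotient\<close>), and the Schur
  test (\<open>schur_test\<close>) bounds the operators on \<open>L\<^sup>q\<close> for every \<open>q\<close> at once.  The factor
  \<open>exp (- \<omega> t)\<close> makes the estimates uniform for large times.  Strong continuity on \<open>L\<^sup>q\<close> follows from
  the initial condition by density (\<open>strongly_continuous_Lq\<close>).
\<close>

section \<open>Radial integrals\<close>

definition sphere_area :: "'a::euclidean_space itself \<Rightarrow> real"
  where "sphere_area _ = real DIM('a) * unit_ball_vol (real DIM('a))"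

lemma sphere_area_pos [simp]: "sphere_area TYPE('a::euclidean_space) > 0"
  by (simp add: sphere_area_def)

text \<open>
  Polar coordinates for radial functions: the image of Lebesgue measure under the norm has the
  density of the surface measure of spheres, since both measures agree on the half-lines
  \<open>{..r}\<close> by the formula for the volume of a ball.
\<close>

lemma distr_norm_lborel:
  "distr (lborel :: 'a::euclidean_space measure) borel norm =
   density lborel (\<lambda>s. ennreal (sphere_area TYPE('a) * s ^ (DIM('a) - 1)) * indicator {0..} s)"
  (is "?M = ?N")
proof (rule measure_eqI_generator_eq[where \<Omega>=UNIV and E="range atMost" and A="\<lambda>n. {..real n}"])
  let ?d = "DIM('a)"
  let ?v = "unit_ball_vol (real ?d)"
  have M: "emeasure ?M {..r} = (if 0 \<le> r then ennreal (?v * r ^ ?d) else 0)" for r :: real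
  proof -
    have "norm -` {..r} = (cball 0 r :: 'a set)" by auto
    then show ?thesis by (auto simp: emeasure_distr emeasure_cball)
  qed
  have N: "emeasure ?N {..r} = (if 0 \<le> r then ennreal (?v * r ^ ?d) else 0)" for r :: real
  proof (cases "0 \<le> r")
    case True
    have "emeasure ?N {..r} =
        (\<integral>\<^sup>+s. ennreal (sphere_area TYPE('a) * s ^ (?d - 1)) * indicator {0..r} s \<partial>lborel)"
      by (subst emeasure_density) (auto intro!: nn_integral_cong simp: indicator_def)
    also have "\<dots> = ennreal (?v * r ^ ?d - ?v * 0 ^ ?d)"
    proof (rule nn_integral_FTC_Icc)
      show "DERIV (\<lambda>s. ?v * s ^ ?d) x :> sphere_area TYPE('a) * x ^ (?d - 1)" for x
        by (auto intro!: derivative_eq_intros simp: sphere_area_def)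
    qed (use True in \<open>auto simp: sphere_area_def\<close>)
    finally show ?thesis using True by simp
  next
    case False
    then have "emeasure ?N {..r} = (\<integral>\<^sup>+(s::real). 0 \<partial>lborel)"
      by (subst emeasure_density, simp, simp, intro nn_integral_cong) (auto simp: indicator_def)
    then show ?thesis using False by simp
  qed
  show "emeasure ?M X = emeasure ?N X" if "X \<in> range atMost" for X using that M N by auto
  show "emeasure ?M {..real n} \<noteq> \<infinity>" for n :: nat using M[of "real n"] by simp
  show "Int_stable (range (atMost :: real \<Rightarrow> real set))"
    by (auto simp: Int_stable_def)
  show "(\<Union>i. {..real i}) = UNIV" by (auto simp: real_arch_simple)
qed (auto simp: borel_eq_atMost)

lemma nn_integral_norm:
  assumes [measurable]: "g \<in> borel_measurable borel"
  shows "(\<integral>\<^sup>+x. g (norm (x::'a::euclidean_space)) \<partial>lborel) =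
    (\<integral>\<^sup>+s. ennreal (sphere_area TYPE('a) * s ^ (DIM('a) - 1)) * indicator {0..} s * g s \<partial>lborel)"
proof -
  have "(\<integral>\<^sup>+x. g (norm (x::'a)) \<partial>lborel) = (\<integral>\<^sup>+s. g s \<partial>distr (lborel :: 'a measure) borel norm)"
    by (subst nn_integral_distr) auto
  also have "\<dots> = (\<integral>\<^sup>+s. ennreal (sphere_area TYPE('a) * s ^ (DIM('a) - 1)) * indicator {0..} s * g s \<partial>lborel)"
    unfolding distr_norm_lborel by (subst nn_integral_density) auto
  finally show ?thesis .
qed

text \<open>The tail integral of \<open>|x|\<^sup>-\<^sup>d\<^sup>-\<^sup>\<alpha>\<close>, which dominates all the tails below.\<close>

lemma nn_integral_norm_power_tail:
  assumes "0 < r" "0 < \<alpha>"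
  shows "(\<integral>\<^sup>+x. ennreal (norm x powr - \<alpha> / norm (x::'a::euclidean_space) ^ DIM('a)) *
      indicator {x. r < norm x} x \<partial>lborel) \<le> ennreal (sphere_area TYPE('a) / \<alpha> * r powr - \<alpha>)"
proof -
  define A where "A = sphere_area TYPE('a)"
  have A: "A > 0" by (simp add: A_def)
  have "(\<integral>\<^sup>+x. ennreal (norm x powr - \<alpha> / norm (x::'a) ^ DIM('a)) * indicator {x. r < norm x} x \<partial>lborel)
      = (\<integral>\<^sup>+x. ennreal (norm x powr - \<alpha> / norm (x::'a) ^ DIM('a)) * indicator {r<..} (norm x) \<partial>lborel)"
    by (intro nn_integral_cong) (auto simp: indicator_def)
  also have "\<dots> = (\<integral>\<^sup>+s. ennreal (A * s ^ (DIM('a) - 1)) * indicator {0..} s *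
      (ennreal (s powr - \<alpha> / s ^ DIM('a)) * indicator {r<..} s) \<partial>lborel)"
    unfolding A_def by (subst nn_integral_norm[symmetric]) auto
  also have "\<dots> \<le> (\<integral>\<^sup>+s. ennreal (A * s powr (- \<alpha> - 1)) * indicator {r..} s \<partial>lborel)"
  proof (intro nn_integral_mono)
    fix s :: real
    have "A * s ^ (DIM('a) - 1) * (s powr - \<alpha> / s ^ DIM('a)) = A * s powr (- \<alpha> - 1)" if "s > r"
    proof -
      have "s > 0" using that assms by simp
      have "s ^ DIM('a) = s ^ (DIM('a) - 1) * s" using DIM_positive[where 'a='a]
        by (metis Suc_pred' power_Suc2)
      then show ?thesis using \<open>s > 0\<close> by (simp add: powr_diff field_simps)
    qed
    then show "ennreal (A * s ^ (DIM('a) - 1)) * indicator {0..} s *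
      (ennreal (s powr - \<alpha> / s ^ DIM('a)) * indicator {r<..} s)
      \<le> ennreal (A * s powr (- \<alpha> - 1)) * indicator {r..} s"
      using A assms by (auto simp: indicator_def ennreal_mult[symmetric])
  qed
  also have "\<dots> = ennreal (0 - (- (A / \<alpha>) * r powr - \<alpha>))"
  proof (rule nn_integral_FTC_atLeast)
    show "DERIV (\<lambda>s. - (A / \<alpha>) * s powr - \<alpha>) x :> A * x powr (- \<alpha> - 1)" if "r \<le> x" for x
      using that assms by (auto intro!: derivative_eq_intros simp: powr_diff)
    show "((\<lambda>s. - (A / \<alpha>) * s powr - \<alpha>) \<longlongrightarrow> 0) at_top"
    proof (rule tendsto_mult_right_zero)
      show "((\<lambda>s. s powr - \<alpha>) \<longlongrightarrow> 0) at_top"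
        using assms by (intro tendsto_neg_powr filterlim_ident) auto
    qed
  qed (use A in auto)
  finally show ?thesis by (simp add: A_def)
qed

text \<open>Stretched exponential decay beats every power.\<close>

lemma power_div_fact_le_exp:
  fixes x :: real
  assumes "x \<ge> 0"
  shows "x ^ n / fact n \<le> exp x"
proof -
  have "(\<Sum>k\<in>{n}. inverse (fact k) * x ^ k) \<le> (\<Sum>k. inverse (fact k) * x ^ k)"
    using assms by (intro sum_le_suminf summable_exp) auto
  then show ?thesis by (simp add: exp_def divide_inverse mult.commute)
qed

lemma power_le_exp_powr:
  fixes b \<beta> :: real
  assumes "0 < b" "0 < \<beta>"
  obtains C where "C > 0" "\<And>s. s \<ge> 1 \<Longrightarrow> s ^ n * exp (- b * s powr \<beta>) \<le> C"
proof -
  define N where "N = nat \<lceil>real n / \<beta>\<rceil>"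
  have N: "real n \<le> real N * \<beta>"
  proof -
    have "real n / \<beta> \<le> real N" unfolding N_def by linarith
    then show ?thesis using assms by (simp add: field_simps)
  qed
  define C where "C = fact N / b ^ N"
  have "s ^ n * exp (- b * s powr \<beta>) \<le> C" if s: "s \<ge> 1" for s
  proof -
    have "s ^ n = s powr real n" using s by (simp add: powr_realpow)
    also have "\<dots> \<le> s powr (\<beta> * real N)" using s N by (intro powr_mono) (auto simp: mult.commute)
    also have "\<dots> = (s powr \<beta>) ^ N" using s by (simp add: powr_powr[symmetric] powr_realpow)
    finally have 1: "s ^ n \<le> (s powr \<beta>) ^ N" .
    have "(b * s powr \<beta>) ^ N / fact N \<le> exp (b * s powr \<beta>)"
      using assms by (intro power_div_fact_le_exp) auto
    then have "(s powr \<beta>) ^ N \<le> C * exp (b * s powr \<beta>)"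
      using assms by (simp add: C_def field_simps power_mult_distrib)
    with 1 have "s ^ n \<le> C * exp (b * s powr \<beta>)" by simp
    then have "s ^ n * exp (- b * s powr \<beta>) \<le> C * exp (b * s powr \<beta>) * exp (- b * s powr \<beta>)"
      by (intro mult_right_mono) auto
    then show ?thesis by (simp add: exp_minus field_simps)
  qed
  moreover have "C > 0" using assms by (simp add: C_def)
  ultimately show thesis using that by blast
qed

section \<open>The scale function\<close>

lemma set_integral_id_Ioc:
  fixes u v :: real
  assumes "u \<le> v"
  shows "set_integrable lborel {u<..v} (\<lambda>s. s)" "(LINT s:{u<..v}|lborel. s) = (v\<^sup>2 - u\<^sup>2) / 2"
proof -
  have *: "has_bochner_integral lborel (\<lambda>x. x * indicator {u..v} x) (v\<^sup>2 / 2 - u\<^sup>2 / 2)"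
    using assms by (intro has_bochner_integral_FTC_Icc_real)
      (auto intro!: derivative_eq_intros continuous_intros)
  have **: "has_bochner_integral lborel (\<lambda>x. indicator {u<..v} x *\<^sub>R x) (v\<^sup>2 / 2 - u\<^sup>2 / 2)"
    by (rule has_bochner_integralI_AE[OF *])
      (auto intro!: AE_I'[of "{u}"] simp: indicator_def split: if_splits)
  show "set_integrable lborel {u<..v} (\<lambda>s. s)" "(LINT s:{u<..v}|lborel. s) = (v\<^sup>2 - u\<^sup>2) / 2"
    using ** unfolding set_integrable_def set_lebesgue_integral_def
    by (auto simp: has_bochner_integral_iff diff_divide_distrib)
qed

locale nonlocal_operator =
  fixes J \<phi> :: "real \<Rightarrow> real"
    and a b \<beta> \<alpha>1 a1 \<kappa>0 \<kappa>1 \<kappa>2 \<delta> :: real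
    and \<kappa> :: "'a::euclidean_space \<Rightarrow> 'a \<Rightarrow> real"
  assumes jump: "jump_kernel_assms DIM('a) J \<phi> a b \<beta> \<alpha>1 a1"
    and coeff: "coefficient_assms \<kappa> \<kappa>0 \<kappa>1 \<kappa>2 \<delta>"
begin

lemma
  shows b_pos: "b > 0" and beta_pos: "\<beta> > 0" and a_ge_1: "a \<ge> 1" and \<alpha>1_pos: "\<alpha>1 > 0" and \<alpha>1_le: "\<alpha>1 \<le> 2"
    and a1_pos: "a1 > 0" and \<kappa>1_pos: "\<kappa>1 > 0" and \<kappa>2_pos: "\<kappa>2 > 0" and \<delta>_pos: "\<delta> > 0"
  using jump coeff unfolding jump_kernel_assms_def coefficient_assms_def by blast+

lemma
  shows phi_strict_mono: "strict_mono_on {0..1} \<phi>" and phi_0: "\<phi> 0 = 0"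
    and integrable_phi_1: "set_integrable lborel {0<..1} (\<lambda>s. s / \<phi> s)"
  using jump unfolding jump_kernel_assms_def by blast+

lemma phi_less: "0 \<le> s \<Longrightarrow> s < t \<Longrightarrow> t \<le> 1 \<Longrightarrow> \<phi> s < \<phi> t"
  using strict_mono_onD[OF phi_strict_mono, of s t] by auto

lemma phi_pos: "0 < s \<Longrightarrow> s \<le> 1 \<Longrightarrow> \<phi> s > 0"
  using phi_less[of 0 s] phi_0 by simp

lemma phi_scaling: "0 < r \<Longrightarrow> r \<le> R \<Longrightarrow> R \<le> 1 \<Longrightarrow> a1 * (R / r) powr \<alpha>1 \<le> \<phi> R / \<phi> r"
  using jump unfolding jump_kernel_assms_def by blast

lemma a1_le_1: "a1 \<le> 1"
  using phi_scaling[of 1 1] phi_pos[of 1] by simp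

lemma integrable_phi:
  assumes "0 \<le> u" "v \<le> 1"
  shows "set_integrable lborel {u<..v} (\<lambda>s. s / \<phi> s)"
proof (rule set_integrable_subset)
  show "set_integrable lborel {0<..1} (\<lambda>s. s / \<phi> s)" by (rule integrable_phi_1)
qed (use assms in auto)

text \<open>
  The integral in the definition of \<open>\<Phi>\<close>, so that \<open>\<Phi>(r) = r\<^sup>2 / (2 F(r))\<close> on \<open>(0,1]\<close>.
\<close>

definition F :: "real \<Rightarrow> real"
  where "F r = (LINT s:{0<..r}|lborel. s / \<phi> s)"

lemma phi_integral_lower:
  assumes "0 \<le> u" "u \<le> v" "v \<le> 1"
  shows "(v\<^sup>2 - u\<^sup>2) / (2 * \<phi> v) \<le> (LINT s:{u<..v}|lborel. s / \<phi> s)"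
proof -
  have "(v\<^sup>2 - u\<^sup>2) / (2 * \<phi> v) = (LINT s:{u<..v}|lborel. s * (1 / \<phi> v))"
    by (subst set_integral_mult_left) (simp add: set_integral_id_Ioc(2)[OF assms(2)])
  also have "\<dots> \<le> (LINT s:{u<..v}|lborel. s / \<phi> s)"
  proof (rule set_integral_mono)
    show "set_integrable lborel {u<..v} (\<lambda>s. s * (1 / \<phi> v))"
      by (intro set_integrable_mult_left set_integral_id_Ioc assms)
    fix s assume s: "s \<in> {u<..v}"
    then have "\<phi> s \<le> \<phi> v" using phi_less[of s v] assms by (cases "s = v") auto
    then show "s * (1 / \<phi> v) \<le> s / \<phi> s" using s assms phi_pos[of s]
      by (auto simp: divide_simps intro!: mult_left_mono)
  qed (use assms integrable_phi in auto)
  finally show ?thesis .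
qed

lemma phi_integral_upper:
  assumes "0 < u" "u \<le> v" "v \<le> 1"
  shows "(LINT s:{u<..v}|lborel. s / \<phi> s) \<le> (v\<^sup>2 - u\<^sup>2) / (2 * \<phi> u)"
proof -
  have "(LINT s:{u<..v}|lborel. s / \<phi> s) \<le> (LINT s:{u<..v}|lborel. s * (1 / \<phi> u))"
  proof (rule set_integral_mono)
    show "set_integrable lborel {u<..v} (\<lambda>s. s * (1 / \<phi> u))"
      by (intro set_integrable_mult_left set_integral_id_Ioc assms)
    fix s assume s: "s \<in> {u<..v}"
    then have "\<phi> u \<le> \<phi> s" using phi_less[of u s] assms by auto
    then show "s / \<phi> s \<le> s * (1 / \<phi> u)" using s assms phi_pos[of u]
      by (auto simp: divide_simps intro!: mult_left_mono)
  qed (use assms integrable_phi in auto)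
  also have "\<dots> = (v\<^sup>2 - u\<^sup>2) / (2 * \<phi> u)"
    by (subst set_integral_mult_left) (simp add: set_integral_id_Ioc(2)[OF assms(2)])
  finally show ?thesis .
qed

lemma F_split:
  assumes "0 \<le> u" "u \<le> v" "v \<le> 1"
  shows "F v = F u + (LINT s:{u<..v}|lborel. s / \<phi> s)"
proof -
  have "{0<..v} = {0<..u} \<union> {u<..v}" using assms by auto
  then show ?thesis unfolding F_def using assms
    by (simp add: set_integral_Un integrable_phi)
qed

text \<open>
  Bounding \<open>\<phi>\<close> by \<open>\<phi>(r/2)\<close> on the first half of the interval makes the inequality strict.
\<close>

lemma F_lower:
  assumes "0 < r" "r \<le> 1"
  shows "r\<^sup>2 / (2 * \<phi> r) < F r"
proof -
  have p: "\<phi> (r/2) > 0" "\<phi> r > 0" "\<phi> (r/2) < \<phi> r" using assms phi_pos phi_less[of "r/2" r] by auto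
  have "F 0 = 0" by (simp add: F_def set_lebesgue_integral_def)
  then have "(r/2)\<^sup>2 / (2 * \<phi> (r/2)) \<le> F (r/2)"
    using phi_integral_lower[of 0 "r/2"] F_split[of 0 "r/2"] assms by simp
  moreover have "(r\<^sup>2 - (r/2)\<^sup>2) / (2 * \<phi> r) \<le> F r - F (r/2)"
    using phi_integral_lower[of "r/2" r] F_split[of "r/2" r] assms by simp
  moreover have "(r/2)\<^sup>2 / (2 * \<phi> r) < (r/2)\<^sup>2 / (2 * \<phi> (r/2))"
    using p assms by (intro divide_strict_left_mono) auto
  ultimately have "(r\<^sup>2 - (r/2)\<^sup>2) / (2 * \<phi> r) + (r/2)\<^sup>2 / (2 * \<phi> r) < F r" by simp
  then show ?thesis by (simp add: add_divide_distrib[symmetric] diff_divide_distrib)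
qed

lemma F_pos: "0 < r \<Longrightarrow> r \<le> 1 \<Longrightarrow> 0 < F r"
  using F_lower[of r] phi_pos[of r] by (smt (verit) zero_le_divide_iff zero_le_power2)

lemma F_mono: "0 \<le> u \<Longrightarrow> u \<le> v \<Longrightarrow> v \<le> 1 \<Longrightarrow> F u \<le> F v"
  using F_split[of u v] phi_integral_lower[of u v] phi_pos[of v]
  by (cases "u = v") (auto, smt (verit) divide_nonneg_nonneg power_mono zero_le_mult_iff)

lemma Phi_F: "0 < r \<Longrightarrow> Phi \<phi> r = (if r \<le> 1 then r\<^sup>2 / (2 * F r) else r\<^sup>2 / (2 * F 1))"
  by (simp add: Phi_def F_def Let_def)

lemma Phi_pos: "0 < r \<Longrightarrow> 0 < Phi \<phi> r"
  using F_pos[of r] F_pos[of 1] by (auto simp: Phi_F)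

text \<open>Substituting \<open>s \<mapsto> (R/r) s\<close> transfers the lower scaling of \<open>\<phi>\<close> to \<open>\<Phi>\<close>.\<close>

lemma F_scaling:
  assumes "0 < r" "r \<le> R" "R \<le> 1"
  shows "a1 * (R / r) powr \<alpha>1 * F R \<le> (R / r)\<^sup>2 * F r"
proof -
  define c where "c = R / r"
  have c: "c \<ge> 1" "c * r = R" using assms by (auto simp: c_def)
  have iR: "set_integrable lborel {0<..R} (\<lambda>s. s / \<phi> s)" by (rule integrable_phi) (use assms in auto)
  have ind: "indicator {0<..R} (c * x) = (indicator {0<..r} x :: real)" for x
  proof -
    have "0 < c * x \<longleftrightarrow> 0 < x" using c by (simp add: zero_less_mult_iff)
    moreover have "c * x \<le> R \<longleftrightarrow> x \<le> r" using c by (metis less_le_trans mult_le_cancel_left_pos zero_less_one)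
    ultimately show ?thesis by (simp add: indicator_def)
  qed
  have eq: "F R = c * (LINT s:{0<..r}|lborel. c * s / \<phi> (c * s))"
    unfolding F_def set_lebesgue_integral_def
    using c by (subst lborel_integral_real_affine[where c=c and t=0]) (simp_all add: ind)
  have int: "set_integrable lborel {0<..r} (\<lambda>s. c * s / \<phi> (c * s))"
    using lborel_integrable_real_affine[of "\<lambda>s. indicator {0<..R} s *\<^sub>R (s / \<phi> s)" c 0] iR c
    by (simp add: set_integrable_def ind)
  have "a1 * c powr \<alpha>1 * F R = c * (LINT s:{0<..r}|lborel. (c * s / \<phi> (c * s)) * (a1 * c powr \<alpha>1))"
    by (subst set_integral_mult_left) (simp add: eq)
  also have "\<dots> \<le> c * (LINT s:{0<..r}|lborel. (s / \<phi> s) * c)"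
  proof (intro mult_left_mono set_integral_mono)
    show "set_integrable lborel {0<..r} (\<lambda>s. (c * s / \<phi> (c * s)) * (a1 * c powr \<alpha>1))"
      by (intro set_integrable_mult_left) (rule int)
    show "set_integrable lborel {0<..r} (\<lambda>s. (s / \<phi> s) * c)"
      by (intro set_integrable_mult_left integrable_phi) (use assms in auto)
    fix s assume s: "s \<in> {0<..r}"
    have cs: "0 < s" "s \<le> c * s" "c * s \<le> 1"
    proof -
      have "c * s \<le> c * r" using s c by (intro mult_left_mono) auto
      then show "c * s \<le> 1" using c assms by simp
      show "0 < s" using s by simp
      then show "s \<le> c * s" using c by (metis mult_le_cancel_right1 order_less_not_sym)
    qed
    have "a1 * c powr \<alpha>1 \<le> \<phi> (c * s) / \<phi> s" using phi_scaling[of s "c * s"] cs by simp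
    then have "a1 * c powr \<alpha>1 * (c * s / \<phi> (c * s)) \<le> \<phi> (c * s) / \<phi> s * (c * s / \<phi> (c * s))"
      using cs phi_pos[of "c * s"] c by (intro mult_right_mono) auto
    also have "\<dots> = s / \<phi> s * c" using cs phi_pos[of "c * s"] c by simp
    finally show "(c * s / \<phi> (c * s)) * (a1 * c powr \<alpha>1) \<le> s / \<phi> s * c" by (simp add: mult_ac)
  qed (use c in auto)
  also have "\<dots> = c\<^sup>2 * F r"
    by (subst set_integral_mult_left) (simp add: F_def power2_eq_square)
  finally show ?thesis by (simp add: c_def)
qed

lemma Phi_lower:
  assumes "0 < r" "r \<le> R"
  shows "a1 * (R / r) powr \<alpha>1 * Phi \<phi> r \<le> Phi \<phi> R"
proof -
  have A: "a1 * (R / r) powr \<alpha>1 * Phi \<phi> r \<le> Phi \<phi> R" if "0 < r" "r \<le> R" "R \<le> 1" for r R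
  proof -
    have "a1 * (R / r) powr \<alpha>1 * F R * r\<^sup>2 \<le> R\<^sup>2 * F r"
      using F_scaling[OF that] that by (simp add: field_simps power_divide)
    then show ?thesis using that F_pos[of r] F_pos[of R]
      by (simp add: Phi_F field_simps)
  qed
  have B: "a1 * (R / r) powr \<alpha>1 * Phi \<phi> r \<le> Phi \<phi> R" if "1 \<le> r" "r \<le> R" for r R
  proof -
    have "a1 * (R / r) powr \<alpha>1 \<le> 1 * (R / r) powr 2"
      using that \<alpha>1_le a1_le_1 by (intro mult_mono powr_mono) auto
    then have "a1 * (R / r) powr \<alpha>1 * Phi \<phi> r \<le> (R / r)\<^sup>2 * Phi \<phi> r"
      using that Phi_pos[of r] by (intro mult_right_mono) auto
    also have "\<dots> = Phi \<phi> R" using that by (auto simp: Phi_F power_divide)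
    finally show ?thesis .
  qed
  consider "R \<le> 1" | "1 \<le> r" | "r \<le> 1" "1 \<le> R" by linarith
  then show ?thesis
  proof cases
    case 3
    have "Phi \<phi> R = R\<^sup>2 * Phi \<phi> 1" using 3 by (auto simp: Phi_F)
    moreover have "R powr \<alpha>1 * Phi \<phi> 1 \<le> R powr 2 * Phi \<phi> 1"
      using 3 \<alpha>1_le Phi_pos[of 1] by (intro mult_right_mono powr_mono) auto
    moreover have "a1 * (R / r) powr \<alpha>1 * Phi \<phi> r = R powr \<alpha>1 * (a1 * (1 / r) powr \<alpha>1 * Phi \<phi> r)"
      using 3 assms by (simp add: powr_divide)
    moreover have "\<dots> \<le> R powr \<alpha>1 * Phi \<phi> 1"
      using A[of r 1] 3 assms by (intro mult_left_mono) auto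
    ultimately show ?thesis using 3 by (simp only: powr_numeral)
  qed (use A B assms in auto)
qed

lemma Phi_upper:
  assumes "0 < r" "r \<le> R"
  shows "Phi \<phi> R \<le> (R / r)\<^sup>2 * Phi \<phi> r"
proof -
  have *: "Phi \<phi> s = s\<^sup>2 / (2 * F (min s 1))" if "0 < s" for s using that by (auto simp: Phi_F)
  have F: "F (min r 1) \<le> F (min R 1)" "F (min r 1) > 0" "F (min R 1) > 0"
    using assms by (auto intro!: F_mono F_pos)
  have "Phi \<phi> R \<le> R\<^sup>2 / (2 * F (min r 1))" using assms F * by (auto intro!: divide_left_mono)
  also have "\<dots> = (R / r)\<^sup>2 * Phi \<phi> r" using assms * by (simp add: power_divide)
  finally show ?thesis .
qed

text \<open>
  On \<open>(0,1]\<close> the growth of \<open>F\<close> over \<open>(r,R]\<close> is at most \<open>(R\<^sup>2 - r\<^sup>2) / (2\<phi>(r))\<close>, which by the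
  lower bound for \<open>F(r)\<close> is less than \<open>F(r) (R\<^sup>2 - r\<^sup>2) / r\<^sup>2\<close>; so \<open>F(r) / r\<^sup>2\<close> decreases.
\<close>

lemma Phi_strict_mono:
  assumes "0 < r" "r < R"
  shows "Phi \<phi> r < Phi \<phi> R"
proof -
  have A: "Phi \<phi> r < Phi \<phi> R" if "0 < r" "r < R" "R \<le> 1" for r R
  proof -
    have p: "\<phi> r > 0" using that phi_pos by auto
    have "F R \<le> F r + (R\<^sup>2 - r\<^sup>2) / (2 * \<phi> r)"
      using F_split[of r R] phi_integral_upper[of r R] that by simp
    moreover have "r\<^sup>2 < 2 * \<phi> r * F r" using F_lower[of r] that p by (simp add: field_simps)
    moreover have "R\<^sup>2 - r\<^sup>2 > 0" using that by (simp add: power_strict_mono)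
    ultimately have "F R * r\<^sup>2 < F r * R\<^sup>2"
    proof -
      have "F R * r\<^sup>2 \<le> (F r + (R\<^sup>2 - r\<^sup>2) / (2 * \<phi> r)) * r\<^sup>2"
        using \<open>F R \<le> _\<close> by (intro mult_right_mono) auto
      also have "\<dots> = F r * r\<^sup>2 + (R\<^sup>2 - r\<^sup>2) * (r\<^sup>2 / (2 * \<phi> r))" by (simp add: distrib_right)
      also have "\<dots> < F r * r\<^sup>2 + (R\<^sup>2 - r\<^sup>2) * F r"
        using F_lower[of r] that \<open>R\<^sup>2 - r\<^sup>2 > 0\<close>
        by (intro add_strict_left_mono mult_strict_left_mono) auto
      finally show ?thesis by (simp add: algebra_simps)
    qed
    then show ?thesis using that F_pos[of r] F_pos[of R] by (simp add: Phi_F field_simps)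
  qed
  have B: "Phi \<phi> r < Phi \<phi> R" if "1 \<le> r" "r < R" for r R
  proof -
    have "r\<^sup>2 < R\<^sup>2" using that by (intro power_strict_mono) auto
    then show ?thesis using that F_pos[of 1] by (cases "r = 1") (auto simp: Phi_F divide_strict_right_mono)
  qed
  consider "R \<le> 1" | "1 \<le> r" | "r < 1" "1 < R" by linarith
  then show ?thesis
  proof cases
    case 3
    then show ?thesis using A[of r 1] B[of 1 R] assms by simp
  qed (use A B assms in auto)
qed

text \<open>Continuity of \<open>\<Phi>\<close> is a consequence of its monotonicity and of quadratic upper scaling.\<close>

lemma continuous_Phi: "continuous_on {0<..} (Phi \<phi>)"
proof (rule continuous_on_eq_continuous_at[THEN iffD2], simp, intro ballI)
  fix r :: real assume "r \<in> {0<..}"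
  then have r: "r > 0" by simp
  define l where "l s = min (Phi \<phi> r) ((s / r)\<^sup>2 * Phi \<phi> r)" for s
  define u where "u s = max (Phi \<phi> r) ((s / r)\<^sup>2 * Phi \<phi> r)" for s
  have "eventually (\<lambda>s. s > 0) (at r)"
    by (rule order_tendstoD[OF tendsto_ident_at]) (use r in auto)
  then have ev: "eventually (\<lambda>s. l s \<le> Phi \<phi> s \<and> Phi \<phi> s \<le> u s) (at r)"
  proof eventually_elim
    case (elim s)
    show ?case
    proof (cases "s \<le> r")
      case True
      have "Phi \<phi> r \<le> (r / s)\<^sup>2 * Phi \<phi> s" by (rule Phi_upper) (use True elim in auto)
      then have "(s / r)\<^sup>2 * Phi \<phi> r \<le> (s / r)\<^sup>2 * ((r / s)\<^sup>2 * Phi \<phi> s)" by (intro mult_left_mono) auto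
      also have "\<dots> = Phi \<phi> s" using elim r by (simp add: power_divide)
      finally show ?thesis using True Phi_strict_mono[of s r] elim
        by (cases "s = r") (auto simp: l_def u_def)
    next
      case False
      then show ?thesis using Phi_upper[of r s] Phi_strict_mono[of r s] r by (auto simp: l_def u_def)
    qed
  qed
  have q: "((\<lambda>s. (s / r)\<^sup>2 * Phi \<phi> r) \<longlongrightarrow> (r / r)\<^sup>2 * Phi \<phi> r) (at r)"
    by (intro tendsto_mult tendsto_power tendsto_divide tendsto_const tendsto_ident_at) (use r in auto)
  have "(l \<longlongrightarrow> l r) (at r)" "(u \<longlongrightarrow> u r) (at r)"
    unfolding l_def u_def by (rule tendsto_min[OF tendsto_const q] tendsto_max[OF tendsto_const q])+
  moreover have "l r = Phi \<phi> r" "u r = Phi \<phi> r" using r by (auto simp: l_def u_def)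
  ultimately show "isCont (Phi \<phi>) r" unfolding isCont_def
    using tendsto_sandwich[OF eventually_mono[OF ev, of "\<lambda>s. l s \<le> Phi \<phi> s"]
        eventually_mono[OF ev, of "\<lambda>s. Phi \<phi> s \<le> u s"], of "Phi \<phi> r"] by simp
qed

lemma Phi_le_powr: "0 < r \<Longrightarrow> r \<le> 1 \<Longrightarrow> Phi \<phi> r \<le> Phi \<phi> 1 / a1 * r powr \<alpha>1"
  using Phi_lower[of r 1] a1_pos by (simp add: powr_divide field_simps)

lemma Phi_bij: "bij_betw (Phi \<phi>) {0<..} {0<..}"
proof (unfold bij_betw_def, intro conjI equalityI subsetI)
  show "inj_on (Phi \<phi>) {0<..}"
    by (metis (no_types, lifting) Phi_strict_mono greaterThan_iff inj_onI linorder_neqE_linordered_idom order_less_irrefl)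
  show "y \<in> {0<..}" if "y \<in> Phi \<phi> ` {0<..}" for y using that Phi_pos by auto
next
  fix y :: real assume "y \<in> {0<..}"
  then have y: "y > 0" by simp
  have "((\<lambda>r. Phi \<phi> 1 / a1 * r powr \<alpha>1) \<longlongrightarrow> Phi \<phi> 1 / a1 * 0) (at_right 0)"
    using tendsto_zero_powrI[of "\<lambda>r. r" "at_right 0" "\<lambda>_. \<alpha>1" \<alpha>1] \<alpha>1_pos
    by (intro tendsto_mult_left) (auto simp: eventually_at_topological)
  then have "eventually (\<lambda>r. Phi \<phi> 1 / a1 * r powr \<alpha>1 < y) (at_right 0)"
    using y by (intro order_tendstoD) auto
  moreover have "eventually (\<lambda>r::real. r \<in> {0<..<1}) (at_right 0)"
    by (rule eventually_at_right_real) simp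
  ultimately have "eventually (\<lambda>r. 0 < r \<and> r < 1 \<and> Phi \<phi> r \<le> y) (at_right 0)"
  proof eventually_elim
    case (elim r) then show ?case using Phi_le_powr[of r] by simp
  qed
  then obtain r where r: "0 < r" "r < 1" "Phi \<phi> r \<le> y"
    using eventually_happens'[of "at_right (0::real)"] by auto
  define R where "R = max 1 (y / Phi \<phi> 1)"
  have "y \<le> Phi \<phi> R"
  proof (cases "y \<le> Phi \<phi> 1")
    case True
    moreover have "R \<ge> 1" by (simp add: R_def)
    ultimately show ?thesis using Phi_strict_mono[of 1 R] by (cases "R = 1") auto
  next
    case False
    then have Ry: "R = y / Phi \<phi> 1" and "R > 1" using Phi_pos[of 1] by (auto simp: R_def)
    then have "Phi \<phi> R = R\<^sup>2 * Phi \<phi> 1" by (auto simp: Phi_F)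
    moreover have "R * Phi \<phi> 1 = y" using Ry Phi_pos[of 1] by simp
    moreover have "R * 1 * Phi \<phi> 1 \<le> R * R * Phi \<phi> 1"
      using \<open>R > 1\<close> Phi_pos[of 1] by (intro mult_right_mono mult_left_mono) auto
    ultimately show ?thesis by (simp add: power2_eq_square)
  qed
  moreover have "continuous_on {r..R} (Phi \<phi>)"
    by (rule continuous_on_subset[OF continuous_Phi]) (use r in auto)
  moreover have "r \<le> R" using r by (simp add: R_def)
  ultimately obtain x where "r \<le> x" "x \<le> R" "Phi \<phi> x = y"
    using IVT'[of "Phi \<phi>" r y R] r by auto
  then show "y \<in> Phi \<phi> ` {0<..}" using r by force
qed

lemma Phi_inv:
  assumes "0 < t"
  shows "Phi_inv \<phi> t > 0" "Phi \<phi> (Phi_inv \<phi> t) = t"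
proof -
  have t: "t \<in> Phi \<phi> ` {0<..}" using Phi_bij assms by (auto simp: bij_betw_def)
  have inj: "inj_on (Phi \<phi>) {0<..}" using Phi_bij by (simp add: bij_betw_def)
  show "Phi_inv \<phi> t > 0" unfolding Phi_inv_def
    using the_inv_into_into[OF inj t subset_refl] by simp
  show "Phi \<phi> (Phi_inv \<phi> t) = t" unfolding Phi_inv_def
    using f_the_inv_into_f[OF inj t] by simp
qed

lemma Phi_inv_mono:
  assumes "0 < s" "s \<le> t"
  shows "Phi_inv \<phi> s \<le> Phi_inv \<phi> t"
  using Phi_inv[of s] Phi_inv[of t] assms Phi_strict_mono[of "Phi_inv \<phi> t" "Phi_inv \<phi> s"]
  by (metis linorder_not_le order_less_le_trans)

end

section \<open>Integral estimates for the bounds and for the jump kernel\<close>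

lemma nn_integral_mult_indicator_mono:
  fixes f g :: "'a \<Rightarrow> real"
  assumes "\<And>x. x \<in> A \<Longrightarrow> f x \<le> g x"
  shows "(\<integral>\<^sup>+x. ennreal (f x) * indicator A x \<partial>M) \<le> (\<integral>\<^sup>+x. ennreal (g x) * indicator A x \<partial>M)"
  by (intro nn_integral_mono) (use assms in \<open>auto simp: indicator_def ennreal_leI\<close>)

context nonlocal_operator
begin

text \<open>The off-diagonal profile \<open>1 / (|z|\<^sup>d \<Phi>(|z|))\<close> of the bounds.\<close>

definition H :: "real \<Rightarrow> real"
  where "H r = (if 0 < r then 1 / (r ^ DIM('a) * Phi \<phi> r) else 0)"

lemma H_nonneg [simp]: "0 \<le> H r"
  using Phi_pos[of r] by (auto simp: H_def)

lemma H_pos: "0 < r \<Longrightarrow> 0 < H r"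
  using Phi_pos[of r] by (auto simp: H_def)

lemma H_antimono: "0 < r \<Longrightarrow> r \<le> s \<Longrightarrow> H s \<le> H r"
  using Phi_strict_mono[of r s] Phi_pos[of r] Phi_pos[of s]
  by (cases "r = s") (auto simp: H_def intro!: divide_left_mono mult_mono power_mono)

lemma H_half: "0 < r \<Longrightarrow> H (r / 2) \<le> 2 ^ (DIM('a) + 2) * H r"
  using Phi_upper[of "r/2" r] Phi_pos[of r] Phi_pos[of "r/2"]
  by (auto simp: H_def field_simps power_divide power_add)

lemma continuous_H: "continuous_on {0<..} H"
proof -
  have "continuous_on {0<..} (\<lambda>r. 1 / (r ^ DIM('a) * Phi \<phi> r))"
    by (intro continuous_intros continuous_Phi) (use Phi_pos in fastforce)
  then show ?thesis by (rule continuous_on_eq) (auto simp: H_def)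
qed

lemma measurable_H [measurable]: "H \<in> borel_measurable borel"
proof -
  have "(\<lambda>r. if r \<in> {0<..} then H r else 0) \<in> borel_measurable borel"
    by (intro borel_measurable_continuous_on_if continuous_H) auto
  moreover have "(\<lambda>r. if r \<in> {0<..} then H r else 0) = H" by (auto simp: H_def)
  ultimately show ?thesis by simp
qed

definition C\<^sub>H :: real where "C\<^sub>H = sphere_area TYPE('a) / (\<alpha>1 * a1)"

lemma C\<^sub>H_pos: "C\<^sub>H > 0" using \<alpha>1_pos a1_pos by (simp add: C\<^sub>H_def)

text \<open>
  The lower scaling of \<open>\<Phi>\<close> dominates the profile outside a ball by \<open>|z|\<^sup>-\<^sup>d\<^sup>-\<^sup>\<alpha>\<close>.
\<close>

lemma H_tail:
  assumes "0 < r"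
  shows "(\<integral>\<^sup>+z. ennreal (H (norm (z::'a))) * indicator {z. r < norm z} z \<partial>lborel) \<le> ennreal (C\<^sub>H / Phi \<phi> r)"
proof -
  define c where "c = r powr \<alpha>1 / (a1 * Phi \<phi> r)"
  have c: "c \<ge> 0" using assms a1_pos Phi_pos[of r] by (simp add: c_def)
  have "H (norm z) \<le> c * (norm z powr - \<alpha>1 / norm z ^ DIM('a))" if "z \<in> {z. r < norm z}" for z :: 'a
  proof -
    have z: "norm z > r" "norm z > 0" using that assms by auto
    have l: "a1 * (norm z / r) powr \<alpha>1 * Phi \<phi> r > 0" using z assms a1_pos Phi_pos[of r] by simp
    have "1 / Phi \<phi> (norm z) \<le> 1 / (a1 * (norm z / r) powr \<alpha>1 * Phi \<phi> r)"
      using Phi_lower[of r "norm z"] z assms Phi_pos l by (intro divide_left_mono) auto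
    also have "\<dots> = c * norm z powr - \<alpha>1"
      using z assms by (simp add: c_def powr_divide powr_minus field_simps)
    finally have "1 / Phi \<phi> (norm z) / norm z ^ DIM('a) \<le> c * norm z powr - \<alpha>1 / norm z ^ DIM('a)"
      using z by (intro divide_right_mono) auto
    then show ?thesis using z by (simp add: H_def mult.commute)
  qed
  then have "(\<integral>\<^sup>+z. ennreal (H (norm (z::'a))) * indicator {z. r < norm z} z \<partial>lborel)
      \<le> (\<integral>\<^sup>+z. ennreal (c * (norm z powr - \<alpha>1 / norm (z::'a) ^ DIM('a))) * indicator {z. r < norm z} z \<partial>lborel)"
    by (rule nn_integral_mult_indicator_mono)
  also have "\<dots> = ennreal c * (\<integral>\<^sup>+z. ennreal (norm z powr - \<alpha>1 / norm (z::'a) ^ DIM('a)) * indicator {z. r < norm z} z \<partial>lborel)"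
    using c by (subst nn_integral_cmult[symmetric]) (auto simp: ennreal_mult mult.assoc simp del: times_divide_eq_right)
  also have "\<dots> \<le> ennreal c * ennreal (sphere_area TYPE('a) / \<alpha>1 * r powr - \<alpha>1)"
    by (intro mult_left_mono nn_integral_norm_power_tail assms \<alpha>1_pos) auto
  also have "\<dots> = ennreal (C\<^sub>H / Phi \<phi> r)"
    using c assms by (subst ennreal_mult[symmetric]) (use \<alpha>1_pos less_imp_le[OF sphere_area_pos[where 'a='a]] in \<open>auto simp: c_def C\<^sub>H_def powr_minus field_simps\<close>)
  finally show ?thesis .
qed

definition G :: "real \<Rightarrow> 'a \<Rightarrow> real" where "G = G_tilde_bound \<phi>"

lemma G_eq:
  "G t z = (let u = 1 / (t * Phi_inv \<phi> t ^ DIM('a)) in if z = 0 then u else min u (H (norm z)))"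
  by (simp add: G_def G_tilde_bound_def Let_def H_def)

lemma G_nonneg: "0 < t \<Longrightarrow> 0 \<le> G t z"
  using Phi_inv[of t] by (auto simp: G_eq Let_def min_def)

lemma G_le_H: "z \<noteq> 0 \<Longrightarrow> G t z \<le> H (norm z)"
  by (simp add: G_eq Let_def)

lemma G_le_top: "G t z \<le> 1 / (t * Phi_inv \<phi> t ^ DIM('a))"
  by (simp add: G_eq Let_def)

lemma G_antimono:
  assumes "0 < s" "s \<le> t"
  shows "G t z \<le> G s z"
proof -
  have "1 / (t * Phi_inv \<phi> t ^ DIM('a)) \<le> 1 / (s * Phi_inv \<phi> s ^ DIM('a))"
    using assms Phi_inv[of s] Phi_inv[of t] Phi_inv_mono[of s t]
    by (intro divide_left_mono mult_mono power_mono mult_pos_pos) auto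
  then show ?thesis by (auto simp: G_eq Let_def)
qed

lemma measurable_G [measurable]: "G t \<in> borel_measurable borel"
proof -
  have "{x. norm x = 0} \<in> sets (borel :: 'a measure)" by simp
  then show ?thesis unfolding G_eq[abs_def] Let_def by measurable
qed

definition C\<^sub>G :: real where "C\<^sub>G = unit_ball_vol (real DIM('a)) + C\<^sub>H"

lemma C\<^sub>G_pos: "C\<^sub>G > 0" using C\<^sub>H_pos by (simp add: C\<^sub>G_def add_pos_pos)

text \<open>
  Inside the ball of radius \<open>\<Phi>\<^sup>-\<^sup>1(t)\<close> the bound is at most constant, outside it is at most the
  profile; both parts contribute a multiple of \<open>1/t\<close>.  This integral makes \<open>G\<close> the source of
  all bounds of order \<open>1/t\<close> below.
\<close>

lemma nn_integral_G:
  assumes "0 < t"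
  shows "(\<integral>\<^sup>+z. ennreal (G t z) \<partial>lborel) \<le> ennreal (C\<^sub>G / t)"
proof -
  define r where "r = Phi_inv \<phi> t"
  have r: "r > 0" "Phi \<phi> r = t" using Phi_inv[OF assms] by (auto simp: r_def)
  define u where "u = 1 / (t * r ^ DIM('a))"
  have u: "u \<ge> 0" using r assms by (simp add: u_def)
  have "(\<integral>\<^sup>+z. ennreal (G t z) \<partial>lborel) \<le>
      (\<integral>\<^sup>+z. ennreal u * indicator (cball (0::'a) r) z + ennreal (H (norm z)) * indicator {z. r < norm z} z \<partial>lborel)"
  proof (intro nn_integral_mono)
    fix z :: 'a
    show "ennreal (G t z) \<le> ennreal u * indicator (cball 0 r) z + ennreal (H (norm z)) * indicator {z. r < norm z} z"
    proof (cases "norm z \<le> r")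
      case True
      then show ?thesis using G_le_top[of t z] by (simp add: u_def r_def ennreal_leI)
    next
      case False
      then have "z \<noteq> 0" using r by auto
      then show ?thesis using G_le_H[of z t] False by (simp add: ennreal_leI)
    qed
  qed
  also have "\<dots> = (\<integral>\<^sup>+z. ennreal u * indicator (cball (0::'a) r) z \<partial>lborel) +
      (\<integral>\<^sup>+z. ennreal (H (norm (z::'a))) * indicator {z. r < norm z} z \<partial>lborel)"
    by (rule nn_integral_add) (measurable, auto)
  also have "\<dots> \<le> ennreal (u * (unit_ball_vol (real DIM('a)) * r ^ DIM('a))) + ennreal (C\<^sub>H / t)"
    using H_tail[OF r(1)] r u
    by (intro add_mono) (auto simp: nn_integral_cmult_indicator emeasure_cball ennreal_mult)
  also have "\<dots> = ennreal (C\<^sub>G / t)"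
    using r assms C\<^sub>H_pos by (subst ennreal_plus[symmetric]) (auto simp: u_def C\<^sub>G_def add_divide_distrib)
  finally show ?thesis .
qed

text \<open>In the range \<open>r > 1\<close> the profile \<open>\<theta>\<close> decays faster than the polynomial \<open>H\<close>.\<close>

lemma theta_le_H: obtains C where "C \<ge> 1" "\<And>r. r > 0 \<Longrightarrow> theta DIM('a) \<phi> b \<beta> r \<le> C * H r"
proof -
  obtain C0 where C0: "C0 > 0" "\<And>s. s \<ge> 1 \<Longrightarrow> s ^ (DIM('a) + 2) * exp (- b * s powr \<beta>) \<le> C0"
    using power_le_exp_powr[OF b_pos beta_pos] by blast
  obtain C1 where C1: "C1 > 0" "\<And>s. s \<ge> 1 \<Longrightarrow> s ^ 1 * exp (- (b/5) * s powr 1) \<le> C1"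
    using power_le_exp_powr[of "b/5" 1 1] b_pos by auto
  define C where "C = 1 + (C0 + C1) * Phi \<phi> 1"
  have P1: "Phi \<phi> 1 > 0" by (rule Phi_pos) simp
  have "theta DIM('a) \<phi> b \<beta> r \<le> C * H r" if r: "r > 0" for r
  proof (cases "r \<le> 1")
    case True
    then have "theta DIM('a) \<phi> b \<beta> r = H r" using r by (simp add: theta_def H_def)
    also have "\<dots> \<le> C * H r" using C0 C1 P1 mult_right_mono[of 1 C "H r"] by (simp add: C_def)
    finally show ?thesis .
  next
    case False
    then have r1: "r > 1" by simp
    have "Phi \<phi> r = r\<^sup>2 * Phi \<phi> 1" using r1 by (simp add: Phi_F)
    then have Hr: "H r = 1 / (r ^ (DIM('a) + 2) * Phi \<phi> 1)" using r1 by (simp add: H_def power_add power2_eq_square)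
    have "theta DIM('a) \<phi> b \<beta> r \<le> (C0 + C1) / r ^ (DIM('a) + 2)"
    proof (cases "\<beta> < 1")
      case True
      have "exp (- b * r powr \<beta>) \<le> C0 / r ^ (DIM('a) + 2)"
        using C0(2)[of r] r1 by (simp add: field_simps)
      also have "\<dots> \<le> (C0 + C1) / r ^ (DIM('a) + 2)" using r1 C1 by (intro divide_right_mono) auto
      finally show ?thesis using True r1 by (simp add: theta_def)
    next
      case False
      have "exp (- (b / 5) * r) \<le> C1 / r"
        using C1(2)[of r] r1 by (simp add: field_simps)
      then have "exp (- (b / 5) * r) / r ^ (DIM('a) + 1) \<le> C1 / r / r ^ (DIM('a) + 1)"
        using r1 by (intro divide_right_mono) auto
      also have "\<dots> = C1 / r ^ (DIM('a) + 2)" by simp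
      also have "\<dots> \<le> (C0 + C1) / r ^ (DIM('a) + 2)" using r1 C0 by (intro divide_right_mono) auto
      finally show ?thesis using False r1 by (simp add: theta_def)
    qed
    also have "\<dots> = (C0 + C1) * Phi \<phi> 1 * H r" using P1 by (simp add: Hr)
    also have "\<dots> \<le> C * H r" by (intro mult_right_mono) (auto simp: C_def)
    finally show ?thesis .
  qed
  moreover have "C \<ge> 1" using C0 C1 P1 by (simp add: C_def)
  ultimately show thesis using that by blast
qed

text \<open>
  Polynomial decay in place of the exponential one gives the upper bound of the kernel the same
  form as the bounds on the operator.
\<close>

lemma G_bound_le_G:
  obtains C where "C \<ge> 1" "\<And>t z. 0 < t \<Longrightarrow> G_bound \<phi> b \<beta> t (z::'a) \<le> C * G t z"
proof -
  obtain C where C: "C \<ge> 1" "\<And>r. r > 0 \<Longrightarrow> theta DIM('a) \<phi> b \<beta> r \<le> C * H r"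
    using theta_le_H by blast
  have "G_bound \<phi> b \<beta> t z \<le> C * G t z" if "0 < t" for t and z :: 'a
  proof -
    define u where "u = 1 / (t * Phi_inv \<phi> t ^ DIM('a))"
    have "u \<ge> 0" using that Phi_inv[of t] by (simp add: u_def)
    then have "1 * u \<le> C * u" using C by (intro mult_right_mono) auto
    then show ?thesis
      using C(2)[of "norm z"] C(1)
      by (auto simp: G_bound_def G_eq Let_def u_def[symmetric] min_def)
  qed
  with C(1) show thesis using that by blast
qed


text \<open>The weight with which the truncated operator integrates increments.\<close>

definition jk :: "real \<Rightarrow> 'a \<Rightarrow> 'a \<Rightarrow> real"
  where "jk \<epsilon> x z = (if \<epsilon> < norm z then \<kappa> x z * J (norm z) else 0)"

lemma
  shows kappa_pos: "\<kappa> x z > 0" and kappa_le: "\<kappa> x z \<le> \<kappa>1" and kappa_minus: "\<kappa> x (- z) = \<kappa> x z"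
    and kappa_holder: "\<bar>\<kappa> x z - \<kappa> y z\<bar> \<le> \<kappa>2 * norm (x - y) powr \<delta>"
    and kappa_measurable [measurable]: "(\<lambda>(x, z). \<kappa> x z) \<in> borel_measurable borel"
  using coeff unfolding coefficient_assms_def by metis+

lemma
  shows J_pos: "0 < r \<Longrightarrow> J r > 0"
    and J_small: "0 < r \<Longrightarrow> r \<le> 1 \<Longrightarrow> J r \<le> a / (r ^ DIM('a) * \<phi> r)"
    and J_large: "1 < r \<Longrightarrow> J r \<le> a * exp (- b * r powr \<beta>)"
    and J_continuous: "continuous_on {0<..} J"
  using jump unfolding jump_kernel_assms_def by blast+

text \<open>
  Set to \<open>0\<close> off \<open>(0,\<infinity>)\<close>, the jump kernel is a measurable function on the whole line.
\<close>

definition J0 :: "real \<Rightarrow> real" where "J0 r = (if 0 < r then J r else 0)"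

lemma J0_nonneg [simp]: "0 \<le> J0 r" using less_imp_le[OF J_pos[of r]] by (simp add: J0_def)

lemma measurable_J0 [measurable]: "J0 \<in> borel_measurable borel"
proof -
  have "(\<lambda>r. if r \<in> {0<..} then J r else 0) \<in> borel_measurable borel"
    by (intro borel_measurable_continuous_on_if J_continuous) auto
  moreover have "(\<lambda>r. if r \<in> {0<..} then J r else 0) = J0" by (auto simp: J0_def)
  ultimately show ?thesis by simp
qed

lemma jk_J0: "0 \<le> \<epsilon> \<Longrightarrow> jk \<epsilon> x z = (if \<epsilon> < norm z then \<kappa> x z * J0 (norm z) else 0)"
  by (auto simp: jk_def J0_def)

lemma jk_nonneg: "0 \<le> \<epsilon> \<Longrightarrow> 0 \<le> jk \<epsilon> x z"
  using kappa_pos[of x z] by (auto simp: jk_J0)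

lemma jk_minus: "jk \<epsilon> x (- z) = jk \<epsilon> x z"
  by (simp add: jk_def kappa_minus)

lemma jk_le: "0 \<le> \<epsilon> \<Longrightarrow> jk \<epsilon> x z \<le> \<kappa>1 * J0 (norm z)"
  using kappa_le[of x z] \<kappa>1_pos by (auto simp: jk_J0 intro!: mult_right_mono)

lemma measurable_jk:
  assumes "0 \<le> \<epsilon>"
  shows "(\<lambda>(x, z). jk \<epsilon> x z) \<in> borel_measurable borel"
proof -
  have [measurable]: "(\<lambda>p. \<kappa> (fst p) (snd p)) \<in> borel_measurable (borel \<Otimes>\<^sub>M borel)"
    using kappa_measurable by (simp add: borel_prod split_beta')
  have "(\<lambda>p. if \<epsilon> < norm (snd p) then \<kappa> (fst p) (snd p) * J0 (norm (snd p)) else 0)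
      \<in> borel_measurable (borel \<Otimes>\<^sub>M borel)" by measurable
  then show ?thesis using assms by (simp add: borel_prod split_beta' jk_J0)
qed

lemma measurable_jk2 [measurable]: "0 \<le> \<epsilon> \<Longrightarrow> (\<lambda>z. jk \<epsilon> x z) \<in> borel_measurable borel"
  using measurable_compose[OF _ measurable_jk, of "\<lambda>z. (x, z)" borel \<epsilon>] by simp

lemma jump_op_trunc_eq:
  "0 \<le> \<epsilon> \<Longrightarrow> jump_op_trunc \<kappa> J \<epsilon> f x = (LINT z|lborel. (f (x + z) - f x) * jk \<epsilon> x z)"
  unfolding jump_op_trunc_def set_lebesgue_integral_def
  by (intro Bochner_Integration.integral_cong) (auto simp: jk_def)

text \<open>
  The jump kernel has a finite second moment: near the origin this is the integrability of
  \<open>s / \<phi>(s)\<close>, far away the decay of \<open>J\<close>.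
\<close>

lemma integrable_J_second_moment: "integrable lborel (\<lambda>z::'a. norm z ^ 2 * J0 (norm z))"
proof (rule integrableI_bounded)
  define A where "A = sphere_area TYPE('a)"
  have A: "A > 0" by (simp add: A_def)
  obtain C where C: "C > 0" "\<And>s. s \<ge> 1 \<Longrightarrow> s ^ (DIM('a) + 3) * exp (- b * s powr \<beta>) \<le> C"
    using power_le_exp_powr[OF b_pos beta_pos] by blast
  have "(\<integral>\<^sup>+z. ennreal (norm (norm (z::'a) ^ 2 * J0 (norm z))) \<partial>lborel) =
      (\<integral>\<^sup>+z. ennreal (norm (z::'a) ^ 2 * J0 (norm z)) \<partial>lborel)" by simp
  also have "\<dots> = (\<integral>\<^sup>+s. ennreal (A * s ^ (DIM('a) - 1)) * indicator {0..} s * ennreal (s ^ 2 * J0 s) \<partial>lborel)"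
    unfolding A_def by (subst nn_integral_norm[symmetric]) auto
  also have "\<dots> \<le> (\<integral>\<^sup>+s. ennreal (A * a * norm (indicator {0<..1} s *\<^sub>R (s / \<phi> s))) +
       ennreal (A * a * C * (1 / s\<^sup>2)) * indicator {1..} s \<partial>lborel)"
  proof (intro nn_integral_mono)
    fix s :: real
    have d: "s ^ DIM('a) = s ^ (DIM('a) - 1) * s" using DIM_positive[where 'a='a]
      by (metis Suc_pred' power_Suc2)
    consider "s \<le> 0" | "0 < s" "s \<le> 1" | "s > 1" by linarith
    then show "ennreal (A * s ^ (DIM('a) - 1)) * indicator {0..} s * ennreal (s ^ 2 * J0 s)
      \<le> ennreal (A * a * norm (indicator {0<..1} s *\<^sub>R (s / \<phi> s))) +
       ennreal (A * a * C * (1 / s\<^sup>2)) * indicator {1..} s"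
    proof cases
      case 2
      have "s ^ (DIM('a) - 1) * (s ^ 2 * J s) \<le> s ^ (DIM('a) - 1) * (s ^ 2 * (a / (s ^ DIM('a) * \<phi> s)))"
        using 2 J_small[of s] by (intro mult_left_mono) auto
      also have "\<dots> = a * (s / \<phi> s)" using 2 by (simp add: d power2_eq_square)
      finally have "A * s ^ (DIM('a) - 1) * (s ^ 2 * J s) \<le> A * a * (s / \<phi> s)"
        using mult_left_mono[of _ _ A] A by (simp only: mult.assoc)
      then show ?thesis using 2 A phi_pos[of s] J_pos[of s]
        by (auto simp: J0_def ennreal_mult[symmetric] intro!: add_increasing2 ennreal_leI)
    next
      case 3
      have "s ^ (DIM('a) - 1) * (s ^ 2 * J s) \<le> s ^ (DIM('a) - 1) * (s ^ 2 * (a * exp (- b * s powr \<beta>)))"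
        using 3 J_large[of s] by (intro mult_left_mono) auto
      also have "\<dots> = a * (s ^ (DIM('a) + 3) * exp (- b * s powr \<beta>)) * (1 / s\<^sup>2)"
        using 3 by (simp add: d power_add field_simps power2_eq_square power3_eq_cube)
      also have "\<dots> \<le> a * C * (1 / s\<^sup>2)"
        using 3 C(2)[of s] a_ge_1 by (intro mult_right_mono mult_left_mono) auto
      finally have "A * s ^ (DIM('a) - 1) * (s ^ 2 * J s) \<le> A * a * C * (1 / s\<^sup>2)"
        using mult_left_mono[of _ _ A] A by (simp only: mult.assoc)
      then show ?thesis using 3 A J_pos[of s]
        by (auto simp: J0_def ennreal_mult[symmetric] intro!: add_increasing ennreal_leI)
    qed (auto simp: J0_def)
  qed
  also have "\<dots> = (\<integral>\<^sup>+s. ennreal (A * a * norm (indicator {0<..1} s *\<^sub>R (s / \<phi> s))) \<partial>lborel) +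
       (\<integral>\<^sup>+s. ennreal (A * a * C * (1 / s\<^sup>2)) * indicator {1..} s \<partial>lborel)"
  proof (rule nn_integral_add)
    define h :: "real \<Rightarrow> real" where "h s = indicator {0<..1} s *\<^sub>R (s / \<phi> s)" for s
    have [measurable]: "h \<in> borel_measurable borel"
      using borel_measurable_integrable[OF integrable_phi_1[unfolded set_integrable_def]]
      unfolding h_def[symmetric] by simp
    show "(\<lambda>s. ennreal (A * a * norm (indicator {0<..1} s *\<^sub>R (s / \<phi> s)))) \<in> borel_measurable lborel"
      unfolding h_def[symmetric] by measurable
  qed auto
  also have "\<dots> < \<infinity>"
  proof -
    have "integrable lborel (\<lambda>s. A * a * norm (indicator {0<..1} s *\<^sub>R (s / \<phi> s)))"
      using integrable_phi_1 unfolding set_integrable_def by (intro integrable_mult_right integrable_norm)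
    then have "(\<integral>\<^sup>+s. ennreal (norm (A * a * norm (indicator {0<..1} s *\<^sub>R (s / \<phi> s)))) \<partial>lborel) < \<infinity>"
      unfolding integrable_iff_bounded by blast
    then have 1: "(\<integral>\<^sup>+s. ennreal (A * a * norm (indicator {0<..1} s *\<^sub>R (s / \<phi> s))) \<partial>lborel) < \<infinity>"
      using A a_ge_1 by (simp add: abs_mult)
    have "(\<integral>\<^sup>+s. ennreal (A * a * C * (1 / s\<^sup>2)) * indicator {1..} s \<partial>lborel) =
        ennreal (0 - (- (A * a * C) / 1))"
    proof (rule nn_integral_FTC_atLeast)
      show "DERIV (\<lambda>s. - (A * a * C) / s) x :> A * a * C * (1 / x\<^sup>2)" if "1 \<le> x" for x
        using that by (auto intro!: derivative_eq_intros simp: power2_eq_square)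
      show "((\<lambda>s. - (A * a * C) / s) \<longlongrightarrow> 0) at_top"
        by (intro tendsto_divide_0[OF tendsto_const] filterlim_at_top_imp_at_infinity filterlim_ident)
    qed (use A a_ge_1 C in auto)
    then show ?thesis using 1 by simp
  qed
  finally show "(\<integral>\<^sup>+z. ennreal (norm (norm (z::'a) ^ 2 * J0 (norm z))) \<partial>lborel) < \<infinity>" .
qed auto

definition K2 :: real where "K2 = (LINT z|lborel. norm (z::'a) ^ 2 * J0 (norm z))"

lemma K2_nonneg: "K2 \<ge> 0" by (simp add: K2_def)

lemma integrable_jk_second_moment:
  assumes "0 \<le> \<epsilon>"
  shows "integrable lborel (\<lambda>z. norm z ^ 2 * jk \<epsilon> x z)" "(LINT z|lborel. norm z ^ 2 * jk \<epsilon> x z) \<le> \<kappa>1 * K2"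
proof -
  have i: "integrable lborel (\<lambda>z::'a. \<kappa>1 * (norm z ^ 2 * J0 (norm z)))"
    by (intro integrable_mult_right integrable_J_second_moment)
  have le: "norm z ^ 2 * jk \<epsilon> x z \<le> \<kappa>1 * (norm z ^ 2 * J0 (norm z))" for z
    using mult_left_mono[OF jk_le[OF assms, of x z], of "norm z ^ 2"] by (simp add: mult_ac)
  show 1: "integrable lborel (\<lambda>z. norm z ^ 2 * jk \<epsilon> x z)"
    by (rule Bochner_Integration.integrable_bound[OF i])
      (use le jk_nonneg[OF assms] \<kappa>1_pos assms in \<open>auto simp: abs_mult\<close>)
  have "(LINT z|lborel. norm z ^ 2 * jk \<epsilon> x z) \<le> (LINT z|lborel. \<kappa>1 * (norm z ^ 2 * J0 (norm (z::'a))))"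
    by (intro integral_mono 1 i le)
  then show "(LINT z|lborel. norm z ^ 2 * jk \<epsilon> x z) \<le> \<kappa>1 * K2" by (simp add: K2_def)
qed

lemma jk_outside:
  assumes "0 < \<epsilon>"
  shows "jk \<epsilon> x z \<le> (1 / \<epsilon>\<^sup>2) * (norm z ^ 2 * jk \<epsilon> x z)" "norm z * jk \<epsilon> x z \<le> (1 / \<epsilon>) * (norm z ^ 2 * jk \<epsilon> x z)"
proof -
  have *: "1 \<le> (1/\<epsilon>) * norm z" if "\<epsilon> < norm z" using that assms by (simp add: field_simps)
  have "1 * jk \<epsilon> x z \<le> ((1/\<epsilon>) * norm z)^2 * jk \<epsilon> x z" if "\<epsilon> < norm z"
    using *[OF that] jk_nonneg[of \<epsilon> x z] assms by (intro mult_right_mono) (auto simp: one_le_power)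
  then show "jk \<epsilon> x z \<le> (1 / \<epsilon>\<^sup>2) * (norm z ^ 2 * jk \<epsilon> x z)"
    by (cases "\<epsilon> < norm z") (auto simp: power_mult_distrib power_divide jk_def)
  have "1 * (norm z * jk \<epsilon> x z) \<le> ((1/\<epsilon>) * norm z) * (norm z * jk \<epsilon> x z)" if "\<epsilon> < norm z"
    using *[OF that] jk_nonneg[of \<epsilon> x z] assms by (intro mult_right_mono) auto
  then show "norm z * jk \<epsilon> x z \<le> (1 / \<epsilon>) * (norm z ^ 2 * jk \<epsilon> x z)"
    by (cases "\<epsilon> < norm z") (auto simp: power2_eq_square jk_def)
qed

lemma integrable_jk:
  assumes "0 < \<epsilon>"
  shows "integrable lborel (\<lambda>z. jk \<epsilon> x z)" "integrable lborel (\<lambda>z. norm z * jk \<epsilon> x z)"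
    "(LINT z|lborel. jk \<epsilon> x z) \<le> \<kappa>1 * K2 / \<epsilon>\<^sup>2"
proof -
  have i: "integrable lborel (\<lambda>z. c * (norm z ^ 2 * jk \<epsilon> x z))" for c
    by (intro integrable_mult_right integrable_jk_second_moment) (use assms in auto)
  show 1: "integrable lborel (\<lambda>z. jk \<epsilon> x z)"
    by (rule Bochner_Integration.integrable_bound[OF i[of "1/\<epsilon>\<^sup>2"]])
      (use jk_outside(1)[OF assms, of x] jk_nonneg[of \<epsilon> x] assms in auto)
  show "integrable lborel (\<lambda>z. norm z * jk \<epsilon> x z)"
    by (rule Bochner_Integration.integrable_bound[OF i[of "1/\<epsilon>"]])
      (use jk_outside(2)[OF assms, of _ x] jk_nonneg[of \<epsilon> x] assms in \<open>auto simp: abs_mult\<close>)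
  have "(LINT z|lborel. jk \<epsilon> x z) \<le> (LINT z|lborel. (1 / \<epsilon>\<^sup>2) * (norm z ^ 2 * jk \<epsilon> x z))"
    by (intro integral_mono 1 i jk_outside assms)
  also have "\<dots> \<le> (1 / \<epsilon>\<^sup>2) * (\<kappa>1 * K2)"
    using integrable_jk_second_moment(2)[of \<epsilon> x] assms by (simp add: divide_right_mono)
  finally show "(LINT z|lborel. jk \<epsilon> x z) \<le> \<kappa>1 * K2 / \<epsilon>\<^sup>2" by simp
qed

end

section \<open>Tools for parameter integrals\<close>

lemma distr_lborel_diff: "distr lborel borel (\<lambda>y. x - y) = (lborel :: 'a::euclidean_space measure)"
  using lborel_affine[of "- 1" x] by (simp add: density_1)

lemma nn_integral_lborel_diff:
  fixes f :: "'a::euclidean_space \<Rightarrow> ennreal"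
  assumes [measurable]: "f \<in> borel_measurable borel"
  shows "(\<integral>\<^sup>+y. f (x - y) \<partial>lborel) = (\<integral>\<^sup>+y. f y \<partial>lborel)"
  by (subst (2) distr_lborel_diff[of x, symmetric]) (simp add: nn_integral_distr)

lemma nn_integral_lborel_plus:
  fixes f :: "'a::euclidean_space \<Rightarrow> ennreal"
  assumes [measurable]: "f \<in> borel_measurable borel"
  shows "(\<integral>\<^sup>+y. f (x + y) \<partial>lborel) = (\<integral>\<^sup>+y. f y \<partial>lborel)"
  by (subst (2) lborel_distr_plus[of x, symmetric]) (simp add: nn_integral_distr)

lemma integral_lborel_uminus:
  fixes f :: "'a::euclidean_space \<Rightarrow> real"
  assumes [measurable]: "f \<in> borel_measurable borel"
  shows "(LINT y|lborel. f (- y)) = (LINT y|lborel. f y)"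
  using distr_lborel_diff[of "0::'a"]
  by (subst (2) distr_lborel_diff[of 0, symmetric]) (simp add: integral_distr)

lemma tendsto_integral_at_within:
  fixes f :: "'c::first_countable_topology \<Rightarrow> 'b \<Rightarrow> 'd::{banach, second_countable_topology}"
  assumes "\<And>s. s \<in> S \<Longrightarrow> f s \<in> borel_measurable M" "g \<in> borel_measurable M"
    and w: "integrable M w"
    and lim: "AE y in M. ((\<lambda>s. f s y) \<longlongrightarrow> g y) (at t within S)"
    and bound: "\<And>s. s \<in> S \<Longrightarrow> AE y in M. norm (f s y) \<le> w y"
  shows "((\<lambda>s. LINT y|M. f s y) \<longlongrightarrow> (LINT y|M. g y)) (at t within S)"
  unfolding tendsto_at_iff_sequentially
proof (intro allI impI)
  fix X assume X: "\<forall>i. X i \<in> S - {t}" "X \<longlonglongrightarrow> t"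
  have "(\<lambda>i. LINT y|M. f (X i) y) \<longlonglongrightarrow> (LINT y|M. g y)"
  proof (rule integral_dominated_convergence[where w=w])
    show "AE y in M. (\<lambda>i. f (X i) y) \<longlonglongrightarrow> g y"
      using lim by eventually_elim (use X in \<open>auto simp: tendsto_at_iff_sequentially comp_def\<close>)
  qed (use X assms in auto)
  then show "((\<lambda>s. LINT y|M. f s y) \<circ> X) \<longlonglongrightarrow> (LINT y|M. g y)" by (simp add: comp_def)
qed

lemma has_real_derivative_integral:
  fixes f :: "real \<Rightarrow> 'b \<Rightarrow> real"
  assumes "\<delta> > 0"
    and int: "\<And>s. s \<in> ball t \<delta> \<Longrightarrow> integrable M (f s)"
    and der: "AE y in M. \<forall>s\<in>ball t \<delta>. ((\<lambda>s. f s y) has_real_derivative f' s y) (at s) \<and> \<bar>f' s y\<bar> \<le> w y"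
    and w: "integrable M w" and meas: "f' t \<in> borel_measurable M"
  shows "((\<lambda>s. LINT y|M. f s y) has_real_derivative (LINT y|M. f' t y)) (at t)"
proof -
  let ?B = "ball t \<delta>"
  have at: "at t within ?B = at t" using assms(1) by (intro at_within_open) auto
  have "((\<lambda>s. LINT y|M. (f s y - f t y) / (s - t)) \<longlongrightarrow> (LINT y|M. f' t y)) (at t within ?B)"
  proof (rule tendsto_integral_at_within[where w=w])
    show "(\<lambda>y. (f s y - f t y) / (s - t)) \<in> borel_measurable M" if "s \<in> ?B" for s
      using that int assms(1) by (auto intro!: borel_measurable_divide borel_measurable_diff)
    show "AE y in M. ((\<lambda>s. (f s y - f t y) / (s - t)) \<longlongrightarrow> f' t y) (at t within ?B)"
      using der unfolding at by eventually_elim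
        (use assms(1) in \<open>auto simp: has_field_derivative_iff\<close>)
    show "AE y in M. norm ((f s y - f t y) / (s - t)) \<le> w y" if s: "s \<in> ?B" for s
      using der
    proof eventually_elim
      case (elim y)
      have "norm (f s y - f t y) \<le> w y * norm (s - t)"
        by (rule field_differentiable_bound[where S="?B" and f'="\<lambda>s. f' s y"])
          (use elim s assms(1) in \<open>auto intro: has_field_derivative_at_within\<close>)
      moreover have "w y \<ge> 0" using bspec[OF elim, of t] assms(1) by (auto dest: order_trans[OF abs_ge_zero])
      ultimately show ?case by (cases "s = t") (auto simp: divide_simps)
    qed
  qed (use w meas in auto)
  then have "((\<lambda>s. LINT y|M. (f s y - f t y) / (s - t)) \<longlongrightarrow> (LINT y|M. f' t y)) (at t)"
    by (simp only: at)
  moreover have "eventually (\<lambda>s. (LINT y|M. (f s y - f t y) / (s - t)) =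
      ((LINT y|M. f s y) - (LINT y|M. f t y)) / (s - t)) (at t)"
  proof -
    have "eventually (\<lambda>s. s \<in> ?B) (at t)"
      using assms(1) by (intro eventually_at_in_open') auto
    then show ?thesis
      by eventually_elim (use int[of t] int assms(1) in simp)
  qed
  ultimately have "((\<lambda>s. ((LINT y|M. f s y) - (LINT y|M. f t y)) / (s - t)) \<longlongrightarrow> (LINT y|M. f' t y)) (at t)"
    by (rule Lim_transform_eventually)
  then show ?thesis by (simp add: has_field_derivative_iff)
qed

text \<open>
  Tent functions serve as test functions: they are Lipschitz with compact support, and they
  detect the sign of a continuous function at a point.
\<close>

definition tent :: "'a::euclidean_space \<Rightarrow> real \<Rightarrow> 'a \<Rightarrow> real"
  where "tent y0 r y = max 0 (r - dist y y0)"

lemma tent_nonneg: "0 \<le> tent y0 r y" by (simp add: tent_def)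

lemma tent_outside: "r \<le> dist y y0 \<Longrightarrow> tent y0 r y = 0" by (simp add: tent_def)

lemma abs_tent_le: "0 \<le> r \<Longrightarrow> \<bar>tent y0 r y\<bar> \<le> r" by (simp add: tent_def)

lemma continuous_tent [continuous_intros]: "continuous_on S (tent y0 r)"
  unfolding tent_def by (intro continuous_intros)

lemma measurable_tent [measurable]: "tent y0 r \<in> borel_measurable borel"
  by (intro borel_measurable_continuous_onI continuous_intros)

lemma bounded_tent: "bounded (range (tent y0 r))"
proof -
  have "\<bar>tent y0 r y\<bar> \<le> \<bar>r\<bar>" for y unfolding tent_def using zero_le_dist[of y y0] by linarith
  then show ?thesis by (auto simp: bounded_iff)
qed

lemma uniformly_continuous_tent: "uniformly_continuous_on UNIV (tent y0 r)"
proof (rule lipschitz_on_uniformly_continuous[where L=1], rule lipschitz_onI)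
  show "dist (tent y0 r x) (tent y0 r y) \<le> 1 * dist x y" for x y
    using abs_dist_diff_le[of x y0 y] unfolding tent_def dist_real_def by (simp add: max_def dist_commute; linarith)
qed auto

text \<open>
  If \<open>k\<close> were positive at the point, its integral against a sufficiently narrow tent would be
  positive.
\<close>

lemma tent_sign_test:
  assumes cont: "isCont k y0" and "\<rho> > 0"
    and int: "\<And>r. 0 < r \<Longrightarrow> r < \<rho> \<Longrightarrow> integrable lborel (\<lambda>y. k y * tent y0 r y)"
    and le: "\<And>r. 0 < r \<Longrightarrow> r < \<rho> \<Longrightarrow> (LINT y|lborel. k y * tent y0 r y) \<le> 0"
  shows "k y0 \<le> (0::real)"
proof (rule ccontr)
  assume "\<not> k y0 \<le> 0"
  then have pos: "k y0 > 0" by simp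
  then obtain s where s: "s > 0" "\<And>y. dist y y0 < s \<Longrightarrow> \<bar>k y - k y0\<bar> < k y0 / 2"
    using cont unfolding continuous_at_eps_delta dist_real_def by (metis half_gt_zero)
  define r where "r = min s (\<rho> / 2)"
  have r: "0 < r" "r < \<rho>" "r \<le> s" using s assms(2) by (auto simp: r_def)
  define A where "A = ball y0 (r/2)"
  have mA: "emeasure lborel A = ennreal (unit_ball_vol (real DIM('a)) * (r/2) ^ DIM('a))"
    unfolding A_def using r by (intro emeasure_ball) auto
  have "(LINT y|lborel. (k y0 / 2 * (r / 2)) * indicator A y) \<le> (LINT y|lborel. k y * tent y0 r y)"
  proof (rule integral_mono)
    show "integrable lborel (\<lambda>y. k y0 / 2 * (r / 2) * indicat_real A y)"
      using mA by (intro integrable_mult_right) (auto simp: integrable_indicator_iff A_def)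
    show "integrable lborel (\<lambda>y. k y * tent y0 r y)" using int r by auto
    fix y
    show "(k y0 / 2 * (r / 2)) * indicator A y \<le> k y * tent y0 r y"
    proof (cases "dist y y0 < r")
      case True
      then have "\<bar>k y - k y0\<bar> < k y0 / 2" using s(2)[of y] r by simp
      then have k: "k y \<ge> k y0 / 2" by linarith
      show ?thesis
      proof (cases "y \<in> A")
        case True
        then have "tent y0 r y \<ge> r / 2" unfolding A_def tent_def mem_ball dist_commute[of y0] by linarith
        then have "k y0 / 2 * (r / 2) \<le> k y * tent y0 r y" using k pos r by (intro mult_mono) auto
        then show ?thesis using True by simp
      qed (use k pos tent_nonneg[of y0 r y] in auto)
    qed (use tent_outside[of r y y0] r in \<open>auto simp: A_def dist_commute\<close>)
  qed
  also have "\<dots> \<le> 0" using le r by auto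
  finally have "(k y0 / 2 * (r / 2)) * measure lborel A \<le> 0" by (simp add: A_def)
  moreover have "measure lborel A > 0"
    using mA r by (simp add: measure_def)
  ultimately show False using pos r by (simp add: mult_le_0_iff)
qed


section \<open>The maximum principle\<close>

context nonlocal_operator
begin

lemma integrable_increment:
  assumes "0 < \<epsilon>" and [measurable]: "f \<in> borel_measurable borel" and bound: "\<And>y. \<bar>f y\<bar> \<le> B"
  shows "integrable lborel (\<lambda>z. (f (x + z) - f x) * jk \<epsilon> x z)"
proof (rule Bochner_Integration.integrable_bound)
  show "integrable lborel (\<lambda>z. (2 * B) * jk \<epsilon> x z)"
    by (intro integrable_mult_right integrable_jk assms)
  show "(\<lambda>z. (f (x + z) - f x) * jk \<epsilon> x z) \<in> borel_measurable lborel"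
    using measurable_jk2[of \<epsilon> x] assms(1) by (auto intro!: borel_measurable_times borel_measurable_diff)
  have "\<bar>(f (x + z) - f x) * jk \<epsilon> x z\<bar> \<le> (2 * B) * jk \<epsilon> x z" for z
    using bound[of x] bound[of "x + z"] jk_nonneg[of \<epsilon> x z] assms(1)
    by (auto simp: abs_mult intro!: mult_right_mono)
  then show "AE z in lborel. norm ((f (x + z) - f x) * jk \<epsilon> x z) \<le> norm (2 * B * jk \<epsilon> x z)"
    by (intro AE_I2) (metis abs_ge_self order_trans real_norm_def)
qed

text \<open>
  The truncated operator maps \<open>|x|\<^sup>2\<close> to a bounded function: by the symmetry of \<open>\<kappa>\<close> the
  linear part of the increment \<open>2 x \<bullet> z + |z|\<^sup>2\<close> integrates to zero.  This makes \<open>|x|\<^sup>2\<close> a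
  barrier at infinity.
\<close>

lemma truncated_operator_square:
  assumes "0 < \<epsilon>"
  shows "integrable lborel (\<lambda>z. (norm (x + z) ^ 2 - norm x ^ 2) * jk \<epsilon> x z)"
    "(LINT z|lborel. (norm (x + z) ^ 2 - norm x ^ 2) * jk \<epsilon> x z) \<le> \<kappa>1 * K2"
proof -
  have e: "\<epsilon> \<ge> 0" using assms by simp
  have [measurable]: "(\<lambda>z. jk \<epsilon> x z) \<in> borel_measurable borel" using e by simp
  have eq: "(norm (x + z) ^ 2 - norm x ^ 2) * jk \<epsilon> x z = 2 * ((x \<bullet> z) * jk \<epsilon> x z) + norm z ^ 2 * jk \<epsilon> x z" for z
    by (simp add: power2_norm_eq_inner inner_add_left inner_add_right inner_commute algebra_simps)
  have i1: "integrable lborel (\<lambda>z. (x \<bullet> z) * jk \<epsilon> x z)"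
  proof (rule Bochner_Integration.integrable_bound)
    show "integrable lborel (\<lambda>z. norm x * (norm z * jk \<epsilon> x z))"
      by (intro integrable_mult_right integrable_jk assms)
    have "\<bar>(x \<bullet> z) * jk \<epsilon> x z\<bar> \<le> norm x * (norm z * jk \<epsilon> x z)" for z
      using mult_right_mono[OF Cauchy_Schwarz_ineq2[of x z] jk_nonneg[OF e, of x z]] jk_nonneg[OF e, of x z]
      by (simp add: abs_mult mult.assoc)
    then show "AE z in lborel. norm ((x \<bullet> z) * jk \<epsilon> x z) \<le> norm (norm x * (norm z * jk \<epsilon> x z))"
      by (intro AE_I2) (metis abs_ge_self order_trans real_norm_def)
  qed auto
  note i2 = integrable_jk_second_moment[OF e, of x]
  show "integrable lborel (\<lambda>z. (norm (x + z) ^ 2 - norm x ^ 2) * jk \<epsilon> x z)"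
    unfolding eq by (intro Bochner_Integration.integrable_add integrable_mult_right i1 i2)
  have "(LINT z|lborel. (x \<bullet> z) * jk \<epsilon> x z) = (LINT z|lborel. (x \<bullet> - z) * jk \<epsilon> x (- z))"
    by (rule integral_lborel_uminus[symmetric]) auto
  also have "\<dots> = - (LINT z|lborel. (x \<bullet> z) * jk \<epsilon> x z)"
    by (simp add: jk_minus)
  finally have "(LINT z|lborel. (x \<bullet> z) * jk \<epsilon> x z) = 0" by simp
  then show "(LINT z|lborel. (norm (x + z) ^ 2 - norm x ^ 2) * jk \<epsilon> x z) \<le> \<kappa>1 * K2"
    unfolding eq using i1 i2 by simp
qed

text \<open>
  If \<open>u\<close> exceeded \<open>m + M t\<close> somewhere, then \<open>u - \<delta>|x|\<^sup>2 - (M + \<delta>(K + 1)) t\<close>, with \<open>K\<close> the bound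
  for the operator on \<open>|x|\<^sup>2\<close> and \<open>\<delta>\<close> small, would have a maximum at a positive time.
  There the time derivative of \<open>u\<close> is at least \<open>M + \<delta>(K + 1)\<close>, while every truncated operator,
  and so their limit, is at most \<open>\<delta>K\<close>.
\<close>

lemma maximum_principle:
  fixes u :: "real \<Rightarrow> 'a \<Rightarrow> real"
  assumes cont: "continuous_on ({0<..T} \<times> UNIV) (\<lambda>(t, x). u t x)"
    and bdd: "\<And>t x. t \<in> {0<..T} \<Longrightarrow> \<bar>u t x\<bar> \<le> B"
    and init: "\<And>\<eta>. \<eta> > 0 \<Longrightarrow> eventually (\<lambda>t. \<forall>x. u t x \<le> m + \<eta>) (at_right 0)"
    and eqn: "\<And>t x. t \<in> {0<..T} \<Longrightarrow> \<exists>D l. ((\<lambda>s. u s x) has_real_derivative D) (at t) \<and>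
      ((\<lambda>\<epsilon>. jump_op_trunc \<kappa> J \<epsilon> (u t) x) \<longlongrightarrow> l) (at_right 0) \<and> D \<le> l + M"
    and "M \<ge> 0" and t1: "t1 \<in> {0<..T}"
  shows "u t1 x1 \<le> m + M * t1"
proof (rule ccontr)
  assume not_le: "\<not> u t1 x1 \<le> m + M * t1"
  define g where "g = u t1 x1 - m - M * t1"
  have g: "g > 0" using not_le by (simp add: g_def)
  define K where "K = \<kappa>1 * K2"
  have K: "K \<ge> 0" using \<kappa>1_pos K2_nonneg by (simp add: K_def)
  define N where "N = norm x1 ^ 2 + (K + 1) * t1 + 1"
  have N: "N \<ge> 1" using K t1 by (simp add: N_def)
  \<comment> \<open>Small enough for the barrier to cost less than half of the excess \<open>g\<close> at \<open>(t1, x1)\<close>.\<close>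
  define \<delta> where "\<delta> = g / (2 * N)"
  have \<delta>: "\<delta> > 0" using g N by (simp add: \<delta>_def)
  have dN: "\<delta> * (norm x1 ^ 2 + (K + 1) * t1) < g / 2"
  proof -
    have "\<delta> * (norm x1 ^ 2 + (K + 1) * t1) < \<delta> * N" using \<delta> by (simp add: N_def)
    also have "\<dots> = g / 2" using N by (simp add: \<delta>_def)
    finally show ?thesis .
  qed
  define w where "w t x = u t x - \<delta> * norm x ^ 2 - (M + \<delta> * (K + 1)) * t" for t x
  have w1: "w t1 x1 > m + g / 2"
  proof -
    have "w t1 x1 = m + g - \<delta> * (norm x1 ^ 2 + (K + 1) * t1)"
      by (simp add: w_def g_def algebra_simps)
    then show ?thesis using dN by linarith
  qed
  have w_le_u: "w t x \<le> u t x - \<delta> * norm x ^ 2" if "t > 0" for t x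
    using that assms(5) \<delta> K by (simp add: w_def)
  obtain \<tau> where \<tau>: "\<tau> > 0" "\<And>t x. 0 < t \<Longrightarrow> t < \<tau> \<Longrightarrow> u t x \<le> m + g / 2"
    using init[of "g/2"] g unfolding eventually_at_right_field by auto
  have small: "w t x \<le> m + g / 2" if "0 < t" "t < \<tau>" for t x
  proof -
    have "0 \<le> \<delta> * norm x ^ 2" using \<delta> by simp
    then show ?thesis using \<tau>(2)[of t x] w_le_u[of t x] that by linarith
  qed
  \<comment> \<open>Outside this ball the barrier keeps \<open>w\<close> below \<open>m + g/2\<close>, so the maximum is attained inside.\<close>
  define R where "R = 1 + \<bar>(B - (m + g/2)) / \<delta>\<bar> + norm x1"
  have R: "R \<ge> 1" "norm x1 \<le> R" by (auto simp: R_def)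
  have large: "w t x \<le> m + g / 2" if "t \<in> {0<..T}" "norm x > R" for t x
  proof -
    have "(B - (m + g/2)) / \<delta> \<le> R"
      using abs_ge_self[of "(B - (m + g/2)) / \<delta>"] norm_ge_zero[of x1] unfolding R_def by linarith
    also have "R \<le> R * R" using R by simp
    also have "\<dots> \<le> norm x ^ 2" using that R unfolding power2_eq_square by (intro mult_mono) auto
    finally have "B - (m + g/2) \<le> \<delta> * norm x ^ 2" using \<delta> by (simp add: field_simps)
    then show ?thesis using bdd[OF that(1), of x] w_le_u[of t x] that by (auto simp: abs_le_iff)
  qed
  have \<tau>t1: "\<tau> \<le> t1" using small[of t1 x1] w1 t1 by (cases "t1 < \<tau>") auto
  let ?S = "{\<tau>/2..T} \<times> cball (0::'a) R"
  have S1: "(t1, x1) \<in> ?S" using \<tau>t1 \<tau> t1 R by auto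
  have sub: "?S \<subseteq> {0<..T} \<times> UNIV" using \<tau> by auto
  have "continuous_on ?S (\<lambda>tx. (\<lambda>(t, x). u t x) tx - \<delta> * norm (snd tx) ^ 2 - (M + \<delta> * (K + 1)) * fst tx)"
    by (intro continuous_intros continuous_on_subset[OF cont sub])
  then have "continuous_on ?S (\<lambda>tx. w (fst tx) (snd tx))" by (simp add: w_def split_beta')
  moreover have "compact ?S" by (intro compact_Times) auto
  ultimately obtain tx where tx: "tx \<in> ?S" "\<And>tx'. tx' \<in> ?S \<Longrightarrow> w (fst tx') (snd tx') \<le> w (fst tx) (snd tx)"
    using continuous_attains_sup[of ?S "\<lambda>tx. w (fst tx) (snd tx)"] S1 by blast
  define t0 x0 where "t0 = fst tx" and "x0 = snd tx"
  have w0: "w t0 x0 > m + g/2" using tx(2)[OF S1] w1 by (simp add: t0_def x0_def)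
  have t0: "t0 \<in> {0<..T}" using tx(1) sub by (auto simp: t0_def mem_Times_iff)
  have max: "w t x \<le> w t0 x0" if "t \<in> {0<..T}" for t x
  proof (cases "t < \<tau> \<or> norm x > R")
    case True
    then have "w t x \<le> m + g / 2" using small[of t x] large[of t x] that by auto
    then show ?thesis using w0 by simp
  next
    case False
    then have "(t, x) \<in> ?S" using that \<tau> by auto
    from tx(2)[OF this] show ?thesis by (simp add: t0_def x0_def)
  qed
  obtain D l where D: "((\<lambda>s. u s x0) has_real_derivative D) (at t0)"
    and l: "((\<lambda>\<epsilon>. jump_op_trunc \<kappa> J \<epsilon> (u t0) x0) \<longlongrightarrow> l) (at_right 0)" and Dl: "D \<le> l + M"
    using eqn[OF t0] by blast
  have Dw: "((\<lambda>s. w s x0) has_real_derivative (D - (M + \<delta> * (K + 1)))) (at t0)"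
    unfolding w_def by (auto intro!: derivative_eq_intros D)
  \<comment> \<open>At a maximum over \<open>(0,T]\<close> the left difference quotients in time are nonnegative, also at the final time.\<close>
  have "D - (M + \<delta> * (K + 1)) \<ge> 0"
  proof (rule ccontr)
    assume "\<not> ?thesis"
    then obtain d where d: "d > 0" "\<And>h. h > 0 \<Longrightarrow> h < d \<Longrightarrow> w t0 x0 < w (t0 - h) x0"
      using DERIV_neg_dec_left[OF Dw] by auto
    define h where "h = min (d/2) (t0/2)"
    have "h > 0" "h < d" "t0 - h \<in> {0<..T}" using d t0 by (auto simp: h_def min_def)
    then show False using d(2)[of h] max[of "t0 - h" x0] by simp
  qed
  moreover have "l \<le> \<delta> * K"
  proof (rule tendsto_upperbound[OF l])
    have "jump_op_trunc \<kappa> J \<epsilon> (u t0) x0 \<le> \<delta> * K" if e: "\<epsilon> > 0" for \<epsilon>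
    proof -
      have "continuous_on UNIV (\<lambda>x. (\<lambda>(t, x). u t x) (t0, x))"
        by (rule continuous_on_compose2[OF cont]) (use t0 in \<open>auto intro!: continuous_intros\<close>)
      then have [measurable]: "u t0 \<in> borel_measurable borel"
        by (intro borel_measurable_continuous_onI) simp
      have "jump_op_trunc \<kappa> J \<epsilon> (u t0) x0 = (LINT z|lborel. (u t0 (x0 + z) - u t0 x0) * jk \<epsilon> x0 z)"
        using e by (simp add: jump_op_trunc_eq)
      also have "\<dots> \<le> (LINT z|lborel. \<delta> * ((norm (x0 + z) ^ 2 - norm x0 ^ 2) * jk \<epsilon> x0 z))"
      proof (rule integral_mono)
        show "integrable lborel (\<lambda>z. (u t0 (x0 + z) - u t0 x0) * jk \<epsilon> x0 z)"
          by (rule integrable_increment[OF e, where B=B]) (use bdd t0 in auto)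
        show "integrable lborel (\<lambda>z. \<delta> * ((norm (x0 + z) ^ 2 - norm x0 ^ 2) * jk \<epsilon> x0 z))"
          by (intro integrable_mult_right truncated_operator_square e)
        fix z
        have "u t0 (x0 + z) - u t0 x0 \<le> \<delta> * (norm (x0 + z) ^ 2 - norm x0 ^ 2)"
          using max[OF t0, of "x0 + z"] by (simp add: w_def algebra_simps)
        from mult_right_mono[OF this jk_nonneg[of \<epsilon> x0 z]] e
        show "(u t0 (x0 + z) - u t0 x0) * jk \<epsilon> x0 z \<le> \<delta> * ((norm (x0 + z) ^ 2 - norm x0 ^ 2) * jk \<epsilon> x0 z)"
          by (simp add: mult.assoc)
      qed
      also have "\<dots> \<le> \<delta> * K"
        using truncated_operator_square[OF e, of x0] \<delta> by (simp add: K_def)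
      finally show ?thesis .
    qed
    then show "eventually (\<lambda>\<epsilon>. jump_op_trunc \<kappa> J \<epsilon> (u t0) x0 \<le> \<delta> * K) (at_right 0)"
      by (auto simp: eventually_at_right_field intro!: exI[of _ 1])
  qed simp
  ultimately have "M + \<delta> * (K + 1) \<le> \<delta> * K + M" using Dl by linarith
  then show False using \<delta> by (simp add: algebra_simps)
qed

end

section \<open>Integrability of the heat kernel\<close>

lemma integrable_times_tent:
  assumes "continuous_on (cball y0 r) k"
  shows "integrable lborel (\<lambda>y. k y * tent y0 r y)"
proof -
  have "integrable lborel (\<lambda>y. indicator (cball y0 r) y *\<^sub>R (k y * tent y0 r y))"
    by (intro borel_integrable_compact continuous_intros assms) auto
  moreover have "indicator (cball y0 r) y *\<^sub>R (k y * tent y0 r y) = k y * tent y0 r y" for y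
    using tent_outside[of r y y0] by (cases "y \<in> cball y0 r") (auto simp: dist_commute)
  ultimately show ?thesis by (simp only:)
qed

locale heat_kernel_setting = nonlocal_operator J \<phi> a b \<beta> \<alpha>1 a1 \<kappa>0 \<kappa>1 \<kappa>2 \<delta> \<kappa>
  for J \<phi> :: "real \<Rightarrow> real"
    and a b \<beta> \<alpha>1 a1 \<kappa>0 \<kappa>1 \<kappa>2 \<delta> :: real
    and \<kappa> :: "'a::euclidean_space \<Rightarrow> 'a \<Rightarrow> real" +
  fixes p :: "real \<Rightarrow> 'a \<Rightarrow> 'a \<Rightarrow> real"
  assumes heat: "heat_kernel J \<phi> b \<beta> \<kappa> p"
begin

definition q :: "real \<Rightarrow> 'a \<Rightarrow> 'a \<Rightarrow> real"
  where "q t x y = jump_op \<kappa> J (\<lambda>w. p t w y) x"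

lemma
  shows p_continuous: "continuous_on ({0<..} \<times> UNIV \<times> UNIV) (\<lambda>(t, x, y). p t x y)"
    and p_derivative: "t > 0 \<Longrightarrow> x \<noteq> y \<Longrightarrow> ((\<lambda>s. p s x y) has_real_derivative q t x y) (at t)"
    and initial_condition: "bounded (range f) \<Longrightarrow> uniformly_continuous_on UNIV f \<Longrightarrow>
       uniform_limit UNIV (\<lambda>t x. LINT y|lborel. p t x y * f y) f (at_right 0)"
  using heat unfolding heat_kernel_def q_def by blast+

lemma truncated_tendsto_q:
  assumes "t > 0"
  shows "((\<lambda>\<epsilon>. jump_op_trunc \<kappa> J \<epsilon> (\<lambda>w. p t w y) x) \<longlongrightarrow> q t x y) (at_right 0)"
proof -
  have "jump_op_exists \<kappa> J (\<lambda>w. p t w y) x" using heat assms unfolding heat_kernel_def by blast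
  then obtain l where l: "((\<lambda>\<epsilon>. jump_op_trunc \<kappa> J \<epsilon> (\<lambda>w. p t w y) x) \<longlongrightarrow> l) (at_right 0)"
    unfolding jump_op_exists_def by blast
  then have "q t x y = l" unfolding q_def jump_op_def by (intro tendsto_Lim) auto
  then show ?thesis using l by simp
qed

text \<open>
  One constant for the upper bound of the kernel and for both bounds on the operator, up to a
  given time; \<open>cT\<close> chooses such a constant, so that it need not be obtained in every proof.
\<close>

definition kernel_bound :: "real \<Rightarrow> real \<Rightarrow> bool"
  where "kernel_bound T c \<longleftrightarrow> c > 0 \<and> (\<forall>t\<in>{0<..T}. \<forall>x y. p t x y \<le> c * t * G t (x - y) \<and>
    \<bar>q t x y\<bar> \<le> c * G t (x - y) \<and>
    (\<forall>\<epsilon>\<in>{0<..1}. \<bar>jump_op_trunc \<kappa> J \<epsilon> (\<lambda>w. p t w y) x\<bar> \<le> c * G t (x - y)))"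

lemma kernel_bound_exists: "\<exists>c. kernel_bound (max 1 T) c"
proof -
  obtain C where C: "C \<ge> 1" "\<And>t z. 0 < t \<Longrightarrow> G_bound \<phi> b \<beta> t (z::'a) \<le> C * G t z"
    using G_bound_le_G by blast
  have "max 1 T \<ge> 1" by simp
  have h1: "\<forall>T\<ge>1. \<exists>c>0. \<forall>t\<in>{0<..T}. \<forall>x y. p t x y \<le> c * t * G_bound \<phi> b \<beta> t (x - y)"
    and h2: "\<forall>T\<ge>1. \<exists>c>0. \<forall>t\<in>{0<..T}. \<forall>x y.
       (\<forall>\<epsilon>\<in>{0<..1}. \<bar>jump_op_trunc \<kappa> J \<epsilon> (\<lambda>w. p t w y) x\<bar> \<le> c * G t (x - y)) \<and>
       \<bar>q t x y\<bar> \<le> c * G t (x - y)"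
    using heat unfolding heat_kernel_def q_def G_def by blast+
  from h1[rule_format, OF \<open>max 1 T \<ge> 1\<close>] obtain c1 where c1: "c1 > 0"
      "\<And>t x y. t \<in> {0<..max 1 T} \<Longrightarrow> p t x y \<le> c1 * t * G_bound \<phi> b \<beta> t (x - y)"
    by blast
  from h2[rule_format, OF \<open>max 1 T \<ge> 1\<close>] obtain c2 where c2: "c2 > 0"
      "\<And>t x y. t \<in> {0<..max 1 T} \<Longrightarrow> \<bar>q t x y\<bar> \<le> c2 * G t (x - y)"
      "\<And>t x y \<epsilon>. t \<in> {0<..max 1 T} \<Longrightarrow> \<epsilon> \<in> {0<..1} \<Longrightarrow>
        \<bar>jump_op_trunc \<kappa> J \<epsilon> (\<lambda>w. p t w y) x\<bar> \<le> c2 * G t (x - y)"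
    by blast
  have "kernel_bound (max 1 T) (c1 * C + c2)"
    unfolding kernel_bound_def
  proof (intro conjI ballI allI)
    show "c1 * C + c2 > 0" using c1 c2 C by (intro add_pos_pos mult_pos_pos) auto
    fix t x y assume t: "t \<in> {0<..max 1 T}"
    then have G: "G t (x - y) \<ge> 0" by (intro G_nonneg) auto
    have le: "c2 * G t (x - y) \<le> (c1 * C + c2) * G t (x - y)"
      using c1 C G by (intro mult_right_mono) auto
    show "\<bar>q t x y\<bar> \<le> (c1 * C + c2) * G t (x - y)" using c2(2)[OF t, of x y] le by linarith
    show "\<bar>jump_op_trunc \<kappa> J \<epsilon> (\<lambda>w. p t w y) x\<bar> \<le> (c1 * C + c2) * G t (x - y)" if "\<epsilon> \<in> {0<..1}" for \<epsilon>
      using c2(3)[OF t that, of y x] le by linarith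
    have "p t x y \<le> c1 * t * G_bound \<phi> b \<beta> t (x - y)" by (rule c1(2)[OF t])
    also have "\<dots> \<le> c1 * t * (C * G t (x - y))" using C(2)[of t "x - y"] t c1 by (intro mult_left_mono) auto
    also have "\<dots> = c1 * C * (t * G t (x - y))" by simp
    also have "\<dots> \<le> (c1 * C + c2) * (t * G t (x - y))" using c2 t G by (intro mult_right_mono) auto
    finally show "p t x y \<le> (c1 * C + c2) * t * G t (x - y)" by (simp add: mult.assoc)
  qed
  then show ?thesis by blast
qed

definition cT :: "real \<Rightarrow> real" where "cT T = (SOME c. kernel_bound (max 1 T) c)"

lemma
  shows cT_pos: "cT T > 0"
    and p_upper: "0 < t \<Longrightarrow> t \<le> T \<Longrightarrow> p t x y \<le> cT T * t * G t (x - y)"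
    and q_bound: "0 < t \<Longrightarrow> t \<le> T \<Longrightarrow> \<bar>q t x y\<bar> \<le> cT T * G t (x - y)"
    and truncated_bound: "0 < t \<Longrightarrow> t \<le> T \<Longrightarrow> 0 < \<epsilon> \<Longrightarrow> \<epsilon> \<le> 1 \<Longrightarrow>
      \<bar>jump_op_trunc \<kappa> J \<epsilon> (\<lambda>w. p t w y) x\<bar> \<le> cT T * G t (x - y)"
proof -
  have *: "kernel_bound (max 1 T) (cT T)" unfolding cT_def by (rule someI_ex[OF kernel_bound_exists])
  show "cT T > 0" using * by (simp add: kernel_bound_def)
  assume t: "0 < t" "t \<le> T"
  then have "t \<in> {0<..max 1 T}" by auto
  note ** = bspec[OF *[unfolded kernel_bound_def, THEN conjunct2] this, rule_format]
  show "p t x y \<le> cT T * t * G t (x - y)" "\<bar>q t x y\<bar> \<le> cT T * G t (x - y)" using ** by blast+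
  assume "0 < \<epsilon>" "\<epsilon> \<le> 1"
  then show "\<bar>jump_op_trunc \<kappa> J \<epsilon> (\<lambda>w. p t w y) x\<bar> \<le> cT T * G t (x - y)" using ** by auto
qed

lemma p_continuous_compose:
  assumes "continuous_on S f" "continuous_on S g" "continuous_on S h" "\<And>s. s \<in> S \<Longrightarrow> 0 < f s"
  shows "continuous_on S (\<lambda>s. p (f s) (g s) (h s))"
proof -
  have "continuous_on S (\<lambda>s. (\<lambda>(t, x, y). p t x y) (f s, g s, h s))"
    by (rule continuous_on_compose2[OF p_continuous]) (use assms in \<open>auto intro!: continuous_intros\<close>)
  then show ?thesis by simp
qed

lemma p_measurable: "t > 0 \<Longrightarrow> (\<lambda>xy. p t (fst xy) (snd xy)) \<in> borel_measurable (borel \<Otimes>\<^sub>M borel)"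
  unfolding borel_prod
  by (intro borel_measurable_continuous_onI p_continuous_compose continuous_intros)

lemma p_measurable_compose [measurable (raw)]:
  assumes "t > 0" "f \<in> borel_measurable M" "g \<in> borel_measurable M"
  shows "(\<lambda>w. p t (f w) (g w)) \<in> borel_measurable M"
  using measurable_compose[OF measurable_Pair[OF assms(2,3)] p_measurable[OF assms(1)]] by simp

lemma
  shows nn_integral_G_row: "0 < t \<Longrightarrow> (\<integral>\<^sup>+y. ennreal (G t (x - y)) \<partial>lborel) \<le> ennreal (C\<^sub>G / t)"
    and nn_integral_G_column: "0 < t \<Longrightarrow> (\<integral>\<^sup>+x. ennreal (G t (x - y)) \<partial>lborel) \<le> ennreal (C\<^sub>G / t)"
proof -
  assume t: "0 < t"
  show "(\<integral>\<^sup>+y. ennreal (G t (x - y)) \<partial>lborel) \<le> ennreal (C\<^sub>G / t)"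
    using nn_integral_G[OF t] nn_integral_lborel_diff[of "\<lambda>z. ennreal (G t z)" x] by simp
  then show "(\<integral>\<^sup>+x. ennreal (G t (x - y)) \<partial>lborel) \<le> ennreal (C\<^sub>G / t)"
    using nn_integral_G[OF t] nn_integral_lborel_plus[of "\<lambda>z. ennreal (G t z)" "- y"] by simp
qed

lemma
  assumes "0 < t"
  shows integrable_G: "integrable lborel (\<lambda>y. G t (x - y))"
    and integral_G: "(LINT y|lborel. G t (x - y)) \<le> C\<^sub>G / t"
proof -
  show i: "integrable lborel (\<lambda>y. G t (x - y))"
    using nn_integral_G_row[OF assms, of x] G_nonneg[OF assms]
    by (intro integrableI_bounded) (auto simp: le_less_trans)
  show "(LINT y|lborel. G t (x - y)) \<le> C\<^sub>G / t"
    using nn_integral_G_row[OF assms, of x] G_nonneg[OF assms] C\<^sub>G_pos assms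
    by (subst integral_eq_nn_integral) (auto intro!: enn2real_leI)
qed

lemma p_increment:
  assumes "0 < s" "s \<le> t" "t \<le> T" "x \<noteq> y"
  shows "\<bar>p t x y - p s x y\<bar> \<le> cT T * G s (x - y) * (t - s)"
proof -
  have "norm (p t x y - p s x y) \<le> cT T * G s (x - y) * norm (t - s)"
  proof (rule field_differentiable_bound[where S="{s..t}" and f'="\<lambda>r. q r x y"])
    fix r assume r: "r \<in> {s..t}"
    then show "((\<lambda>s. p s x y) has_field_derivative q r x y) (at r within {s..t})"
      using assms by (intro has_field_derivative_at_within[OF p_derivative]) auto
    have "\<bar>q r x y\<bar> \<le> cT T * G r (x - y)" using r assms by (intro q_bound) auto
    also have "\<dots> \<le> cT T * G s (x - y)" using r assms cT_pos[of T] by (intro mult_left_mono G_antimono) auto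
    finally show "norm (q r x y) \<le> cT T * G s (x - y)" by simp
  qed (use assms in auto)
  then show ?thesis using assms by simp
qed

lemma p_increment_H:
  assumes "0 < s" "s \<le> t" "t \<le> T" "x \<noteq> y"
  shows "\<bar>p t x y - p s x y\<bar> \<le> cT T * H (norm (x - y)) * (t - s)"
proof -
  have "cT T * G s (x - y) * (t - s) \<le> cT T * H (norm (x - y)) * (t - s)"
    using assms cT_pos[of T] by (intro mult_right_mono mult_left_mono G_le_H) auto
  then show ?thesis using p_increment[OF assms] by linarith
qed

text \<open>
  The bound on the kernel is one-sided, but off the diagonal it extends to the absolute value:
  the time derivative is bounded near time \<open>0\<close>, where \<open>p(t,x,\<cdot>)\<close> tends to \<open>0\<close> weakly away from
  \<open>x\<close> by the initial condition.
\<close>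

lemma p_off_diagonal:
  assumes "0 < t" "t \<le> T" "x \<noteq> y0"
  shows "\<bar>p t x y0\<bar> \<le> cT T * t * H (norm (x - y0))"
proof -
  define c where "c = cT T"
  have c: "c > 0" by (simp add: c_def cT_pos)
  \<comment> \<open>The claimed lower bound is \<open>k \<le> 0\<close>, tested against tents whose support avoids \<open>x\<close>.\<close>
  define k where "k y = - (p t x y + c * t * H (norm (x - y)))" for y
  define \<rho> where "\<rho> = norm (x - y0)"
  have \<rho>: "\<rho> > 0" using assms by (simp add: \<rho>_def)
  have contk: "continuous_on (- {x}) k" unfolding k_def
    by (intro continuous_intros p_continuous_compose continuous_on_compose2[OF continuous_H]) (use assms in auto)
  have "k y0 \<le> 0"
  proof (rule tent_sign_test[where k=k and ?y0.0=y0, OF _ \<rho>])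
    show "isCont k y0" using contk assms by (subst (asm) continuous_on_eq_continuous_at) auto
    fix r assume r: "0 < r" "r < \<rho>"
    have away: "cball y0 r \<subseteq> - {x}" using r by (auto simp: \<rho>_def dist_norm norm_minus_commute)
    show ik: "integrable lborel (\<lambda>y. k y * tent y0 r y)"
      by (intro integrable_times_tent continuous_on_subset[OF contk away])
    have ip: "integrable lborel (\<lambda>y. p s x y * tent y0 r y)" if "s > 0" for s
      using that by (intro integrable_times_tent p_continuous_compose continuous_intros)
    have "((\<lambda>s. - (LINT y|lborel. p s x y * tent y0 r y)) \<longlongrightarrow> - tent y0 r x) (at_right 0)"
      using tendsto_uniform_limitI[OF initial_condition[OF bounded_tent uniformly_continuous_tent, of y0 r]]
      by (intro tendsto_minus) auto
    moreover have "tent y0 r x = 0" using r by (intro tent_outside) (simp add: \<rho>_def dist_norm)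
    ultimately have lim: "((\<lambda>s. - (LINT y|lborel. p s x y * tent y0 r y)) \<longlongrightarrow> 0) (at_right 0)" by simp
    show "(LINT y|lborel. k y * tent y0 r y) \<le> 0"
    proof (rule tendsto_lowerbound[OF lim])
      have "(LINT y|lborel. k y * tent y0 r y) \<le> - (LINT y|lborel. p s x y * tent y0 r y)" if s: "s \<in> {0<..<t}" for s
      proof -
        have "(LINT y|lborel. k y * tent y0 r y) \<le> (LINT y|lborel. - (p s x y * tent y0 r y))"
        proof (rule integral_mono[OF ik])
          show "integrable lborel (\<lambda>y. - (p s x y * tent y0 r y))" using ip s by simp
          fix y
          show "k y * tent y0 r y \<le> - (p s x y * tent y0 r y)"
          proof (cases "y \<in> cball y0 r")
            case True
            then have "x \<noteq> y" using away by auto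
            then have "\<bar>p t x y - p s x y\<bar> \<le> c * H (norm (x - y)) * (t - s)"
              unfolding c_def using s assms by (intro p_increment_H) auto
            also have "\<dots> \<le> c * H (norm (x - y)) * t" using s c by (intro mult_left_mono) auto
            finally have "k y \<le> - p s x y" by (simp add: k_def mult_ac abs_le_iff)
            from mult_right_mono[OF this tent_nonneg[of y0 r y]] show ?thesis by simp
          qed (use tent_outside[of r y y0] in \<open>auto simp: dist_commute\<close>)
        qed
        then show ?thesis by simp
      qed
      then show "eventually (\<lambda>s. (LINT y|lborel. k y * tent y0 r y) \<le> - (LINT y|lborel. p s x y * tent y0 r y)) (at_right 0)"
        using eventually_at_right_real[OF assms(1)] by (rule eventually_mono[rotated])
    qed simp
  qed
  then have "- (c * t * H (norm (x - y0))) \<le> p t x y0" by (simp add: k_def)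
  moreover have "p t x y0 \<le> c * t * H (norm (x - y0))"
  proof -
    have "p t x y0 \<le> c * t * G t (x - y0)" unfolding c_def by (rule p_upper[OF assms(1,2)])
    also have "\<dots> \<le> c * t * H (norm (x - y0))" using assms c by (intro mult_left_mono G_le_H) auto
    finally show ?thesis .
  qed
  ultimately show ?thesis by (simp add: c_def abs_le_iff)
qed

lemma integrable_H_tail:
  assumes "0 < r"
  shows "integrable lborel (\<lambda>z::'a. H (norm z) * indicator {z. r < norm z} z)"
proof (rule integrableI_bounded)
  have "(\<integral>\<^sup>+z. ennreal (norm (H (norm (z::'a)) * indicator {z. r < norm z} z)) \<partial>lborel) =
      (\<integral>\<^sup>+z. ennreal (H (norm (z::'a))) * indicator {z. r < norm z} z \<partial>lborel)"
    by (intro nn_integral_cong) (auto simp: indicator_def)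
  then show "(\<integral>\<^sup>+z. ennreal (norm (H (norm (z::'a)) * indicator {z. r < norm z} z)) \<partial>lborel) < \<infinity>"
    using H_tail[OF assms] by (simp add: le_less_trans)
qed auto

text \<open>A local integrable majorant of the rows, from joint continuity near the diagonal.\<close>

lemma p_dominated:
  assumes "0 < t0"
  obtains w where "integrable lborel w"
    "\<And>t x y. t \<in> {t0/2..2*t0} \<Longrightarrow> dist x x0 \<le> 1 \<Longrightarrow> \<bar>p t x y\<bar> \<le> w y"
proof -
  \<comment> \<open>Near the diagonal compactness bounds the kernel, away from it the off-diagonal bound does.\<close>
  define S where "S = {t0/2..2*t0} \<times> cball x0 1 \<times> cball x0 2"
  have "compact ((\<lambda>s. p (fst s) (fst (snd s)) (snd (snd s))) ` S)"
    unfolding S_def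
    by (intro compact_continuous_image p_continuous_compose continuous_intros compact_Times)
      (use assms in auto)
  from compact_imp_bounded[OF this]
  obtain B where "\<forall>v\<in>(\<lambda>s. p (fst s) (fst (snd s)) (snd (snd s))) ` S. norm v \<le> B"
    unfolding bounded_iff ..
  then have B: "\<bar>p (fst s) (fst (snd s)) (snd (snd s))\<bar> \<le> B" if "s \<in> S" for s
    using that by simp
  have "B \<ge> 0" using B[of "(t0, x0, x0)"] assms by (force simp: S_def)
  define c where "c = cT (2*t0) * (2*t0) * 2 ^ (DIM('a) + 2)"
  have c: "c \<ge> 0" using cT_pos[of "2*t0"] assms by (simp add: c_def)
  define w where "w y = B * indicator (cball x0 2) y +
    c * (H (norm (x0 - y)) * indicator {z. 1 < norm z} (x0 - y))" for y
  have "integrable lborel (\<lambda>y. H (norm (x0 - y)) * indicator {z. 1 < norm z} (x0 - y))"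
    using integrable_H_tail[of 1] distr_lborel_diff[of x0]
      integrable_distr_eq[of "\<lambda>y. x0 - y" lborel borel "\<lambda>z. H (norm z) * indicator {z. 1 < norm z} z"] by auto
  then have "integrable lborel w" unfolding w_def
    by (intro Bochner_Integration.integrable_add integrable_mult_right) (auto simp: emeasure_cball)
  moreover have "\<bar>p t x y\<bar> \<le> w y" if t: "t \<in> {t0/2..2*t0}" and x: "dist x x0 \<le> 1" for t x y
  proof (cases "y \<in> cball x0 2")
    case True
    then have "\<bar>p t x y\<bar> \<le> B" using B[of "(t, x, y)"] t x by (auto simp: S_def dist_commute)
    then show ?thesis using True c by (simp add: w_def add_increasing2)
  next
    case False
    then have far: "norm (x0 - y) > 2" by (simp add: dist_norm)
    have "norm (x0 - y) \<le> norm (x0 - x) + norm (x - y)" using norm_triangle_ineq[of "x0 - x" "x - y"] by simp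
    then have near: "norm (x0 - y) / 2 \<le> norm (x - y)"
      using far x by (simp add: dist_norm norm_minus_commute)
    then have "x \<noteq> y" using far by auto
    then have "\<bar>p t x y\<bar> \<le> cT (2*t0) * t * H (norm (x - y))" using t assms by (intro p_off_diagonal) auto
    also have "\<dots> \<le> cT (2*t0) * (2*t0) * H (norm (x0 - y) / 2)"
      using near far t assms cT_pos[of "2*t0"] by (intro mult_mono H_antimono) auto
    also have "\<dots> \<le> cT (2*t0) * (2*t0) * (2 ^ (DIM('a) + 2) * H (norm (x0 - y)))"
      using far assms cT_pos[of "2*t0"] by (intro mult_left_mono H_half) auto
    also have "\<dots> = c * H (norm (x0 - y))" by (simp add: c_def)
    finally show ?thesis using far \<open>B \<ge> 0\<close> by (simp add: w_def indicator_def)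
  qed
  ultimately show thesis by (rule that)
qed

lemma integrable_p: 
  assumes "t > 0"
  shows "integrable lborel (p t x)"
proof -
  obtain w where w: "integrable lborel w"
    "\<And>s z y. s \<in> {t/2..2*t} \<Longrightarrow> dist z x \<le> 1 \<Longrightarrow> \<bar>p s z y\<bar> \<le> w y"
    using p_dominated[OF assms] by blast
  show ?thesis
  proof (rule Bochner_Integration.integrable_bound[OF w(1)])
    show "p t x \<in> borel_measurable lborel" using p_measurable_compose[OF assms, of "\<lambda>_. x" lborel "\<lambda>y. y"] by simp
    have "\<bar>p t x y\<bar> \<le> w y" for y using w(2)[of t x y] assms by auto
    then show "AE y in lborel. norm (p t x y) \<le> norm (w y)"
      by (intro AE_I2) (metis abs_ge_self order_trans real_norm_def)
  qed
qed

text \<open>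
  The total mass of \<open>p(t,x,\<cdot>)\<close> tends to \<open>1\<close> uniformly, so for small times the integral of the
  negative part is controlled by that of the positive part.
\<close>

lemma p_mass_bound:
  obtains C where "C > 0" "\<And>t x. 0 < t \<Longrightarrow> t \<le> T \<Longrightarrow> (LINT y|lborel. \<bar>p t x y\<bar>) \<le> C"
proof -
  define c where "c = cT (max 1 T)"
  have c: "c > 0" by (simp add: c_def cT_pos)
  have "uniform_limit UNIV (\<lambda>t x. LINT y|lborel. p t x y * 1) (\<lambda>_. 1) (at_right 0)"
    by (intro initial_condition) (auto intro: uniformly_continuous_on_const)
  then have "eventually (\<lambda>t. \<forall>x. dist (LINT y|lborel. p t x y * 1) 1 < 1) (at_right 0)"
    unfolding uniform_limit_iff by auto
  then obtain t1 where t1: "t1 > 0" "\<And>t x. 0 < t \<Longrightarrow> t < t1 \<Longrightarrow> dist (LINT y|lborel. p t x y) 1 < 1"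
    unfolding eventually_at_right_field by auto
  define t0 where "t0 = min (t1 / 2) 1"
  have t0: "t0 > 0" "t0 < t1" "t0 \<le> 1" using t1 by (auto simp: t0_def)
  \<comment> \<open>As \<open>p\<close> is at most \<open>u = c t G\<close> and \<open>u\<close> is nonnegative, \<open>|p| \<le> 2 u - p\<close>; and the integral of \<open>p\<close> is nonnegative.\<close>
  have small: "(LINT y|lborel. \<bar>p t x y\<bar>) \<le> 2 * c * C\<^sub>G" if t: "0 < t" "t \<le> t0" for t x
  proof -
    have le: "\<bar>p t x y\<bar> \<le> 2 * (c * t * G t (x - y)) - p t x y" for y
    proof -
      have "p t x y \<le> c * t * G t (x - y)" unfolding c_def using t t0 by (intro p_upper) auto
      moreover have "0 \<le> c * t * G t (x - y)" using t c G_nonneg[of t "x - y"] by simp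
      ultimately show ?thesis by linarith
    qed
    have "(LINT y|lborel. \<bar>p t x y\<bar>) \<le> (LINT y|lborel. 2 * (c * t * G t (x - y)) - p t x y)"
      using t by (intro integral_mono le Bochner_Integration.integrable_diff integrable_mult_right
        integrable_p integrable_G integrable_abs) auto
    also have "\<dots> = 2 * (c * t * (LINT y|lborel. G t (x - y))) - (LINT y|lborel. p t x y)"
      using integrable_p[OF t(1)] integrable_G[OF t(1)] by simp
    also have "\<dots> \<le> 2 * (c * t * (C\<^sub>G / t)) - 0"
    proof (intro diff_mono mult_left_mono integral_G)
      show "0 \<le> (LINT y|lborel. p t x y)" using t1(2)[of t x] t t0 by (simp add: dist_real_def)
    qed (use t c in auto)
    finally show ?thesis using t by simp
  qed
  define C where "C = 2 * c * C\<^sub>G + c * (C\<^sub>G / t0) * max 1 T"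
  have "(LINT y|lborel. \<bar>p t x y\<bar>) \<le> C" if t: "0 < t" "t \<le> T" for t x
  proof (cases "t \<le> t0")
    case True
    then show ?thesis using small[OF t(1) True, of x] c C\<^sub>G_pos t0 by (simp add: C_def add_increasing2)
  next
    case False
    have ae: "AE y in lborel. \<bar>p t x y\<bar> \<le> \<bar>p t0 x y\<bar> + c * (t - t0) * G t0 (x - y)"
      using AE_lborel_singleton[of x]
    proof eventually_elim
      case (elim y)
      then have "\<bar>p t x y - p t0 x y\<bar> \<le> c * G t0 (x - y) * (t - t0)"
        unfolding c_def using False t t0 by (intro p_increment) auto
      then show ?case by (simp add: mult_ac)
    qed
    have "(LINT y|lborel. \<bar>p t x y\<bar>) \<le> (LINT y|lborel. \<bar>p t0 x y\<bar> + c * (t - t0) * G t0 (x - y))"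
      using t t0 by (intro integral_mono_AE ae Bochner_Integration.integrable_add integrable_mult_right
        integrable_p integrable_G integrable_abs) auto
    also have "\<dots> = (LINT y|lborel. \<bar>p t0 x y\<bar>) + c * (t - t0) * (LINT y|lborel. G t0 (x - y))"
      using integrable_p[OF t0(1)] integrable_G[OF t0(1)] by simp
    also have "\<dots> \<le> 2 * c * C\<^sub>G + c * max 1 T * (C\<^sub>G / t0)"
      using t t0 c False small[of t0 x] integral_G[OF t0(1), of x] C\<^sub>G_pos
      by (intro add_mono mult_mono) (auto intro!: Bochner_Integration.integral_nonneg G_nonneg)
    finally show ?thesis by (simp add: C_def mult_ac)
  qed
  moreover have "C > 0" using c C\<^sub>G_pos t0 by (auto simp: C_def intro!: add_pos_nonneg)
  ultimately show thesis using that by blast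
qed

end

section \<open>The semigroup on bounded functions\<close>

lemma uniformly_continuous_vanishing:
  fixes h :: "'a::euclidean_space \<Rightarrow> real"
  assumes cont: "continuous_on UNIV h"
    and van: "\<And>e. e > 0 \<Longrightarrow> \<exists>R. \<forall>x. norm x > R \<longrightarrow> \<bar>h x\<bar> < e"
  shows "uniformly_continuous_on UNIV h"
  unfolding uniformly_continuous_on_def
proof (intro allI impI)
  fix e :: real assume e: "e > 0"
  obtain R where R: "\<And>x. norm x > R \<Longrightarrow> \<bar>h x\<bar> < e / 2" using van[of "e/2"] e by auto
  have "uniformly_continuous_on (cball 0 (R + 1)) h"
    by (intro compact_uniformly_continuous continuous_on_subset[OF cont]) auto
  then obtain d where d: "d > 0"
      "\<And>x y. x \<in> cball 0 (R+1) \<Longrightarrow> y \<in> cball 0 (R+1) \<Longrightarrow> dist y x < d \<Longrightarrow> dist (h y) (h x) < e"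
    using e unfolding uniformly_continuous_on_def by meson
  have "dist (h y) (h x) < e" if xy: "dist y x < min d 1" for x y
  proof (cases "norm x > R \<and> norm y > R")
    case True
    then show ?thesis using R[of x] R[of y] by (auto simp: dist_real_def)
  next
    case False
    have "\<bar>norm x - norm y\<bar> < 1" using xy norm_triangle_ineq3[of x y] by (simp add: dist_norm norm_minus_commute)
    then have "x \<in> cball 0 (R+1)" "y \<in> cball 0 (R+1)" using False by auto
    then show ?thesis using d(2) xy by auto
  qed
  then show "\<exists>d>0. \<forall>x\<in>UNIV. \<forall>x'\<in>UNIV. dist x' x < d \<longrightarrow> dist (h x') (h x) < e"
    using d(1) by (intro exI[of _ "min d 1"]) auto
qed

lemma eventually_at_right_1: "eventually (\<lambda>\<epsilon>::real. \<epsilon> \<in> {0<..1}) (at_right 0)"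
  by (rule eventually_mono[OF eventually_at_right_real[of 0 1]]) auto

context nonlocal_operator
begin

lemma truncated_operator_linear:
  fixes u v :: "'a \<Rightarrow> real"
  assumes "0 < \<epsilon>" "u \<in> borel_measurable borel" "v \<in> borel_measurable borel"
    "\<And>x. \<bar>u x\<bar> \<le> B" "\<And>x. \<bar>v x\<bar> \<le> B'"
  shows "jump_op_trunc \<kappa> J \<epsilon> (\<lambda>x. \<alpha> * u x + \<gamma> * v x) x =
    \<alpha> * jump_op_trunc \<kappa> J \<epsilon> u x + \<gamma> * jump_op_trunc \<kappa> J \<epsilon> v x"
proof -
  have iu: "integrable lborel (\<lambda>z. (u (x + z) - u x) * jk \<epsilon> x z)"
    and iv: "integrable lborel (\<lambda>z. (v (x + z) - v x) * jk \<epsilon> x z)"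
    using assms by (auto intro!: integrable_increment)
  have "jump_op_trunc \<kappa> J \<epsilon> (\<lambda>x. \<alpha> * u x + \<gamma> * v x) x =
      (LINT z|lborel. \<alpha> * ((u (x + z) - u x) * jk \<epsilon> x z) + \<gamma> * ((v (x + z) - v x) * jk \<epsilon> x z))"
    using assms(1) by (simp add: jump_op_trunc_eq) (intro Bochner_Integration.integral_cong, auto simp: algebra_simps)
  also have "\<dots> = \<alpha> * jump_op_trunc \<kappa> J \<epsilon> u x + \<gamma> * jump_op_trunc \<kappa> J \<epsilon> v x"
    using iu iv assms(1) by (simp add: jump_op_trunc_eq)
  finally show ?thesis .
qed

text \<open>
  A bounded continuous function of time and space with time derivative \<open>D\<close> to which the
  operator applies at all positive times, with result \<open>l\<close>.  Keeping \<open>D\<close> and \<open>l\<close> apart admits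
  inhomogeneous equations.
\<close>

definition evolves :: "real \<Rightarrow> (real \<Rightarrow> 'a \<Rightarrow> real) \<Rightarrow> (real \<Rightarrow> 'a \<Rightarrow> real) \<Rightarrow> (real \<Rightarrow> 'a \<Rightarrow> real) \<Rightarrow> bool"
  where "evolves T u D l \<longleftrightarrow> continuous_on ({0<..T} \<times> UNIV) (\<lambda>tx. u (fst tx) (snd tx)) \<and>
    (\<exists>B. \<forall>t\<in>{0<..T}. \<forall>x. \<bar>u t x\<bar> \<le> B) \<and>
    (\<forall>t\<in>{0<..T}. \<forall>x. ((\<lambda>s. u s x) has_real_derivative D t x) (at t) \<and>
       ((\<lambda>\<epsilon>. jump_op_trunc \<kappa> J \<epsilon> (u t) x) \<longlongrightarrow> l t x) (at_right 0))"

lemma evolves_measurable: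
  assumes "evolves T u D l" "t \<in> {0<..T}"
  shows "u t \<in> borel_measurable borel"
proof -
  have "continuous_on UNIV (\<lambda>x. (\<lambda>tx. u (fst tx) (snd tx)) (t, x))"
    by (rule continuous_on_compose2[of "{0<..T} \<times> UNIV"])
      (use assms in \<open>auto simp: evolves_def intro!: continuous_intros\<close>)
  then show ?thesis by (intro borel_measurable_continuous_onI) simp
qed

lemma evolves_linear:
  assumes u: "evolves T u D l" and v: "evolves T v D' l'"
  shows "evolves T (\<lambda>t x. \<alpha> * u t x + \<gamma> * v t x) (\<lambda>t x. \<alpha> * D t x + \<gamma> * D' t x) (\<lambda>t x. \<alpha> * l t x + \<gamma> * l' t x)"
proof -
  obtain B where B: "\<And>t x. t \<in> {0<..T} \<Longrightarrow> \<bar>u t x\<bar> \<le> B" using u unfolding evolves_def by blast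
  obtain B' where B': "\<And>t x. t \<in> {0<..T} \<Longrightarrow> \<bar>v t x\<bar> \<le> B'" using v unfolding evolves_def by blast
  have "\<bar>\<alpha> * u t x + \<gamma> * v t x\<bar> \<le> \<bar>\<alpha>\<bar> * B + \<bar>\<gamma>\<bar> * B'" if "t \<in> {0<..T}" for t x
    using mult_left_mono[OF B[OF that, of x] abs_ge_zero[of \<alpha>]] mult_left_mono[OF B'[OF that, of x] abs_ge_zero[of \<gamma>]]
    by (simp add: abs_mult[symmetric])
  moreover have "((\<lambda>\<epsilon>. jump_op_trunc \<kappa> J \<epsilon> (\<lambda>x. \<alpha> * u t x + \<gamma> * v t x) x) \<longlongrightarrow> \<alpha> * l t x + \<gamma> * l' t x) (at_right 0)"
    if t: "t \<in> {0<..T}" for t x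
  proof (rule Lim_transform_eventually)
    show "((\<lambda>\<epsilon>. \<alpha> * jump_op_trunc \<kappa> J \<epsilon> (u t) x + \<gamma> * jump_op_trunc \<kappa> J \<epsilon> (v t) x) \<longlongrightarrow> \<alpha> * l t x + \<gamma> * l' t x) (at_right 0)"
      using u v t unfolding evolves_def by (intro tendsto_intros) auto
    show "eventually (\<lambda>\<epsilon>. \<alpha> * jump_op_trunc \<kappa> J \<epsilon> (u t) x + \<gamma> * jump_op_trunc \<kappa> J \<epsilon> (v t) x =
        jump_op_trunc \<kappa> J \<epsilon> (\<lambda>x. \<alpha> * u t x + \<gamma> * v t x) x) (at_right 0)"
      using eventually_at_right_1
    proof eventually_elim
      case (elim \<epsilon>)
      then show ?case
        using truncated_operator_linear[OF _ evolves_measurable[OF u t] evolves_measurable[OF v t] B[OF t] B'[OF t], of \<epsilon> \<alpha> \<gamma> x]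
        by simp
    qed
  qed
  moreover have "((\<lambda>s. \<alpha> * u s x + \<gamma> * v s x) has_real_derivative \<alpha> * D t x + \<gamma> * D' t x) (at t)"
    if "t \<in> {0<..T}" for t x
    using u v that unfolding evolves_def by (auto intro!: derivative_eq_intros)
  moreover have "continuous_on ({0<..T} \<times> UNIV) (\<lambda>tx. \<alpha> * u (fst tx) (snd tx) + \<gamma> * v (fst tx) (snd tx))"
    using u v unfolding evolves_def by (intro continuous_intros) auto
  ultimately show ?thesis unfolding evolves_def by blast
qed

lemma evolves_le:
  assumes "evolves T u D l" and "\<And>t x. t \<in> {0<..T} \<Longrightarrow> D t x \<le> l t x + M" "M \<ge> 0"
    and "\<And>\<eta>. \<eta> > 0 \<Longrightarrow> eventually (\<lambda>t. \<forall>x. u t x \<le> m + \<eta>) (at_right 0)"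
    and "t \<in> {0<..T}"
  shows "u t x \<le> m + M * t"
proof -
  obtain B where B: "\<And>t x. t \<in> {0<..T} \<Longrightarrow> \<bar>u t x\<bar> \<le> B" using assms(1) unfolding evolves_def by blast
  show ?thesis
  proof (rule maximum_principle[OF _ B assms(4) _ assms(3) assms(5)])
    show "continuous_on ({0<..T} \<times> UNIV) (\<lambda>(t, x). u t x)"
      using assms(1) by (simp add: evolves_def split_beta')
    show "\<exists>D l. ((\<lambda>s. u s x) has_real_derivative D) (at t) \<and>
      ((\<lambda>\<epsilon>. jump_op_trunc \<kappa> J \<epsilon> (u t) x) \<longlongrightarrow> l) (at_right 0) \<and> D \<le> l + M" if "t \<in> {0<..T}" for t x
      using assms(1,2) that unfolding evolves_def by blast
  qed
qed

end

context heat_kernel_setting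
begin

definition Pt :: "real \<Rightarrow> ('a \<Rightarrow> real) \<Rightarrow> 'a \<Rightarrow> real"
  where "Pt t f x = (LINT y|lborel. p t x y * f y)"

definition Qt :: "real \<Rightarrow> ('a \<Rightarrow> real) \<Rightarrow> 'a \<Rightarrow> real"
  where "Qt t f x = (LINT y|lborel. q t x y * f y)"

lemma q_measurable:
  assumes "t > 0"
  shows "q t x \<in> borel_measurable borel"
proof (rule borel_measurable_LIMSEQ_real)
  fix i :: nat
  have "{y. y = x} \<in> sets borel" "0 < t + inverse (real (Suc i))"
    using assms by (auto intro!: add_pos_pos simp del: of_nat_Suc)
  then show "(\<lambda>y. if y = x then q t x x else (p (t + inverse (real (Suc i))) x y - p t x y) / inverse (real (Suc i)))
      \<in> borel_measurable borel"
    using assms by (intro measurable_If borel_measurable_divide borel_measurable_diff p_measurable_compose) auto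
next
  fix y
  show "(\<lambda>i. if y = x then q t x x else (p (t + inverse (real (Suc i))) x y - p t x y) / inverse (real (Suc i)))
      \<longlonglongrightarrow> q t x y"
  proof (cases "y = x")
    case False
    then have "((\<lambda>h. (p (t + h) x y - p t x y) / h) \<longlongrightarrow> q t x y) (at 0)"
      using p_derivative[OF assms, of x y] by (simp add: DERIV_def)
    moreover have "filterlim (\<lambda>i. inverse (real (Suc i))) (at 0) sequentially"
      by (rule filterlim_atI[OF LIMSEQ_inverse_real_of_nat]) simp
    ultimately have "(\<lambda>i. (p (t + inverse (real (Suc i))) x y - p t x y) / inverse (real (Suc i))) \<longlonglongrightarrow> q t x y"
      by (rule filterlim_compose)
    then show ?thesis using False by simp
  qed simp
qed

lemma integrable_p_times:
  assumes "t > 0" and [measurable]: "f \<in> borel_measurable borel" and "\<And>y. \<bar>f y\<bar> \<le> B"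
  shows "integrable lborel (\<lambda>y. p t x y * f y)"
proof (rule Bochner_Integration.integrable_bound)
  show "integrable lborel (\<lambda>y. B * p t x y)" by (intro integrable_mult_right integrable_p assms)
  show "(\<lambda>y. p t x y * f y) \<in> borel_measurable lborel" using assms(1) by measurable
  have "\<bar>p t x y * f y\<bar> \<le> \<bar>B * p t x y\<bar>" for y
    using mult_left_mono[OF assms(3)[of y] abs_ge_zero[of "p t x y"]] assms(3)[of y]
    by (auto simp: abs_mult mult.commute)
  then show "AE y in lborel. norm (p t x y * f y) \<le> norm (B * p t x y)" by auto
qed

lemma abs_q_times_le:
  assumes "0 < t" "t \<le> T" "\<bar>c\<bar> \<le> B"
  shows "\<bar>q t x y * c\<bar> \<le> cT T * B * G t (x - y)"
proof -
  have "\<bar>q t x y * c\<bar> = \<bar>q t x y\<bar> * \<bar>c\<bar>" by (rule abs_mult)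
  also have "\<dots> \<le> cT T * G t (x - y) * B"
    using q_bound[OF assms(1,2), of x y] assms cT_pos[of T] G_nonneg[OF assms(1), of "x - y"]
    by (intro mult_mono) auto
  finally show ?thesis by (simp add: mult_ac)
qed

lemma Qt_bound:
  assumes "0 < t" "t \<le> T" and [measurable]: "f \<in> borel_measurable borel" and f: "\<And>y. \<bar>f y\<bar> \<le> B"
  shows "\<bar>Qt t f x\<bar> \<le> cT T * B * C\<^sub>G / t"
proof -
  note le = abs_q_times_le[OF assms(1,2) f]
  have G: "integrable lborel (\<lambda>y. cT T * B * G t (x - y))"
    by (intro integrable_mult_right integrable_G assms)
  have i: "integrable lborel (\<lambda>y. q t x y * f y)"
  proof (rule Bochner_Integration.integrable_bound[OF G])
    show "(\<lambda>y. q t x y * f y) \<in> borel_measurable lborel"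
      using q_measurable[OF assms(1), of x] by simp
    show "AE y in lborel. norm (q t x y * f y) \<le> norm (cT T * B * G t (x - y))"
      using order_trans[OF le abs_ge_self] by simp
  qed
  have "\<bar>Qt t f x\<bar> \<le> (LINT y|lborel. \<bar>q t x y * f y\<bar>)" unfolding Qt_def by (rule integral_abs_bound)
  also have "\<dots> \<le> (LINT y|lborel. cT T * B * G t (x - y))"
    by (intro integral_mono integrable_abs i G le)
  also have "\<dots> \<le> cT T * B * (C\<^sub>G / t)"
    using integral_G[OF assms(1), of x] cT_pos[of T] order_trans[OF abs_ge_zero f[of x]]
    by (auto intro!: mult_left_mono simp del: times_divide_eq_right)
  finally show "\<bar>Qt t f x\<bar> \<le> cT T * B * C\<^sub>G / t" by simp
qed

lemma Pt_derivative:
  assumes t: "0 < t" and [measurable]: "f \<in> borel_measurable borel" and f: "\<And>y. \<bar>f y\<bar> \<le> B"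
  shows "((\<lambda>s. Pt s f x) has_real_derivative Qt t f x) (at t)"
  unfolding Pt_def Qt_def
proof (rule has_real_derivative_integral[where \<delta>="t/2" and w="\<lambda>y. cT (2*t) * B * G (t/2) (x - y)"])
  show "t / 2 > 0" using t by simp
  have ball: "t / 2 < s \<and> s < 2 * t" if "s \<in> ball t (t/2)" for s
    using that t by (auto simp: dist_real_def abs_if split: if_splits)
  show "integrable lborel (\<lambda>y. p s x y * f y)" if "s \<in> ball t (t/2)" for s
    using ball[OF that] t by (intro integrable_p_times[where B=B] f) auto
  show "integrable lborel (\<lambda>y. cT (2*t) * B * G (t/2) (x - y))"
    using t by (intro integrable_mult_right integrable_G) auto
  show "(\<lambda>y. q t x y * f y) \<in> borel_measurable lborel"
    using q_measurable[OF t, of x] by simp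
  show "AE y in lborel. \<forall>s\<in>ball t (t/2). ((\<lambda>s. p s x y * f y) has_real_derivative q s x y * f y) (at s) \<and>
      \<bar>q s x y * f y\<bar> \<le> cT (2*t) * B * G (t/2) (x - y)"
    using AE_lborel_singleton[of x]
  proof eventually_elim
    case (elim y)
    show ?case
    proof (intro ballI conjI)
      fix s assume s: "s \<in> ball t (t/2)"
      note s = ball[OF s]
      show "((\<lambda>s. p s x y * f y) has_real_derivative q s x y * f y) (at s)"
        using s t elim p_derivative[of s x y] by (intro DERIV_cmult_right) auto
      have "\<bar>q s x y * f y\<bar> \<le> cT (2*t) * B * G s (x - y)" using s t f by (intro abs_q_times_le) auto
      also have "\<dots> \<le> cT (2*t) * B * G (t/2) (x - y)"
        using s t cT_pos[of "2*t"] order_trans[OF abs_ge_zero f[of x]] by (intro mult_left_mono G_antimono) auto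
      finally show "\<bar>q s x y * f y\<bar> \<le> cT (2*t) * B * G (t/2) (x - y)" .
    qed
  qed
qed

lemma Pt_continuous:
  assumes [measurable]: "f \<in> borel_measurable borel" and f: "\<And>y. \<bar>f y\<bar> \<le> B"
  shows "continuous_on ({0<..} \<times> UNIV) (\<lambda>tx. Pt (fst tx) f (snd tx))"
proof -
  have "isCont (\<lambda>tx. Pt (fst tx) f (snd tx)) (t0, x0)" if t0: "t0 > 0" for t0 x0
  proof -
    define S where "S = {t0/2<..<2*t0} \<times> ball x0 1"
    have S: "open S" "(t0, x0) \<in> S" using t0 by (auto simp: S_def intro!: open_Times)
    obtain w where w: "integrable lborel w"
      "\<And>t x y. t \<in> {t0/2..2*t0} \<Longrightarrow> dist x x0 \<le> 1 \<Longrightarrow> \<bar>p t x y\<bar> \<le> w y"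
      using p_dominated[OF t0] by blast
    have "((\<lambda>tx. LINT y|lborel. p (fst tx) (snd tx) y * f y) \<longlongrightarrow> (LINT y|lborel. p t0 x0 y * f y)) (at (t0, x0) within S)"
    proof (rule tendsto_integral_at_within[where w="\<lambda>y. B * w y"])
      show "integrable lborel (\<lambda>y. B * w y)" using w by simp
      show "(\<lambda>y. p (fst s) (snd s) y * f y) \<in> borel_measurable lborel" if "s \<in> S" for s
        using that t0 by (auto simp: S_def intro!: borel_measurable_times p_measurable_compose)
      show "(\<lambda>y. p t0 x0 y * f y) \<in> borel_measurable lborel" using t0 by measurable
      show "AE y in lborel. norm (p (fst s) (snd s) y * f y) \<le> B * w y" if "s \<in> S" for s
      proof (intro AE_I2)
        fix y
        have "\<bar>p (fst s) (snd s) y\<bar> \<le> w y" using that by (intro w) (auto simp: S_def dist_commute)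
        then have "\<bar>f y\<bar> * \<bar>p (fst s) (snd s) y\<bar> \<le> B * w y"
          using f[of y] order_trans[OF abs_ge_zero f[of y]] by (intro mult_mono) auto
        then show "norm (p (fst s) (snd s) y * f y) \<le> B * w y" by (simp add: abs_mult mult.commute)
      qed
      show "AE y in lborel. ((\<lambda>s. p (fst s) (snd s) y * f y) \<longlongrightarrow> p t0 x0 y * f y) (at (t0, x0) within S)"
      proof (intro AE_I2 tendsto_mult tendsto_const)
        fix y
        have "continuous_on S (\<lambda>s. p (fst s) (snd s) y)"
          using t0 by (intro p_continuous_compose continuous_intros) (auto simp: S_def)
        then show "((\<lambda>s. p (fst s) (snd s) y) \<longlongrightarrow> p t0 x0 y) (at (t0, x0) within S)"
          using S(2) unfolding continuous_on_def by force
      qed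
    qed
    then show ?thesis
      using at_within_open[OF S(2,1)] by (simp add: isCont_def Pt_def)
  qed
  moreover have "open ({0::real<..} \<times> (UNIV :: 'a set))" by (intro open_Times) auto
  ultimately show ?thesis by (auto simp: continuous_on_eq_continuous_at)
qed

lemma Pt_continuous_space:
  assumes "t > 0" "f \<in> borel_measurable borel" "\<And>y. \<bar>f y\<bar> \<le> B"
  shows "continuous_on UNIV (Pt t f)"
proof -
  have "continuous_on UNIV (\<lambda>x. (\<lambda>tx. Pt (fst tx) f (snd tx)) (t, x))"
    by (rule continuous_on_compose2[OF Pt_continuous[OF assms(2,3)]])
      (use assms in \<open>auto intro!: continuous_intros\<close>)
  then show ?thesis by simp
qed

lemma Pt_bounded:
  assumes "f \<in> borel_measurable borel" "\<And>y. \<bar>f y\<bar> \<le> B"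
  obtains C where "\<And>t x. 0 < t \<Longrightarrow> t \<le> T \<Longrightarrow> \<bar>Pt t f x\<bar> \<le> C"
proof -
  obtain C where C: "C > 0" "\<And>t x. 0 < t \<Longrightarrow> t \<le> T \<Longrightarrow> (LINT y|lborel. \<bar>p t x y\<bar>) \<le> C"
    using p_mass_bound by blast
  have B: "B \<ge> 0" using order_trans[OF abs_ge_zero assms(2)[of undefined]] .
  have "\<bar>Pt t f x\<bar> \<le> B * C" if t: "0 < t" "t \<le> T" for t x
  proof -
    have "\<bar>Pt t f x\<bar> \<le> (LINT y|lborel. \<bar>p t x y * f y\<bar>)" unfolding Pt_def by (rule integral_abs_bound)
    also have "\<dots> \<le> (LINT y|lborel. B * \<bar>p t x y\<bar>)"
      using t assms
      by (intro integral_mono integrable_abs integrable_mult_right integrable_p_times integrable_p)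
        (auto simp: abs_mult mult.commute intro!: mult_right_mono)
    also have "\<dots> \<le> B * C" using C(2)[OF t, of x] B by (simp add: mult_left_mono)
    finally show ?thesis .
  qed
  then show thesis using that by blast
qed

text \<open>By Fubini, the truncated operator can be applied to the kernel under the integral.\<close>

lemma truncated_Pt:
  assumes t: "0 < t" and [measurable]: "f \<in> borel_measurable borel" and f: "\<And>y. \<bar>f y\<bar> \<le> B" and e: "0 < \<epsilon>"
  shows "jump_op_trunc \<kappa> J \<epsilon> (Pt t f) x = (LINT y|lborel. jump_op_trunc \<kappa> J \<epsilon> (\<lambda>w. p t w y) x * f y)"
    "(\<lambda>y. jump_op_trunc \<kappa> J \<epsilon> (\<lambda>w. p t w y) x) \<in> borel_measurable lborel"
proof -
  define F where "F z y = (p t (x + z) y - p t x y) * f y * jk \<epsilon> x z" for z y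
  have [measurable]: "(\<lambda>z. jk \<epsilon> x z) \<in> borel_measurable borel" using e by simp
  obtain C where C0: "C > 0" "\<And>s x. 0 < s \<Longrightarrow> s \<le> t \<Longrightarrow> (LINT y|lborel. \<bar>p s x y\<bar>) \<le> C"
    using p_mass_bound by blast
  have C: "C > 0" "\<And>x. (LINT y|lborel. \<bar>p t x y\<bar>) \<le> C" using C0 t by auto
  have B: "B \<ge> 0" using order_trans[OF abs_ge_zero f[of x]] .
  have i1: "integrable lborel (F z)" for z
    unfolding F_def left_diff_distrib using t
    by (intro Bochner_Integration.integrable_diff integrable_mult_left integrable_p_times[where B=B] f) auto
  have bound: "(LINT y|lborel. norm (F z y)) \<le> 2 * B * C * jk \<epsilon> x z" for z
  proof -
    have "(LINT y|lborel. norm (F z y)) \<le> (LINT y|lborel. B * jk \<epsilon> x z * (\<bar>p t (x + z) y\<bar> + \<bar>p t x y\<bar>))"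
    proof (rule integral_mono)
      show "integrable lborel (\<lambda>y. norm (F z y))" using i1 by (rule integrable_norm)
      show "integrable lborel (\<lambda>y. B * jk \<epsilon> x z * (\<bar>p t (x + z) y\<bar> + \<bar>p t x y\<bar>))"
        by (intro integrable_mult_right Bochner_Integration.integrable_add integrable_abs integrable_p t)
      fix y
      have "norm (F z y) = \<bar>f y\<bar> * jk \<epsilon> x z * \<bar>p t (x + z) y - p t x y\<bar>"
        using jk_nonneg[of \<epsilon> x z] e by (simp add: F_def abs_mult)
      also have "\<dots> \<le> B * jk \<epsilon> x z * (\<bar>p t (x + z) y\<bar> + \<bar>p t x y\<bar>)"
        using jk_nonneg[of \<epsilon> x z] e f[of y] B by (intro mult_mono) auto
      finally show "norm (F z y) \<le> B * jk \<epsilon> x z * (\<bar>p t (x + z) y\<bar> + \<bar>p t x y\<bar>)" .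
    qed
    also have "\<dots> = B * jk \<epsilon> x z * ((LINT y|lborel. \<bar>p t (x + z) y\<bar>) + (LINT y|lborel. \<bar>p t x y\<bar>))"
      using t by (simp add: integrable_p)
    also have "\<dots> \<le> B * jk \<epsilon> x z * (C + C)"
      using C jk_nonneg[of \<epsilon> x z] e B by (intro mult_left_mono add_mono) auto
    finally show ?thesis by (simp add: mult_ac)
  qed
  have meas: "(\<lambda>zy. F (fst zy) (snd zy)) \<in> borel_measurable (lborel \<Otimes>\<^sub>M lborel)"
    unfolding F_def using t by measurable
  have int: "integrable (lborel \<Otimes>\<^sub>M lborel) (\<lambda>(z, y). F z y)"
  proof (rule lborel_pair.Fubini_integrable)
    show "(\<lambda>(z, y). F z y) \<in> borel_measurable (lborel \<Otimes>\<^sub>M lborel)"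
      using meas by (simp add: split_beta')
    show "AE z in lborel. integrable lborel (\<lambda>y. case (z, y) of (z, y) \<Rightarrow> F z y)" using i1 by simp
    show "integrable lborel (\<lambda>z. LINT y|lborel. norm (case (z, y) of (z, y) \<Rightarrow> F z y))"
    proof (rule Bochner_Integration.integrable_bound)
      show "integrable lborel (\<lambda>z. 2 * B * C * jk \<epsilon> x z)" by (intro integrable_mult_right integrable_jk e)
      show "(\<lambda>z. LINT y|lborel. norm (case (z, y) of (z, y) \<Rightarrow> F z y)) \<in> borel_measurable lborel"
        using meas by (intro lborel.borel_measurable_lebesgue_integral) (simp add: split_beta')
      show "AE z in lborel. norm (LINT y|lborel. norm (case (z, y) of (z, y) \<Rightarrow> F z y)) \<le> norm (2 * B * C * jk \<epsilon> x z)"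
        using order_trans[OF bound abs_ge_self] by (intro AE_I2) (simp add: Bochner_Integration.integral_nonneg)
    qed
  qed
  have tr: "jump_op_trunc \<kappa> J \<epsilon> (\<lambda>w. p t w y) x * f y = (LINT z|lborel. F z y)" for y
  proof -
    have "jump_op_trunc \<kappa> J \<epsilon> (\<lambda>w. p t w y) x * f y = (LINT z|lborel. (p t (x + z) y - p t x y) * jk \<epsilon> x z * f y)"
      using e by (simp add: jump_op_trunc_eq)
    then show ?thesis by (simp add: F_def mult_ac)
  qed
  have "jump_op_trunc \<kappa> J \<epsilon> (Pt t f) x = (LINT z|lborel. (Pt t f (x + z) - Pt t f x) * jk \<epsilon> x z)"
    using e by (simp add: jump_op_trunc_eq)
  also have "\<dots> = (LINT z|lborel. LINT y|lborel. F z y)"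
  proof (intro Bochner_Integration.integral_cong refl)
    fix z
    have "(LINT y|lborel. F z y) = (LINT y|lborel. (p t (x + z) y * f y - p t x y * f y) * jk \<epsilon> x z)"
      by (simp add: F_def left_diff_distrib)
    also have "\<dots> = (Pt t f (x + z) - Pt t f x) * jk \<epsilon> x z"
      using integrable_p_times[OF t assms(2) f] by (simp add: Pt_def)
    finally show "(Pt t f (x + z) - Pt t f x) * jk \<epsilon> x z = (LINT y|lborel. F z y)" ..
  qed
  also have "\<dots> = (LINT y|lborel. LINT z|lborel. F z y)"
    by (rule lborel_pair.Fubini_integral[OF int, symmetric])
  finally show "jump_op_trunc \<kappa> J \<epsilon> (Pt t f) x = (LINT y|lborel. jump_op_trunc \<kappa> J \<epsilon> (\<lambda>w. p t w y) x * f y)"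
    by (simp add: tr)
  have "(\<lambda>yz. (p t (x + snd yz) (fst yz) - p t x (fst yz)) * jk \<epsilon> x (snd yz)) \<in> borel_measurable (lborel \<Otimes>\<^sub>M lborel)"
    using t by measurable
  then have "(\<lambda>y. LINT z|lborel. (p t (x + z) y - p t x y) * jk \<epsilon> x z) \<in> borel_measurable lborel"
    by (intro lborel.borel_measurable_lebesgue_integral) (simp add: split_beta')
  then show "(\<lambda>y. jump_op_trunc \<kappa> J \<epsilon> (\<lambda>w. p t w y) x) \<in> borel_measurable lborel"
    using e by (simp add: jump_op_trunc_eq)
qed

text \<open>
  The bound on the truncated operators is uniform in \<open>\<epsilon>\<close>, so dominated convergence applies.
\<close>

lemma truncated_Pt_tendsto:
  assumes t: "0 < t" and [measurable]: "f \<in> borel_measurable borel" and f: "\<And>y. \<bar>f y\<bar> \<le> B"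
  shows "((\<lambda>\<epsilon>. jump_op_trunc \<kappa> J \<epsilon> (Pt t f) x) \<longlongrightarrow> Qt t f x) (at_right 0)"
proof -
  have at: "at 0 within {0<..1::real} = at_right 0"
    by (rule at_within_nhd[where S="{..<1}"]) auto
  have B: "B \<ge> 0" using order_trans[OF abs_ge_zero f[of x]] .
  have "((\<lambda>\<epsilon>. LINT y|lborel. jump_op_trunc \<kappa> J \<epsilon> (\<lambda>w. p t w y) x * f y) \<longlongrightarrow> (LINT y|lborel. q t x y * f y))
      (at 0 within {0<..1})"
  proof (rule tendsto_integral_at_within[where w="\<lambda>y. cT t * B * G t (x - y)"])
    show "(\<lambda>y. jump_op_trunc \<kappa> J \<epsilon> (\<lambda>w. p t w y) x * f y) \<in> borel_measurable lborel" if "\<epsilon> \<in> {0<..1}" for \<epsilon>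
      using truncated_Pt(2)[OF t assms(2) f, of \<epsilon> x] that by auto
    show "(\<lambda>y. q t x y * f y) \<in> borel_measurable lborel"
      using q_measurable[OF t, of x] by simp
    show "integrable lborel (\<lambda>y. cT t * B * G t (x - y))"
      using t by (intro integrable_mult_right integrable_G) auto
    show "AE y in lborel. ((\<lambda>\<epsilon>. jump_op_trunc \<kappa> J \<epsilon> (\<lambda>w. p t w y) x * f y) \<longlongrightarrow> q t x y * f y) (at 0 within {0<..1})"
      unfolding at by (intro AE_I2 tendsto_mult tendsto_const truncated_tendsto_q t)
    show "AE y in lborel. norm (jump_op_trunc \<kappa> J \<epsilon> (\<lambda>w. p t w y) x * f y) \<le> cT t * B * G t (x - y)"
      if "\<epsilon> \<in> {0<..1}" for \<epsilon>
    proof (intro AE_I2)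
      fix y
      have "\<bar>jump_op_trunc \<kappa> J \<epsilon> (\<lambda>w. p t w y) x\<bar> * \<bar>f y\<bar> \<le> cT t * G t (x - y) * B"
        using truncated_bound[OF t order_refl, of \<epsilon> y x] that f[of y] cT_pos[of t] G_nonneg[OF t, of "x - y"]
        by (intro mult_mono) auto
      then show "norm (jump_op_trunc \<kappa> J \<epsilon> (\<lambda>w. p t w y) x * f y) \<le> cT t * B * G t (x - y)"
        by (simp add: abs_mult mult_ac)
    qed
  qed
  then have "((\<lambda>\<epsilon>. LINT y|lborel. jump_op_trunc \<kappa> J \<epsilon> (\<lambda>w. p t w y) x * f y) \<longlongrightarrow> Qt t f x) (at_right 0)"
    by (simp add: at Qt_def)
  then show ?thesis
  proof (rule Lim_transform_eventually)
    show "eventually (\<lambda>\<epsilon>. (LINT y|lborel. jump_op_trunc \<kappa> J \<epsilon> (\<lambda>w. p t w y) x * f y) = jump_op_trunc \<kappa> J \<epsilon> (Pt t f) x) (at_right 0)"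
      using eventually_at_right_1 by eventually_elim (use truncated_Pt(1)[OF t assms(2) f] in auto)
  qed
qed

text \<open>
  The equation for \<open>P\<^sub>t f\<close>: time derivative and operator may be taken under the integral, and
  both give the integral of \<open>f\<close> against \<open>q\<close>.  The shift by \<open>s\<close> serves the semigroup
  property, where \<open>P\<^sub>s f\<close> is the initial value.
\<close>

lemma evolves_Pt:
  assumes "f \<in> borel_measurable borel" "\<And>y. \<bar>f y\<bar> \<le> B" "s \<ge> 0"
  shows "evolves T (\<lambda>t. Pt (t + s) f) (\<lambda>t. Qt (t + s) f) (\<lambda>t. Qt (t + s) f)"
proof -
  have "continuous_on ({0<..T} \<times> UNIV) (\<lambda>tx. (\<lambda>tx. Pt (fst tx) f (snd tx)) (fst tx + s, snd tx))"
    by (rule continuous_on_compose2[OF Pt_continuous[OF assms(1,2)]])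
      (use assms in \<open>auto intro!: continuous_intros\<close>)
  moreover obtain C where C: "\<And>t x. 0 < t \<Longrightarrow> t \<le> T + s \<Longrightarrow> \<bar>Pt t f x\<bar> \<le> C"
    using Pt_bounded[OF assms(1,2)] by blast
  moreover have "((\<lambda>t. Pt (t + s) f x) has_real_derivative Qt (t + s) f x) (at t)" if "t > 0" for t x
    using Pt_derivative[OF _ assms(1,2), of "t + s" x] that assms(3) by (simp add: DERIV_shift)
  moreover have "((\<lambda>\<epsilon>. jump_op_trunc \<kappa> J \<epsilon> (Pt (t + s) f) x) \<longlongrightarrow> Qt (t + s) f x) (at_right 0)" if "t > 0" for t x
    using that assms(3) by (intro truncated_Pt_tendsto[OF _ assms(1,2)]) auto
  ultimately show ?thesis unfolding evolves_def using assms(3)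
    by (auto intro!: exI[of _ C])
qed

lemma bounded_range_measurable:
  fixes f :: "'a \<Rightarrow> real"
  assumes "bounded (range f)" "uniformly_continuous_on UNIV f"
  obtains B where "f \<in> borel_measurable borel" "\<And>y. \<bar>f y\<bar> \<le> B"
proof -
  obtain B where "\<And>y. \<bar>f y\<bar> \<le> B" using assms(1) unfolding bounded_iff by auto
  then show thesis
    using that borel_measurable_continuous_onI[OF uniformly_continuous_imp_continuous[OF assms(2)]] by blast
qed

lemma Pt_initial:
  assumes "bounded (range f)" "uniformly_continuous_on UNIV f" "e > 0"
  shows "eventually (\<lambda>t. \<forall>x. \<bar>Pt t f x - f x\<bar> < e) (at_right 0)"
  using initial_condition[OF assms(1,2)] assms(3) unfolding uniform_limit_iff Pt_def by (simp add: dist_real_def)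

lemma Pt_le:
  assumes f: "bounded (range f)" "uniformly_continuous_on UNIV f" and m: "\<And>y. f y \<le> m" and "0 < t"
  shows "Pt t f x \<le> m"
proof -
  obtain B where B: "f \<in> borel_measurable borel" "\<And>y. \<bar>f y\<bar> \<le> B"
    using bounded_range_measurable[OF f] by blast
  have "Pt (t + 0) f x \<le> m + 0 * t"
  proof (rule evolves_le[OF evolves_Pt[OF B], where T=t])
    show "eventually (\<lambda>t. \<forall>x. Pt (t + 0) f x \<le> m + \<eta>) (at_right 0)" if "\<eta> > 0" for \<eta>
      using Pt_initial[OF f that]
    proof eventually_elim
      case (elim t)
      show ?case
      proof
        fix x
        show "Pt (t + 0) f x \<le> m + \<eta>" using spec[OF elim, of x] m[of x] by simp
      qed
    qed
  qed (use assms in auto)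
  then show ?thesis by simp
qed

lemma Pt_ge:
  assumes f: "bounded (range f)" "uniformly_continuous_on UNIV f" and m: "\<And>y. m \<le> f y" and "0 < t"
  shows "m \<le> Pt t f x"
proof -
  have "Pt t (\<lambda>y. - f y) x \<le> - m"
  proof (rule Pt_le)
    show "bounded (range (\<lambda>y. - f y))" using f(1) unfolding bounded_iff by auto
    show "uniformly_continuous_on UNIV (\<lambda>y. - f y)" by (intro uniformly_continuous_on_minus f)
  qed (use assms in auto)
  then show ?thesis by (simp add: Pt_def)
qed

lemma Pt_one: "0 < t \<Longrightarrow> Pt t (\<lambda>_. 1) x = 1"
  using Pt_le[of "\<lambda>_. 1" 1 t x] Pt_ge[of "\<lambda>_. 1" 1 t x]
  by (auto intro!: antisym uniformly_continuous_on_const)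

lemma p_mass: "0 < t \<Longrightarrow> (LINT y|lborel. p t x y) = 1"
  using Pt_one[of t x] by (simp add: Pt_def)

text \<open>
  Integrals of \<open>p(t,x,\<cdot>)\<close> against tents are nonnegative by the maximum principle.
\<close>

lemma p_nonneg:
  assumes "0 < t"
  shows "0 \<le> p t x y"
proof -
  have "- p t x y \<le> 0"
  proof (rule tent_sign_test[where k="\<lambda>y. - p t x y" and ?y0.0=y and \<rho>=1])
    have c: "continuous_on S (\<lambda>y. - p t x y)" for S
      using assms by (intro continuous_intros p_continuous_compose)
    show "isCont (\<lambda>y. - p t x y) y" using c[of UNIV] by (simp add: continuous_on_eq_continuous_at)
    show "integrable lborel (\<lambda>ya. - p t x ya * tent y r ya)" if "0 < r" "r < 1" for r
      by (intro integrable_times_tent c)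
    show "(LINT ya|lborel. - p t x ya * tent y r ya) \<le> 0" if "0 < r" "r < 1" for r
      using Pt_ge[OF bounded_tent uniformly_continuous_tent tent_nonneg assms, of y r x]
      by (simp add: Pt_def)
  qed simp
  then show ?thesis by simp
qed

lemma p_sup:
  assumes "0 < t"
  shows "p t x y \<le> cT t / Phi_inv \<phi> t ^ DIM('a)"
proof -
  have "p t x y \<le> cT t * t * G t (x - y)" by (rule p_upper) (use assms in auto)
  also have "\<dots> \<le> cT t * t * (1 / (t * Phi_inv \<phi> t ^ DIM('a)))"
    using assms cT_pos[of t] by (intro mult_left_mono G_le_top) auto
  finally show ?thesis using assms by simp
qed

section \<open>The Chapman--Kolmogorov equation\<close>

lemma H_vanishes:
  assumes "e > 0"
  obtains R where "R \<ge> 1" "\<And>r. r > R \<Longrightarrow> H r < e"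
proof -
  define R where "R = max 1 (1 / (Phi \<phi> 1 * e))"
  have "H r < e" if r: "r > R" for r
  proof -
    have P1: "Phi \<phi> 1 > 0" by (rule Phi_pos) simp
    have r1: "r > 1" "r > 1 / (Phi \<phi> 1 * e)" using r by (auto simp: R_def)
    have "r ^ 1 \<le> r ^ DIM('a)" using r1 DIM_positive[where 'a='a] by (intro power_increasing) auto
    then have "r * Phi \<phi> 1 \<le> r ^ DIM('a) * Phi \<phi> r"
      using r1 P1 Phi_strict_mono[of 1 r] by (intro mult_mono) auto
    then have "H r \<le> 1 / (r * Phi \<phi> 1)"
      using r1 P1 by (auto simp: H_def intro!: divide_left_mono mult_pos_pos Phi_pos)
    also have "\<dots> < e" using r1 P1 assms by (simp add: field_simps)
    finally show ?thesis .
  qed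
  then show thesis using that[of R] by (simp add: R_def)
qed

text \<open>
  The initial condition speaks of uniformly continuous functions, so \<open>P\<^sub>t h\<close> has to be one
  before \<open>P\<^sub>s\<close> can be applied to it.  For tents \<open>h\<close> this holds because \<open>P\<^sub>t h\<close> is continuous
  and vanishes at infinity.
\<close>

lemma Pt_tent_uniformly_continuous:
  assumes "0 < t" "0 < r"
  shows "uniformly_continuous_on UNIV (Pt t (tent y0 r))"
proof (rule uniformly_continuous_vanishing)
  have B: "\<bar>tent y0 r y\<bar> \<le> r" for y using assms abs_tent_le[of r y0 y] by simp
  show "continuous_on UNIV (Pt t (tent y0 r))"
    by (rule Pt_continuous_space[OF assms(1) measurable_tent B])
  fix e :: real assume e: "e > 0"
  define V where "V = measure lborel (cball y0 r)"
  define A where "A = cT t * t * r * (V + 1)"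
  have A: "A > 0" using assms cT_pos[of t] by (simp add: A_def V_def add_nonneg_pos)
  obtain R where R: "R \<ge> 1" "\<And>s. s > R \<Longrightarrow> H s < e / A" using H_vanishes[of "e / A"] e A by auto
  have "\<bar>Pt t (tent y0 r) x\<bar> < e" if x: "norm x > R + r + norm y0" for x
  proof -
    have far: "norm (x - y) > norm x - norm y0 - r \<or> norm (x - y) = norm x - norm y0 - r" if "y \<in> cball y0 r" for y
    proof -
      have "norm x \<le> norm (x - y) + norm (y - y0) + norm y0"
        using norm_triangle_ineq[of "x - y" y] norm_triangle_ineq[of "y - y0" y0] by simp
      then show ?thesis using that by (auto simp: dist_norm norm_minus_commute)
    qed
    define s where "s = norm x - norm y0 - r"
    have s: "s > R" "s > 0" using x R by (auto simp: s_def)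
    have le: "\<bar>p t x y * tent y0 r y\<bar> \<le> (cT t * t * H s * r) * indicator (cball y0 r) y" for y
    proof (cases "y \<in> cball y0 r")
      case True
      have ns: "s \<le> norm (x - y)" using far[OF True] by (auto simp: s_def)
      then have "x \<noteq> y" using s by auto
      then have "\<bar>p t x y\<bar> \<le> cT t * t * H (norm (x - y))" using assms by (intro p_off_diagonal) auto
      also have "\<dots> \<le> cT t * t * H s" using assms cT_pos[of t] s ns by (intro mult_left_mono H_antimono) auto
      finally have "\<bar>p t x y\<bar> * \<bar>tent y0 r y\<bar> \<le> cT t * t * H s * r"
        using B[of y] assms cT_pos[of t] by (intro mult_mono) auto
      then show ?thesis using True by (simp add: abs_mult)
    next
      case False
      then show ?thesis using tent_outside[of r y y0] by (simp add: dist_commute)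
    qed
    have "\<bar>Pt t (tent y0 r) x\<bar> \<le> (LINT y|lborel. \<bar>p t x y * tent y0 r y\<bar>)" unfolding Pt_def by (rule integral_abs_bound)
    also have "\<dots> \<le> (LINT y|lborel. (cT t * t * H s * r) * indicator (cball y0 r) y)"
      by (intro integral_mono le integrable_abs integrable_mult_right integrable_p_times[OF assms(1) measurable_tent B])
        (use assms in \<open>auto simp: emeasure_cball\<close>)
    also have "\<dots> = cT t * t * r * V * H s" by (simp add: V_def)
    also have "\<dots> \<le> A * H s" using assms cT_pos[of t] by (intro mult_right_mono) (auto simp: A_def V_def)
    also have "\<dots> < A * (e / A)" using R(2)[OF s(1)] A by (intro mult_strict_left_mono) auto
    also have "\<dots> = e" using A by simp
    finally show ?thesis .
  qed
  then show "\<exists>R. \<forall>x. norm x > R \<longrightarrow> \<bar>Pt t (tent y0 r) x\<bar> < e" by blast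
qed

lemma Pt_time_continuity:
  assumes "0 < s" and f: "f \<in> borel_measurable borel" "\<And>y. \<bar>f y\<bar> \<le> B" and t: "0 < t" "t \<le> 1"
  shows "\<bar>Pt (t + s) f x - Pt s f x\<bar> \<le> cT (s + 1) * B * C\<^sub>G / s * t"
proof -
  have B: "B \<ge> 0" using order_trans[OF abs_ge_zero f(2)[of x]] .
  have "norm (Pt (t + s) f x - Pt s f x) \<le> (cT (s + 1) * B * C\<^sub>G / s) * norm ((t + s) - s)"
  proof (rule field_differentiable_bound[where S="{s..t+s}" and f'="\<lambda>r. Qt r f x"])
    fix r assume r: "r \<in> {s..t+s}"
    then show "((\<lambda>s. Pt s f x) has_field_derivative Qt r f x) (at r within {s..t + s})"
      using assms by (intro has_field_derivative_at_within[OF Pt_derivative[OF _ f]]) auto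
    have "\<bar>Qt r f x\<bar> \<le> cT (s + 1) * B * C\<^sub>G / r" using r assms by (intro Qt_bound) auto
    also have "\<dots> \<le> cT (s + 1) * B * C\<^sub>G / s"
      using r assms cT_pos[of "s + 1"] C\<^sub>G_pos B by (intro divide_left_mono) auto
    finally show "norm (Qt r f x) \<le> cT (s + 1) * B * C\<^sub>G / s" by simp
  qed (use t in auto)
  then show ?thesis using t by simp
qed

text \<open>
  Both sides of the semigroup identity solve the equation with the same initial value, so the
  maximum principle applies to their difference.
\<close>

lemma Pt_semigroup:
  assumes s: "0 < s" and t: "0 < t" and f: "f \<in> borel_measurable borel" "\<And>y. \<bar>f y\<bar> \<le> B"
    and uc: "uniformly_continuous_on UNIV (Pt s f)"
  shows "Pt (t + s) f x = Pt t (Pt s f) x"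
proof -
  have B: "B \<ge> 0" using order_trans[OF abs_ge_zero f(2)[of x]] .
  define h where "h = Pt s f"
  obtain C where C: "\<And>x. \<bar>h x\<bar> \<le> C" unfolding h_def using Pt_bounded[OF f, of s] s by (metis order_refl)
  have h: "h \<in> borel_measurable borel" "bounded (range h)" "uniformly_continuous_on UNIV h"
    using uc uniformly_continuous_imp_continuous[OF uc] C unfolding h_def[symmetric]
    by (auto simp: bounded_iff intro: borel_measurable_continuous_onI)
  have ev: "evolves t (\<lambda>t x. \<alpha> * Pt (t + s) f x + \<gamma> * Pt (t + 0) h x)
      (\<lambda>t x. \<alpha> * Qt (t + s) f x + \<gamma> * Qt (t + 0) h x) (\<lambda>t x. \<alpha> * Qt (t + s) f x + \<gamma> * Qt (t + 0) h x)" for \<alpha> \<gamma>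
    by (intro evolves_linear evolves_Pt[OF f] evolves_Pt[OF h(1) C]) (use s in auto)
  define L where "L = cT (s + 1) * B * C\<^sub>G / s"
  have L: "L \<ge> 0" using cT_pos[of "s + 1"] C\<^sub>G_pos B s by (simp add: L_def)
  have init: "eventually (\<lambda>t. \<forall>x. \<bar>Pt (t + s) f x - Pt t h x\<bar> \<le> \<eta>) (at_right 0)" if \<eta>: "\<eta> > 0" for \<eta>
  proof -
    have "eventually (\<lambda>t. t \<in> {0<..<min 1 (\<eta> / (2 * (L + 1)))}) (at_right 0)"
      using \<eta> L by (intro eventually_at_right_real) auto
    moreover have "eventually (\<lambda>t. \<forall>x. \<bar>Pt t h x - h x\<bar> < \<eta> / 2) (at_right 0)"
      using \<eta> by (intro Pt_initial h) auto
    ultimately show ?thesis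
    proof eventually_elim
      case (elim t)
      show ?case
      proof
        fix x
        have "\<bar>Pt (t + s) f x - h x\<bar> \<le> L * t" unfolding L_def h_def
          using elim by (intro Pt_time_continuity s f) auto
        moreover have "L * t \<le> \<eta> / 2"
        proof -
          have "L * t \<le> (L + 1) * (\<eta> / (2 * (L + 1)))" using elim L by (intro mult_mono) auto
          also have "\<dots> = \<eta> / 2" using L by (simp add: field_simps)
          finally show ?thesis .
        qed
        ultimately show "\<bar>Pt (t + s) f x - Pt t h x\<bar> \<le> \<eta>" using spec[OF elim(2), of x] by linarith
      qed
    qed
  qed
  have "1 * Pt (t + s) f x + (-1) * Pt (t + 0) h x \<le> 0 + 0 * t"
  proof (rule evolves_le[OF ev])
    show "eventually (\<lambda>t. \<forall>x. 1 * Pt (t + s) f x + (-1) * Pt (t + 0) h x \<le> 0 + \<eta>) (at_right 0)" if "\<eta> > 0" for \<eta>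
      using init[OF that] by eventually_elim (auto simp: abs_le_iff algebra_simps)
  qed (use t in auto)
  moreover have "(-1) * Pt (t + s) f x + 1 * Pt (t + 0) h x \<le> 0 + 0 * t"
  proof (rule evolves_le[OF ev])
    show "eventually (\<lambda>t. \<forall>x. (-1) * Pt (t + s) f x + 1 * Pt (t + 0) h x \<le> 0 + \<eta>) (at_right 0)" if "\<eta> > 0" for \<eta>
      using init[OF that] by eventually_elim (auto simp: abs_le_iff algebra_simps)
  qed (use t in auto)
  ultimately show ?thesis by (simp add: h_def)
qed

lemma abs_p_le:
  assumes "0 < t"
  shows "\<bar>p t x y\<bar> \<le> cT t / Phi_inv \<phi> t ^ DIM('a)"
  using p_sup[OF assms, of x y] p_nonneg[OF assms, of x y] by simp

text \<open>
  By Fubini the semigroup property for tents says that both sides, which are continuous in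
  \<open>y\<close>, have the same integrals against tents.
\<close>

lemma chapman_kolmogorov:
  assumes t: "0 < t" and s: "0 < s"
  shows "p (t + s) x y = (LINT w|lborel. p t x w * p s w y)"
proof -
  define B where "B = cT s / Phi_inv \<phi> s ^ DIM('a)"
  have B: "\<bar>p s w y\<bar> \<le> B" for w y unfolding B_def by (rule abs_p_le[OF s])
  have B0: "B \<ge> 0" using order_trans[OF abs_ge_zero B] .
  define R where "R y = (LINT w|lborel. p t x w * p s w y)" for y
  have pm: "(\<lambda>w. p s w y) \<in> borel_measurable borel" for y using s by measurable
  have i: "integrable lborel (\<lambda>w. p t x w * p s w y)" for y
    by (rule integrable_p_times[OF t pm B])
  have cR: "continuous_on UNIV R"
    unfolding continuous_on_def R_def
  proof
    fix y :: 'a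
    show "((\<lambda>y. LINT w|lborel. p t x w * p s w y) \<longlongrightarrow> (LINT w|lborel. p t x w * p s w y)) (at y within UNIV)"
    proof (rule tendsto_integral_at_within[where w="\<lambda>w. B * \<bar>p t x w\<bar>"])
      show "integrable lborel (\<lambda>w. B * \<bar>p t x w\<bar>)" by (intro integrable_mult_right integrable_abs integrable_p t)
      show "AE w in lborel. ((\<lambda>y. p t x w * p s w y) \<longlongrightarrow> p t x w * p s w y) (at y within UNIV)"
      proof (intro AE_I2 tendsto_mult tendsto_const)
        fix w
        have "continuous_on UNIV (\<lambda>y. p s w y)" using s by (intro p_continuous_compose continuous_intros)
        then show "((\<lambda>y. p s w y) \<longlongrightarrow> p s w y) (at y within UNIV)" unfolding continuous_on_def by blast
      qed
      show "AE w in lborel. norm (p t x w * p s w z) \<le> B * \<bar>p t x w\<bar>" for z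
        using mult_left_mono[OF B, of "\<bar>p t x _\<bar>"] by (intro AE_I2) (simp add: abs_mult mult.commute)
    qed (use i in auto)
  qed
  have cp: "continuous_on UNIV (\<lambda>y. p (t + s) x y)" using s t by (intro p_continuous_compose continuous_intros) auto
  have eq: "(LINT y|lborel. R y * tent y0 r y) = (LINT y|lborel. p (t + s) x y * tent y0 r y)" if r: "0 < r" for y0 r
  proof -
    define F where "F y w = p t x w * p s w y * tent y0 r y" for y w
    have iF: "integrable lborel (F y)" for y unfolding F_def by (intro integrable_mult_left i)
    have meas: "(\<lambda>yw. F (fst yw) (snd yw)) \<in> borel_measurable (lborel \<Otimes>\<^sub>M lborel)"
      unfolding F_def using t s by measurable
    have nF: "(LINT w|lborel. norm (F y w)) \<le> B * tent y0 r y" for y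
    proof -
      have "(LINT w|lborel. norm (F y w)) \<le> (LINT w|lborel. B * tent y0 r y * p t x w)"
      proof (intro integral_mono integrable_norm iF integrable_mult_right integrable_p t)
        fix w
        have "norm (F y w) = p t x w * \<bar>p s w y\<bar> * tent y0 r y"
          using p_nonneg[OF t, of x w] tent_nonneg[of y0 r y] by (simp add: F_def abs_mult)
        also have "\<dots> \<le> p t x w * B * tent y0 r y"
          using p_nonneg[OF t, of x w] tent_nonneg[of y0 r y] B[of w y] by (intro mult_right_mono mult_left_mono) auto
        finally show "norm (F y w) \<le> B * tent y0 r y * p t x w" by (simp add: mult_ac)
      qed
      then show ?thesis using p_mass[OF t, of x] by simp
    qed
    have int: "integrable (lborel \<Otimes>\<^sub>M lborel) (\<lambda>(y, w). F y w)"
    proof (rule lborel_pair.Fubini_integrable)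
      show "(\<lambda>(y, w). F y w) \<in> borel_measurable (lborel \<Otimes>\<^sub>M lborel)" using meas by (simp add: split_beta')
      show "AE y in lborel. integrable lborel (\<lambda>w. case (y, w) of (y, w) \<Rightarrow> F y w)" using iF by simp
      show "integrable lborel (\<lambda>y. LINT w|lborel. norm (case (y, w) of (y, w) \<Rightarrow> F y w))"
      proof (rule Bochner_Integration.integrable_bound)
        show "integrable lborel (\<lambda>y. B * tent y0 r y)" by (intro integrable_times_tent continuous_intros)
        show "(\<lambda>y. LINT w|lborel. norm (case (y, w) of (y, w) \<Rightarrow> F y w)) \<in> borel_measurable lborel"
          using meas by (intro lborel.borel_measurable_lebesgue_integral) (simp add: split_beta')
        show "AE y in lborel. norm (LINT w|lborel. norm (case (y, w) of (y, w) \<Rightarrow> F y w)) \<le> norm (B * tent y0 r y)"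
          using order_trans[OF nF abs_ge_self] by (intro AE_I2) (simp add: Bochner_Integration.integral_nonneg)
      qed
    qed
    have "(LINT y|lborel. R y * tent y0 r y) = (LINT y|lborel. LINT w|lborel. F y w)"
      using i by (simp add: R_def F_def)
    also have "\<dots> = (LINT w|lborel. LINT y|lborel. F y w)"
      by (rule lborel_pair.Fubini_integral[OF int, symmetric])
    also have "\<dots> = (LINT w|lborel. p t x w * Pt s (tent y0 r) w)"
      by (simp add: F_def Pt_def mult.assoc)
    also have "\<dots> = Pt t (Pt s (tent y0 r)) x" by (simp add: Pt_def)
    also have "\<dots> = Pt (t + s) (tent y0 r) x"
      using r by (intro Pt_semigroup[symmetric, where B=r] s t Pt_tent_uniformly_continuous abs_tent_le) auto
    finally show ?thesis by (simp add: Pt_def)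
  qed
  \<comment> \<open>The sign test is one-sided, so it is applied to both signs \<open>\<alpha>\<close>.\<close>
  have *: "\<alpha> * (R y - p (t + s) x y) \<le> 0" for \<alpha>
  proof (rule tent_sign_test[where k="\<lambda>y. \<alpha> * (R y - p (t + s) x y)" and ?y0.0=y and \<rho>=1])
    show "isCont (\<lambda>y. \<alpha> * (R y - p (t + s) x y)) y"
      using cR cp by (intro continuous_intros) (auto simp: continuous_on_eq_continuous_at)
    fix r :: real assume r: "0 < r" "r < 1"
    have iR: "integrable lborel (\<lambda>ya. R ya * tent y r ya)" "integrable lborel (\<lambda>ya. p (t + s) x ya * tent y r ya)"
      by (intro integrable_times_tent continuous_on_subset[OF cR] continuous_on_subset[OF cp]; simp)+
    have e: "\<alpha> * (R ya - p (t + s) x ya) * tent y r ya = \<alpha> * (R ya * tent y r ya - p (t + s) x ya * tent y r ya)" for ya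
      by (simp add: algebra_simps)
    show "integrable lborel (\<lambda>ya. \<alpha> * (R ya - p (t + s) x ya) * tent y r ya)"
      unfolding e by (intro integrable_mult_right Bochner_Integration.integrable_diff iR)
    show "(LINT ya|lborel. \<alpha> * (R ya - p (t + s) x ya) * tent y r ya) \<le> 0"
      unfolding e using iR eq[OF r(1), of y] by simp
  qed simp
  show ?thesis using *[of 1] *[of "-1"] by (simp add: R_def)
qed

text \<open>
  The convolution identity makes the kernel differentiable in time also on the diagonal,
  where the equation says nothing.
\<close>

definition p1 :: "real \<Rightarrow> 'a \<Rightarrow> 'a \<Rightarrow> real"
  where "p1 t x y = deriv (\<lambda>s. p s x y) t"

lemma p1_eq_q: "0 < t \<Longrightarrow> x \<noteq> y \<Longrightarrow> p1 t x y = q t x y"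
  unfolding p1_def by (intro DERIV_imp_deriv p_derivative)

lemma
  assumes t: "0 < t" and s: "0 < s"
  shows p_derivative_everywhere: "((\<lambda>r. p r x y) has_real_derivative p1 (t + s) x y) (at (t + s))"
    and chapman_kolmogorov_derivative: "p1 (t + s) x y = (LINT w|lborel. p1 t x w * p s w y)"
proof -
  have pm: "(\<lambda>w. p s w y) \<in> borel_measurable borel" using s by measurable
  have "((\<lambda>r. Pt r (\<lambda>w. p s w y) x) has_real_derivative Qt t (\<lambda>w. p s w y) x) (at t)"
    by (rule Pt_derivative[OF t pm abs_p_le[OF s]])
  then have "((\<lambda>r. p (r + s) x y) has_real_derivative Qt t (\<lambda>w. p s w y) x) (at t)"
  proof (rule DERIV_cong_ev[THEN iffD1, rotated 3, OF _ refl _ refl])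
    show "eventually (\<lambda>r. Pt r (\<lambda>w. p s w y) x = p (r + s) x y) (nhds t)"
      using eventually_nhds_in_open[of "{0<..}" t] t
      by (auto elim!: eventually_mono simp: Pt_def chapman_kolmogorov[OF _ s])
  qed
  then have "((\<lambda>r. p r x y) has_real_derivative Qt t (\<lambda>w. p s w y) x) (at (t + s))"
    by (simp add: DERIV_shift)
  moreover have "Qt t (\<lambda>w. p s w y) x = (LINT w|lborel. p1 t x w * p s w y)"
    unfolding Qt_def
  proof (rule integral_cong_AE)
    have ae: "AE w in lborel. q t x w * p s w y = p1 t x w * p s w y"
      using AE_lborel_singleton[of x] by eventually_elim (simp add: p1_eq_q[OF t])
    show "AE w in lborel. q t x w * p s w y = p1 t x w * p s w y" by fact
    show "(\<lambda>w. q t x w * p s w y) \<in> borel_measurable lborel" using q_measurable[OF t, of x] pm by simp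
    have "{w. w = x} \<in> sets borel" by simp
    then have "(\<lambda>w. if w = x then p1 t x x else q t x w) \<in> borel_measurable borel"
      using q_measurable[OF t, of x] by (intro measurable_If) auto
    moreover have "(\<lambda>w. if w = x then p1 t x x else q t x w) = p1 t x" by (auto simp: p1_eq_q[OF t])
    ultimately show "(\<lambda>w. p1 t x w * p s w y) \<in> borel_measurable lborel" using pm by simp
  qed
  ultimately have D: "((\<lambda>r. p r x y) has_real_derivative (LINT w|lborel. p1 t x w * p s w y)) (at (t + s))" by simp
  then show "p1 (t + s) x y = (LINT w|lborel. p1 t x w * p s w y)"
    unfolding p1_def[of "t + s"] by (rule DERIV_imp_deriv)
  then show "((\<lambda>r. p r x y) has_real_derivative p1 (t + s) x y) (at (t + s))" using D by simp
qed

end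

section \<open>The generator on smooth functions\<close>

text \<open>
  What the operator needs of a function with bounded second derivative: it is Lipschitz, and
  its second differences are of quadratic order.
\<close>

definition quadratic_differences :: "('a::euclidean_space \<Rightarrow> real) \<Rightarrow> real \<Rightarrow> real \<Rightarrow> real \<Rightarrow> bool"
  where "quadratic_differences f B L C \<longleftrightarrow> B \<ge> 0 \<and> L \<ge> 0 \<and> C \<ge> 0 \<and> (\<forall>x. \<bar>f x\<bar> \<le> B) \<and>
    (\<forall>x y. \<bar>f x - f y\<bar> \<le> L * norm (x - y)) \<and>
    (\<forall>x z. \<bar>f (x + z) + f (x - z) - 2 * f x\<bar> \<le> C * norm z ^ 2)"

text \<open>
  Comparing second differences along a unit vector with the second derivative, whose
  oscillation over distance one is bounded by the Hoelder condition, bounds the second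
  derivative by the supremum of the function; the bound on the first derivative then follows
  from Taylor's formula.
\<close>

lemma Cb2_holder_quadratic_differences:
  fixes f :: "'a::euclidean_space \<Rightarrow> real"
  assumes "f \<in> Cb2_holder \<epsilon>" "\<epsilon> > 0"
  shows "\<exists>B L C. quadratic_differences f B L C"
proof -
  obtain f' :: "'a \<Rightarrow> 'a \<Rightarrow>\<^sub>L real" and f'' :: "'a \<Rightarrow> 'a \<Rightarrow>\<^sub>L 'a \<Rightarrow>\<^sub>L real" and C0
    where f': "\<And>x. (f has_derivative blinfun_apply (f' x)) (at x)"
      and f'': "\<And>x. (f' has_derivative blinfun_apply (f'' x)) (at x)"
      and C0: "\<And>x y. norm (f'' x - f'' y) \<le> C0 * norm (x - y) powr \<epsilon>"
    using assms(1) unfolding Cb2_holder_def by auto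
  obtain B where B: "\<And>x. \<bar>f x\<bar> \<le> B"
    using assms(1) unfolding Cb2_holder_def by (auto simp: bounded_iff)
  have B0: "B \<ge> 0" using order_trans[OF abs_ge_zero B] .
  have d1: "((\<lambda>s. f (x + s *\<^sub>R e)) has_real_derivative f' (x + s *\<^sub>R e) e) (at s)" for x e s
  proof -
    have "((\<lambda>s. f (x + s *\<^sub>R e)) has_derivative (\<lambda>h. f' (x + s *\<^sub>R e) (h *\<^sub>R e))) (at s)"
      by (rule has_derivative_compose[OF _ f']) (auto intro!: derivative_eq_intros)
    then show ?thesis
      by (simp add: has_field_derivative_def blinfun.scaleR_right mult_commute_abs)
  qed
  have d2: "((\<lambda>s. f' (x + s *\<^sub>R e) e) has_real_derivative f'' (x + s *\<^sub>R e) e e) (at s)" for x e s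
  proof -
    have "((\<lambda>s. f' (x + s *\<^sub>R e)) has_derivative (\<lambda>h. f'' (x + s *\<^sub>R e) (h *\<^sub>R e))) (at s)"
      by (rule has_derivative_compose[OF _ f'']) (auto intro!: derivative_eq_intros)
    then have "((\<lambda>s. f' (x + s *\<^sub>R e) e) has_derivative (\<lambda>h. f'' (x + s *\<^sub>R e) (h *\<^sub>R e) e)) (at s)"
      by (rule bounded_linear.has_derivative[OF blinfun.bounded_linear_left])
    then show ?thesis
      by (simp add: has_field_derivative_def blinfun.scaleR_right blinfun.scaleR_left mult_commute_abs)
  qed
  have taylor: "\<exists>\<xi>. 0 \<le> \<xi> \<and> \<xi> \<le> 1 \<and> f (x + e) = f x + f' x e + f'' (x + \<xi> *\<^sub>R e) e e / 2" for x e
  proof -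
    let ?diff = "\<lambda>(m::nat) s. if m = 0 then f (x + s *\<^sub>R e) else if m = 1 then f' (x + s *\<^sub>R e) e else f'' (x + s *\<^sub>R e) e e"
    have "\<exists>t>0. t < 1 \<and> f (x + 1 *\<^sub>R e) = (\<Sum>m<2. ?diff m 0 / fact m * 1 ^ m) + ?diff 2 t / fact 2 * 1 ^ 2"
      by (rule Maclaurin[where diff="?diff"]) (auto simp: less_2_cases_iff d1 d2)
    then obtain t where "t > 0" "t < 1"
      "f (x + 1 *\<^sub>R e) = (\<Sum>m<2. ?diff m 0 / fact m * 1 ^ m) + ?diff 2 t / fact 2 * 1 ^ 2" by blast
    then show ?thesis by (intro exI[of _ t]) (simp add: numeral_2_eq_2)
  qed
  \<comment> \<open>The bound for the second derivative: \<open>4 B\<close> from the second difference, \<open>C0\<close> from the oscillation.\<close>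
  define D where "D = 4 * B + \<bar>C0\<bar>"
  have D0: "D \<ge> 0" using B0 by (simp add: D_def)
  have unit: "\<bar>f'' x e e\<bar> \<le> D" if e: "norm e = 1" for x e
  proof -
    obtain s where s: "0 \<le> s" "s \<le> 1" "f (x + e) = f x + f' x e + f'' (x + s *\<^sub>R e) e e / 2"
      using taylor[of x e] by blast
    obtain r where r: "0 \<le> r" "r \<le> 1" "f (x + - e) = f x + f' x (- e) + f'' (x + r *\<^sub>R (- e)) (- e) (- e) / 2"
      using taylor[of x "- e"] by blast
    have osc: "\<bar>f'' (x + h) e e - f'' x e e\<bar> \<le> \<bar>C0\<bar>" if h: "norm h \<le> 1" for h
    proof -
      have "\<bar>f'' (x + h) e e - f'' x e e\<bar> = norm ((f'' (x + h) - f'' x) e e)"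
        by (simp add: blinfun.diff_left)
      also have "\<dots> \<le> norm ((f'' (x + h) - f'' x) e) * norm e" by (rule norm_blinfun)
      also have "\<dots> \<le> norm (f'' (x + h) - f'' x) * norm e * norm e"
        by (intro mult_right_mono norm_blinfun) auto
      also have "\<dots> \<le> \<bar>C0\<bar> * norm h powr \<epsilon>"
        using C0[of "x + h" x] e abs_ge_self[of C0]
        by (auto intro: order_trans[OF _ mult_right_mono])
      also have "\<dots> \<le> \<bar>C0\<bar> * 1" using h assms(2) by (intro mult_left_mono powr_le1) auto
      finally show ?thesis by simp
    qed
    have "f'' (x + s *\<^sub>R e) e e + f'' (x + r *\<^sub>R (- e)) e e = 2 * (f (x + e) + f (x + - e) - 2 * f x)"
      using s(3) r(3) by (simp add: blinfun.minus_right blinfun.minus_left)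
    moreover have "\<bar>f'' (x + s *\<^sub>R e) e e - f'' x e e\<bar> \<le> \<bar>C0\<bar>" "\<bar>f'' (x + r *\<^sub>R (- e)) e e - f'' x e e\<bar> \<le> \<bar>C0\<bar>"
      using osc[of "s *\<^sub>R e"] osc[of "r *\<^sub>R (- e)"] s r e by auto
    moreover have "\<bar>w\<bar> \<le> 4 * B + c"
      if "u + v = 2 * (a1 + a2 - 2 * a0)" "\<bar>u - w\<bar> \<le> c" "\<bar>v - w\<bar> \<le> c" "\<bar>a1\<bar> \<le> B" "\<bar>a2\<bar> \<le> B" "\<bar>a0\<bar> \<le> B"
      for u v w a0 a1 a2 c :: real
      using that unfolding abs_le_iff by (simp add: algebra_simps)
    ultimately show ?thesis
      using B unfolding D_def by blast
  qed
  have quad: "\<bar>f'' x h h\<bar> \<le> D * norm h ^ 2" for x h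
  proof (cases "h = 0")
    case False
    have "norm h *\<^sub>R sgn h = h" by (simp add: sgn_div_norm False)
    then have "f'' x h h = f'' x (norm h *\<^sub>R sgn h) (norm h *\<^sub>R sgn h)" by (simp only:)
    also have "\<dots> = norm h ^ 2 * f'' x (sgn h) (sgn h)"
      by (simp only: blinfun.scaleR_left blinfun.scaleR_right power2_eq_square real_scaleR_def mult.assoc)
    finally have "f'' x h h = norm h ^ 2 * f'' x (sgn h) (sgn h)" .
    then show ?thesis using unit[of "sgn h" x] False
      by (simp add: abs_mult norm_sgn mult.commute mult_right_mono)
  qed simp
  define L where "L = 2 * B + D / 2"
  have L0: "L \<ge> 0" using B0 D0 by (simp add: L_def)
  have grad1: "\<bar>f' x e\<bar> \<le> L" if "norm e = 1" for x e
  proof -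
    obtain s where s: "f (x + e) = f x + f' x e + f'' (x + s *\<^sub>R e) e e / 2"
      using taylor[of x e] by blast
    then show ?thesis using unit[OF that, of "x + s *\<^sub>R e"] B[of "x + e"] B[of x] unfolding L_def by linarith
  qed
  have grad: "\<bar>f' x h\<bar> \<le> L * norm h" for x h
  proof (cases "h = 0")
    case False
    have "norm h *\<^sub>R sgn h = h" by (simp add: sgn_div_norm False)
    then have "f' x h = f' x (norm h *\<^sub>R sgn h)" by (simp only:)
    also have "\<dots> = norm h * f' x (sgn h)" by (simp only: blinfun.scaleR_right real_scaleR_def)
    finally have "f' x h = norm h * f' x (sgn h)" .
    then show ?thesis using grad1[of "sgn h" x] False
      by (simp add: abs_mult norm_sgn mult.commute mult_right_mono)
  qed simp
  have "\<bar>f x - f y\<bar> \<le> L * norm (x - y)" for x y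
  proof -
    have "norm (f (y + 1 *\<^sub>R (x - y)) - f (y + 0 *\<^sub>R (x - y))) \<le> (L * norm (x - y)) * norm (1 - 0 :: real)"
      by (rule field_differentiable_bound[where S="{0..1}" and f="\<lambda>s. f (y + s *\<^sub>R (x - y))",
            OF _ has_field_derivative_at_within[OF d1]])
        (use grad in auto)
    then show ?thesis by simp
  qed
  moreover have "\<bar>f (x + z) + f (x - z) - 2 * f x\<bar> \<le> D * norm z ^ 2" for x z
  proof -
    obtain s where s: "f (x + z) = f x + f' x z + f'' (x + s *\<^sub>R z) z z / 2"
      using taylor[of x z] by blast
    obtain r where r: "f (x + - z) = f x + f' x (- z) + f'' (x + r *\<^sub>R (- z)) (- z) (- z) / 2"
      using taylor[of x "- z"] by blast
    have "2 * (f (x + z) + f (x + - z) - 2 * f x) = f'' (x + s *\<^sub>R z) z z + f'' (x + r *\<^sub>R (- z)) z z"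
      using s r by (simp add: blinfun.minus_right blinfun.minus_left)
    then show ?thesis using quad[of "x + s *\<^sub>R z" z] quad[of "x + r *\<^sub>R (- z)" z] by simp
  qed
  ultimately show ?thesis
    unfolding quadratic_differences_def using B B0 L0 D0 by blast
qed

context nonlocal_operator
begin

definition second_difference_operator :: "('a \<Rightarrow> real) \<Rightarrow> 'a \<Rightarrow> real"
  where "second_difference_operator f x = (LINT z|lborel. (f (x + z) + f (x - z) - 2 * f x) / 2 * jk 0 x z)"

lemma quadratic_differences_measurable:
  assumes "quadratic_differences f B L C"
  shows "f \<in> borel_measurable borel" "uniformly_continuous_on UNIV f" "bounded (range f)"
proof -
  have "L-lipschitz_on UNIV f"
    using assms by (intro lipschitz_onI) (auto simp: quadratic_differences_def dist_norm)
  then show u: "uniformly_continuous_on UNIV f" by (rule lipschitz_on_uniformly_continuous)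
  then show "f \<in> borel_measurable borel"
    by (intro borel_measurable_continuous_onI uniformly_continuous_imp_continuous)
  show "bounded (range f)" using assms by (auto simp: bounded_iff quadratic_differences_def)
qed

text \<open>By the symmetry of \<open>\<kappa>\<close>, increments may be replaced by halved second differences.\<close>

lemma truncated_operator_symmetric:
  assumes e: "0 < \<epsilon>" and [measurable]: "f \<in> borel_measurable borel" and f: "\<And>y. \<bar>f y\<bar> \<le> B"
  shows "jump_op_trunc \<kappa> J \<epsilon> f x = (LINT z|lborel. (f (x + z) + f (x - z) - 2 * f x) / 2 * jk \<epsilon> x z)"
    and "integrable lborel (\<lambda>z. (f (x + z) + f (x - z) - 2 * f x) / 2 * jk \<epsilon> x z)"
proof -
  have [measurable]: "(\<lambda>z. jk \<epsilon> x z) \<in> borel_measurable borel" using e by simp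
  define h where "h z = (f (x + z) - f x) * jk \<epsilon> x z" for z
  have [measurable]: "h \<in> borel_measurable borel" unfolding h_def by measurable
  have ih: "integrable lborel h" unfolding h_def by (rule integrable_increment[OF e assms(2) f])
  then have ihm: "integrable lborel (\<lambda>z. h (- z))"
    using distr_lborel_diff[of "0::'a"] integrable_distr_eq[of uminus lborel borel h] by simp
  have eq: "(f (x + z) + f (x - z) - 2 * f x) / 2 * jk \<epsilon> x z = (h z + h (- z)) / 2" for z
    by (simp add: h_def jk_minus algebra_simps)
  show "integrable lborel (\<lambda>z. (f (x + z) + f (x - z) - 2 * f x) / 2 * jk \<epsilon> x z)"
    unfolding eq by (intro integrable_divide Bochner_Integration.integrable_add ih ihm)
  have "(LINT z|lborel. h (- z)) = (LINT z|lborel. h z)"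
    by (rule integral_lborel_uminus) auto
  then show "jump_op_trunc \<kappa> J \<epsilon> f x = (LINT z|lborel. (f (x + z) + f (x - z) - 2 * f x) / 2 * jk \<epsilon> x z)"
    unfolding eq using e ih ihm by (simp add: jump_op_trunc_eq h_def[symmetric])
qed

definition small_jumps :: "real \<Rightarrow> real"
  where "small_jumps \<epsilon> = (LINT z|lborel. norm (z::'a) ^ 2 * J0 (norm z) * indicator {z. norm z \<le> \<epsilon>} z)"

lemma small_jumps_tendsto: "(small_jumps \<longlongrightarrow> 0) (at_right 0)"
proof -
  have "((\<lambda>\<epsilon>. LINT z|lborel. norm (z::'a) ^ 2 * J0 (norm z) * indicator {z. norm z \<le> \<epsilon>} z) \<longlongrightarrow> (LINT z|lborel. (0::real) * norm (z::'a)))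
      (at_right 0)"
  proof (rule tendsto_integral_at_within[where w="\<lambda>z. norm z ^ 2 * J0 (norm z)"])
    show "integrable lborel (\<lambda>z::'a. norm z ^ 2 * J0 (norm z))" by (rule integrable_J_second_moment)
    show "AE z::'a in lborel. ((\<lambda>\<epsilon>. norm z ^ 2 * J0 (norm z) * indicator {z. norm z \<le> \<epsilon>} z) \<longlongrightarrow> 0 * norm z) (at_right 0)"
    proof (rule AE_I2)
      fix z :: 'a
      have "eventually (\<lambda>\<epsilon>. 0 * norm z = norm z ^ 2 * J0 (norm z) * indicator {z. norm z \<le> \<epsilon>} z) (at_right 0)"
      proof (cases "z = 0")
        case False
        then show ?thesis by (intro eventually_mono[OF eventually_at_right_real[of 0 "norm z"]]) auto
      qed simp
      then show "((\<lambda>\<epsilon>. norm z ^ 2 * J0 (norm z) * indicator {z. norm z \<le> \<epsilon>} z) \<longlongrightarrow> 0 * norm z) (at_right 0)"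
        by (rule Lim_transform_eventually[OF tendsto_const])
    qed
    show "AE z::'a in lborel. norm (norm z ^ 2 * J0 (norm z) * indicator {z. norm z \<le> \<epsilon>} z) \<le> norm z ^ 2 * J0 (norm z)" for \<epsilon>
      by (auto simp: indicator_def)
  qed auto
  then show ?thesis by (simp add: small_jumps_def[abs_def])
qed

text \<open>
  The truncated operator and its limit differ by the jumps of size at most \<open>\<epsilon>\<close>, whose second
  moment tends to zero.  The estimate is uniform in \<open>x\<close>.
\<close>

lemma truncated_operator_error:
  assumes f: "quadratic_differences f B L C" and e: "0 < \<epsilon>"
  shows "\<bar>jump_op_trunc \<kappa> J \<epsilon> f x - second_difference_operator f x\<bar> \<le> C * \<kappa>1 * small_jumps \<epsilon>"
    and "\<bar>second_difference_operator f x\<bar> \<le> C * (\<kappa>1 * K2)"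
proof -
  note [measurable] = quadratic_differences_measurable(1)[OF f]
  have C: "C \<ge> 0" and fB: "\<bar>f y\<bar> \<le> B" and sd: "\<bar>f (x + z) + f (x - z) - 2 * f x\<bar> \<le> C * norm z ^ 2" for x y z
    using f unfolding quadratic_differences_def by auto
  define s where "s z = (f (x + z) + f (x - z) - 2 * f x) / 2" for z
  have [measurable]: "s \<in> borel_measurable borel" unfolding s_def by measurable
  have [measurable]: "(\<lambda>z. jk 0 x z) \<in> borel_measurable borel" "(\<lambda>z. jk \<epsilon> x z) \<in> borel_measurable borel" using e by auto
  have sC: "\<bar>s z\<bar> \<le> C * norm z ^ 2" for z using sd[of x z] C by (simp add: s_def)
  have i0: "integrable lborel (\<lambda>z. C * (norm z ^ 2 * jk 0 x z))"
    by (intro integrable_mult_right integrable_jk_second_moment) auto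
  have le0: "\<bar>s z * jk 0 x z\<bar> \<le> C * (norm z ^ 2 * jk 0 x z)" for z
    using mult_right_mono[OF sC[of z] jk_nonneg[of 0 x z]] jk_nonneg[of 0 x z] by (simp add: abs_mult)
  have i1: "integrable lborel (\<lambda>z. s z * jk 0 x z)"
    by (rule Bochner_Integration.integrable_bound[OF i0])
      (use order_trans[OF le0 abs_ge_self] in \<open>auto\<close>)
  have ise: "integrable lborel (\<lambda>z. s z * jk \<epsilon> x z)"
    unfolding s_def by (rule truncated_operator_symmetric(2)[OF e _ fB]) simp
  have "\<bar>second_difference_operator f x\<bar> \<le> (LINT z|lborel. \<bar>s z * jk 0 x z\<bar>)"
    unfolding second_difference_operator_def s_def by (rule integral_abs_bound)
  also have "\<dots> \<le> (LINT z|lborel. C * (norm z ^ 2 * jk 0 x z))"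
    by (intro integral_mono integrable_abs i1 i0 le0)
  also have "\<dots> \<le> C * (\<kappa>1 * K2)"
    using integrable_jk_second_moment(2)[of 0 x] C by (simp add: mult_left_mono)
  finally show "\<bar>second_difference_operator f x\<bar> \<le> C * (\<kappa>1 * K2)" .
  have "\<bar>jump_op_trunc \<kappa> J \<epsilon> f x - second_difference_operator f x\<bar> = \<bar>LINT z|lborel. s z * jk \<epsilon> x z - s z * jk 0 x z\<bar>"
    using i1 ise truncated_operator_symmetric(1)[OF e quadratic_differences_measurable(1)[OF f] fB, where x=x]
    by (simp add: second_difference_operator_def s_def)
  also have "\<dots> \<le> (LINT z|lborel. \<bar>s z * jk \<epsilon> x z - s z * jk 0 x z\<bar>)" by (rule integral_abs_bound)
  also have "\<dots> \<le> (LINT z|lborel. C * \<kappa>1 * (norm (z::'a) ^ 2 * J0 (norm z) * indicator {z. norm z \<le> \<epsilon>} z))"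
  proof (rule integral_mono)
    show "integrable lborel (\<lambda>z. \<bar>s z * jk \<epsilon> x z - s z * jk 0 x z\<bar>)"
      by (intro integrable_abs Bochner_Integration.integrable_diff i1 ise)
    show "integrable lborel (\<lambda>z::'a. C * \<kappa>1 * (norm z ^ 2 * J0 (norm z) * indicator {z. norm z \<le> \<epsilon>} z))"
      by (intro integrable_mult_right integrable_real_mult_indicator integrable_J_second_moment) auto
    fix z
    show "\<bar>s z * jk \<epsilon> x z - s z * jk 0 x z\<bar> \<le> C * \<kappa>1 * (norm z ^ 2 * J0 (norm z) * indicator {z. norm z \<le> \<epsilon>} z)"
    proof (cases "norm z \<le> \<epsilon>")
      case True
      then have "\<bar>s z * jk \<epsilon> x z - s z * jk 0 x z\<bar> = \<bar>s z * jk 0 x z\<bar>" by (simp add: jk_def)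
      also have "\<dots> \<le> C * (norm z ^ 2 * jk 0 x z)" by (rule le0)
      also have "\<dots> \<le> C * (norm z ^ 2 * (\<kappa>1 * J0 (norm z)))" using C by (intro mult_left_mono jk_le) auto
      finally show ?thesis using True by (simp add: mult_ac)
    next
      case False
      then have "jk \<epsilon> x z = jk 0 x z" using e by (auto simp: jk_def)
      then show ?thesis using False by simp
    qed
  qed
  also have "\<dots> = C * \<kappa>1 * small_jumps \<epsilon>" by (simp add: small_jumps_def)
  finally show "\<bar>jump_op_trunc \<kappa> J \<epsilon> f x - second_difference_operator f x\<bar> \<le> C * \<kappa>1 * small_jumps \<epsilon>" .
qed

lemma truncated_operator_tendsto:
  assumes f: "quadratic_differences f B L C"
  shows "((\<lambda>\<epsilon>. jump_op_trunc \<kappa> J \<epsilon> f x) \<longlongrightarrow> second_difference_operator f x) (at_right 0)"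
proof -
  have "((\<lambda>\<epsilon>. jump_op_trunc \<kappa> J \<epsilon> f x - second_difference_operator f x) \<longlongrightarrow> 0) (at_right 0)"
  proof (rule Lim_null_comparison)
    show "((\<lambda>\<epsilon>. C * \<kappa>1 * small_jumps \<epsilon>) \<longlongrightarrow> 0) (at_right 0)"
      by (intro tendsto_mult_right_zero small_jumps_tendsto)
    show "eventually (\<lambda>\<epsilon>. norm (jump_op_trunc \<kappa> J \<epsilon> f x - second_difference_operator f x) \<le> C * \<kappa>1 * small_jumps \<epsilon>) (at_right 0)"
      using eventually_at_right_1 by eventually_elim (use truncated_operator_error(1)[OF f] in auto)
  qed
  then show ?thesis by (simp add: LIM_zero_iff)
qed

lemma integrable_J_outside:
  assumes "0 < \<epsilon>"
  shows "integrable lborel (\<lambda>z::'a. J0 (norm z) * indicator {z. \<epsilon> < norm z} z)"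
proof (rule Bochner_Integration.integrable_bound)
  show "integrable lborel (\<lambda>z::'a. (1 / \<epsilon>\<^sup>2) * (norm z ^ 2 * J0 (norm z)))"
    by (intro integrable_mult_right integrable_J_second_moment)
  show "AE z::'a in lborel. norm (J0 (norm z) * indicator {z. \<epsilon> < norm z} z) \<le> norm ((1 / \<epsilon>\<^sup>2) * (norm z ^ 2 * J0 (norm z)))"
  proof (rule AE_I2)
    fix z :: 'a
    have "1 * J0 (norm z) \<le> (1 / \<epsilon>\<^sup>2 * norm z ^ 2) * J0 (norm z)" if "\<epsilon> < norm z"
    proof (rule mult_right_mono)
      have "\<epsilon>\<^sup>2 \<le> norm z ^ 2" using that assms by (intro power_mono) auto
      then show "1 \<le> 1 / \<epsilon>\<^sup>2 * norm z ^ 2" using assms by (simp add: field_simps)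
    qed simp
    then show "norm (J0 (norm z) * indicator {z. \<epsilon> < norm z} z) \<le> norm ((1 / \<epsilon>\<^sup>2) * (norm z ^ 2 * J0 (norm z)))"
      by (auto simp: indicator_def mult.assoc)
  qed
qed auto

text \<open>
  The increments of \<open>f\<close> vary at a Lipschitz rate, the coefficient at a Hoelder rate, and the
  jumps larger than \<open>\<epsilon>\<close> have finite total intensity.
\<close>

lemma truncated_operator_uniformly_continuous:
  assumes f: "quadratic_differences f B L C" and e: "0 < \<epsilon>"
  shows "uniformly_continuous_on UNIV (jump_op_trunc \<kappa> J \<epsilon> f)"
proof -
  note [measurable] = quadratic_differences_measurable(1)[OF f]
  have fB: "\<bar>f y\<bar> \<le> B" and fL: "\<bar>f x - f y\<bar> \<le> L * norm (x - y)" and BL: "B \<ge> 0" "L \<ge> 0" for x y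
    using f unfolding quadratic_differences_def by auto
  define N where "N = (LINT z|lborel. J0 (norm (z::'a)) * indicator {z. \<epsilon> < norm z} z)"
  define m where "m r = (2 * L * \<kappa>1 * r + 2 * B * \<kappa>2 * r powr \<delta>) * N" for r
  have le: "\<bar>jump_op_trunc \<kappa> J \<epsilon> f x - jump_op_trunc \<kappa> J \<epsilon> f y\<bar> \<le> m (norm (x - y))" for x y
  proof -
    have ix: "integrable lborel (\<lambda>z. (f (x + z) - f x) * jk \<epsilon> x z)" for x
      by (rule integrable_increment[OF e _ fB]) simp
    have "\<bar>jump_op_trunc \<kappa> J \<epsilon> f x - jump_op_trunc \<kappa> J \<epsilon> f y\<bar> =
        \<bar>LINT z|lborel. (f (x + z) - f x) * jk \<epsilon> x z - (f (y + z) - f y) * jk \<epsilon> y z\<bar>"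
      using ix e by (simp add: jump_op_trunc_eq)
    also have "\<dots> \<le> (LINT z|lborel. \<bar>(f (x + z) - f x) * jk \<epsilon> x z - (f (y + z) - f y) * jk \<epsilon> y z\<bar>)"
      by (rule integral_abs_bound)
    also have "\<dots> \<le> (LINT z|lborel. (2 * L * \<kappa>1 * norm (x - y) + 2 * B * \<kappa>2 * norm (x - y) powr \<delta>) * (J0 (norm (z::'a)) * indicator {z. \<epsilon> < norm z} z))"
    proof (intro integral_mono integrable_abs Bochner_Integration.integrable_diff ix integrable_mult_right integrable_J_outside e)
      fix z
      show "\<bar>(f (x + z) - f x) * jk \<epsilon> x z - (f (y + z) - f y) * jk \<epsilon> y z\<bar> \<le>
        (2 * L * \<kappa>1 * norm (x - y) + 2 * B * \<kappa>2 * norm (x - y) powr \<delta>) * (J0 (norm z) * indicator {z. \<epsilon> < norm z} z)"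
      proof (cases "\<epsilon> < norm z")
        case True
        define u v where "u = f (x + z) - f x" and "v = f (y + z) - f y"
        have uv: "\<bar>u - v\<bar> \<le> 2 * L * norm (x - y)"
          using fL[of "x + z" "y + z"] fL[of x y] by (simp add: u_def v_def)
        have v: "\<bar>v\<bar> \<le> 2 * B" using fB[of "y + z"] fB[of y] by (simp add: v_def)
        have "u * \<kappa> x z - v * \<kappa> y z = (u - v) * \<kappa> x z + v * (\<kappa> x z - \<kappa> y z)" by (simp add: algebra_simps)
        then have "\<bar>u * \<kappa> x z - v * \<kappa> y z\<bar> \<le> \<bar>u - v\<bar> * \<kappa> x z + \<bar>v\<bar> * \<bar>\<kappa> x z - \<kappa> y z\<bar>"
          using kappa_pos[of x z] by (metis abs_mult abs_of_pos abs_triangle_ineq)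
        also have "\<dots> \<le> (2 * L * norm (x - y)) * \<kappa>1 + (2 * B) * (\<kappa>2 * norm (x - y) powr \<delta>)"
          using uv v kappa_pos[of x z] kappa_le[of x z] kappa_holder[of x z y] BL \<kappa>2_pos
          by (intro add_mono mult_mono) auto
        finally have "\<bar>u * \<kappa> x z - v * \<kappa> y z\<bar> * J0 (norm z) \<le>
            ((2 * L * norm (x - y)) * \<kappa>1 + (2 * B) * (\<kappa>2 * norm (x - y) powr \<delta>)) * J0 (norm z)"
          by (intro mult_right_mono) auto
        moreover have "\<bar>u * (\<kappa> x z * J0 (norm z)) - v * (\<kappa> y z * J0 (norm z))\<bar> = \<bar>u * \<kappa> x z - v * \<kappa> y z\<bar> * J0 (norm z)"
        proof -
          have "u * (\<kappa> x z * J0 (norm z)) - v * (\<kappa> y z * J0 (norm z)) = (u * \<kappa> x z - v * \<kappa> y z) * J0 (norm z)"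
            by (simp add: algebra_simps)
          then show ?thesis by (simp only: abs_mult abs_of_nonneg[OF J0_nonneg])
        qed
        ultimately show ?thesis using True e by (simp add: jk_J0 u_def v_def mult_ac)
      qed (simp add: jk_def)
    qed
    finally show ?thesis by (simp add: m_def N_def)
  qed
  have mlim: "(m \<longlongrightarrow> 0) (at_right 0)"
  proof -
    have "((\<lambda>r. r powr \<delta>) \<longlongrightarrow> 0) (at_right 0)"
      using tendsto_zero_powrI[of "\<lambda>r. r" "at_right 0" "\<lambda>_. \<delta>" \<delta>] \<delta>_pos
      by (auto simp: eventually_at_topological)
    then have "(m \<longlongrightarrow> (2 * L * \<kappa>1 * 0 + 2 * B * \<kappa>2 * 0) * N) (at_right 0)"
      unfolding m_def by (intro tendsto_intros)
    then show ?thesis by simp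
  qed
  show ?thesis unfolding uniformly_continuous_on_def
  proof (intro allI impI)
    fix e :: real assume "e > 0"
    then have "eventually (\<lambda>r. m r < e) (at_right 0)" using mlim by (rule order_tendstoD(2)[rotated])
    then obtain d where d: "d > 0" "\<And>r. 0 < r \<Longrightarrow> r < d \<Longrightarrow> m r < e"
      unfolding eventually_at_right_field by auto
    have "dist (jump_op_trunc \<kappa> J \<epsilon> f y) (jump_op_trunc \<kappa> J \<epsilon> f x) < e" if "dist y x < d" for x y
    proof (cases "x = y")
      case False
      then have "m (norm (y - x)) < e" using that by (intro d) (auto simp: dist_norm)
      then show ?thesis using le[of y x] by (simp add: dist_real_def)
    qed (use \<open>e > 0\<close> in simp)
    then show "\<exists>d>0. \<forall>x\<in>UNIV. \<forall>x'\<in>UNIV. dist x' x < d \<longrightarrow> dist (jump_op_trunc \<kappa> J \<epsilon> f x') (jump_op_trunc \<kappa> J \<epsilon> f x) < e"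
      using d(1) by blast
  qed
qed

text \<open>
  A uniform limit of uniformly continuous functions.
\<close>

lemma second_difference_operator_uniformly_continuous:
  assumes f: "quadratic_differences f B L C"
  shows "uniformly_continuous_on UNIV (second_difference_operator f)"
  unfolding uniformly_continuous_on_def
proof (intro allI impI)
  fix e :: real assume e: "e > 0"
  have "((\<lambda>\<epsilon>. C * \<kappa>1 * small_jumps \<epsilon>) \<longlongrightarrow> 0) (at_right 0)"
    by (intro tendsto_mult_right_zero small_jumps_tendsto)
  then have "eventually (\<lambda>\<epsilon>. C * \<kappa>1 * small_jumps \<epsilon> < e / 3) (at_right 0)"
    using e by (intro order_tendstoD(2)) auto
  then obtain d0 where "d0 > 0" "\<And>\<epsilon>. 0 < \<epsilon> \<Longrightarrow> \<epsilon> < d0 \<Longrightarrow> C * \<kappa>1 * small_jumps \<epsilon> < e / 3"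
    unfolding eventually_at_right_field by auto
  then have "d0 / 2 > 0" "C * \<kappa>1 * small_jumps (d0 / 2) < e / 3" by auto
  then obtain \<epsilon> where \<epsilon>: "\<epsilon> > 0" "C * \<kappa>1 * small_jumps \<epsilon> < e / 3" by blast
  let ?T = "jump_op_trunc \<kappa> J \<epsilon> f"
  have err: "\<bar>?T x - second_difference_operator f x\<bar> < e / 3" for x
    using truncated_operator_error(1)[OF f \<epsilon>(1), of x] \<epsilon>(2) by linarith
  have "e / 3 > 0" using e by simp
  from truncated_operator_uniformly_continuous[OF f \<epsilon>(1), unfolded uniformly_continuous_on_def, rule_format, OF this]
  obtain d where d: "d > 0" "\<And>x y. dist y x < d \<Longrightarrow> dist (?T y) (?T x) < e / 3"
    by auto
  have "dist (second_difference_operator f y) (second_difference_operator f x) < e" if "dist y x < d" for x y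
    using err[of x] err[of y] d(2)[OF that] unfolding dist_real_def by linarith
  then show "\<exists>d>0. \<forall>x\<in>UNIV. \<forall>x'\<in>UNIV. dist x' x < d \<longrightarrow>
      dist (second_difference_operator f x') (second_difference_operator f x) < e"
    using d(1) by blast
qed

lemma jump_op_eq:
  assumes f: "quadratic_differences f B L C"
  shows "jump_op_exists \<kappa> J f x" "jump_op \<kappa> J f x = second_difference_operator f x"
  using truncated_operator_tendsto[OF f, of x] unfolding jump_op_exists_def jump_op_def
  by (auto intro!: tendsto_Lim)

lemma evolves_affine:
  assumes "continuous_on UNIV h" "\<And>x. \<bar>h x\<bar> \<le> B"
    and lim: "\<And>x. ((\<lambda>\<epsilon>. jump_op_trunc \<kappa> J \<epsilon> h x) \<longlongrightarrow> l x) (at_right 0)"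
  shows "evolves T (\<lambda>t x. h x) (\<lambda>t x. 0) (\<lambda>t x. l x)"
    "evolves T (\<lambda>t x. t * h x) (\<lambda>t x. h x) (\<lambda>t x. t * l x)"
proof -
  have c: "continuous_on S (\<lambda>tx. h (snd tx))" for S :: "(real \<times> 'a) set"
    by (rule continuous_on_compose2[OF assms(1)]) (auto intro!: continuous_intros)
  show "evolves T (\<lambda>t x. h x) (\<lambda>t x. 0) (\<lambda>t x. l x)"
    using c assms(2) lim unfolding evolves_def by (auto intro!: exI[of _ B])
  have hm: "h \<in> borel_measurable borel" using assms(1) by (rule borel_measurable_continuous_onI)
  have "((\<lambda>\<epsilon>. jump_op_trunc \<kappa> J \<epsilon> (\<lambda>x. t * h x) x) \<longlongrightarrow> t * l x) (at_right 0)" for t x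
  proof (rule Lim_transform_eventually)
    show "((\<lambda>\<epsilon>. t * jump_op_trunc \<kappa> J \<epsilon> h x) \<longlongrightarrow> t * l x) (at_right 0)"
      by (intro tendsto_mult tendsto_const lim)
    show "eventually (\<lambda>\<epsilon>. t * jump_op_trunc \<kappa> J \<epsilon> h x = jump_op_trunc \<kappa> J \<epsilon> (\<lambda>x. t * h x) x) (at_right 0)"
      using eventually_at_right_1
      by eventually_elim (use truncated_operator_linear[OF _ hm hm assms(2) assms(2), of _ t 0 x] in auto)
  qed
  moreover have "\<bar>t * h x\<bar> \<le> T * B" if "t \<in> {0<..T}" for t x
    using that assms(2)[of x] by (auto simp: abs_mult intro!: mult_mono)
  ultimately show "evolves T (\<lambda>t x. t * h x) (\<lambda>t x. h x) (\<lambda>t x. t * l x)"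
    using c unfolding evolves_def by (auto intro!: continuous_intros derivative_eq_intros exI[of _ "T * B"])
qed

end

context heat_kernel_setting
begin

text \<open>
  Let \<open>g\<close> be the image of \<open>f\<close> under the operator.  The function
  \<open>u(t) = P\<^sub>t f - f - t P\<^sub>\<eta> g\<close> starts at zero and solves the equation up to the error
  \<open>g - P\<^sub>\<eta> g + t L P\<^sub>\<eta> g\<close>, so \<open>|u(t)| \<le> t (\<parallel>g - P\<^sub>\<eta> g\<parallel> + t \<parallel>L P\<^sub>\<eta> g\<parallel>)\<close>.
  Replacing \<open>g\<close> by the smoother \<open>P\<^sub>\<eta> g\<close> is what makes the operator applicable to \<open>u(t)\<close>.
\<close>

lemma generator_estimate:
  assumes f: "quadratic_differences f B L C" and t: "0 < t" and \<eta>: "0 < \<eta>"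
    and g: "g = second_difference_operator f" and e: "\<And>x. \<bar>Pt \<eta> g x - g x\<bar> \<le> e"
    and K: "\<And>x. \<bar>Qt \<eta> g x\<bar> \<le> K"
  shows "\<bar>Pt t f x - f x - t * Pt \<eta> g x\<bar> \<le> (e + t * K) * t"
proof -
  note fm = quadratic_differences_measurable[OF f]
  have fB: "\<bar>f y\<bar> \<le> B" for y using f unfolding quadratic_differences_def by auto
  define Bg where "Bg = C * (\<kappa>1 * K2)"
  have gB: "\<bar>g y\<bar> \<le> Bg" for y unfolding g Bg_def by (rule truncated_operator_error(2)[OF f zero_less_one])
  have gu: "uniformly_continuous_on UNIV g" unfolding g by (rule second_difference_operator_uniformly_continuous[OF f])
  have gm: "g \<in> borel_measurable borel" "bounded (range g)"
    using gu gB by (auto simp: bounded_iff intro: borel_measurable_continuous_onI uniformly_continuous_imp_continuous)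
  have PB: "\<bar>Pt \<eta> g x\<bar> \<le> Bg" for x
    using Pt_le[OF gm(2) gu _ \<eta>, of Bg x] Pt_ge[OF gm(2) gu _ \<eta>, of "- Bg" x] gB by (auto simp: abs_le_iff minus_le_iff)
  have "e \<ge> 0" "K \<ge> 0" using order_trans[OF abs_ge_zero e] order_trans[OF abs_ge_zero K] by auto
  define M where "M = e + t * K"
  have M: "M \<ge> 0" using \<open>e \<ge> 0\<close> \<open>K \<ge> 0\<close> t by (simp add: M_def)
  have ev1: "evolves t (\<lambda>t x. Pt (t + 0) f x) (\<lambda>t x. Qt (t + 0) f x) (\<lambda>t x. Qt (t + 0) f x)"
    by (rule evolves_Pt[OF fm(1) fB]) simp
  have ev2: "evolves t (\<lambda>t x. f x) (\<lambda>t x. 0) (\<lambda>t x. g x)"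
    unfolding g by (rule evolves_affine(1)[OF uniformly_continuous_imp_continuous[OF fm(2)] fB truncated_operator_tendsto[OF f]])
  have ev3: "evolves t (\<lambda>t x. t * Pt \<eta> g x) (\<lambda>t x. Pt \<eta> g x) (\<lambda>t x. t * Qt \<eta> g x)"
    by (rule evolves_affine(2)[OF Pt_continuous_space[OF \<eta> gm(1) gB] PB truncated_Pt_tendsto[OF \<eta> gm(1) gB]])
  have ev: "evolves t (\<lambda>t x. \<alpha> * (1 * Pt (t + 0) f x + (-1) * f x) + (- \<alpha>) * (t * Pt \<eta> g x))
      (\<lambda>t x. \<alpha> * (1 * Qt (t + 0) f x + (-1) * 0) + (- \<alpha>) * Pt \<eta> g x)
      (\<lambda>t x. \<alpha> * (1 * Qt (t + 0) f x + (-1) * g x) + (- \<alpha>) * (t * Qt \<eta> g x))" for \<alpha>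
    by (intro evolves_linear[OF evolves_linear[OF ev1 ev2] ev3])
  \<comment> \<open>Both signs \<open>\<alpha>\<close> are needed; the factors \<open>1\<close> and \<open>- 1\<close> match the form of a linear combination.\<close>
  have bound: "\<alpha> * (1 * Pt (t + 0) f x + (-1) * f x) + (- \<alpha>) * (t * Pt \<eta> g x) \<le> 0 + M * t" if \<alpha>: "\<bar>\<alpha>\<bar> = 1" for \<alpha>
  proof (rule evolves_le[OF ev])
    fix s x assume s: "s \<in> {0<..t}"
    have "s * \<bar>Qt \<eta> g x\<bar> \<le> t * K" using s K[of x] by (intro mult_mono) auto
    then have "\<bar>s * Qt \<eta> g x\<bar> \<le> t * K" using s by (simp add: abs_mult)
    moreover have "\<bar>\<alpha> * (g x - Pt \<eta> g x + s * Qt \<eta> g x)\<bar> = \<bar>g x - Pt \<eta> g x + s * Qt \<eta> g x\<bar>"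
      using \<alpha> by (simp add: abs_mult)
    ultimately have "\<alpha> * (g x - Pt \<eta> g x + s * Qt \<eta> g x) \<le> M"
      using e[of x] unfolding M_def by linarith
    then show "\<alpha> * (1 * Qt (s + 0) f x + (-1) * 0) + (- \<alpha>) * Pt \<eta> g x \<le>
        \<alpha> * (1 * Qt (s + 0) f x + (-1) * g x) + (- \<alpha>) * (s * Qt \<eta> g x) + M"
      by (simp add: algebra_simps)
  next
    fix \<epsilon> :: real assume \<epsilon>: "\<epsilon> > 0"
    have Bg: "Bg \<ge> 0" using order_trans[OF abs_ge_zero gB] .
    have "eventually (\<lambda>t. t \<in> {0<..<\<epsilon> / (2 * (Bg + 1))}) (at_right 0)"
      using \<epsilon> Bg by (intro eventually_at_right_real) auto
    moreover have "eventually (\<lambda>t. \<forall>x. \<bar>Pt t f x - f x\<bar> < \<epsilon> / 2) (at_right 0)"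
      using \<epsilon> by (intro Pt_initial fm) auto
    ultimately show "eventually (\<lambda>t. \<forall>x. \<alpha> * (1 * Pt (t + 0) f x + (-1) * f x) + (- \<alpha>) * (t * Pt \<eta> g x) \<le> 0 + \<epsilon>) (at_right 0)"
    proof eventually_elim
      case (elim s)
      show ?case
      proof
        fix x
        have "s * \<bar>Pt \<eta> g x\<bar> \<le> (\<epsilon> / (2 * (Bg + 1))) * (Bg + 1)"
          using elim(1) PB[of x] \<epsilon> by (intro mult_mono) auto
        also have "\<dots> = \<epsilon> / 2" using Bg by (simp add: field_simps)
        finally have "\<bar>s * Pt \<eta> g x\<bar> \<le> \<epsilon> / 2" using elim(1) by (simp add: abs_mult)
        moreover have "\<bar>\<alpha> * (Pt s f x - f x - s * Pt \<eta> g x)\<bar> = \<bar>Pt s f x - f x - s * Pt \<eta> g x\<bar>"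
          using \<alpha> by (simp add: abs_mult)
        ultimately have "\<alpha> * (Pt s f x - f x - s * Pt \<eta> g x) \<le> \<epsilon>"
          using spec[OF elim(2), of x] by linarith
        then show "\<alpha> * (1 * Pt (s + 0) f x + (-1) * f x) + (- \<alpha>) * (s * Pt \<eta> g x) \<le> 0 + \<epsilon>"
          by (simp add: algebra_simps)
      qed
    qed
  qed (use M t in auto)
  show ?thesis using bound[of 1] bound[of "-1"] unfolding M_def by (simp add: abs_le_iff algebra_simps)
qed

theorem generator:
  assumes f: "quadratic_differences f B L C"
  shows "uniform_limit UNIV (\<lambda>t x. (1 / t) * (Pt t f x - f x)) (jump_op \<kappa> J f) (at_right 0)"
  unfolding uniform_limit_iff
proof (intro allI impI)
  fix \<epsilon> :: real assume \<epsilon>: "\<epsilon> > 0"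
  define g where "g = second_difference_operator f"
  have Lf: "jump_op \<kappa> J f = g" using jump_op_eq(2)[OF f] by (auto simp: g_def)
  define Bg where "Bg = C * (\<kappa>1 * K2)"
  have gB: "\<bar>g y\<bar> \<le> Bg" for y unfolding g_def Bg_def by (rule truncated_operator_error(2)[OF f zero_less_one])
  have gu: "uniformly_continuous_on UNIV g" unfolding g_def by (rule second_difference_operator_uniformly_continuous[OF f])
  have gm: "g \<in> borel_measurable borel" "bounded (range g)"
    using gu gB by (auto simp: bounded_iff intro: borel_measurable_continuous_onI uniformly_continuous_imp_continuous)
  have "eventually (\<lambda>\<eta>. \<forall>x. \<bar>Pt \<eta> g x - g x\<bar> < \<epsilon> / 4) (at_right 0)"
    using \<epsilon> by (intro Pt_initial gm gu) auto
  then obtain d where "d > 0" "\<And>\<eta>. 0 < \<eta> \<Longrightarrow> \<eta> < d \<Longrightarrow> \<forall>x. \<bar>Pt \<eta> g x - g x\<bar> < \<epsilon> / 4"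
    unfolding eventually_at_right_field by auto
  then have "d / 2 > 0" "\<forall>x. \<bar>Pt (d / 2) g x - g x\<bar> < \<epsilon> / 4" by auto
  then obtain \<eta> where \<eta>: "\<eta> > 0" "\<And>x. \<bar>Pt \<eta> g x - g x\<bar> < \<epsilon> / 4" by blast
  define K where "K = cT \<eta> * Bg * C\<^sub>G / \<eta>"
  have K: "\<bar>Qt \<eta> g x\<bar> \<le> K" for x unfolding K_def by (rule Qt_bound[OF \<eta>(1) order_refl gm(1) gB])
  have K0: "K \<ge> 0" using order_trans[OF abs_ge_zero K] .
  have "eventually (\<lambda>t. t \<in> {0<..<\<epsilon> / (4 * (K + 1))}) (at_right 0)"
    using \<epsilon> K0 by (intro eventually_at_right_real) auto
  then show "eventually (\<lambda>t. \<forall>x\<in>UNIV. dist ((1 / t) * (Pt t f x - f x)) (jump_op \<kappa> J f x) < \<epsilon>) (at_right 0)"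
  proof eventually_elim
    case (elim t)
    then have t: "t > 0" "t < \<epsilon> / (4 * (K + 1))" by auto
    have tK: "t * K < \<epsilon> / 4"
    proof -
      have "t * K \<le> t * (K + 1)" using t by (intro mult_left_mono) auto
      also have "\<dots> < \<epsilon> / (4 * (K + 1)) * (K + 1)" using t K0 by (intro mult_strict_right_mono) auto
      also have "\<dots> = \<epsilon> / 4" using K0 by (simp add: field_simps)
      finally show ?thesis .
    qed
    show ?case
    proof
      fix x
      have "\<bar>Pt t f x - f x - t * Pt \<eta> g x\<bar> \<le> (\<epsilon> / 4 + t * K) * t"
        by (rule generator_estimate[OF f t(1) \<eta>(1) g_def less_imp_le[OF \<eta>(2)] K])
      then have "\<bar>(Pt t f x - f x - t * Pt \<eta> g x) / t\<bar> \<le> \<epsilon> / 4 + t * K"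
        using t by (simp add: field_simps)
      moreover have "(Pt t f x - f x - t * Pt \<eta> g x) / t = (1 / t) * (Pt t f x - f x) - Pt \<eta> g x"
        using t by (simp add: field_simps)
      ultimately have "\<bar>(1 / t) * (Pt t f x - f x) - Pt \<eta> g x\<bar> \<le> \<epsilon> / 4 + t * K" by simp
      then show "dist ((1 / t) * (Pt t f x - f x)) (jump_op \<kappa> J f x) < \<epsilon>"
        using \<eta>(2)[of x] tK \<epsilon> unfolding Lf dist_real_def by linarith
    qed
  qed
qed

end

section \<open>Integral operators with Schur-bounded kernels on \<open>L\<^sup>q\<close>\<close>

text \<open>
  Jensen's inequality for a measure \<open>k dM\<close> of total mass at most \<open>m\<close>: integrate the tangent
  line bound \<open>u \<le> c\<^sup>1\<^sup>-\<^sup>q u\<^sup>q / q + (1 - 1/q) c\<close> and choose \<open>c\<close> optimally.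
\<close>

lemma tangent_line_powr:
  fixes u c q :: real
  assumes "u \<ge> 0" "c > 0" "q \<ge> 1"
  shows "u \<le> c powr (1 - q) * u powr q / q + (1 - 1 / q) * c"
proof (cases "u = 0")
  case True
  then show ?thesis using assms by simp
next
  case False
  define s where "s = u / c"
  have s: "s > 0" using False assms by (simp add: s_def)
  have "(s powr q) powr (1 / q) * 1 powr (1 - 1 / q) \<le> (1 / q) * (s powr q) + (1 - 1 / q) * 1"
    using assms s by (intro Youngs_inequality_0) auto
  then have "s \<le> (1 / q) * (s powr q) + (1 - 1 / q)" using s assms by (simp add: powr_powr)
  then have "c * s \<le> c * ((1 / q) * (s powr q) + (1 - 1 / q))" using assms by (intro mult_left_mono) auto
  moreover have "c * s = u" using assms by (simp add: s_def)
  moreover have "c * s powr q = c powr (1 - q) * u powr q"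
    using assms False by (simp add: s_def powr_divide powr_diff)
  ultimately show ?thesis by (simp add: algebra_simps)
qed

lemma weighted_jensen_powr:
  fixes k g :: "'b \<Rightarrow> real"
  assumes [measurable]: "k \<in> borel_measurable M" "g \<in> borel_measurable M"
    and k: "integrable M k" "\<And>y. 0 \<le> k y" "(LINT y|M. k y) \<le> m" and g: "\<And>y. 0 \<le> g y"
    and kg: "integrable M (\<lambda>y. k y * g y powr q)" and m: "m > 0" and q: "q \<ge> 1"
  shows "integrable M (\<lambda>y. k y * g y)"
    and "(LINT y|M. k y * g y) powr q \<le> m powr (q - 1) * (LINT y|M. k y * g y powr q)"
proof -
  have le: "k y * g y \<le> (c powr (1 - q) / q) * (k y * g y powr q) + ((1 - 1 / q) * c) * k y" if "c > 0" for c y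
    using mult_left_mono[OF tangent_line_powr[OF g[of y] that q] k(2)[of y]] by (simp add: algebra_simps)
  have i: "integrable M (\<lambda>y. (c powr (1 - q) / q) * (k y * g y powr q) + ((1 - 1 / q) * c) * k y)" for c
    by (intro Bochner_Integration.integrable_add integrable_mult_right k kg)
  show ikg: "integrable M (\<lambda>y. k y * g y)"
    by (rule Bochner_Integration.integrable_bound[OF i[of 1]])
      (use order_trans[OF le[of 1] abs_ge_self] k(2) g in auto)
  define F where "F = (LINT y|M. k y * g y powr q)"
  have F0: "F \<ge> 0" unfolding F_def using k(2) by (intro Bochner_Integration.integral_nonneg) auto
  define I where "I = (LINT y|M. k y * g y)"
  have I0: "I \<ge> 0" unfolding I_def using k(2) g by (intro Bochner_Integration.integral_nonneg) auto
  have main: "I \<le> c powr (1 - q) / q * F + (1 - 1 / q) * c * m" if c: "c > 0" for c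
  proof -
    have "I \<le> (LINT y|M. (c powr (1 - q) / q) * (k y * g y powr q) + ((1 - 1 / q) * c) * k y)"
      unfolding I_def by (intro integral_mono ikg i le c)
    also have "\<dots> = c powr (1 - q) / q * F + (1 - 1 / q) * c * (LINT y|M. k y)"
      using k kg by (simp add: F_def)
    also have "\<dots> \<le> c powr (1 - q) / q * F + (1 - 1 / q) * c * m"
      using k(3) c q by (intro add_left_mono mult_left_mono) auto
    finally show ?thesis .
  qed
  have "I powr q \<le> m powr (q - 1) * F"
  proof (cases "F = 0")
    case True
    have "I \<le> 0"
    proof (rule field_le_epsilon)
      fix e :: real assume e: "e > 0"
      have "I \<le> (1 - 1 / q) * (e / m) * m" using main[of "e / m"] True e m by simp
      also have "\<dots> \<le> 1 * (e / m) * m" using q e m by (intro mult_right_mono) auto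
      finally show "I \<le> 0 + e" using m by simp
    qed
    then show ?thesis using I0 True q by simp
  next
    case False
    then have F: "F > 0" using F0 by simp
    \<comment> \<open>The tangent point that makes the tangent line bound optimal.\<close>
    define c where "c = (F / m) powr (1 / q)"
    have c: "c > 0" using F m by (simp add: c_def)
    have cq: "c powr q = F / m" using F m q by (simp add: c_def powr_powr)
    have "c powr (1 - q) * F = c * m" using c cq F m by (simp add: powr_diff)
    then have "I \<le> c * m / q + (1 - 1 / q) * c * m" using main[OF c] by simp
    also have "\<dots> = c * m" using q by (simp add: field_simps)
    finally have "I powr q \<le> (c * m) powr q" using I0 q by (intro powr_mono2) auto
    also have "\<dots> = m powr (q - 1) * F" using c m cq by (simp add: powr_mult powr_diff)
    finally show ?thesis .
  qed
  then show "(LINT y|M. k y * g y) powr q \<le> m powr (q - 1) * (LINT y|M. k y * g y powr q)"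
    by (simp add: I_def F_def)
qed

text \<open>
  The integrals in \<open>y\<close> control the operator on \<open>L\<^sup>\<infinity>\<close>, those in \<open>x\<close> the operator on \<open>L\<^sup>1\<close>.  The
  constant is positive so that it can be divided by in Jensen's inequality.
\<close>

definition schur_bounded ::
    "('a::euclidean_space \<Rightarrow> 'a \<Rightarrow> 'c::real_normed_vector) \<Rightarrow> real \<Rightarrow> bool"
  where "schur_bounded K m \<longleftrightarrow> m > 0 \<and>
    (\<lambda>xy. K (fst xy) (snd xy)) \<in> borel_measurable (borel \<Otimes>\<^sub>M borel) \<and>
    (\<forall>x. (\<integral>\<^sup>+y. ennreal (norm (K x y)) \<partial>lborel) \<le> ennreal m) \<and>
    (\<forall>y. (\<integral>\<^sup>+x. ennreal (norm (K x y)) \<partial>lborel) \<le> ennreal m)"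

lemma schur_pos: "schur_bounded K m \<Longrightarrow> m > 0"
  by (simp add: schur_bounded_def)

lemma schur_row: "schur_bounded K m \<Longrightarrow> (\<integral>\<^sup>+y. ennreal (norm (K x y)) \<partial>lborel) \<le> ennreal m"
  by (simp add: schur_bounded_def)

lemma schur_column: "schur_bounded K m \<Longrightarrow> (\<integral>\<^sup>+x. ennreal (norm (K x y)) \<partial>lborel) \<le> ennreal m"
  by (simp add: schur_bounded_def)

lemma schur_measurable:
  assumes "schur_bounded K m" "f \<in> borel_measurable N" "g \<in> borel_measurable N"
  shows "(\<lambda>w. K (f w) (g w)) \<in> borel_measurable N"
  using measurable_compose[OF measurable_Pair[OF assms(2,3)], of "\<lambda>xy. K (fst xy) (snd xy)" borel] assms(1)
  by (simp add: schur_bounded_def)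

lemma schur_measurable_row: "schur_bounded K m \<Longrightarrow> K x \<in> borel_measurable borel"
  by (rule schur_measurable[of K m "\<lambda>_. x" borel "\<lambda>y. y"]) auto

lemma schur_measurable_column: "schur_bounded K m \<Longrightarrow> (\<lambda>x. K x y) \<in> borel_measurable borel"
  by (rule schur_measurable[of K m "\<lambda>x. x" borel "\<lambda>_. y"]) auto

lemma schur_bounded_mono: "schur_bounded K m \<Longrightarrow> m \<le> m' \<Longrightarrow> schur_bounded K m'"
  unfolding schur_bounded_def by (auto intro: order_trans ennreal_leI)

lemma schur_integrable_row:
  fixes K :: "'a::euclidean_space \<Rightarrow> 'a \<Rightarrow> 'c::{banach, second_countable_topology}"
  assumes "schur_bounded K m"
  shows "integrable lborel (K x)" "(LINT y|lborel. norm (K x y)) \<le> m"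
proof -
  show i: "integrable lborel (K x)"
    using schur_row[OF assms, of x] schur_measurable_row[OF assms]
    by (intro integrableI_bounded) (auto simp: le_less_trans)
  show "(LINT y|lborel. norm (K x y)) \<le> m"
    using schur_row[OF assms, of x] schur_pos[OF assms] integrable_norm[OF i]
    by (subst integral_eq_nn_integral) (auto intro!: enn2real_leI)
qed

text \<open>Estimates need a proof for the rows only; the columns are the rows of the transposed kernel.\<close>

lemma schur_transpose:
  assumes "schur_bounded K m"
  shows "schur_bounded (\<lambda>x y. K y x) m"
  using assms schur_measurable[OF assms measurable_snd measurable_fst]
  unfolding schur_bounded_def by blast

lemma schur_scale:
  fixes K :: "'a::euclidean_space \<Rightarrow> 'a \<Rightarrow> 'c::{real_normed_field, banach, second_countable_topology}"
  assumes "schur_bounded K m" "norm c * m \<le> m'" "m' > 0"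
  shows "schur_bounded (\<lambda>x y. c * K x y) m'"
  unfolding schur_bounded_def
proof (intro conjI allI assms(3))
  have [measurable]: "(\<lambda>xy. K (fst xy) (snd xy)) \<in> borel_measurable (borel \<Otimes>\<^sub>M borel)"
    using assms(1) by (simp add: schur_bounded_def)
  show "(\<lambda>xy. c * K (fst xy) (snd xy)) \<in> borel_measurable (borel \<Otimes>\<^sub>M borel)" by measurable
  have [measurable]: "(\<lambda>y. K x y) \<in> borel_measurable borel" "(\<lambda>x. K x y) \<in> borel_measurable borel" for x y
    by (rule schur_measurable_row[OF assms(1)] schur_measurable_column[OF assms(1)])+
  have le: "ennreal (norm c) * ennreal m \<le> ennreal m'"
    using assms schur_pos[OF assms(1)] by (subst ennreal_mult[symmetric]) (auto intro: ennreal_leI)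
  show "(\<integral>\<^sup>+y. ennreal (norm (c * K x y)) \<partial>lborel) \<le> ennreal m'" for x
    using order_trans[OF mult_left_mono[OF schur_row[OF assms(1)]] le]
    by (simp add: norm_mult ennreal_mult nn_integral_cmult)
  show "(\<integral>\<^sup>+x. ennreal (norm (c * K x y)) \<partial>lborel) \<le> ennreal m'" for y
    using order_trans[OF mult_left_mono[OF schur_column[OF assms(1)]] le]
    by (simp add: norm_mult ennreal_mult nn_integral_cmult)
qed

lemma schur_add:
  fixes K L :: "'a::euclidean_space \<Rightarrow> 'a \<Rightarrow> 'c::{real_normed_field, banach, second_countable_topology}"
  assumes K: "schur_bounded K m" and L: "schur_bounded L n"
  shows "schur_bounded (\<lambda>x y. K x y + L x y) (m + n)"
proof -
  have row: "(\<integral>\<^sup>+y. ennreal (norm (K x y + L x y)) \<partial>lborel) \<le> ennreal (m + n)"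
    if K: "schur_bounded K m" and L: "schur_bounded L n" for K L :: "'a \<Rightarrow> 'a \<Rightarrow> 'c" and x
  proof -
    note [measurable (raw)] = schur_measurable[OF K] schur_measurable[OF L]
    have le: "ennreal (norm (K x y + L x y)) \<le> ennreal (norm (K x y)) + ennreal (norm (L x y))" for y
      using ennreal_leI[OF norm_triangle_ineq[of "K x y" "L x y"]] by simp
    have "(\<integral>\<^sup>+y. ennreal (norm (K x y + L x y)) \<partial>lborel) \<le> (\<integral>\<^sup>+y. ennreal (norm (K x y)) + ennreal (norm (L x y)) \<partial>lborel)"
      by (intro nn_integral_mono le)
    also have "\<dots> = (\<integral>\<^sup>+y. ennreal (norm (K x y)) \<partial>lborel) + (\<integral>\<^sup>+y. ennreal (norm (L x y)) \<partial>lborel)"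
      by (rule nn_integral_add) measurable
    also have "\<dots> \<le> ennreal m + ennreal n" by (intro add_mono schur_row[OF K] schur_row[OF L])
    finally show ?thesis using schur_pos[OF K] schur_pos[OF L] by simp
  qed
  note [measurable (raw)] = schur_measurable[OF K] schur_measurable[OF L]
  have "(\<lambda>xy. K (fst xy) (snd xy) + L (fst xy) (snd xy)) \<in> borel_measurable (borel \<Otimes>\<^sub>M borel)" by measurable
  then show ?thesis
    using row[OF K L] row[OF schur_transpose[OF K] schur_transpose[OF L]] schur_pos[OF K] schur_pos[OF L]
    by (simp add: schur_bounded_def)
qed

lemma schur_of_real:
  fixes K :: "'a::euclidean_space \<Rightarrow> 'a \<Rightarrow> real"
  assumes "schur_bounded K m"
  shows "schur_bounded (\<lambda>x y. complex_of_real (K x y)) m"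
proof -
  have [measurable]: "(\<lambda>xy. K (fst xy) (snd xy)) \<in> borel_measurable (borel \<Otimes>\<^sub>M borel)"
    using assms by (simp add: schur_bounded_def)
  have "(\<lambda>xy. complex_of_real (K (fst xy) (snd xy))) \<in> borel_measurable (borel \<Otimes>\<^sub>M borel)" by measurable
  then show ?thesis using assms by (simp add: schur_bounded_def)
qed

lemma schur_compose_bound:
  fixes K L :: "'a::euclidean_space \<Rightarrow> 'a \<Rightarrow> 'c::{banach, second_countable_topology, real_normed_field}"
  assumes K: "schur_bounded K m" and L: "schur_bounded L n"
  shows "schur_bounded (\<lambda>x y. LINT w|lborel. K x w * L w y) (m * n)"
proof -
  have row: "(\<integral>\<^sup>+y. ennreal (norm (LINT w|lborel. K x w * L w y)) \<partial>lborel) \<le> ennreal (m * n)"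
    if K: "schur_bounded K m" and L: "schur_bounded L n" for K L :: "'a \<Rightarrow> 'a \<Rightarrow> 'c" and x m n
  proof -
    note [measurable (raw)] = schur_measurable[OF K] schur_measurable[OF L]
    have le: "ennreal (norm (LINT w|lborel. K x w * L w y)) \<le> (\<integral>\<^sup>+w. ennreal (norm (K x w)) * ennreal (norm (L w y)) \<partial>lborel)" for y
    proof (cases "integrable lborel (\<lambda>w. K x w * L w y)")
      case True
      have "ennreal (norm (LINT w|lborel. K x w * L w y)) \<le> ennreal (LINT w|lborel. norm (K x w * L w y))"
        by (intro ennreal_leI integral_norm_bound)
      also have "\<dots> = (\<integral>\<^sup>+w. ennreal (norm (K x w * L w y)) \<partial>lborel)"
        using True by (intro nn_integral_eq_integral[symmetric]) auto
      finally show ?thesis by (simp add: norm_mult ennreal_mult)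
    qed (simp add: not_integrable_integral_eq)
    have "(\<integral>\<^sup>+y. ennreal (norm (LINT w|lborel. K x w * L w y)) \<partial>lborel) \<le>
        (\<integral>\<^sup>+y. \<integral>\<^sup>+w. ennreal (norm (K x w)) * ennreal (norm (L w y)) \<partial>lborel \<partial>lborel)"
      by (intro nn_integral_mono le)
    also have "\<dots> = (\<integral>\<^sup>+w. \<integral>\<^sup>+y. ennreal (norm (K x w)) * ennreal (norm (L w y)) \<partial>lborel \<partial>lborel)"
    proof (rule lborel_pair.Fubini')
      have "(\<lambda>wy. ennreal (norm (K x (fst wy))) * ennreal (norm (L (fst wy) (snd wy)))) \<in> borel_measurable (lborel \<Otimes>\<^sub>M lborel)"
        by measurable
      then show "(\<lambda>(w, y). ennreal (norm (K x w)) * ennreal (norm (L w y))) \<in> borel_measurable (lborel \<Otimes>\<^sub>M lborel)"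
        by (simp add: split_beta')
    qed
    also have "\<dots> = (\<integral>\<^sup>+w. ennreal (norm (K x w)) * (\<integral>\<^sup>+y. ennreal (norm (L w y)) \<partial>lborel) \<partial>lborel)"
      using schur_measurable_row[OF L] by (simp add: nn_integral_cmult)
    also have "\<dots> \<le> (\<integral>\<^sup>+w. ennreal (norm (K x w)) * ennreal n \<partial>lborel)"
      by (intro nn_integral_mono mult_left_mono schur_row[OF L]) auto
    also have "\<dots> = (\<integral>\<^sup>+w. ennreal (norm (K x w)) \<partial>lborel) * ennreal n"
      using schur_measurable_row[OF K] by (simp add: nn_integral_multc)
    also have "\<dots> \<le> ennreal m * ennreal n" by (intro mult_right_mono schur_row[OF K]) auto
    finally show ?thesis using schur_pos[OF K] schur_pos[OF L] by (simp add: ennreal_mult)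
  qed
  note [measurable (raw)] = schur_measurable[OF K] schur_measurable[OF L]
  have "(\<lambda>zw. K (fst (fst zw)) (snd zw) * L (snd zw) (snd (fst zw))) \<in> borel_measurable ((borel \<Otimes>\<^sub>M borel) \<Otimes>\<^sub>M lborel)"
    by measurable
  then have "(\<lambda>(xy, w). K (fst xy) w * L w (snd xy)) \<in> borel_measurable ((borel \<Otimes>\<^sub>M borel) \<Otimes>\<^sub>M lborel)"
    by (simp add: split_beta')
  then have "(\<lambda>xy. LINT w|lborel. K (fst xy) w * L w (snd xy)) \<in> borel_measurable (borel \<Otimes>\<^sub>M borel)"
    by (rule lborel.borel_measurable_lebesgue_integral)
  then show ?thesis
    using row[OF K L] row[OF schur_transpose[OF L] schur_transpose[OF K]] schur_pos[OF K] schur_pos[OF L]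
    by (simp add: schur_bounded_def mult.commute)
qed

lemma schur_series:
  fixes K :: "'a::euclidean_space \<Rightarrow> 'a \<Rightarrow> complex"
  assumes Kn: "\<And>n. schur_bounded (Kn n) (m n)" and c: "summable (\<lambda>n. norm (c n) * m n)"
    and abs: "\<And>x y. summable (\<lambda>n. norm (c n * Kn n x y))"
    and sums: "\<And>x y. (\<lambda>n. c n * Kn n x y) sums K x y"
    and M: "(\<Sum>n. norm (c n) * m n) \<le> M" "M > 0"
  shows "schur_bounded K M"
proof -
  have row: "(\<integral>\<^sup>+y. ennreal (norm (K x y)) \<partial>lborel) \<le> ennreal M"
    if Kn: "\<And>n. schur_bounded (Kn n) (m n)" and abs: "\<And>x y. summable (\<lambda>n. norm (c n * Kn n x y))"
      and sums: "\<And>x y. (\<lambda>n. c n * Kn n x y) sums K x y" for Kn and K :: "'a \<Rightarrow> 'a \<Rightarrow> complex" and x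
  proof -
    have le: "ennreal (norm (K x y)) \<le> (\<Sum>n. ennreal (norm (c n * Kn n x y)))" for y
    proof -
      have "norm (K x y) \<le> (\<Sum>n. norm (c n * Kn n x y))"
        using summable_norm[OF abs[of x y]] sums_unique[OF sums[of x y]] by simp
      then show ?thesis using abs by (subst suminf_ennreal2) (auto intro: ennreal_leI)
    qed
    have m0: "0 \<le> norm (c n) * m n" for n using schur_pos[OF Kn, of n] by simp
    have mK: "(\<lambda>y. Kn n x y) \<in> borel_measurable borel" for n by (rule schur_measurable_row[OF Kn])
    have "(\<integral>\<^sup>+y. ennreal (norm (K x y)) \<partial>lborel) \<le> (\<integral>\<^sup>+y. (\<Sum>n. ennreal (norm (c n * Kn n x y))) \<partial>lborel)"
      by (intro nn_integral_mono le)
    also have "\<dots> = (\<Sum>n. (\<integral>\<^sup>+y. ennreal (norm (c n * Kn n x y)) \<partial>lborel))"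
      using mK by (intro nn_integral_suminf) auto
    also have "\<dots> = (\<Sum>n. ennreal (norm (c n)) * (\<integral>\<^sup>+y. ennreal (norm (Kn n x y)) \<partial>lborel))"
      using mK by (simp add: norm_mult ennreal_mult nn_integral_cmult)
    also have "\<dots> \<le> (\<Sum>n. ennreal (norm (c n) * m n))"
    proof (intro suminf_le summableI)
      fix n
      have "ennreal (norm (c n)) * (\<integral>\<^sup>+y. ennreal (norm (Kn n x y)) \<partial>lborel) \<le> ennreal (norm (c n)) * ennreal (m n)"
        by (intro mult_left_mono schur_row[OF Kn]) auto
      then show "ennreal (norm (c n)) * (\<integral>\<^sup>+y. ennreal (norm (Kn n x y)) \<partial>lborel) \<le> ennreal (norm (c n) * m n)"
        using schur_pos[OF Kn, of n] by (simp add: ennreal_mult)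
    qed
    also have "\<dots> \<le> ennreal M" using M c m0 by (subst suminf_ennreal2) (auto intro: ennreal_leI)
    finally show ?thesis .
  qed
  have "(\<lambda>xy. K (fst xy) (snd xy)) \<in> borel_measurable (borel \<Otimes>\<^sub>M borel)"
  proof (rule borel_measurable_LIMSEQ_metric)
    show "(\<lambda>xy. \<Sum>i<n. c i * Kn i (fst xy) (snd xy)) \<in> borel_measurable (borel \<Otimes>\<^sub>M borel)" for n
      by (intro borel_measurable_sum borel_measurable_times borel_measurable_const schur_measurable[OF Kn]) auto
    show "(\<lambda>n. \<Sum>i<n. c i * Kn i (fst xy) (snd xy)) \<longlonglongrightarrow> K (fst xy) (snd xy)" for xy
      using sums[of "fst xy" "snd xy"] by (simp add: sums_def)
  qed
  then show ?thesis
    using row[OF Kn abs sums] row[where Kn="\<lambda>n x y. Kn n y x" and K="\<lambda>x y. K y x", OF schur_transpose[OF Kn] abs sums] M(2)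
    by (simp add: schur_bounded_def)
qed

definition kernel_op ::
    "('a::euclidean_space \<Rightarrow> 'a \<Rightarrow> complex) \<Rightarrow> ('a \<Rightarrow> complex) \<Rightarrow> 'a \<Rightarrow> complex"
  where "kernel_op K f x = (LINT y|lborel. K x y * f y)"

text \<open>
  The Schur test: Jensen's inequality for the rows, then Fubini and the bound for the columns.
\<close>

lemma schur_test:
  fixes K :: "'a::euclidean_space \<Rightarrow> 'a \<Rightarrow> complex"
  assumes K: "schur_bounded K m" and q: "q \<ge> 1" and f: "f \<in> Lq_space q"
  shows "AE x in lborel. integrable lborel (\<lambda>y. norm (K x y) * norm (f y))" (is ?A)
    and "kernel_op K f \<in> Lq_space q" (is ?B)
    and "Lq_norm q (kernel_op K f) \<le> m * Lq_norm q f" (is ?C)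
proof -
  note [measurable (raw)] = schur_measurable[OF K]
  have m: "m > 0" by (rule schur_pos[OF K])
  have fm [measurable]: "f \<in> borel_measurable borel" and fi: "integrable lborel (\<lambda>x. norm (f x) powr q)"
    using f by (auto simp: Lq_space_def)
  define N where "N = (LINT x|lborel. norm (f x) powr q)"
  have N0: "N \<ge> 0" by (simp add: N_def)
  have mK: "(\<lambda>y. K x y) \<in> borel_measurable borel" "(\<lambda>x. K x y) \<in> borel_measurable borel" for x y
    by (rule schur_measurable_row[OF K] schur_measurable_column[OF K])+
  define F where "F x = (\<integral>\<^sup>+y. ennreal (norm (K x y)) * ennreal (norm (f y) powr q) \<partial>lborel)" for x
  have mp: "(\<lambda>xy. ennreal (norm (K (fst xy) (snd xy))) * ennreal (norm (f (snd xy)) powr q)) \<in> borel_measurable (lborel \<Otimes>\<^sub>M lborel)"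
    by measurable
  then have Fm [measurable]: "F \<in> borel_measurable lborel"
    unfolding F_def by (intro lborel.borel_measurable_nn_integral) (simp add: split_beta')
  have intF: "(\<integral>\<^sup>+x. F x \<partial>lborel) \<le> ennreal (m * N)"
  proof -
    have "(\<integral>\<^sup>+x. F x \<partial>lborel) = (\<integral>\<^sup>+y. \<integral>\<^sup>+x. ennreal (norm (K x y)) * ennreal (norm (f y) powr q) \<partial>lborel \<partial>lborel)"
      unfolding F_def using mp by (intro lborel_pair.Fubini'[symmetric]) (simp add: split_beta')
    also have "\<dots> = (\<integral>\<^sup>+y. (\<integral>\<^sup>+x. ennreal (norm (K x y)) \<partial>lborel) * ennreal (norm (f y) powr q) \<partial>lborel)"
      using mK by (simp add: nn_integral_multc)
    also have "\<dots> \<le> (\<integral>\<^sup>+y. ennreal m * ennreal (norm (f y) powr q) \<partial>lborel)"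
      by (intro nn_integral_mono mult_right_mono schur_column[OF K]) auto
    also have "\<dots> = ennreal m * (\<integral>\<^sup>+y. ennreal (norm (f y) powr q) \<partial>lborel)"
      by (intro nn_integral_cmult) measurable
    also have "(\<integral>\<^sup>+y. ennreal (norm (f y) powr q) \<partial>lborel) = ennreal N"
      unfolding N_def by (intro nn_integral_eq_integral fi) auto
    finally show ?thesis using m N0 by (simp add: ennreal_mult)
  qed
  then have "(\<integral>\<^sup>+x. F x \<partial>lborel) \<noteq> \<infinity>" by (auto simp: top_unique)
  then have ae: "AE x in lborel. F x \<noteq> \<infinity>" by (intro nn_integral_PInf_AE) auto
  have jensen: "integrable lborel (\<lambda>y. norm (K x y) * norm (f y)) \<and>
      ennreal (norm (kernel_op K f x) powr q) \<le> ennreal (m powr (q - 1)) * F x" if Fx: "F x \<noteq> \<infinity>" for x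
  proof -
    have kg: "integrable lborel (\<lambda>y. norm (K x y) * norm (f y) powr q)"
    proof (rule integrableI_bounded)
      show "(\<lambda>y. norm (K x y) * norm (f y) powr q) \<in> borel_measurable lborel" using mK(1)[of x] by measurable
      show "(\<integral>\<^sup>+y. ennreal (norm (norm (K x y) * norm (f y) powr q)) \<partial>lborel) < \<infinity>"
        using Fx by (simp add: F_def ennreal_mult less_top)
    qed
    note J = weighted_jensen_powr[of "\<lambda>y. norm (K x y)" lborel "\<lambda>y. norm (f y)" m q]
    have i: "integrable lborel (\<lambda>y. norm (K x y) * norm (f y))"
      using schur_integrable_row[OF K, of x] mK(1)[of x] kg m q by (intro J) auto
    have le: "(LINT y|lborel. norm (K x y) * norm (f y)) powr q \<le> m powr (q - 1) * (LINT y|lborel. norm (K x y) * norm (f y) powr q)"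
      using schur_integrable_row[OF K, of x] mK(1)[of x] kg m q by (intro J) auto
    have "norm (kernel_op K f x) \<le> (LINT y|lborel. norm (K x y) * norm (f y))"
      unfolding kernel_op_def using integral_norm_bound[of lborel "\<lambda>y. K x y * f y"] by (simp add: norm_mult)
    then have "norm (kernel_op K f x) powr q \<le> (LINT y|lborel. norm (K x y) * norm (f y)) powr q"
      using q by (intro powr_mono2) auto
    also note le
    finally have "ennreal (norm (kernel_op K f x) powr q) \<le> ennreal (m powr (q - 1) * (LINT y|lborel. norm (K x y) * norm (f y) powr q))"
      by (rule ennreal_leI)
    also have "\<dots> = ennreal (m powr (q - 1)) * ennreal (LINT y|lborel. norm (K x y) * norm (f y) powr q)"
      by (intro ennreal_mult) auto
    also have "ennreal (LINT y|lborel. norm (K x y) * norm (f y) powr q) = F x"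
      unfolding F_def using kg by (subst nn_integral_eq_integral[symmetric]) (auto simp: ennreal_mult)
    finally show ?thesis using i by simp
  qed
  show ?A using ae by eventually_elim (use jensen in blast)
  have opm: "kernel_op K f \<in> borel_measurable lborel"
  proof -
    have "(\<lambda>xy. K (fst xy) (snd xy) * f (snd xy)) \<in> borel_measurable (lborel \<Otimes>\<^sub>M lborel)"
      by measurable
    then show ?thesis unfolding kernel_op_def[abs_def]
      by (intro lborel.borel_measurable_lebesgue_integral) (simp add: split_beta')
  qed
  have opm' [measurable]: "kernel_op K f \<in> borel_measurable borel" using opm by simp
  have tot: "(\<integral>\<^sup>+x. ennreal (norm (kernel_op K f x) powr q) \<partial>lborel) \<le> ennreal (m powr q * N)"
  proof -
    have "(\<integral>\<^sup>+x. ennreal (norm (kernel_op K f x) powr q) \<partial>lborel) \<le> (\<integral>\<^sup>+x. ennreal (m powr (q - 1)) * F x \<partial>lborel)"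
    proof (rule nn_integral_mono_AE)
      show "AE x in lborel. ennreal (norm (kernel_op K f x) powr q) \<le> ennreal (m powr (q - 1)) * F x"
        using ae by eventually_elim (use jensen in blast)
    qed
    also have "\<dots> = ennreal (m powr (q - 1)) * (\<integral>\<^sup>+x. F x \<partial>lborel)" by (intro nn_integral_cmult) measurable
    also have "\<dots> \<le> ennreal (m powr (q - 1)) * ennreal (m * N)" by (intro mult_left_mono intF) auto
    also have "\<dots> = ennreal (m powr q * N)"
      using m N0 by (subst ennreal_mult[symmetric]) (auto simp: powr_diff)
    finally show ?thesis .
  qed
  have i: "integrable lborel (\<lambda>x. norm (kernel_op K f x) powr q)"
    using tot by (intro integrableI_bounded) (measurable, auto simp: le_less_trans)
  then show ?B by (simp add: Lq_space_def)
  have "(LINT x|lborel. norm (kernel_op K f x) powr q) \<le> m powr q * N"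
    using tot i m N0 by (subst integral_eq_nn_integral) (auto intro!: enn2real_leI)
  then have "Lq_norm q (kernel_op K f) \<le> (m powr q * N) powr (1 / q)"
    unfolding Lq_norm_def using q by (intro powr_mono2) auto
  also have "\<dots> = m * N powr (1 / q)" using m N0 q by (simp add: powr_mult powr_powr)
  finally show ?C by (simp add: Lq_norm_def N_def)
qed

lemma kernel_op_integrable:
  fixes K :: "'a::euclidean_space \<Rightarrow> 'a \<Rightarrow> complex"
  assumes K: "schur_bounded K m" and q: "q \<ge> 1" and f: "f \<in> Lq_space q"
  shows "AE x in lborel. integrable lborel (\<lambda>y. K x y * f y)"
  using schur_test(1)[OF assms]
proof eventually_elim
  case (elim x)
  have "(\<lambda>y. K x y * f y) \<in> borel_measurable lborel"
    using f schur_measurable_row[OF K, of x] by (auto simp: Lq_space_def)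
  then show ?case using elim by (simp add: integrable_norm_iff[symmetric] norm_mult)
qed

lemma kernel_op_bounded_linear:
  assumes K: "schur_bounded K m" and q: "q \<ge> 1"
  shows "Lq_bounded_linear q (kernel_op K)"
  unfolding Lq_bounded_linear_def
proof (intro conjI ballI allI)
  fix f g :: "'a \<Rightarrow> complex" assume f: "f \<in> Lq_space q" and g: "g \<in> Lq_space q"
  show "AE x in lborel. kernel_op K (\<lambda>y. f y + g y) x = kernel_op K f x + kernel_op K g x"
    using kernel_op_integrable[OF K q f] kernel_op_integrable[OF K q g]
    by eventually_elim (simp add: kernel_op_def distrib_left)
next
  fix c and f :: "'a \<Rightarrow> complex" assume f: "f \<in> Lq_space q"
  have "kernel_op K (\<lambda>y. c * f y) x = c * kernel_op K f x" for x
    by (simp add: kernel_op_def mult.left_commute[of _ c])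
  then show "AE x in lborel. kernel_op K (\<lambda>y. c * f y) x = c * kernel_op K f x" by simp
next
  show "\<exists>C. \<forall>f\<in>Lq_space q. Lq_norm q (kernel_op K f) \<le> C * Lq_norm q f"
    using schur_test(3)[OF K q] by blast
qed (rule schur_test(2)[OF K q])

text \<open>
  Fubini in the order \<open>K(x,w) L(w,y) f(y)\<close>; absolute integrability at almost every \<open>x\<close> is the
  Schur test for \<open>|K|\<close> and \<open>|L|\<close> applied to \<open>|f|\<close>.
\<close>

lemma kernel_op_compose:
  fixes K L R :: "'a::euclidean_space \<Rightarrow> 'a \<Rightarrow> complex"
  assumes K: "schur_bounded K m" and L: "schur_bounded L n" and q: "q \<ge> 1" and f: "f \<in> Lq_space q"
    and R: "\<And>x y. (LINT w|lborel. K x w * L w y) = R x y"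
  shows "AE x in lborel. kernel_op R f x = kernel_op K (kernel_op L f) x"
proof -
  note [measurable (raw)] = schur_measurable[OF K] schur_measurable[OF L]
  define f' where "f' y = complex_of_real (norm (f y))" for y
  have fm [measurable]: "f \<in> borel_measurable borel" using f by (simp add: Lq_space_def)
  have [measurable]: "f' \<in> borel_measurable borel" unfolding f'_def by measurable
  have f': "f' \<in> Lq_space q" using f by (simp add: Lq_space_def) (simp add: f'_def)
  define Ln where "Ln x y = complex_of_real (norm (L x y))" for x y
  have Ln: "schur_bounded Ln n"
  proof -
    have [measurable]: "(\<lambda>xy. L (fst xy) (snd xy)) \<in> borel_measurable (borel \<Otimes>\<^sub>M borel)"
      using L by (simp add: schur_bounded_def)
    have "(\<lambda>xy. complex_of_real (norm (L (fst xy) (snd xy)))) \<in> borel_measurable (borel \<Otimes>\<^sub>M borel)" by measurable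
    then show ?thesis using L by (simp add: schur_bounded_def Ln_def)
  qed
  note g = schur_test(2)[OF Ln q f']
  have normg: "norm (kernel_op Ln f' w) = (LINT y|lborel. norm (L w y * f y))" for w
  proof -
    have "kernel_op Ln f' w = complex_of_real (LINT y|lborel. norm (L w y * f y))"
      unfolding kernel_op_def Ln_def f'_def by (simp add: norm_mult flip: of_real_mult)
    then show ?thesis by simp
  qed
  have aeL: "AE w in lborel. integrable lborel (\<lambda>y. L w y * f y)" by (rule kernel_op_integrable[OF L q f])
  show ?thesis using schur_test(1)[OF K q g]
  proof eventually_elim
    case (elim x)
    have meas: "(\<lambda>wy. K x (fst wy) * L (fst wy) (snd wy) * f (snd wy)) \<in> borel_measurable (lborel \<Otimes>\<^sub>M lborel)"
      by measurable
    have int: "integrable (lborel \<Otimes>\<^sub>M lborel) (\<lambda>(w, y). K x w * L w y * f y)"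
    proof (rule lborel_pair.Fubini_integrable)
      show "(\<lambda>(w, y). K x w * L w y * f y) \<in> borel_measurable (lborel \<Otimes>\<^sub>M lborel)"
        using meas by (simp add: split_beta')
      show "AE w in lborel. integrable lborel (\<lambda>y. case (w, y) of (w, y) \<Rightarrow> K x w * L w y * f y)"
        using aeL by eventually_elim (simp add: mult.assoc)
      have "(LINT y|lborel. norm (K x w * L w y * f y)) = norm (K x w) * norm (kernel_op Ln f' w)" for w
        by (simp add: normg norm_mult mult.assoc)
      then show "integrable lborel (\<lambda>w. LINT y|lborel. norm (case (w, y) of (w, y) \<Rightarrow> K x w * L w y * f y))"
        using elim by simp
    qed
    have "kernel_op K (kernel_op L f) x = (LINT w|lborel. LINT y|lborel. K x w * L w y * f y)"
      unfolding kernel_op_def by (simp add: mult.assoc)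
    also have "\<dots> = (LINT y|lborel. LINT w|lborel. K x w * L w y * f y)"
      by (rule lborel_pair.Fubini_integral[OF int, symmetric])
    also have "\<dots> = kernel_op R f x" unfolding kernel_op_def by (simp add: R)
    finally show ?case ..
  qed
qed

section \<open>Holomorphic extension of smooth functions with Cauchy bounds\<close>

text \<open>
  If the derivatives satisfy \<open>|g\<^sub>n(t)| \<le> A n! (\<Lambda>/t)\<^sup>n\<close>, the Taylor series of \<open>g\<close> at \<open>t\<close> converges to a
  holomorphic function on a disc of radius proportional to \<open>t\<close>, which agrees with \<open>g\<close> on
  the real axis.  Expanding it again at the real part of a point \<open>z\<close> of the disc gives
  the Taylor series of \<open>g\<close> at \<open>Re z\<close>, so the extension does not depend on the centre.
\<close>

text \<open>
  The family lists a function together with its derivatives; the bounds are required away from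
  \<open>t = 0\<close>, since the kernel itself is unbounded there.
\<close>

definition cauchy_bounds :: "(nat \<Rightarrow> real \<Rightarrow> real) \<Rightarrow> real \<Rightarrow> bool"
  where "cauchy_bounds g \<Lambda> \<longleftrightarrow> \<Lambda> \<ge> 1 \<and>
    (\<forall>n. \<forall>t>0. (g n has_real_derivative g (Suc n) t) (at t)) \<and>
    (\<forall>t0>0. \<exists>A. \<forall>n. \<forall>t\<ge>t0. \<bar>g n t\<bar> \<le> A * fact n * (\<Lambda> / t) ^ n)"

definition taylor_extension :: "(nat \<Rightarrow> real \<Rightarrow> real) \<Rightarrow> complex \<Rightarrow> complex"
  where "taylor_extension g z = (\<Sum>n. of_real (g n (Re z) / fact n) * (\<i> * of_real (Im z)) ^ n)"

lemma cauchy_bounds_summable: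
  fixes z :: complex
  assumes g: "cauchy_bounds g \<Lambda>" and t: "t > 0" and z: "\<Lambda> * norm (z - of_real t) \<le> t / 2"
  shows "summable (\<lambda>n. norm (of_real (g n t / fact n) * (z - of_real t) ^ n))"
proof -
  obtain A where A: "\<And>n s. t \<le> s \<Longrightarrow> \<bar>g n s\<bar> \<le> A * fact n * (\<Lambda> / s) ^ n"
    using g t unfolding cauchy_bounds_def by blast
  have L: "\<Lambda> \<ge> 1" using g by (simp add: cauchy_bounds_def)
  have A0: "A \<ge> 0" using order_trans[OF abs_ge_zero A[of t 0]] by simp
  show ?thesis
  proof (rule summable_comparison_test')
    show "summable (\<lambda>n. A * (1/2) ^ n)" by (intro summable_mult summable_geometric) simp
    fix n
    have le: "\<Lambda> / t * norm (z - of_real t) \<le> 1 / 2" using z t by (simp add: field_simps)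
    have "norm (of_real (g n t / fact n) * (z - of_real t) ^ n) = \<bar>g n t\<bar> / fact n * norm (z - of_real t) ^ n"
      by (simp add: norm_mult norm_power norm_divide)
    also have "\<dots> \<le> (A * fact n * (\<Lambda> / t) ^ n) / fact n * norm (z - of_real t) ^ n"
      by (intro mult_right_mono divide_right_mono A) auto
    also have "\<dots> = A * (\<Lambda> / t * norm (z - of_real t)) ^ n" by (simp add: power_mult_distrib[symmetric])
    also have "\<dots> \<le> A * (1/2) ^ n"
      using le A0 L t by (intro mult_left_mono power_mono) auto
    finally show "norm (norm (of_real (g n t / fact n) * (z - of_real t) ^ n)) \<le> A * (1/2) ^ n" by simp
  qed
qed

text \<open>
  The Lagrange remainder of order \<open>n\<close> is at most \<open>A / 2\<^sup>n\<close> by the Cauchy bounds.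
\<close>

lemma taylor_real:
  assumes g: "cauchy_bounds g \<Lambda>" and t: "t > 0" and s: "\<bar>s - t\<bar> < t / (4 * \<Lambda>)"
  shows "(\<lambda>n. g n t / fact n * (s - t) ^ n) sums g 0 s"
proof (cases "s = t")
  case True
  have "(\<lambda>n. g n t / fact n * (s - t) ^ n) = (\<lambda>n. if n = 0 then g 0 s else 0)" using True by auto
  then show ?thesis using sums_single[of 0 "\<lambda>_. g 0 s"] by simp
next
  case False
  have L: "\<Lambda> \<ge> 1" and der: "\<And>n t. t > 0 \<Longrightarrow> (g n has_real_derivative g (Suc n) t) (at t)"
    using g by (auto simp: cauchy_bounds_def)
  define r where "r = t / (4 * \<Lambda>)"
  have r: "r > 0" "r \<le> t / 4" "\<Lambda> * r = t / 4" using L t by (auto simp: r_def field_simps)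
  obtain A where A: "\<And>n s. t/2 \<le> s \<Longrightarrow> \<bar>g n s\<bar> \<le> A * fact n * (\<Lambda> / s) ^ n"
    using g t unfolding cauchy_bounds_def by (metis half_gt_zero)
  have A0: "A \<ge> 0" using order_trans[OF abs_ge_zero A[of t 0]] t by simp
  have rem: "\<bar>g 0 s - (\<Sum>m<n. g m t / fact m * (s - t) ^ m)\<bar> \<le> A * (1/2) ^ n" for n
  proof (cases "n = 0")
    case True
    then show ?thesis using A[of s 0] s r by (simp add: r_def[symmetric] abs_if split: if_splits)
  next
    case n: False
    have "\<exists>u. (if s < t then s < u \<and> u < t else t < u \<and> u < s) \<and>
      g 0 s = (\<Sum>m<n. (g m t / fact m) * (s - t) ^ m) + (g n u / fact n) * (s - t) ^ n"
    proof (rule Taylor[where a="t - r" and b="t + r"])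
      show "\<forall>m u. m < n \<and> t - r \<le> u \<and> u \<le> t + r \<longrightarrow> (g m has_real_derivative g (Suc m) u) (at u)"
      proof (intro allI impI der)
        fix m u assume "m < n \<and> t - r \<le> u \<and> u \<le> t + r"
        then show "u > 0" using r(2) t by linarith
      qed
    qed (use n False s r in \<open>auto simp: r_def[symmetric] abs_if split: if_splits\<close>)
    then obtain u where u0: "if s < t then s < u \<and> u < t else t < u \<and> u < s"
      and eq: "g 0 s = (\<Sum>m<n. (g m t / fact m) * (s - t) ^ m) + (g n u / fact n) * (s - t) ^ n" by blast
    have u: "\<bar>u - t\<bar> < r" using s u0 by (auto simp: r_def[symmetric] abs_if split: if_splits)
    have u2: "u \<ge> t / 2" "u > 0" using u r t by (auto simp: abs_if split: if_splits)
    have q: "\<Lambda> / u * \<bar>s - t\<bar> \<le> 1 / 2"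
    proof -
      have "\<Lambda> * \<bar>s - t\<bar> \<le> \<Lambda> * r" using s L by (intro mult_left_mono) (auto simp: r_def)
      also have "\<dots> \<le> u / 2" using r u2 by simp
      finally show ?thesis using u2 by (simp add: field_simps)
    qed
    have "\<bar>g 0 s - (\<Sum>m<n. g m t / fact m * (s - t) ^ m)\<bar> = \<bar>g n u\<bar> / fact n * \<bar>s - t\<bar> ^ n"
      using eq by (simp add: abs_mult power_abs)
    also have "\<dots> \<le> (A * fact n * (\<Lambda> / u) ^ n) / fact n * \<bar>s - t\<bar> ^ n"
      using u2 by (intro mult_right_mono divide_right_mono A) auto
    also have "\<dots> = A * (\<Lambda> / u * \<bar>s - t\<bar>) ^ n" by (simp add: power_mult_distrib[symmetric])
    also have "\<dots> \<le> A * (1/2) ^ n" using q A0 L u2 by (intro mult_left_mono power_mono) auto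
    finally show ?thesis .
  qed
  have "(\<lambda>n. (\<Sum>m<n. g m t / fact m * (s - t) ^ m) - g 0 s) \<longlonglongrightarrow> 0"
  proof (rule Lim_null_comparison)
    have "(\<lambda>n. A * (1/2::real) ^ n) \<longlonglongrightarrow> A * 0" by (intro tendsto_intros LIMSEQ_realpow_zero) auto
    then show "(\<lambda>n. A * (1/2::real) ^ n) \<longlonglongrightarrow> 0" by simp
    show "eventually (\<lambda>n. norm ((\<Sum>m<n. g m t / fact m * (s - t) ^ m) - g 0 s) \<le> A * (1/2) ^ n) sequentially"
      using rem by (intro always_eventually allI) (simp add: abs_minus_commute)
  qed
  then show ?thesis by (simp add: sums_def LIM_zero_iff)
qed

lemma taylor_recentre:
  assumes g: "cauchy_bounds g \<Lambda>" and t: "t > 0" and z: "norm (z - of_real t) < t / (8 * \<Lambda>)"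
  shows "(\<lambda>n. of_real (g n t / fact n) * (z - of_real t) ^ n) sums taylor_extension g z"
proof -
  have L: "\<Lambda> \<ge> 1" and der: "\<And>n t. t > 0 \<Longrightarrow> (g n has_real_derivative g (Suc n) t) (at t)"
    using g by (auto simp: cauchy_bounds_def)
  define r where "r = t / (4 * \<Lambda>)"
  have r: "r > 0" "r \<le> t / 4" "\<Lambda> * r = t / 4" using L t by (auto simp: r_def field_simps)
  define F where "F w = (\<Sum>n. of_real (g n t / fact n) * (w - of_real t) ^ n)" for w :: complex
  have F: "(\<lambda>n. of_real (g n t / fact n) * (w - of_real t) ^ n) sums F w" if w: "w \<in> ball (of_real t) r" for w
  proof -
    have "\<Lambda> * norm (w - of_real t) \<le> \<Lambda> * r"
      using w L by (intro mult_left_mono) (auto simp: dist_norm norm_minus_commute)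
    then have "\<Lambda> * norm (w - of_real t) \<le> t / 2" using r t by simp
    from summable_norm_cancel[OF cauchy_bounds_summable[OF g t this]]
    show ?thesis unfolding F_def by (rule summable_sums)
  qed
  have hol: "F holomorphic_on ball (of_real t) r" by (rule power_series_holomorphic[OF F])
  \<comment> \<open>The sum of the series at \<open>t\<close> has the prescribed derivatives on the real axis, not only at \<open>t\<close>.\<close>
  have Fn: "(deriv ^^ n) F (of_real s) = of_real (g n s)" if "\<bar>s - t\<bar> < r" for n s
    using that
  proof (induction n arbitrary: s)
    case 0
    have "complex_of_real s \<in> ball (of_real t) r"
      using 0 by (simp add: dist_norm norm_minus_commute flip: of_real_diff)
    moreover have "(\<lambda>n. complex_of_real (g n t / fact n * (s - t) ^ n)) sums of_real (g 0 s)"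
      using taylor_real[OF g t, of s] 0 by (intro sums_of_real) (simp add: r_def)
    ultimately show ?case using F[of "of_real s"] sums_unique2 by fastforce
  next
    case (Suc n)
    have s: "complex_of_real s \<in> ball (of_real t) r"
      using Suc.prems by (simp add: dist_norm norm_minus_commute flip: of_real_diff)
    have "((deriv ^^ n) F has_field_derivative deriv ((deriv ^^ n) F) (of_real s)) (at (of_real s))"
      by (rule holomorphic_derivI[OF holomorphic_higher_deriv[OF hol open_ball] open_ball s])
    then have "((\<lambda>u. (deriv ^^ n) F (of_real u)) has_vector_derivative deriv ((deriv ^^ n) F) (of_real s)) (at s)"
      by (rule has_vector_derivative_real_field)
    then have "((\<lambda>u. complex_of_real (g n u)) has_vector_derivative deriv ((deriv ^^ n) F) (of_real s)) (at s)"
    proof (rule has_vector_derivative_transform_within_open)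
      show "open (ball t r)" "s \<in> ball t r" using Suc.prems by (auto simp: dist_real_def abs_minus_commute)
      show "(deriv ^^ n) F (of_real u) = complex_of_real (g n u)" if "u \<in> ball t r" for u
        using that by (intro Suc.IH) (auto simp: dist_real_def abs_minus_commute)
    qed
    moreover have "((\<lambda>u. complex_of_real (g n u)) has_vector_derivative complex_of_real (g (Suc n) s)) (at s)"
    proof -
      have "s > 0" using Suc.prems r t by (auto simp: abs_if split: if_splits)
      then have "(g n has_vector_derivative g (Suc n) s) (at s)"
        using der by (simp add: has_real_derivative_iff_has_vector_derivative[symmetric])
      then show ?thesis by (rule bounded_linear.has_vector_derivative[OF bounded_linear_of_real])
    qed
    ultimately show ?case by (simp add: vector_derivative_unique_at)
  qed
  have b1: "\<bar>Re z - t\<bar> \<le> norm (z - of_real t)" "\<bar>Im z\<bar> \<le> norm (z - of_real t)"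
    using abs_Re_le_cmod[of "z - of_real t"] abs_Im_le_cmod[of "z - of_real t"] by auto
  moreover have z2: "2 * norm (z - of_real t) < r" using z L t by (simp add: r_def field_simps)
  ultimately have b2: "\<bar>Re z - t\<bar> + \<bar>Im z\<bar> < r" by linarith
  \<comment> \<open>The largest disc around \<open>Re z\<close> inside the disc of convergence.\<close>
  define d where "d = r - \<bar>Re z - t\<bar>"
  have sub: "ball (complex_of_real (Re z)) d \<subseteq> ball (of_real t) r"
    by (subst ball_subset_ball_iff) (auto simp: d_def dist_norm simp flip: of_real_diff)
  have zin: "z \<in> ball (complex_of_real (Re z)) d"
  proof -
    have "norm (complex_of_real (Re z) - z) = \<bar>Im z\<bar>" by (simp add: cmod_def)
    then show ?thesis using b2 by (simp add: dist_norm d_def)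
  qed
  have "(\<lambda>n. (deriv ^^ n) F (of_real (Re z)) / fact n * (z - of_real (Re z)) ^ n) sums F z"
    by (rule holomorphic_power_series[OF holomorphic_on_subset[OF hol sub] zin])
  moreover have "(deriv ^^ n) F (of_real (Re z)) / fact n * (z - of_real (Re z)) ^ n =
      of_real (g n (Re z) / fact n) * (\<i> * of_real (Im z)) ^ n" for n
  proof -
    have "z - of_real (Re z) = \<i> * of_real (Im z)" by (simp add: complex_eq_iff)
    moreover have "\<bar>Re z - t\<bar> < r" using b2 by linarith
    ultimately show ?thesis by (simp add: Fn)
  qed
  ultimately have "taylor_extension g z = F z" unfolding taylor_extension_def by (simp add: sums_iff)
  moreover have "z \<in> ball (of_real t) r"
  proof -
    have "norm (z - of_real t) < r" using z2 norm_ge_zero[of "z - of_real t"] by linarith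
    then show ?thesis by (simp add: dist_norm norm_minus_commute)
  qed
  ultimately show ?thesis using F by simp
qed

lemma taylor_extension_real:
  assumes "t > 0"
  shows "taylor_extension g (of_real t) = of_real (g 0 t)"
proof -
  have "(\<lambda>n. complex_of_real (g n t / fact n) * (\<i> * of_real 0) ^ n) = (\<lambda>n. if n = 0 then of_real (g 0 t) else 0)"
    by auto
  then show ?thesis using sums_unique[OF sums_single[of 0 "\<lambda>_. complex_of_real (g 0 t)"]]
    by (simp add: taylor_extension_def)
qed

section \<open>Smooth semigroups of Schur-bounded kernels\<close>

text \<open>
  What analyticity needs of a semigroup of kernels: uniform Schur bounds, a time derivative of
  Schur norm \<open>C/t\<close>, boundedness away from time \<open>0\<close>, and the composition formulas for the kernel
  and its derivative.
\<close>

locale smooth_kernel_semigroup =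
  fixes k k1 :: "real \<Rightarrow> 'a::euclidean_space \<Rightarrow> 'a \<Rightarrow> real" and M C :: real
  assumes C_ge_1: "C \<ge> 1"
    and k_schur: "t > 0 \<Longrightarrow> schur_bounded (k t) M"
    and k1_schur: "t > 0 \<Longrightarrow> schur_bounded (k1 t) (C / t)"
    and k_sup: "t0 > 0 \<Longrightarrow> \<exists>B. \<forall>t\<ge>t0. \<forall>x y. \<bar>k t x y\<bar> \<le> B"
    and k_compose: "t > 0 \<Longrightarrow> s > 0 \<Longrightarrow> k (t + s) x y = (LINT w|lborel. k t x w * k s w y)"
    and k_derivative: "t > 0 \<Longrightarrow> ((\<lambda>s. k s x y) has_real_derivative k1 t x y) (at t)"
    and k1_compose: "t > 0 \<Longrightarrow> s > 0 \<Longrightarrow> k1 (t + s) x y = (LINT w|lborel. k1 t x w * k s w y)"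
begin

lemma M_pos: "M > 0"
  using schur_pos[OF k_schur[of 1]] by simp

primrec kn :: "nat \<Rightarrow> real \<Rightarrow> 'a \<Rightarrow> 'a \<Rightarrow> real" where
  "kn 0 = k"
| "kn (Suc n) = (\<lambda>t x y. deriv (\<lambda>s. kn n s x y) t)"

lemma schur_row_derivative:
  assumes K: "schur_bounded K m" and "\<delta> > 0"
    and der: "\<And>w r. \<bar>r - s\<bar> < \<delta> \<Longrightarrow> ((\<lambda>r. h r w) has_real_derivative h' r w) (at r)"
    and B: "\<And>w r. \<bar>r - s\<bar> < \<delta> \<Longrightarrow> \<bar>h r w\<bar> \<le> B" "\<And>w r. \<bar>r - s\<bar> < \<delta> \<Longrightarrow> \<bar>h' r w\<bar> \<le> B"
    and meas: "\<And>r. \<bar>r - s\<bar> < \<delta> \<Longrightarrow> h r \<in> borel_measurable borel" "h' s \<in> borel_measurable borel"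
  shows "((\<lambda>r. LINT w|lborel. K x w * h r w) has_real_derivative (LINT w|lborel. K x w * h' s w)) (at s)"
proof (rule has_real_derivative_integral[OF \<open>\<delta> > 0\<close>])
  have iK: "integrable lborel (\<lambda>w. B * \<bar>K x w\<bar>)"
    using schur_integrable_row(1)[OF K, of x] by (intro integrable_mult_right integrable_abs)
  then show "integrable lborel (\<lambda>w. B * \<bar>K x w\<bar>)" .
  have mK: "K x \<in> borel_measurable borel" by (rule schur_measurable_row[OF K])
  show "(\<lambda>w. K x w * h' s w) \<in> borel_measurable lborel" using mK meas(2) by simp
  show "integrable lborel (\<lambda>w. K x w * h r w)" if "r \<in> ball s \<delta>" for r
  proof (rule Bochner_Integration.integrable_bound[OF iK])
    have r: "\<bar>r - s\<bar> < \<delta>" using that by (simp add: dist_real_def abs_minus_commute)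
    show "(\<lambda>w. K x w * h r w) \<in> borel_measurable lborel" using mK meas(1)[OF r] by simp
    have "\<bar>h r w\<bar> * \<bar>K x w\<bar> \<le> \<bar>B\<bar> * \<bar>K x w\<bar>" for w
      by (intro mult_right_mono order_trans[OF B(1)[OF r] abs_ge_self]) auto
    then show "AE w in lborel. norm (K x w * h r w) \<le> norm (B * \<bar>K x w\<bar>)"
      by (simp add: abs_mult mult.commute)
  qed
  show "AE w in lborel. \<forall>r\<in>ball s \<delta>. ((\<lambda>r. K x w * h r w) has_real_derivative K x w * h' r w) (at r) \<and>
      \<bar>K x w * h' r w\<bar> \<le> B * \<bar>K x w\<bar>"
  proof (intro AE_I2 ballI conjI)
    fix w r assume "r \<in> ball s \<delta>"
    then have r: "\<bar>r - s\<bar> < \<delta>" by (simp add: dist_real_def abs_minus_commute)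
    show "((\<lambda>r. K x w * h r w) has_real_derivative K x w * h' r w) (at r)" by (intro DERIV_cmult der r)
    show "\<bar>K x w * h' r w\<bar> \<le> B * \<bar>K x w\<bar>"
      using mult_right_mono[OF B(2)[OF r, of w] abs_ge_zero[of "K x w"]] by (simp add: abs_mult mult.commute)
  qed
qed

lemma schur_row_sup:
  fixes K :: "'a \<Rightarrow> 'a \<Rightarrow> real"
  assumes K: "schur_bounded K m" and B: "\<And>w. \<bar>h w\<bar> \<le> B" and [measurable]: "h \<in> borel_measurable borel"
  shows "integrable lborel (\<lambda>w. K x w * h w)" "\<bar>LINT w|lborel. K x w * h w\<bar> \<le> m * B"
proof -
  have mK [measurable]: "K x \<in> borel_measurable borel" by (rule schur_measurable_row[OF K])
  have iK: "integrable lborel (\<lambda>w. B * norm (K x w))"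
    using schur_integrable_row(1)[OF K, of x] by (intro integrable_mult_right integrable_norm)
  have le: "\<bar>K x w * h w\<bar> \<le> B * norm (K x w)" for w
    using mult_right_mono[OF B[of w] abs_ge_zero[of "K x w"]] by (simp add: abs_mult mult.commute)
  show i: "integrable lborel (\<lambda>w. K x w * h w)"
    by (rule Bochner_Integration.integrable_bound[OF iK]) (use order_trans[OF le abs_ge_self] in auto)
  have "\<bar>LINT w|lborel. K x w * h w\<bar> \<le> (LINT w|lborel. \<bar>K x w * h w\<bar>)" by (rule integral_abs_bound)
  also have "\<dots> \<le> (LINT w|lborel. B * norm (K x w))" by (intro integral_mono integrable_abs i iK le)
  also have "\<dots> \<le> B * m"
    using schur_integrable_row(2)[OF K, of x] order_trans[OF abs_ge_zero B] by (simp add: mult_left_mono)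
  finally show "\<bar>LINT w|lborel. K x w * h w\<bar> \<le> m * B" by (simp add: mult.commute)
qed

text \<open>
  All time derivatives exist, and each further one is obtained by composing with \<open>k1\<close>:
  the composition formula at order \<open>n\<close> can be differentiated in the right factor, which is
  bounded.
\<close>

lemma kn_facts:
  shows "(\<forall>t>0. \<forall>x y. ((\<lambda>s. kn n s x y) has_real_derivative kn (Suc n) t x y) (at t)) \<and>
    (\<forall>t>0. \<forall>s>0. \<forall>x y. kn (Suc n) (t + s) x y = (LINT w|lborel. k1 t x w * kn n s w y)) \<and>
    (\<forall>t>0. (\<lambda>xy. kn n t (fst xy) (snd xy)) \<in> borel_measurable (borel \<Otimes>\<^sub>M borel)) \<and>
    (\<forall>t0>0. \<exists>B. \<forall>t\<ge>t0. \<forall>x y. \<bar>kn n t x y\<bar> \<le> B)"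
proof (induction n)
  case 0
  have "kn (Suc 0) t x y = k1 t x y" if "t > 0" for t x y
    using DERIV_imp_deriv[OF k_derivative[OF that]] by simp
  moreover have "(\<lambda>xy. k t (fst xy) (snd xy)) \<in> borel_measurable (borel \<Otimes>\<^sub>M borel)" if "t > 0" for t
    using k_schur[OF that] by (simp add: schur_bounded_def)
  ultimately show ?case using k_derivative k1_compose k_sup by (simp del: kn.simps(2))
next
  case (Suc n)
  note der = Suc[THEN conjunct1, rule_format]
  note comp = Suc[THEN conjunct2, THEN conjunct1, rule_format]
  note meas = Suc[THEN conjunct2, THEN conjunct2, THEN conjunct1, rule_format]
  note sup = Suc[THEN conjunct2, THEN conjunct2, THEN conjunct2, rule_format]
  have meas1: "(\<lambda>w. kn n t w y) \<in> borel_measurable borel" if "t > 0" for t y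
    using measurable_compose[OF _ meas[OF that], of "\<lambda>w. (w, y)" borel] by simp
  have meas': "(\<lambda>xy. kn (Suc n) t (fst xy) (snd xy)) \<in> borel_measurable (borel \<Otimes>\<^sub>M borel)" if t: "t > 0" for t
  proof -
    have t2: "t / 2 > 0" using t by simp
    note [measurable (raw)] = schur_measurable[OF k1_schur[OF t2]]
      measurable_compose[OF measurable_Pair meas[OF t2], simplified]
    have "(\<lambda>zw. k1 (t/2) (fst (fst zw)) (snd zw) * kn n (t/2) (snd zw) (snd (fst zw))) \<in> borel_measurable ((borel \<Otimes>\<^sub>M borel) \<Otimes>\<^sub>M lborel)"
      using t by measurable
    then have "(\<lambda>xy. LINT w|lborel. k1 (t/2) (fst xy) w * kn n (t/2) w (snd xy)) \<in> borel_measurable (borel \<Otimes>\<^sub>M borel)"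
      by (intro lborel.borel_measurable_lebesgue_integral) (simp add: split_beta')
    moreover have "kn (Suc n) t x y = (LINT w|lborel. k1 (t/2) x w * kn n (t/2) w y)" for x y
      using comp[of "t/2" "t/2" x y] t by simp
    ultimately show ?thesis by (simp del: kn.simps(2))
  qed
  have meas1': "(\<lambda>w. kn (Suc n) t w y) \<in> borel_measurable borel" if "t > 0" for t y
    using measurable_compose[OF _ meas'[OF that], of "\<lambda>w. (w, y)" borel] by (simp del: kn.simps(2))
  have sup': "\<exists>B. \<forall>t\<ge>t0. \<forall>x y. \<bar>kn (Suc n) t x y\<bar> \<le> B" if t0: "t0 > 0" for t0
  proof -
    obtain B where B: "\<And>t x y. t \<ge> t0/2 \<Longrightarrow> \<bar>kn n t x y\<bar> \<le> B" using sup[of "t0/2"] t0 by auto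
    have "\<bar>kn (Suc n) t x y\<bar> \<le> C / (t0/2) * B" if t: "t \<ge> t0" for t x y
    proof -
      have "kn (Suc n) t x y = (LINT w|lborel. k1 (t0/2) x w * kn n (t - t0/2) w y)"
        using comp[of "t0/2" "t - t0/2" x y] t0 t by simp
      moreover have "\<bar>LINT w|lborel. k1 (t0/2) x w * kn n (t - t0/2) w y\<bar> \<le> C / (t0/2) * B"
        using t0 t by (intro schur_row_sup(2)[OF k1_schur] B meas1) auto
      ultimately show ?thesis by simp
    qed
    then show ?thesis by blast
  qed
  have D: "((\<lambda>r. kn (Suc n) r x y) has_real_derivative (LINT w|lborel. k1 t x w * kn (Suc n) s w y)) (at (t + s))"
    if t: "t > 0" and s: "s > 0" for t s x y
  proof -
    obtain B1 where B1: "\<And>t x y. t \<ge> s/2 \<Longrightarrow> \<bar>kn n t x y\<bar> \<le> B1" using sup[of "s/2"] s by auto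
    obtain B2 where B2: "\<And>t x y. t \<ge> s/2 \<Longrightarrow> \<bar>kn (Suc n) t x y\<bar> \<le> B2" using sup'[of "s/2"] s by auto
    have "((\<lambda>r. LINT w|lborel. k1 t x w * kn n r w y) has_real_derivative (LINT w|lborel. k1 t x w * kn (Suc n) s w y)) (at s)"
    proof (rule schur_row_derivative[OF k1_schur[OF t], where \<delta>="s/2" and B="max B1 B2"])
      fix w r assume "\<bar>r - s\<bar> < s/2"
      then have r: "r \<ge> s/2" "r > 0" using s by (auto simp: abs_if split: if_splits)
      show "((\<lambda>r. kn n r w y) has_real_derivative kn (Suc n) r w y) (at r)" by (rule der[OF r(2)])
      show "\<bar>kn n r w y\<bar> \<le> max B1 B2" using B1[OF r(1), of w y] by simp
      show "\<bar>kn (Suc n) r w y\<bar> \<le> max B1 B2" using B2[OF r(1), of w y] by (simp del: kn.simps(2))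
    next
      fix r assume "\<bar>r - s\<bar> < s/2"
      then have r: "r > 0" using s by (auto simp: abs_if split: if_splits)
      show "(\<lambda>w. kn n r w y) \<in> borel_measurable borel" by (rule meas1[OF r])
    qed (use s meas1' in auto)
    then have "((\<lambda>r. kn (Suc n) (r + t) x y) has_real_derivative (LINT w|lborel. k1 t x w * kn (Suc n) s w y)) (at s)"
    proof (rule DERIV_cong_ev[THEN iffD1, rotated 3, OF _ refl _ refl])
      show "eventually (\<lambda>r. (LINT w|lborel. k1 t x w * kn n r w y) = kn (Suc n) (r + t) x y) (nhds s)"
      proof -
        have "eventually (\<lambda>r. r \<in> {0<..}) (nhds s)" using s by (intro eventually_nhds_in_open) auto
        then show ?thesis
          by eventually_elim (use comp[OF t] in \<open>auto simp: add.commute simp del: kn.simps(2)\<close>)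
      qed
    qed
    then show ?thesis by (simp only: DERIV_shift add.commute)
  qed
  have DD: "kn (Suc (Suc n)) (t + s) x y = (LINT w|lborel. k1 t x w * kn (Suc n) s w y)" if "t > 0" "s > 0" for t s x y
    using DERIV_imp_deriv[OF D[OF that, of x y]] by (subst kn.simps(2))
  have "((\<lambda>s. kn (Suc n) s x y) has_real_derivative kn (Suc (Suc n)) t x y) (at t)" if "t > 0" for t x y
    using D[of "t/2" "t/2" x y] DD[of "t/2" "t/2" x y] that by (simp del: kn.simps(2))
  then show ?case using DD meas' sup' by (simp del: kn.simps(2))
qed

lemmas kn_derivative = kn_facts[THEN conjunct1, rule_format]
lemmas kn_compose_k1 = kn_facts[THEN conjunct2, THEN conjunct1, rule_format]
lemmas kn_measurable = kn_facts[THEN conjunct2, THEN conjunct2, THEN conjunct1, rule_format]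
lemmas kn_sup = kn_facts[THEN conjunct2, THEN conjunct2, THEN conjunct2, rule_format]

declare kn.simps(2) [simp del]

lemma kn_measurable_section: "t > 0 \<Longrightarrow> (\<lambda>w. kn n t w y) \<in> borel_measurable borel"
  using measurable_compose[OF _ kn_measurable, of "\<lambda>w. (w, y)" borel t n] by simp

lemma kn_schur_step:
  assumes "h > 0" "s > 0"
  shows "schur_bounded (kn n (real n * h + s)) ((C / h) ^ n * M)"
proof (induction n)
  case 0
  then show ?case using k_schur[OF assms(2)] by simp
next
  case (Suc n)
  have "kn (Suc n) (real (Suc n) * h + s) = (\<lambda>x y. LINT w|lborel. k1 h x w * kn n (real n * h + s) w y)"
  proof (intro ext)
    fix x y
    have "real (Suc n) * h + s = h + (real n * h + s)" by (simp add: algebra_simps)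
    then show "kn (Suc n) (real (Suc n) * h + s) x y = (LINT w|lborel. k1 h x w * kn n (real n * h + s) w y)"
      using assms by (simp only:) (intro kn_compose_k1, auto intro: add_nonneg_pos)
  qed
  then show ?case using schur_compose_bound[OF k1_schur[OF assms(1)] Suc] by (simp add: mult.assoc)
qed

text \<open>
  Twice the constant in the Schur norms of the derivatives: the pointwise bounds are obtained
  by writing \<open>t = t/2 + t/2\<close>.
\<close>

definition \<Lambda> :: real where "\<Lambda> = 2 * exp 1 * C"

lemma \<Lambda>_ge_1: "\<Lambda> \<ge> 1"
proof -
  have "1 * 1 \<le> (2 * exp 1) * C" using C_ge_1 exp_ge_add_one_self[of "1::real"] by (intro mult_mono) auto
  then show ?thesis by (simp add: \<Lambda>_def)
qed

text \<open>
  With \<open>h = t/(n+1)\<close>, the derivative of order \<open>n\<close> is a composition of \<open>n\<close> factors \<open>k1 h\<close> and one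
  factor \<open>k h\<close>, which gives \<open>(C/h)\<^sup>n M\<close>; and \<open>(n+1)\<^sup>n \<le> n! e\<^sup>n\<^sup>+\<^sup>1\<close>.
\<close>

lemma kn_schur:
  assumes t: "t > 0"
  shows "schur_bounded (kn n t) (exp 1 * M * fact n * (exp 1 * C / t) ^ n)"
proof -
  define h where "h = t / real (Suc n)"
  have h: "h > 0" "real n * h + h = t"
  proof -
    have "real n * h + h = real (Suc n) * h" by (simp add: algebra_simps)
    then show "real n * h + h = t" by (simp add: h_def)
  qed (use t in \<open>simp add: h_def\<close>)
  have "schur_bounded (kn n t) ((C / h) ^ n * M)" using kn_schur_step[OF h(1) h(1), of n] h(2) by simp
  then show ?thesis
  proof (rule schur_bounded_mono)
    have "real (Suc n) ^ n / fact n \<le> exp (real (Suc n))" by (rule power_div_fact_le_exp) simp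
    also have "\<dots> = exp 1 * exp 1 ^ n" by (simp add: exp_add exp_of_nat_mult[symmetric])
    finally have "real (Suc n) ^ n \<le> exp 1 * exp 1 ^ n * fact n" by (simp add: field_simps)
    then have "real (Suc n) ^ n * ((C / t) ^ n * M) \<le> (exp 1 * exp 1 ^ n * fact n) * ((C / t) ^ n * M)"
      using C_ge_1 t M_pos by (intro mult_right_mono) auto
    moreover have "(C / h) ^ n * M = real (Suc n) ^ n * ((C / t) ^ n * M)"
      by (simp add: h_def power_mult_distrib power_divide)
    moreover have "(exp 1 * exp 1 ^ n * fact n) * ((C / t) ^ n * M) = exp 1 * M * fact n * (exp 1 * C / t) ^ n"
      by (simp add: power_mult_distrib power_divide)
    ultimately show "(C / h) ^ n * M \<le> exp 1 * M * fact n * (exp 1 * C / t) ^ n" by (simp only:)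
  qed
qed

lemma schur_compose_assoc:
  fixes K L :: "'a \<Rightarrow> 'a \<Rightarrow> real"
  assumes K: "schur_bounded K m" and L: "schur_bounded L n"
    and B: "\<And>w. \<bar>h w\<bar> \<le> B" and [measurable]: "h \<in> borel_measurable borel"
  shows "(LINT w|lborel. (LINT v|lborel. K x v * L v w) * h w) = (LINT v|lborel. K x v * (LINT w|lborel. L v w * h w))"
proof -
  note [measurable (raw)] = schur_measurable[OF K] schur_measurable[OF L]
  have B0: "B \<ge> 0" using order_trans[OF abs_ge_zero B] .
  have iL: "integrable lborel (\<lambda>w. L v w * h w)" for v by (rule schur_row_sup(1)[OF L B]) simp
  have meas: "(\<lambda>vw. K x (fst vw) * (L (fst vw) (snd vw) * h (snd vw))) \<in> borel_measurable (lborel \<Otimes>\<^sub>M lborel)"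
    by measurable
  have int: "integrable (lborel \<Otimes>\<^sub>M lborel) (\<lambda>(v, w). K x v * (L v w * h w))"
  proof (rule lborel_pair.Fubini_integrable)
    show "(\<lambda>(v, w). K x v * (L v w * h w)) \<in> borel_measurable (lborel \<Otimes>\<^sub>M lborel)"
      using meas by (simp add: split_beta')
    show "AE v in lborel. integrable lborel (\<lambda>w. case (v, w) of (v, w) \<Rightarrow> K x v * (L v w * h w))"
      using iL by simp
    show "integrable lborel (\<lambda>v. LINT w|lborel. norm (case (v, w) of (v, w) \<Rightarrow> K x v * (L v w * h w)))"
    proof (rule Bochner_Integration.integrable_bound)
      show "integrable lborel (\<lambda>v. n * B * norm (K x v))"
        using schur_integrable_row(1)[OF K, of x] by (intro integrable_mult_right integrable_norm)
      show "(\<lambda>v. LINT w|lborel. norm (case (v, w) of (v, w) \<Rightarrow> K x v * (L v w * h w))) \<in> borel_measurable lborel"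
        using meas by (intro lborel.borel_measurable_lebesgue_integral) (simp add: split_beta')
      have "(LINT w|lborel. norm (K x v * (L v w * h w))) \<le> n * B * norm (K x v)" for v
      proof -
        have "(LINT w|lborel. norm (L v w * h w)) \<le> (LINT w|lborel. norm (L v w) * B)"
          using schur_integrable_row(1)[OF L, of v] iL[of v] B
          by (intro integral_mono integrable_norm integrable_mult_left) (auto simp: abs_mult intro!: mult_left_mono)
        also have "\<dots> \<le> n * B" using schur_integrable_row(2)[OF L, of v] B0 by (simp add: mult_right_mono)
        finally have "norm (K x v) * (LINT w|lborel. norm (L v w * h w)) \<le> norm (K x v) * (n * B)"
          by (intro mult_left_mono) auto
        moreover have "(LINT w|lborel. norm (K x v * (L v w * h w))) = norm (K x v) * (LINT w|lborel. norm (L v w * h w))"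
          by (simp only: norm_mult[of "K x v"] integral_mult_right_zero)
        ultimately show ?thesis by (simp add: mult.commute)
      qed
      then show "AE v in lborel. norm (LINT w|lborel. norm (case (v, w) of (v, w) \<Rightarrow> K x v * (L v w * h w))) \<le> norm (n * B * norm (K x v))"
        by (intro AE_I2) (simp add: Bochner_Integration.integral_nonneg order_trans[OF _ abs_ge_self])
    qed
  qed
  have "(LINT w|lborel. (LINT v|lborel. K x v * L v w) * h w) = (LINT w|lborel. LINT v|lborel. K x v * (L v w * h w))"
    by (simp add: mult.assoc flip: integral_mult_left_zero)
  also have "\<dots> = (LINT v|lborel. LINT w|lborel. K x v * (L v w * h w))"
    by (rule lborel_pair.Fubini_integral[OF int])
  finally show ?thesis by simp
qed

text \<open>
  Differentiate the composition formula in the right factor.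
\<close>

lemma k_compose_kn:
  assumes t: "t > 0"
  shows "s > 0 \<Longrightarrow> (LINT w|lborel. k t x w * kn j s w y) = kn j (t + s) x y"
proof (induction j arbitrary: s)
  case 0
  then show ?case using k_compose[OF t] by simp
next
  case (Suc j)
  obtain B1 where B1: "\<And>r x y. r \<ge> s/2 \<Longrightarrow> \<bar>kn j r x y\<bar> \<le> B1" using kn_sup[of "s/2" j] Suc.prems by auto
  obtain B2 where B2: "\<And>r x y. r \<ge> s/2 \<Longrightarrow> \<bar>kn (Suc j) r x y\<bar> \<le> B2" using kn_sup[of "s/2" "Suc j"] Suc.prems by auto
  have "((\<lambda>r. LINT w|lborel. k t x w * kn j r w y) has_real_derivative (LINT w|lborel. k t x w * kn (Suc j) s w y)) (at s)"
  proof (rule schur_row_derivative[OF k_schur[OF t], where \<delta>="s/2" and B="max B1 B2"])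
    fix w r assume "\<bar>r - s\<bar> < s/2"
    then have r: "r \<ge> s/2" "r > 0" using Suc.prems by (auto simp: abs_if split: if_splits)
    show "((\<lambda>r. kn j r w y) has_real_derivative kn (Suc j) r w y) (at r)" by (rule kn_derivative[OF r(2)])
    show "\<bar>kn j r w y\<bar> \<le> max B1 B2" using B1[OF r(1), of w y] by simp
    show "\<bar>kn (Suc j) r w y\<bar> \<le> max B1 B2" using B2[OF r(1), of w y] by simp
  next
    fix r assume "\<bar>r - s\<bar> < s/2"
    then have r: "r > 0" using Suc.prems by (auto simp: abs_if split: if_splits)
    show "(\<lambda>w. kn j r w y) \<in> borel_measurable borel" by (rule kn_measurable_section[OF r])
  qed (use Suc.prems kn_measurable_section in auto)
  then have "((\<lambda>r. kn j (r + t) x y) has_real_derivative (LINT w|lborel. k t x w * kn (Suc j) s w y)) (at s)"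
  proof (rule DERIV_cong_ev[THEN iffD1, rotated 3, OF _ refl _ refl])
    show "eventually (\<lambda>r. (LINT w|lborel. k t x w * kn j r w y) = kn j (r + t) x y) (nhds s)"
    proof -
      have "eventually (\<lambda>r. r \<in> {0<..}) (nhds s)" using Suc.prems by (intro eventually_nhds_in_open) auto
      then show ?thesis by eventually_elim (use Suc.IH in \<open>auto simp: add.commute\<close>)
    qed
  qed
  then have "((\<lambda>r. kn j r x y) has_real_derivative (LINT w|lborel. k t x w * kn (Suc j) s w y)) (at (s + t))"
    by (simp only: DERIV_shift)
  moreover have "((\<lambda>r. kn j r x y) has_real_derivative kn (Suc j) (s + t) x y) (at (s + t))"
    using t Suc.prems by (intro kn_derivative) auto
  ultimately show ?case using DERIV_unique by (metis add.commute)
qed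

lemma kn_compose:
  assumes s: "s > 0"
  shows "t > 0 \<Longrightarrow> (LINT w|lborel. kn i t x w * kn j s w y) = kn (i + j) (t + s) x y"
proof (induction i arbitrary: t x)
  case 0
  then show ?case using k_compose_kn[OF _ s] by simp
next
  case (Suc i)
  have t2: "t / 2 > 0" using Suc.prems by simp
  obtain B where B: "\<And>x y. \<bar>kn j s x y\<bar> \<le> B" using kn_sup[OF s, of j] by auto
  have "kn (Suc i) t x w = (LINT v|lborel. k1 (t/2) x v * kn i (t/2) v w)" for w
    using kn_compose_k1[OF t2 t2, of i x w] by simp
  then have "(LINT w|lborel. kn (Suc i) t x w * kn j s w y) =
      (LINT w|lborel. (LINT v|lborel. k1 (t/2) x v * kn i (t/2) v w) * kn j s w y)" by simp
  also have "\<dots> = (LINT v|lborel. k1 (t/2) x v * (LINT w|lborel. kn i (t/2) v w * kn j s w y))"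
    by (rule schur_compose_assoc[OF k1_schur[OF t2] kn_schur[OF t2] B kn_measurable_section[OF s]])
  also have "\<dots> = (LINT v|lborel. k1 (t/2) x v * kn (i + j) (t/2 + s) v y)"
    by (simp only: Suc.IH[OF t2])
  also have "\<dots> = kn (Suc (i + j)) (t/2 + (t/2 + s)) x y"
    using t2 s by (intro kn_compose_k1[symmetric]) auto
  finally show ?case by simp
qed

lemma kn_bounds:
  assumes t0: "t0 > 0"
  shows "\<exists>A\<ge>0. \<forall>n. \<forall>t\<ge>t0. \<forall>x y. \<bar>kn n t x y\<bar> \<le> A * fact n * (\<Lambda> / t) ^ n"
proof -
  obtain B where B: "\<And>t x y. t \<ge> t0/2 \<Longrightarrow> \<bar>k t x y\<bar> \<le> B" using k_sup[of "t0/2"] t0 by auto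
  have "B \<ge> 0" using order_trans[OF abs_ge_zero B[OF order_refl]] .
  have "\<bar>kn n t x y\<bar> \<le> (exp 1 * M * B) * fact n * (\<Lambda> / t) ^ n" if t: "t \<ge> t0" for n t x y
  proof -
    have t2: "t/2 > 0" "t/2 \<ge> t0/2" using t t0 by auto
    have "kn n t x y = (LINT w|lborel. kn n (t/2) x w * kn 0 (t/2) w y)"
      using kn_compose[OF t2(1) t2(1), of n x 0 y] by simp
    also have "\<bar>\<dots>\<bar> \<le> (exp 1 * M * fact n * (exp 1 * C / (t/2)) ^ n) * B"
      using B[OF t2(2)] kn_measurable_section[OF t2(1), of 0]
      by (intro schur_row_sup(2)[OF kn_schur[OF t2(1)]]) auto
    also have "exp 1 * C / (t/2) = \<Lambda> / t" by (simp add: \<Lambda>_def)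
    finally show ?thesis by (simp add: mult_ac)
  qed
  then show ?thesis using \<open>B \<ge> 0\<close> M_pos by (intro exI[of _ "exp 1 * M * B"]) auto
qed

lemma cauchy_bounds_kn: "cauchy_bounds (\<lambda>n t. kn n t x y) \<Lambda>"
  unfolding cauchy_bounds_def
proof (intro conjI allI impI)
  fix t0 :: real assume "t0 > 0"
  from kn_bounds[OF this] obtain A
    where "\<And>n t x y. t \<ge> t0 \<Longrightarrow> \<bar>kn n t x y\<bar> \<le> A * fact n * (\<Lambda> / t) ^ n" by blast
  then show "\<exists>A. \<forall>n. \<forall>t\<ge>t0. \<bar>kn n t x y\<bar> \<le> A * fact n * (\<Lambda> / t) ^ n" by blast
qed (use \<Lambda>_ge_1 kn_derivative in auto)

text \<open>
  The kernel at complex times.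
\<close>

definition kz :: "complex \<Rightarrow> 'a \<Rightarrow> 'a \<Rightarrow> complex"
  where "kz z x y = taylor_extension (\<lambda>n t. kn n t x y) z"

lemma kz_real: "t > 0 \<Longrightarrow> kz (of_real t) x y = of_real (k t x y)"
  using taylor_extension_real[of t "\<lambda>n t. kn n t x y"] by (simp add: kz_def)

lemma kz_sums:
  assumes "t > 0" "norm (z - of_real t) < t / (8 * \<Lambda>)"
  shows "(\<lambda>n. (z - of_real t) ^ n / fact n * of_real (kn n t x y)) sums kz z x y"
  using taylor_recentre[OF cauchy_bounds_kn assms, of x y] by (simp add: kz_def mult.commute)

lemma kz_summable:
  fixes z :: complex
  assumes "t > 0" "norm (z - of_real t) < t / (8 * \<Lambda>)"
  shows "summable (\<lambda>n. norm ((z - of_real t) ^ n / fact n * of_real (kn n t x y)))"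
proof -
  have "\<Lambda> * norm (z - of_real t) \<le> t / 2"
    using assms \<Lambda>_ge_1 by (simp add: field_simps)
  from cauchy_bounds_summable[OF cauchy_bounds_kn assms(1) this, of x y]
  show ?thesis by (simp add: mult.commute)
qed

definition E :: real where "E = exp 1 * M"

lemma E_pos: "E > 0" using M_pos by (simp add: E_def)

lemma kn_schur': "t > 0 \<Longrightarrow> schur_bounded (\<lambda>x y. complex_of_real (kn n t x y)) (E * fact n * (\<Lambda> / (2 * t)) ^ n)"
  using schur_of_real[OF kn_schur[of t n]] by (simp add: E_def \<Lambda>_def)

lemma geometric_bound:
  assumes "t > 0" "0 \<le> r" "r \<le> t / (8 * \<Lambda>)"
  shows "(\<Lambda> / (2 * t)) ^ n * r ^ n \<le> (1 / 16) ^ n"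
proof -
  have "\<Lambda> / (2 * t) * r \<le> 1 / 16" using assms \<Lambda>_ge_1 by (simp add: field_simps)
  then have "(\<Lambda> / (2 * t) * r) ^ n \<le> (1 / 16) ^ n" using assms \<Lambda>_ge_1 by (intro power_mono) auto
  then show ?thesis by (simp only: power_mult_distrib)
qed

lemma kz_schur:
  assumes t: "t > 0" and z: "norm (z - of_real t) < t / (8 * \<Lambda>)"
  shows "schur_bounded (kz z) (2 * E)"
proof (rule schur_series[OF kn_schur'[OF t] _ kz_summable[OF t z] kz_sums[OF t z]])
  have le: "norm ((z - of_real t) ^ n / fact n) * (E * fact n * (\<Lambda> / (2 * t)) ^ n) \<le> E * (1 / 16) ^ n" for n
  proof -
    have "norm ((z - of_real t) ^ n / fact n) * (E * fact n * (\<Lambda> / (2 * t)) ^ n) =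
        E * ((\<Lambda> / (2 * t)) ^ n * norm (z - of_real t) ^ n)"
      by (simp add: norm_divide norm_power)
    also have "\<dots> \<le> E * (1 / 16) ^ n" using t z E_pos by (intro mult_left_mono geometric_bound) auto
    finally show ?thesis .
  qed
  have g: "summable (\<lambda>n. E * (1 / 16 :: real) ^ n)" by (intro summable_mult summable_geometric) simp
  have nn: "0 \<le> norm ((z - of_real t) ^ n / fact n) * (E * fact n * (\<Lambda> / (2 * t)) ^ n)" for n
    using E_pos t \<Lambda>_ge_1 by auto
  show s: "summable (\<lambda>n. norm ((z - of_real t) ^ n / fact n) * (E * fact n * (\<Lambda> / (2 * t)) ^ n))"
    by (rule summable_comparison_test'[OF g]) (use le nn in auto)
  have "(\<Sum>n. norm ((z - of_real t) ^ n / fact n) * (E * fact n * (\<Lambda> / (2 * t)) ^ n)) \<le> (\<Sum>n. E * (1 / 16) ^ n)"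
    by (intro suminf_le le s g)
  also have "\<dots> = E * (16 / 15)" by (subst suminf_mult) (auto simp: suminf_geometric summable_geometric)
  finally show "(\<Sum>n. norm ((z - of_real t) ^ n / fact n) * (E * fact n * (\<Lambda> / (2 * t)) ^ n)) \<le> 2 * E"
    using E_pos by simp
qed (use E_pos in simp)

text \<open>The sector of those \<open>z\<close> that lie in the disc of convergence around their real part.\<close>

definition cone :: "complex set"
  where "cone = {z. 0 < Re z \<and> \<bar>Im z\<bar> < Re z / (8 * \<Lambda>)}"

lemma cone_centre:
  assumes "z \<in> cone"
  shows "0 < Re z" "norm (z - of_real (Re z)) < Re z / (8 * \<Lambda>)" "z - of_real (Re z) = \<i> * of_real (Im z)"
proof -
  show e: "z - of_real (Re z) = \<i> * of_real (Im z)" by (simp add: complex_eq_iff)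
  show "0 < Re z" "norm (z - of_real (Re z)) < Re z / (8 * \<Lambda>)"
    using assms unfolding e by (auto simp: cone_def norm_mult)
qed

text \<open>
  The Cauchy product of the two Taylor series at the real parts turns the composition
  formulas for the derivatives into the semigroup property.
\<close>

lemma kz_compose:
  assumes z: "z \<in> cone" and w: "w \<in> cone"
  shows "(LINT u|lborel. kz z x u * kz w u y) = kz (z + w) x y"
proof -
  define t s where "t = Re z" and "s = Re w"
  note cz = cone_centre[OF z, folded t_def] and cw = cone_centre[OF w, folded s_def]
  define S :: "complex \<Rightarrow> nat \<Rightarrow> complex" where "S v n = v ^ n /\<^sub>R fact n" for v n
  define a where "a n u = S (\<i> * of_real (Im z)) n * of_real (kn n t x u)" for n u
  define b where "b n u = S (\<i> * of_real (Im w)) n * of_real (kn n s u y)" for n u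
  have S_eq: "S v n = v ^ n / fact n" for v n by (simp add: S_def scaleR_conv_of_real field_simps)
  have a_sums: "(\<lambda>n. a n u) sums kz z x u" and a_abs: "summable (\<lambda>n. norm (a n u))" for u
    using kz_sums[OF cz(1,2), of x u] kz_summable[OF cz(1,2), of x u] by (simp_all add: a_def S_eq cz(3))
  have b_sums: "(\<lambda>n. b n u) sums kz w u y" and b_abs: "summable (\<lambda>n. norm (b n u))" for u
    using kz_sums[OF cw(1,2), of u y] kz_summable[OF cw(1,2), of u y] by (simp_all add: b_def S_eq cw(3))
  have ia: "integrable lborel (a n)" and na: "(LINT u|lborel. norm (a n u)) \<le> E * (1 / 16) ^ n" for n
  proof -
    note sch = kn_schur'[OF cz(1), of n]
    have i: "integrable lborel (\<lambda>u. complex_of_real (kn n t x u))" by (rule schur_integrable_row(1)[OF sch])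
    show "integrable lborel (a n)" unfolding a_def by (intro integrable_mult_right i)
    have "(LINT u|lborel. norm (a n u)) = norm (S (\<i> * of_real (Im z)) n) * (LINT u|lborel. norm (complex_of_real (kn n t x u)))"
      by (simp add: a_def norm_mult)
    also have "\<dots> \<le> norm (S (\<i> * of_real (Im z)) n) * (E * fact n * (\<Lambda> / (2 * t)) ^ n)"
      by (intro mult_left_mono schur_integrable_row(2)[OF sch]) auto
    also have "\<dots> = E * ((\<Lambda> / (2 * t)) ^ n * norm (z - of_real t) ^ n)"
      by (simp add: S_eq cz(3) norm_divide norm_mult norm_power)
    also have "\<dots> \<le> E * (1 / 16) ^ n"
      using cz E_pos by (intro mult_left_mono geometric_bound) auto
    finally show "(LINT u|lborel. norm (a n u)) \<le> E * (1 / 16) ^ n" .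
  qed
  obtain A where A: "A \<ge> 0" "\<And>n u. \<bar>kn n s u y\<bar> \<le> A * fact n * (\<Lambda> / s) ^ n"
    using kn_bounds[OF cw(1)] by blast
  have nb: "norm (b n u) \<le> A * (1 / 8) ^ n" for n u
  proof -
    have "norm (b n u) \<le> norm (S (\<i> * of_real (Im w)) n) * (A * fact n * (\<Lambda> / s) ^ n)"
      unfolding b_def norm_mult using A(2)[of n u] by (intro mult_left_mono) auto
    also have "\<dots> = A * (2 ^ n * ((\<Lambda> / (2 * s)) ^ n * norm (w - of_real s) ^ n))"
      by (simp add: S_eq cw(3) norm_divide norm_mult norm_power power_divide power_mult_distrib)
    also have "\<dots> \<le> A * (2 ^ n * (1 / 16) ^ n)"
      using cw A(1) by (intro mult_left_mono geometric_bound) auto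
    also have "2 ^ n * (1 / 16) ^ n = (1 / 8 :: real) ^ n" by (simp add: power_mult_distrib[symmetric])
    finally show ?thesis .
  qed
  have mb: "b n \<in> borel_measurable borel" for n
    unfolding b_def using kn_measurable_section[OF cw(1), of n y] by (intro borel_measurable_times borel_measurable_of_real) auto
  have iab: "integrable lborel (\<lambda>u. a i u * b j u)" and nab: "(LINT u|lborel. norm (a i u * b j u)) \<le> (E * (1 / 16) ^ i) * (A * (1 / 8) ^ j)" for i j
  proof -
    have ib: "integrable lborel (\<lambda>u. norm (a i u) * (A * (1 / 8) ^ j))" by (intro integrable_mult_left integrable_norm ia)
    show i: "integrable lborel (\<lambda>u. a i u * b j u)"
    proof (rule Bochner_Integration.integrable_bound[OF ib])
      show "(\<lambda>u. a i u * b j u) \<in> borel_measurable lborel"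
        using borel_measurable_integrable[OF ia, of i] mb[of j] by simp
      show "AE u in lborel. norm (a i u * b j u) \<le> norm (norm (a i u) * (A * (1 / 8) ^ j))"
        using nb A(1) by (intro AE_I2) (simp add: norm_mult mult_left_mono)
    qed
    have "(LINT u|lborel. norm (a i u * b j u)) \<le> (LINT u|lborel. norm (a i u) * (A * (1 / 8) ^ j))"
      using nb by (intro integral_mono integrable_norm i ib) (simp add: norm_mult mult_left_mono)
    also have "\<dots> \<le> (E * (1 / 16) ^ i) * (A * (1 / 8) ^ j)"
      using na[of i] A(1) by (simp add: mult_right_mono)
    finally show "(LINT u|lborel. norm (a i u * b j u)) \<le> (E * (1 / 16) ^ i) * (A * (1 / 8) ^ j)" .
  qed
  define f where "f m u = (\<Sum>i\<le>m. a i u * b (m - i) u)" for m u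
  have f_sums: "(\<lambda>m. f m u) sums (kz z x u * kz w u y)" for u
    using Cauchy_product_sums[OF a_abs b_abs, of u u] a_sums[of u] b_sums[of u] by (simp add: f_def sums_iff)
  have f_abs: "summable (\<lambda>m. norm (f m u))" for u
  proof (rule summable_comparison_test')
    have "summable (\<lambda>k. norm (norm (a k u)))" "summable (\<lambda>k. norm (norm (b k u)))" using a_abs b_abs by simp_all
    then show "summable (\<lambda>m. \<Sum>i\<le>m. norm (a i u) * norm (b (m - i) u))" by (rule summable_Cauchy_product)
    show "norm (norm (f m u)) \<le> (\<Sum>i\<le>m. norm (a i u) * norm (b (m - i) u))" for m
      unfolding f_def by (simp add: sum_norm_le norm_mult)
  qed
  have if': "integrable lborel (f m)" for m unfolding f_def by (intro Bochner_Integration.integrable_sum iab)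
  have f_int: "summable (\<lambda>m. LINT u|lborel. norm (f m u))"
  proof (rule summable_comparison_test')
    have "summable (\<lambda>k. norm (E * (1 / 16 :: real) ^ k))" "summable (\<lambda>k. norm (A * (1 / 8 :: real) ^ k))"
      using E_pos A(1) by (auto simp: abs_mult intro!: summable_mult summable_geometric)
    then show "summable (\<lambda>m. \<Sum>i\<le>m. (E * (1 / 16) ^ i) * (A * (1 / 8) ^ (m - i)))" by (rule summable_Cauchy_product)
    fix m
    have "(LINT u|lborel. norm (f m u)) \<le> (LINT u|lborel. (\<Sum>i\<le>m. norm (a i u * b (m - i) u)))"
      by (intro integral_mono integrable_norm if' Bochner_Integration.integrable_sum iab) (simp add: f_def sum_norm_le)
    also have "\<dots> = (\<Sum>i\<le>m. LINT u|lborel. norm (a i u * b (m - i) u))"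
      by (intro Bochner_Integration.integral_sum integrable_norm iab)
    also have "\<dots> \<le> (\<Sum>i\<le>m. (E * (1 / 16) ^ i) * (A * (1 / 8) ^ (m - i)))" by (intro sum_mono nab)
    finally show "norm (LINT u|lborel. norm (f m u)) \<le> (\<Sum>i\<le>m. (E * (1 / 16) ^ i) * (A * (1 / 8) ^ (m - i)))" by simp
  qed
  have "(\<lambda>m. LINT u|lborel. f m u) sums (LINT u|lborel. (\<Sum>m. f m u))"
    by (rule sums_integral[OF if' _ f_int]) (use f_abs in auto)
  moreover have "(\<Sum>m. f m u) = kz z x u * kz w u y" for u using f_sums[of u] by (simp add: sums_iff)
  moreover have "(LINT u|lborel. f m u) = of_real (kn m (Re (z + w)) x y / fact m) * (\<i> * of_real (Im (z + w))) ^ m" for m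
  proof -
    have e: "(LINT u|lborel. a i u * b (m - i) u) = S (\<i> * of_real (Im z)) i * S (\<i> * of_real (Im w)) (m - i) * of_real (kn m (t + s) x y)"
      if "i \<le> m" for i
    proof -
      have "(LINT u|lborel. a i u * b (m - i) u) =
        (LINT u|lborel. (S (\<i> * of_real (Im z)) i * S (\<i> * of_real (Im w)) (m - i)) * complex_of_real (kn i t x u * kn (m - i) s u y))"
        by (simp add: a_def b_def mult_ac)
      also have "\<dots> = (S (\<i> * of_real (Im z)) i * S (\<i> * of_real (Im w)) (m - i)) * of_real (LINT u|lborel. kn i t x u * kn (m - i) s u y)"
        by (simp only: integral_mult_right_zero integral_complex_of_real)
      also have "(LINT u|lborel. kn i t x u * kn (m - i) s u y) = kn m (t + s) x y"
        using kn_compose[OF cw(1) cz(1), of i x "m - i" y] that by simp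
      finally show ?thesis .
    qed
    have "(LINT u|lborel. f m u) = (\<Sum>i\<le>m. LINT u|lborel. a i u * b (m - i) u)"
      unfolding f_def by (intro Bochner_Integration.integral_sum iab)
    also have "\<dots> = (\<Sum>i\<le>m. S (\<i> * of_real (Im z)) i * S (\<i> * of_real (Im w)) (m - i)) * of_real (kn m (t + s) x y)"
      unfolding sum_distrib_right by (intro sum.cong refl e) auto
    also have "(\<Sum>i\<le>m. S (\<i> * of_real (Im z)) i * S (\<i> * of_real (Im w)) (m - i)) = S (\<i> * of_real (Im z) + \<i> * of_real (Im w)) m"
      unfolding S_def by (rule exp_series_add_commuting[symmetric]) (simp add: mult.commute)
    finally show ?thesis by (simp add: S_eq t_def s_def distrib_left mult.commute)
  qed
  ultimately show ?thesis
    unfolding kz_def taylor_extension_def by (simp add: sums_iff)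
qed

text \<open>
  The termwise derivative of the Taylor series at the real part.  The term of order \<open>0\<close>
  vanishes thanks to its factor \<open>0\<close>, although the exponent \<open>n - 1\<close> is truncated there.
\<close>

definition kz' :: "complex \<Rightarrow> 'a \<Rightarrow> 'a \<Rightarrow> complex"
  where "kz' z x y = (\<Sum>n. of_nat n * (z - of_real (Re z)) ^ (n - 1) / fact n * of_real (kn n (Re z) x y))"

lemma nat_mult_pred_le: "real n * real (n - 1) \<le> 4 ^ n" "real n \<le> 2 ^ n"
proof -
  show n: "real n \<le> 2 ^ n" by (rule less_imp_le[OF of_nat_less_two_power])
  have "real (n - 1) \<le> 2 ^ n" by (rule order_trans[OF _ n]) simp
  then have "real n * real (n - 1) \<le> 2 ^ n * 2 ^ n" using n by (intro mult_mono) auto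
  also have "\<dots> = 4 ^ n" by (simp flip: power_mult_distrib)
  finally show "real n * real (n - 1) \<le> 4 ^ n" .
qed

lemma derivative_coefficient_bound:
  fixes v :: complex
  assumes "K > 0" "norm v \<le> K" "c * K \<le> 1 / 8" "c \<ge> 0"
  shows "norm (of_nat n * v ^ (n - 1)) * c ^ n \<le> (1 / K) * (1 / 4) ^ n"
proof (cases n)
  case (Suc j)
  have n2: "norm (of_nat n :: complex) \<le> 2 ^ n" using nat_mult_pred_le(2)[of n] by simp
  have "norm v ^ j \<le> K ^ j" using assms by (intro power_mono) auto
  then have "norm (of_nat n * v ^ j) * c ^ n \<le> (2 ^ n * K ^ j) * c ^ n"
    unfolding norm_mult norm_power using assms n2 by (intro mult_right_mono mult_mono) auto
  then have "norm (of_nat n * v ^ (n - 1)) * c ^ n \<le> (2 ^ n * K ^ j) * c ^ n" using Suc by simp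
  also have "\<dots> = (1 / K) * (2 * (c * K)) ^ n" using assms Suc by (simp add: power_mult_distrib)
  also have "\<dots> \<le> (1 / K) * (1 / 4) ^ n" using assms by (intro mult_left_mono power_mono) auto
  finally show ?thesis .
qed (use assms in simp)

lemma
  assumes z: "z \<in> cone"
  shows kz'_sums: "(\<lambda>n. of_nat n * (z - of_real (Re z)) ^ (n - 1) / fact n * of_real (kn n (Re z) x y)) sums kz' z x y"
    and kz'_summable: "summable (\<lambda>n. norm (of_nat n * (z - of_real (Re z)) ^ (n - 1) / fact n * of_real (kn n (Re z) x y)))"
    and kz'_schur: "schur_bounded (kz' z) (2 * E * (8 * \<Lambda> / Re z))"
proof -
  define t where "t = Re z"
  define K where "K = t / (8 * \<Lambda>)"
  note cz = cone_centre[OF z, folded t_def]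
  have K: "K > 0" "norm (z - of_real t) \<le> K" using cz \<Lambda>_ge_1 by (auto simp: K_def)
  have cK: "\<Lambda> / t * K \<le> 1 / 8" "\<Lambda> / (2 * t) * K \<le> 1 / 8" using cz(1) \<Lambda>_ge_1 by (auto simp: K_def field_simps)
  have c0: "0 \<le> \<Lambda> / t" "0 \<le> \<Lambda> / (2 * t)" using cz(1) \<Lambda>_ge_1 by auto
  show abs: "summable (\<lambda>n. norm (of_nat n * (z - of_real (Re z)) ^ (n - 1) / fact n * of_real (kn n (Re z) x y)))" for x y
  proof -
    obtain A where A: "A \<ge> 0" "\<And>n. \<bar>kn n t x y\<bar> \<le> A * fact n * (\<Lambda> / t) ^ n"
      using kn_bounds[OF cz(1)] by blast
    show ?thesis unfolding t_def[symmetric]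
    proof (rule summable_comparison_test')
      show "summable (\<lambda>n. A * ((1 / K) * (1 / 4) ^ n))" by (intro summable_mult summable_geometric) simp
      fix n
      have "norm (of_nat n * (z - of_real t) ^ (n - 1) / fact n * of_real (kn n t x y)) =
          norm (of_nat n * (z - of_real t) ^ (n - 1)) * (\<bar>kn n t x y\<bar> / fact n)"
        by (simp add: norm_mult norm_divide)
      also have "\<dots> \<le> norm (of_nat n * (z - of_real t) ^ (n - 1)) * ((A * fact n * (\<Lambda> / t) ^ n) / fact n)"
        by (intro mult_left_mono divide_right_mono A) auto
      also have "\<dots> = A * (norm (of_nat n * (z - of_real t) ^ (n - 1)) * (\<Lambda> / t) ^ n)" by simp
      also have "\<dots> \<le> A * ((1 / K) * (1 / 4) ^ n)"
        by (intro mult_left_mono derivative_coefficient_bound K cK c0 A(1))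
      finally show "norm (norm (of_nat n * (z - of_real t) ^ (n - 1) / fact n * of_real (kn n t x y))) \<le> A * ((1 / K) * (1 / 4) ^ n)"
        by simp
    qed
  qed
  show sums: "(\<lambda>n. of_nat n * (z - of_real (Re z)) ^ (n - 1) / fact n * of_real (kn n (Re z) x y)) sums kz' z x y" for x y
    unfolding kz'_def by (rule summable_sums[OF summable_norm_cancel[OF abs]])
  show "schur_bounded (kz' z) (2 * E * (8 * \<Lambda> / Re z))"
  proof (rule schur_series[OF kn_schur'[OF cz(1)] _ abs[folded t_def] sums[folded t_def]])
    have le: "norm (of_nat n * (z - of_real t) ^ (n - 1) / fact n) * (E * fact n * (\<Lambda> / (2 * t)) ^ n) \<le> E * ((1 / K) * (1 / 4) ^ n)" for n
    proof -
      have "norm (of_nat n * (z - of_real t) ^ (n - 1) / fact n) * (E * fact n * (\<Lambda> / (2 * t)) ^ n) =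
          E * (norm (of_nat n * (z - of_real t) ^ (n - 1)) * (\<Lambda> / (2 * t)) ^ n)"
        by (simp add: norm_divide)
      also have "\<dots> \<le> E * ((1 / K) * (1 / 4) ^ n)"
        using E_pos by (intro mult_left_mono derivative_coefficient_bound K cK c0) auto
      finally show ?thesis .
    qed
    have g: "summable (\<lambda>n. E * ((1 / K) * (1 / 4) ^ n))" by (intro summable_mult summable_geometric) simp
    have nn: "0 \<le> norm (of_nat n * (z - of_real t) ^ (n - 1) / fact n) * (E * fact n * (\<Lambda> / (2 * t)) ^ n)" for n
      using E_pos c0 by auto
    show s: "summable (\<lambda>n. norm (of_nat n * (z - of_real t) ^ (n - 1) / fact n) * (E * fact n * (\<Lambda> / (2 * t)) ^ n))"
      by (rule summable_comparison_test'[OF g]) (use le nn in auto)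
    have "(\<Sum>n. norm (of_nat n * (z - of_real t) ^ (n - 1) / fact n) * (E * fact n * (\<Lambda> / (2 * t)) ^ n)) \<le> (\<Sum>n. E * ((1 / K) * (1 / 4) ^ n))"
      by (intro suminf_le le s g)
    also have "\<dots> = E * ((1 / K) * (4 / 3))"
      using sums_mult[OF sums_mult[OF geometric_sums[of "1/4::real"]], of E "1 / K"] by (simp add: sums_iff)
    also have "\<dots> \<le> E * ((1 / K) * 2)" using E_pos K by (intro mult_left_mono) auto
    also have "\<dots> = 2 * E * (8 * \<Lambda> / Re z)" by (simp add: K_def t_def)
    finally show "(\<Sum>n. norm (of_nat n * (z - of_real t) ^ (n - 1) / fact n) * (E * fact n * (\<Lambda> / (2 * t)) ^ n)) \<le> 2 * E * (8 * \<Lambda> / Re z)" .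
    show "2 * E * (8 * \<Lambda> / Re z) > 0" using E_pos \<Lambda>_ge_1 cz(1) by (simp add: t_def)
  qed
qed

text \<open>The difference quotient converges to the derivative in the Schur norm, at a linear rate.\<close>

lemma kz_difference_quotient:
  assumes z: "z \<in> cone" and wz: "w \<noteq> z" and w: "norm (w - of_real (Re z)) < Re z / (8 * \<Lambda>)"
  shows "schur_bounded (\<lambda>x y. (kz w x y - kz z x y) / (w - z) - kz' z x y) (2 * E * (8 * \<Lambda> / Re z)\<^sup>2 * norm (w - z))"
proof -
  define t where "t = Re z"
  define K where "K = t / (8 * \<Lambda>)"
  note cz = cone_centre[OF z, folded t_def]
  have K: "K > 0" "norm (z - of_real t) \<le> K" "norm (w - of_real t) \<le> K"
    using cz \<Lambda>_ge_1 w by (auto simp: K_def t_def)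
  have c: "\<Lambda> / (2 * t) * K = 1 / 16" using cz(1) \<Lambda>_ge_1 by (simp add: K_def)
  define c where "c n = (((w - of_real t) ^ n - (z - of_real t) ^ n) / (w - z) - of_nat n * (z - of_real t) ^ (n - 1)) / fact n" for n
  have cn: "c n * of_real (kn n t x y) = (1 / (w - z)) * ((w - of_real t) ^ n / fact n * of_real (kn n t x y))
      - (1 / (w - z)) * ((z - of_real t) ^ n / fact n * of_real (kn n t x y))
      - of_nat n * (z - of_real t) ^ (n - 1) / fact n * of_real (kn n t x y)" for n x y
    unfolding c_def by (simp add: divide_inverse algebra_simps)
  have sums: "(\<lambda>n. c n * of_real (kn n t x y)) sums ((1 / (w - z)) * kz w x y - (1 / (w - z)) * kz z x y - kz' z x y)" for x y
    unfolding cn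
    by (intro sums_diff sums_mult kz_sums[OF cz(1) w[folded t_def]] kz_sums[OF cz(1,2)] kz'_sums[OF z, folded t_def])
  have abs: "summable (\<lambda>n. norm (c n * of_real (kn n t x y)))" for x y
  proof (rule summable_comparison_test')
    define A1 where "A1 n = norm ((w - of_real t) ^ n / fact n * complex_of_real (kn n t x y))" for n
    define A2 where "A2 n = norm ((z - of_real t) ^ n / fact n * complex_of_real (kn n t x y))" for n
    define A3 where "A3 n = norm (of_nat n * (z - of_real t) ^ (n - 1) / fact n * complex_of_real (kn n t x y))" for n
    show "summable (\<lambda>n. norm (1 / (w - z)) * A1 n + norm (1 / (w - z)) * A2 n + A3 n)"
      unfolding A1_def A2_def A3_def
      by (intro summable_add summable_mult kz_summable[OF cz(1) w[folded t_def]] kz_summable[OF cz(1,2)] kz'_summable[OF z, folded t_def])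
    show "norm (norm (c n * of_real (kn n t x y))) \<le> norm (1 / (w - z)) * A1 n + norm (1 / (w - z)) * A2 n + A3 n" for n
      unfolding cn A1_def A2_def A3_def real_norm_def abs_norm_cancel norm_mult[symmetric]
      by (intro order_trans[OF norm_triangle_ineq4] add_mono order_refl)
  qed
  have le: "norm (c n) * (E * fact n * (\<Lambda> / (2 * t)) ^ n) \<le> E * norm (w - z) / K\<^sup>2 * (1 / 4) ^ n" for n
  proof -
    have td: "norm (((w - of_real t) ^ n - (z - of_real t) ^ n) / (w - z) - of_nat n * (z - of_real t) ^ (n - Suc 0))
        \<le> real n * real (n - Suc 0) * K ^ (n - 2) * norm (w - z)"
      using lemma_termdiff3[of "w - z" "z - of_real t" K n] wz K by simp
    have "norm (c n) * (E * fact n * (\<Lambda> / (2 * t)) ^ n) =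
        E * (norm (((w - of_real t) ^ n - (z - of_real t) ^ n) / (w - z) - of_nat n * (z - of_real t) ^ (n - Suc 0)) * (\<Lambda> / (2 * t)) ^ n)"
      by (simp add: c_def norm_divide)
    also have "\<dots> \<le> E * ((real n * real (n - 1) * K ^ (n - 2) * norm (w - z)) * (\<Lambda> / (2 * t)) ^ n)"
      using td E_pos cz(1) \<Lambda>_ge_1 by (intro mult_left_mono mult_right_mono) auto
    also have "\<dots> \<le> E * (norm (w - z) / K\<^sup>2 * (1 / 4) ^ n)"
    proof (cases "n \<ge> 2")
      case True
      have Kn: "K ^ (n - 2) = K ^ n / K\<^sup>2" using K True by (simp add: power_diff)
      have "(real n * real (n - 1) * K ^ (n - 2) * norm (w - z)) * (\<Lambda> / (2 * t)) ^ n =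
          norm (w - z) / K\<^sup>2 * (real n * real (n - 1) * (\<Lambda> / (2 * t) * K) ^ n)"
        unfolding Kn power_mult_distrib[of "\<Lambda> / (2 * t)"] by simp
      also have "\<dots> \<le> norm (w - z) / K\<^sup>2 * (4 ^ n * (1 / 16) ^ n)"
        unfolding c using nat_mult_pred_le(1)[of n] by (intro mult_left_mono mult_right_mono) auto
      also have "4 ^ n * (1 / 16) ^ n = (1 / 4 :: real) ^ n" by (simp flip: power_mult_distrib)
      finally show ?thesis using E_pos by (intro mult_left_mono) auto
    next
      case False
      then have "n = 0 \<or> n = 1" by auto
      then show ?thesis using E_pos by auto
    qed
    finally show ?thesis by simp
  qed
  have "schur_bounded (\<lambda>x y. (1 / (w - z)) * kz w x y - (1 / (w - z)) * kz z x y - kz' z x y) (2 * E * (8 * \<Lambda> / Re z)\<^sup>2 * norm (w - z))"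
  proof (rule schur_series[OF kn_schur'[OF cz(1)] _ abs sums])
    have g: "summable (\<lambda>n. E * norm (w - z) / K\<^sup>2 * (1 / 4) ^ n)" by (intro summable_mult summable_geometric) simp
    have nn: "0 \<le> norm (c n) * (E * fact n * (\<Lambda> / (2 * t)) ^ n)" for n
      using E_pos cz(1) \<Lambda>_ge_1 by auto
    show s: "summable (\<lambda>n. norm (c n) * (E * fact n * (\<Lambda> / (2 * t)) ^ n))"
      by (rule summable_comparison_test'[OF g]) (use le nn in auto)
    have "(\<Sum>n. norm (c n) * (E * fact n * (\<Lambda> / (2 * t)) ^ n)) \<le> (\<Sum>n. E * norm (w - z) / K\<^sup>2 * (1 / 4) ^ n)"
      by (intro suminf_le le s g)
    also have "\<dots> = E * norm (w - z) / K\<^sup>2 * (4 / 3)"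
      by (subst suminf_mult) (auto simp: suminf_geometric summable_geometric)
    also have "\<dots> \<le> E * norm (w - z) / K\<^sup>2 * 2" using E_pos by (intro mult_left_mono) auto
    also have "\<dots> = 2 * E * (8 * \<Lambda> / Re z)\<^sup>2 * norm (w - z)" by (simp add: K_def t_def power_divide)
    finally show "(\<Sum>n. norm (c n) * (E * fact n * (\<Lambda> / (2 * t)) ^ n)) \<le> 2 * E * (8 * \<Lambda> / Re z)\<^sup>2 * norm (w - z)" .
    show "2 * E * (8 * \<Lambda> / Re z)\<^sup>2 * norm (w - z) > 0" using E_pos \<Lambda>_ge_1 cz(1) wz by (simp add: t_def)
  qed
  then show ?thesis by (simp add: diff_divide_distrib)
qed

end

section \<open>Analytic semigroups on \<open>L\<^sup>q\<close>\<close>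

lemma Lq_norm_nonneg: "0 \<le> Lq_norm q f"
  by (simp add: Lq_norm_def)

lemma Lq_norm_cong_AE:
  assumes "f \<in> Lq_space q" "g \<in> borel_measurable lborel" "AE x in lborel. g x = f x"
  shows "g \<in> Lq_space q" "Lq_norm q g = Lq_norm q f"
proof -
  have [measurable]: "f \<in> borel_measurable borel" "g \<in> borel_measurable borel" using assms by (auto simp: Lq_space_def)
  have ae: "AE x in lborel. norm (g x) powr q = norm (f x) powr q" using assms(3) by eventually_elim simp
  show "Lq_norm q g = Lq_norm q f"
    unfolding Lq_norm_def by (subst integral_cong_AE[OF _ _ ae]) auto
  have "integrable lborel (\<lambda>x. norm (g x) powr q) \<longleftrightarrow> integrable lborel (\<lambda>x. norm (f x) powr q)"
    by (rule integrable_cong_AE[OF _ _ ae]) measurable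
  then show "g \<in> Lq_space q" using assms(1) by (simp add: Lq_space_def)
qed

lemma Lq_scale:
  assumes "f \<in> Lq_space q" "q \<ge> 1"
  shows "(\<lambda>x. c * f x) \<in> Lq_space q" "Lq_norm q (\<lambda>x. c * f x) = norm c * Lq_norm q f"
  using assms by (auto simp: Lq_space_def Lq_norm_def norm_mult powr_mult powr_powr)

text \<open>A quasi-triangle inequality suffices below and spares Minkowski's inequality.\<close>

lemma Lq_add:
  assumes f: "f \<in> Lq_space q" and g: "g \<in> Lq_space q" and q: "q \<ge> 1"
  shows "(\<lambda>x. f x + g x) \<in> Lq_space q" "Lq_norm q (\<lambda>x. f x + g x) \<le> 4 * (Lq_norm q f + Lq_norm q g)"
proof -
  have [measurable]: "f \<in> borel_measurable borel" "g \<in> borel_measurable borel"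
    and fi: "integrable lborel (\<lambda>x. norm (f x) powr q)" and gi: "integrable lborel (\<lambda>x. norm (g x) powr q)"
    using f g by (auto simp: Lq_space_def)
  define I where "I = (LINT x|lborel. norm (f x) powr q)"
  define I' where "I' = (LINT x|lborel. norm (g x) powr q)"
  have I: "I \<ge> 0" "I' \<ge> 0" by (auto simp: I_def I'_def)
  have le: "norm (f x + g x) powr q \<le> 2 powr q * (norm (f x) powr q + norm (g x) powr q)" for x
  proof -
    have "norm (f x + g x) powr q \<le> (2 * max (norm (f x)) (norm (g x))) powr q"
      using q norm_triangle_ineq[of "f x" "g x"] by (intro powr_mono2) auto
    also have "\<dots> = 2 powr q * max (norm (f x)) (norm (g x)) powr q" by (subst powr_mult) auto
    also have "\<dots> \<le> 2 powr q * (norm (f x) powr q + norm (g x) powr q)"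
      by (intro mult_left_mono) (auto simp: max_def)
    finally show ?thesis .
  qed
  have ib: "integrable lborel (\<lambda>x. 2 powr q * (norm (f x) powr q + norm (g x) powr q))"
    by (intro integrable_mult_right Bochner_Integration.integrable_add fi gi)
  have i: "integrable lborel (\<lambda>x. norm (f x + g x) powr q)"
    by (rule Bochner_Integration.integrable_bound[OF ib]) (measurable, use order_trans[OF le abs_ge_self] in auto)
  then show "(\<lambda>x. f x + g x) \<in> Lq_space q" by (simp add: Lq_space_def)
  have "(LINT x|lborel. norm (f x + g x) powr q) \<le> 2 powr q * (I + I')"
  proof -
    have "(LINT x|lborel. norm (f x + g x) powr q) \<le> (LINT x|lborel. 2 powr q * (norm (f x) powr q + norm (g x) powr q))"
      by (intro integral_mono i ib le)
    then show ?thesis using fi gi by (simp add: I_def I'_def)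
  qed
  also have "\<dots> \<le> 2 powr q * (2 * max I I')" by (intro mult_left_mono) auto
  finally have "Lq_norm q (\<lambda>x. f x + g x) \<le> (2 powr q * (2 * max I I')) powr (1 / q)"
    unfolding Lq_norm_def using q by (intro powr_mono2) auto
  also have "\<dots> = 2 * (2 powr (1 / q) * max I I' powr (1 / q))"
    using I q by (simp add: powr_mult powr_powr)
  also have "\<dots> \<le> 2 * (2 * (I powr (1 / q) + I' powr (1 / q)))"
  proof (intro mult_left_mono mult_mono)
    have "(2::real) powr (1 / q) \<le> 2 powr 1" using q by (intro powr_mono) auto
    then show "(2::real) powr (1 / q) \<le> 2" by simp
  qed (auto simp: max_def)
  finally show "Lq_norm q (\<lambda>x. f x + g x) \<le> 4 * (Lq_norm q f + Lq_norm q g)"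
    by (simp add: Lq_norm_def I_def I'_def)
qed

lemma Lq_diff:
  assumes f: "f \<in> Lq_space q" and g: "g \<in> Lq_space q" and q: "q \<ge> 1"
  shows "(\<lambda>x. f x - g x) \<in> Lq_space q" "Lq_norm q (\<lambda>x. f x - g x) \<le> 4 * (Lq_norm q f + Lq_norm q g)"
  using Lq_add[OF f Lq_scale(1)[OF g q, of "-1"] q] Lq_scale(2)[OF g q, of "-1"] by auto

lemma sector_subset_cone:
  assumes "\<rho> > 0" "z \<in> sector (arctan \<rho>)"
  shows "0 < Re z" "\<bar>Im z\<bar> < \<rho> * Re z"
proof -
  have z: "z \<noteq> 0" "\<bar>Arg z\<bar> < arctan \<rho>" using assms(2) by (auto simp: sector_def)
  have pi: "\<bar>Arg z\<bar> < pi / 2" using z arctan_ubound[of \<rho>] by linarith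
  have c: "cos (Arg z) > 0" using pi by (intro cos_gt_zero_pi) auto
  have "z = rcis (cmod z) (Arg z)" by (simp add: rcis_cmod_Arg)
  then have e: "Re z = cmod z * cos (Arg z)" "Im z = cmod z * sin (Arg z)" by (metis Re_rcis, metis Im_rcis)
  show "0 < Re z" using c z by (simp add: e)
  have "tan \<bar>Arg z\<bar> < tan (arctan \<rho>)"
    using z pi arctan_ubound[of \<rho>] by (intro tan_monotone) auto
  then have "tan \<bar>Arg z\<bar> < \<rho>" by (simp add: tan_arctan)
  moreover have "\<bar>sin (Arg z)\<bar> = tan \<bar>Arg z\<bar> * cos (Arg z)"
  proof -
    have "\<bar>sin (Arg z)\<bar> = sin \<bar>Arg z\<bar>" using pi sin_ge_zero[of "\<bar>Arg z\<bar>"] by (cases "Arg z \<ge> 0") (auto simp: abs_if)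
    moreover have "cos \<bar>Arg z\<bar> = cos (Arg z)" by (simp add: abs_if)
    ultimately show ?thesis using c by (simp add: tan_def)
  qed
  ultimately have "\<bar>sin (Arg z)\<bar> < \<rho> * cos (Arg z)" using c by simp
  then show "\<bar>Im z\<bar> < \<rho> * Re z" using z by (simp add: e abs_mult)
qed

context smooth_kernel_semigroup
begin

text \<open>
  The kernels at complex times have uniform Schur bounds in the whole sector; the
  exponential factor admits semigroups with exponential growth.
\<close>

definition rescaled :: "real \<Rightarrow> complex \<Rightarrow> 'a \<Rightarrow> 'a \<Rightarrow> complex"
  where "rescaled \<omega> z x y = exp (of_real \<omega> * z) * kz z x y"

definition rescaled_op :: "real \<Rightarrow> complex \<Rightarrow> ('a \<Rightarrow> complex) \<Rightarrow> 'a \<Rightarrow> complex"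
  where "rescaled_op \<omega> z f = (if z = 0 then f else kernel_op (rescaled \<omega> z) f)"

lemma cone_nonzero: "z \<in> cone \<Longrightarrow> z \<noteq> 0"
  by (auto simp: cone_def)

lemma rescaled_schur:
  assumes "z \<in> cone"
  shows "schur_bounded (rescaled \<omega> z) (exp (\<omega> * Re z) * (2 * E))"
proof -
  have "schur_bounded (\<lambda>x y. exp (of_real \<omega> * z) * kz z x y) (exp (\<omega> * Re z) * (2 * E))"
    using cone_centre[OF assms] E_pos
    by (intro schur_scale[OF kz_schur[of "Re z" z]]) auto
  then show ?thesis by (simp add: rescaled_def[abs_def])
qed

lemma rescaled_op_bounded_linear:
  assumes "z \<in> insert 0 cone" "q \<ge> 1"
  shows "Lq_bounded_linear q (rescaled_op \<omega> z)"
proof (cases "z = 0")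
  case True
  then show ?thesis by (auto simp: rescaled_op_def Lq_bounded_linear_def intro!: exI[of _ 1])
next
  case False
  then have "rescaled_op \<omega> z = kernel_op (rescaled \<omega> z)" by (auto simp: rescaled_op_def)
  then show ?thesis using kernel_op_bounded_linear[OF rescaled_schur assms(2)] assms(1) False by auto
qed

lemma rescaled_op_compose:
  assumes z: "z \<in> insert 0 cone" and w: "w \<in> insert 0 cone" and q: "q \<ge> 1" and f: "f \<in> Lq_space q"
  shows "AE x in lborel. rescaled_op \<omega> (z + w) f x = rescaled_op \<omega> z (rescaled_op \<omega> w f) x"
proof (cases "z = 0 \<or> w = 0")
  case True
  then show ?thesis by (auto simp: rescaled_op_def)
next
  case False
  then have zw: "z \<in> cone" "w \<in> cone" using z w by auto
  have "Re (z + w) > 0" using zw by (simp add: cone_def)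
  then have "z + w \<noteq> 0" by (metis less_irrefl zero_complex.sel(1))
  moreover have "(LINT u|lborel. rescaled \<omega> z x u * rescaled \<omega> w u y) = rescaled \<omega> (z + w) x y" for x y
  proof -
    have "(LINT u|lborel. rescaled \<omega> z x u * rescaled \<omega> w u y) =
        (LINT u|lborel. (exp (of_real \<omega> * z) * exp (of_real \<omega> * w)) * (kz z x u * kz w u y))"
      by (simp add: rescaled_def mult_ac)
    also have "\<dots> = exp (of_real \<omega> * z) * exp (of_real \<omega> * w) * kz (z + w) x y"
      by (simp only: integral_mult_right_zero kz_compose[OF zw])
    finally show ?thesis by (simp add: rescaled_def distrib_left exp_add)
  qed
  ultimately show ?thesis
    using kernel_op_compose[OF rescaled_schur[OF zw(1)] rescaled_schur[OF zw(2)] q f] False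
    by (simp add: rescaled_op_def)
qed

text \<open>
  The product rule for \<open>exp (\<omega> z)\<close> and \<open>kz\<close>.  All error terms are kernels of small Schur norm, so
  by the Schur test the limit exists in operator norm.
\<close>

lemma rescaled_op_derivative:
  assumes z: "z \<in> cone" and q: "q \<ge> 1"
  shows "\<exists>S'. Lq_bounded_linear q S' \<and>
      (\<forall>\<eta>>0. \<forall>\<^sub>F w in at z within cone. \<forall>f\<in>Lq_space q.
        Lq_norm q (\<lambda>x. (rescaled_op \<omega> w f x - rescaled_op \<omega> z f x) / (w - z) - S' f x) \<le> \<eta> * Lq_norm q f)"
proof -
  define e where "e w = exp (of_real \<omega> * w)" for w :: complex
  define D where "D x y = e z * kz' z x y + (of_real \<omega> * e z) * kz z x y" for x y
  note cz = cone_centre[OF z]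
  define a where "a = 2 * E * (8 * \<Lambda> / Re z)\<^sup>2"
  define b where "b = 2 * E * (8 * \<Lambda> / Re z)"
  have ab: "a \<ge> 0" "b \<ge> 0" using E_pos \<Lambda>_ge_1 cz(1) by (auto simp: a_def b_def)
  note s1 = kz'_schur[OF z, folded b_def]
  note s2 = kz_schur[OF cz(1,2)]
  have Ds: "schur_bounded D ((norm (e z) * b + 1) + (norm (of_real \<omega> * e z) * (2 * E) + 1))"
    unfolding D_def using ab E_pos
    by (intro schur_add schur_scale[OF s1] schur_scale[OF s2]) (auto intro: add_nonneg_pos)
  have de: "(e has_field_derivative (of_real \<omega> * e z)) (at z)"
    unfolding e_def by (auto intro!: derivative_eq_intros)
  have "\<forall>\<^sub>F w in at z within cone. \<forall>f\<in>Lq_space q.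
        Lq_norm q (\<lambda>x. (rescaled_op \<omega> w f x - rescaled_op \<omega> z f x) / (w - z) - kernel_op D f x) \<le> \<eta> * Lq_norm q f"
    if \<eta>: "\<eta> > 0" for \<eta>
  proof -
    have t1: "((\<lambda>w. norm (e w) * (a * norm (w - z))) \<longlongrightarrow> norm (e z) * (a * norm (z - z))) (at z within cone)"
      unfolding e_def by (intro tendsto_intros)
    have t2: "((\<lambda>w. norm (e w - e z) * b) \<longlongrightarrow> norm (e z - e z) * b) (at z within cone)"
      unfolding e_def by (intro tendsto_intros)
    have t3: "((\<lambda>w. norm ((e w - e z) / (w - z) - of_real \<omega> * e z) * (2 * E)) \<longlongrightarrow>
        norm (of_real \<omega> * e z - of_real \<omega> * e z) * (2 * E)) (at z within cone)"
      using has_field_derivative_at_within[OF de, of cone] unfolding has_field_derivative_iff by (intro tendsto_intros)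
    have t4: "((\<lambda>w. norm (w - of_real (Re z))) \<longlongrightarrow> norm (z - of_real (Re z))) (at z within cone)"
      by (intro tendsto_intros)
    have ev: "\<forall>\<^sub>F w in at z within cone. norm (e w) * (a * norm (w - z)) < \<eta> / 3"
        "\<forall>\<^sub>F w in at z within cone. norm (e w - e z) * b < \<eta> / 3"
        "\<forall>\<^sub>F w in at z within cone. norm ((e w - e z) / (w - z) - of_real \<omega> * e z) * (2 * E) < \<eta> / 3"
        "\<forall>\<^sub>F w in at z within cone. norm (w - of_real (Re z)) < Re z / (8 * \<Lambda>)"
      using order_tendstoD(2)[OF t1, of "\<eta> / 3"] order_tendstoD(2)[OF t2, of "\<eta> / 3"]
        order_tendstoD(2)[OF t3, of "\<eta> / 3"] order_tendstoD(2)[OF t4 cz(2)] \<eta> by auto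
    have "\<forall>\<^sub>F w in at z within cone. w \<in> cone \<and> w \<noteq> z" by (auto simp: eventually_at_filter)
    with ev show ?thesis
    proof eventually_elim
      case (elim w)
      then have w: "w \<in> cone" "w \<noteq> z" by auto
      \<comment> \<open>The error in the product rule, split into three terms that each have Schur norm at most \<open>\<eta> / 3\<close>.\<close>
      define R where "R x y = (e w * ((kz w x y - kz z x y) / (w - z) - kz' z x y) + (e w - e z) * kz' z x y)
         + ((e w - e z) / (w - z) - of_real \<omega> * e z) * kz z x y" for x y
      have "schur_bounded R ((\<eta> / 3 + \<eta> / 3) + \<eta> / 3)"
        unfolding R_def
        by (intro schur_add schur_scale[OF kz_difference_quotient[OF z w(2) elim(4), folded a_def]] schur_scale[OF s1] schur_scale[OF s2])
          (use elim \<eta> in auto)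
      then have Rs: "schur_bounded R \<eta>" by simp
      have R: "R x y = (rescaled \<omega> w x y - rescaled \<omega> z x y) / (w - z) - D x y" for x y
        using w(2) by (simp add: R_def D_def rescaled_def e_def[symmetric] divide_simps) (simp add: algebra_simps)
      show ?case
      proof
        fix f :: "'a \<Rightarrow> complex" assume f: "f \<in> Lq_space q"
        have ae: "AE x in lborel. (rescaled_op \<omega> w f x - rescaled_op \<omega> z f x) / (w - z) - kernel_op D f x = kernel_op R f x"
          using kernel_op_integrable[OF rescaled_schur[OF w(1), of \<omega>] q f] kernel_op_integrable[OF rescaled_schur[OF z, of \<omega>] q f]
            kernel_op_integrable[OF Ds q f]
        proof eventually_elim
          case (elim x)
          have "kernel_op R f x = (LINT y|lborel. (rescaled \<omega> w x y * f y - rescaled \<omega> z x y * f y) / (w - z) - D x y * f y)"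
            unfolding kernel_op_def R by (simp add: diff_divide_distrib left_diff_distrib)
          also have "\<dots> = (kernel_op (rescaled \<omega> w) f x - kernel_op (rescaled \<omega> z) f x) / (w - z) - kernel_op D f x"
            using elim by (simp add: kernel_op_def)
          finally show ?case using cone_nonzero[OF w(1)] cone_nonzero[OF z] by (simp add: rescaled_op_def)
        qed
        have "(\<lambda>x. (rescaled_op \<omega> w f x - rescaled_op \<omega> z f x) / (w - z) - kernel_op D f x) \<in> borel_measurable lborel"
          using schur_test(2)[OF rescaled_schur[OF w(1), of \<omega>] q f] schur_test(2)[OF rescaled_schur[OF z, of \<omega>] q f]
            schur_test(2)[OF Ds q f] cone_nonzero[OF w(1)] cone_nonzero[OF z]
          by (auto simp: rescaled_op_def Lq_space_def)
        then show "Lq_norm q (\<lambda>x. (rescaled_op \<omega> w f x - rescaled_op \<omega> z f x) / (w - z) - kernel_op D f x) \<le> \<eta> * Lq_norm q f"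
          using Lq_norm_cong_AE(2)[OF schur_test(2)[OF Rs q f] _ ae] schur_test(3)[OF Rs q f] by simp
      qed
    qed
  qed
  then show ?thesis using kernel_op_bounded_linear[OF Ds q] by blast
qed

lemma rescaled_op_continuous:
  assumes z: "z \<in> cone" and q: "q \<ge> 1" and f: "f \<in> Lq_space q"
  shows "((\<lambda>w. Lq_norm q (\<lambda>x. rescaled_op \<omega> w f x - rescaled_op \<omega> z f x)) \<longlongrightarrow> 0) (at z within cone)"
proof -
  obtain S' where S': "Lq_bounded_linear q S'"
    "\<forall>\<eta>>0. \<forall>\<^sub>F w in at z within cone. \<forall>f\<in>Lq_space q.
        Lq_norm q (\<lambda>x. (rescaled_op \<omega> w f x - rescaled_op \<omega> z f x) / (w - z) - S' f x) \<le> \<eta> * Lq_norm q f"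
    using rescaled_op_derivative[OF z q] by blast
  define c where "c = 4 * (Lq_norm q f + Lq_norm q (S' f))"
  have S'f: "S' f \<in> Lq_space q" using S'(1) f by (simp add: Lq_bounded_linear_def)
  have "\<forall>\<^sub>F w in at z within cone. norm (Lq_norm q (\<lambda>x. rescaled_op \<omega> w f x - rescaled_op \<omega> z f x)) \<le> norm (w - z) * c"
  proof -
    have "\<forall>\<^sub>F w in at z within cone. w \<in> cone \<and> w \<noteq> z" by (auto simp: eventually_at_filter)
    with S'(2)[rule_format, OF zero_less_one] show ?thesis
    proof eventually_elim
      case (elim w)
      then have w: "w \<in> cone" "w \<noteq> z" by auto
      define d where "d x = (rescaled_op \<omega> w f x - rescaled_op \<omega> z f x) / (w - z) - S' f x" for x
      have op: "rescaled_op \<omega> v f \<in> Lq_space q" if "v \<in> cone" for v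
        using rescaled_op_bounded_linear[of v q \<omega>] that q f by (auto simp: Lq_bounded_linear_def)
      have d: "d \<in> Lq_space q"
        using Lq_diff(1)[OF Lq_scale(1)[OF Lq_diff(1)[OF op[OF w(1)] op[OF z] q] q, of "1 / (w - z)"] S'f q]
        by (simp add: d_def[abs_def])
      have e: "(\<lambda>x. rescaled_op \<omega> w f x - rescaled_op \<omega> z f x) = (\<lambda>x. (w - z) * (d x + S' f x))"
        using w(2) by (simp add: d_def)
      have "Lq_norm q (\<lambda>x. (w - z) * (d x + S' f x)) = norm (w - z) * Lq_norm q (\<lambda>x. d x + S' f x)"
        by (rule Lq_scale(2)[OF Lq_add(1)[OF d S'f q] q])
      also have "\<dots> \<le> norm (w - z) * (4 * (Lq_norm q d + Lq_norm q (S' f)))"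
        by (intro mult_left_mono Lq_add(2)[OF d S'f q]) auto
      also have "\<dots> \<le> norm (w - z) * c"
        using elim(1)[rule_format, OF f] unfolding c_def d_def[abs_def, symmetric] by (intro mult_left_mono) auto
      finally show ?case unfolding e using Lq_norm_nonneg[of q "\<lambda>x. (w - z) * (d x + S' f x)"] by simp
    qed
  qed
  moreover have "((\<lambda>w. norm (w - z) * c) \<longlongrightarrow> norm (z - z) * c) (at z within cone)" by (intro tendsto_intros)
  then have "((\<lambda>w. norm (w - z) * c) \<longlongrightarrow> 0) (at z within cone)" by simp
  ultimately show ?thesis by (rule Lim_null_comparison)
qed

text \<open>
  Strong continuity in the sector reduces to that along the positive axis by the uniform bound
  for the operators near \<open>0\<close>: compare \<open>f\<close> with \<open>S(s) f\<close> for a small \<open>s > 0\<close>, where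
  \<open>z \<mapsto> S(z + s) f\<close> is continuous.
\<close>

lemma rescaled_op_strongly_continuous:
  assumes q: "q \<ge> 1" and f: "f \<in> Lq_space q" and \<omega>: "\<omega> \<ge> 0"
    and real: "((\<lambda>t. Lq_norm q (\<lambda>x. rescaled_op \<omega> (of_real t) f x - f x)) \<longlongrightarrow> 0) (at_right 0)"
  shows "((\<lambda>z. Lq_norm q (\<lambda>x. rescaled_op \<omega> z f x - f x)) \<longlongrightarrow> 0) (at 0 within cone)"
proof (rule tendstoI)
  fix e :: real assume e: "e > 0"
  define B where "B = exp \<omega> * (2 * E)"
  have B: "B > 0" using E_pos by (simp add: B_def)
  \<comment> \<open>The factors \<open>4\<close> of the quasi-triangle inequality accumulate to less than \<open>64 (B + 1)\<close>.\<close>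
  define e1 where "e1 = e / 64 / (B + 1)"
  have e1: "e1 > 0" using e B by (simp add: e1_def)
  have "\<forall>\<^sub>F t in at_right 0. Lq_norm q (\<lambda>x. rescaled_op \<omega> (of_real t) f x - f x) < e1"
    using order_tendstoD(2)[OF real e1] .
  then obtain d where "d > 0" "\<And>t. 0 < t \<Longrightarrow> t < d \<Longrightarrow> Lq_norm q (\<lambda>x. rescaled_op \<omega> (of_real t) f x - f x) < e1"
    unfolding eventually_at_right_field by auto
  moreover from this(1) obtain s where "0 < s" "s < d" using dense by blast
  ultimately have s: "s > 0" "Lq_norm q (\<lambda>x. rescaled_op \<omega> (of_real s) f x - f x) < e1" by auto
  have sc: "complex_of_real s \<in> cone" using s(1) \<Lambda>_ge_1 by (simp add: cone_def)
  define g where "g = rescaled_op \<omega> (of_real s) f"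
  have op: "rescaled_op \<omega> v h \<in> Lq_space q" if "v \<in> cone" "h \<in> Lq_space q" for v h
    using rescaled_op_bounded_linear[of v q \<omega>] that q by (auto simp: Lq_bounded_linear_def)
  have g: "g \<in> Lq_space q" unfolding g_def by (rule op[OF sc f])
  have "((\<lambda>w. Lq_norm q (\<lambda>x. rescaled_op \<omega> w f x - g x)) \<longlongrightarrow> 0) (at (of_real s) within cone)"
    unfolding g_def by (rule rescaled_op_continuous[OF sc q f])
  moreover have "filterlim (\<lambda>z. z + of_real s) (at (complex_of_real s) within cone) (at 0 within cone)"
    unfolding filterlim_at
  proof (intro conjI)
    show "((\<lambda>z. z + of_real s) \<longlongrightarrow> complex_of_real s) (at 0 within cone)"
      using tendsto_add[OF tendsto_ident_at tendsto_const, of "of_real s" 0 cone] by simp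
    have "z + of_real s \<in> cone" if "z \<in> cone" for z
      using that s(1) \<Lambda>_ge_1 by (auto simp: cone_def field_simps)
    then show "\<forall>\<^sub>F z in at 0 within cone. z + of_real s \<in> cone \<and> z + of_real s \<noteq> of_real s"
      by (auto simp: eventually_at_filter)
  qed
  ultimately have "((\<lambda>z. Lq_norm q (\<lambda>x. rescaled_op \<omega> (z + of_real s) f x - g x)) \<longlongrightarrow> 0) (at 0 within cone)"
    by (rule filterlim_compose)
  then have ev1: "\<forall>\<^sub>F z in at 0 within cone. Lq_norm q (\<lambda>x. rescaled_op \<omega> (z + of_real s) f x - g x) < e1"
    using e1 by (rule order_tendstoD(2))
  have ev2: "\<forall>\<^sub>F z in at 0 within cone. z \<in> cone \<and> norm z < 1"
    by (auto simp: eventually_at intro!: exI[of _ 1])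
  show "\<forall>\<^sub>F z in at 0 within cone. dist (Lq_norm q (\<lambda>x. rescaled_op \<omega> z f x - f x)) 0 < e"
    using ev1 ev2
  proof eventually_elim
    case (elim z)
    then have z: "z \<in> cone" and nz: "norm z < 1" by auto
    define h where "h x = f x - g x" for x
    have h: "h \<in> Lq_space q" unfolding h_def by (rule Lq_diff(1)[OF f g q])
    have hn: "Lq_norm q h < e1"
    proof -
      have "Lq_norm q h = Lq_norm q (\<lambda>x. g x - f x)" by (simp add: Lq_norm_def h_def norm_minus_commute)
      then show ?thesis using s(2) by (simp add: g_def)
    qed
    have Szh: "Lq_norm q (rescaled_op \<omega> z h) \<le> B * e1"
    proof -
      have "Lq_norm q (rescaled_op \<omega> z h) \<le> (exp (\<omega> * Re z) * (2 * E)) * Lq_norm q h"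
        using schur_test(3)[OF rescaled_schur[OF z, of \<omega>] q h] cone_nonzero[OF z] by (simp add: rescaled_op_def)
      also have "\<dots> \<le> B * e1"
      proof (intro mult_mono)
        have "\<omega> * Re z \<le> \<omega> * 1" using \<omega> nz complex_Re_le_cmod[of z] by (intro mult_left_mono) auto
        then show "exp (\<omega> * Re z) * (2 * E) \<le> B" using E_pos by (simp add: B_def)
      qed (use hn B Lq_norm_nonneg in auto)
      finally show ?thesis .
    qed
    define u where "u x = rescaled_op \<omega> (z + of_real s) f x - g x" for x
    define v where "v x = g x - f x" for x
    have zs: "z + of_real s \<in> cone" using z s(1) \<Lambda>_ge_1 by (auto simp: cone_def field_simps)
    have u: "u \<in> Lq_space q" unfolding u_def by (rule Lq_diff(1)[OF op[OF zs f] g q])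
    have v: "v \<in> Lq_space q" unfolding v_def by (rule Lq_diff(1)[OF g f q])
    have vn: "Lq_norm q v < e1" using s(2) by (simp add: v_def[abs_def] g_def)
    have un: "Lq_norm q u < e1" using elim(1) by (simp add: u_def[abs_def])
    have lin: "AE x in lborel. rescaled_op \<omega> z (\<lambda>y. f y + (-1) * g y) x = rescaled_op \<omega> z f x + (-1) * rescaled_op \<omega> z g x"
    proof -
      have L: "Lq_bounded_linear q (rescaled_op \<omega> z)" using rescaled_op_bounded_linear z q by blast
      have a1: "AE x in lborel. rescaled_op \<omega> z (\<lambda>y. f y + (-1) * g y) x = rescaled_op \<omega> z f x + rescaled_op \<omega> z (\<lambda>y. (-1) * g y) x"
        by (rule L[unfolded Lq_bounded_linear_def, THEN conjunct2, THEN conjunct1, rule_format, OF f Lq_scale(1)[OF g q]])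
      have a2: "AE x in lborel. rescaled_op \<omega> z (\<lambda>y. (-1) * g y) x = (-1) * rescaled_op \<omega> z g x"
        by (rule L[unfolded Lq_bounded_linear_def, THEN conjunct2, THEN conjunct2, THEN conjunct1, rule_format, OF g])
      show ?thesis using a1 a2 by eventually_elim simp
    qed
    have comp: "AE x in lborel. rescaled_op \<omega> (z + of_real s) f x = rescaled_op \<omega> z g x"
      unfolding g_def using z sc by (intro rescaled_op_compose[OF _ _ q f]) auto
    have ae: "AE x in lborel. rescaled_op \<omega> z f x - f x = (rescaled_op \<omega> z h x + u x) + v x"
      using lin comp by eventually_elim (simp add: h_def[abs_def] u_def v_def)
    have sum: "(\<lambda>x. rescaled_op \<omega> z h x + u x) \<in> Lq_space q" by (rule Lq_add(1)[OF op[OF z h] u q])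
    have "(\<lambda>x. rescaled_op \<omega> z f x - f x) \<in> borel_measurable lborel"
      using Lq_diff(1)[OF op[OF z f] f q] by (simp add: Lq_space_def)
    then have "Lq_norm q (\<lambda>x. rescaled_op \<omega> z f x - f x) = Lq_norm q (\<lambda>x. (rescaled_op \<omega> z h x + u x) + v x)"
      by (rule Lq_norm_cong_AE(2)[OF Lq_add(1)[OF sum v q] _ ae])
    also have "\<dots> \<le> 4 * (Lq_norm q (\<lambda>x. rescaled_op \<omega> z h x + u x) + Lq_norm q v)" by (rule Lq_add(2)[OF sum v q])
    also have "\<dots> \<le> 4 * (4 * (Lq_norm q (rescaled_op \<omega> z h) + Lq_norm q u) + Lq_norm q v)"
      using Lq_add(2)[OF op[OF z h] u q] by simp
    also have "\<dots> \<le> 4 * (4 * (B * e1 + e1) + e1)" using Szh un vn by simp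
    also have "\<dots> \<le> 32 * ((B + 1) * e1)" using e1 B by (simp add: algebra_simps)
    also have "(B + 1) * e1 = e / 64"
    proof -
      have "(B + 1) * (d / (B + 1)) = d" for d using B by simp
      then show ?thesis unfolding e1_def .
    qed
    also have "32 * (e / 64) = e / 2" by simp
    also have "\<dots> < e" using e by simp
    finally show ?case by (simp add: dist_real_def abs_of_nonneg[OF Lq_norm_nonneg])
  qed
qed

theorem analytic_semigroup:
  assumes q: "q \<ge> 1" and \<omega>: "\<omega> \<ge> 0"
    and P0: "\<And>f x. P 0 f x = f x"
    and Pt: "\<And>t f x. t > 0 \<Longrightarrow> P t f x = kernel_op (\<lambda>x y. of_real (exp (\<omega> * t) * k t x y)) f x"
    and cont: "\<And>f. f \<in> Lq_space q \<Longrightarrow> ((\<lambda>t. Lq_norm q (\<lambda>x. P t f x - f x)) \<longlongrightarrow> 0) (at_right 0)"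
  shows "analytic_semigroup_on_Lq q P"
proof -
  define \<rho> where "\<rho> = 1 / (8 * \<Lambda>)"
  have \<rho>: "\<rho> > 0" using \<Lambda>_ge_1 by (simp add: \<rho>_def)
  define \<psi> where "\<psi> = arctan \<rho>"
  have \<psi>: "0 < \<psi>" "\<psi> \<le> pi / 2" using \<rho> arctan_ubound[of \<rho>] by (auto simp: \<psi>_def)
  have sub: "sector \<psi> \<subseteq> cone"
    using sector_subset_cone[OF \<rho>] by (auto simp: cone_def \<psi>_def \<rho>_def)
  have sub0: "z \<in> insert 0 cone" if "z \<in> insert 0 (sector \<psi>)" for z using that sub by auto
  have tc: "complex_of_real t \<in> cone" if "t > 0" for t using that \<Lambda>_ge_1 by (simp add: cone_def)
  have eq: "rescaled_op \<omega> (of_real t) f x = P t f x" if "t \<ge> 0" for t f x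
  proof (cases "t = 0")
    case True
    then show ?thesis by (simp add: rescaled_op_def P0)
  next
    case False
    then have t: "t > 0" using that by simp
    have "rescaled \<omega> (of_real t) x y = of_real (exp (\<omega> * t) * k t x y)" for x y
      by (simp add: rescaled_def kz_real[OF t] exp_of_real flip: of_real_mult)
    then show ?thesis using t by (simp add: rescaled_op_def Pt kernel_op_def)
  qed
  have mem: "P t f \<in> Lq_space q" if "t \<ge> 0" "f \<in> Lq_space q" for t f
  proof -
    have "of_real t \<in> insert 0 cone" using tc that by (cases "t = 0") auto
    then have "rescaled_op \<omega> (of_real t) f \<in> Lq_space q"
      using rescaled_op_bounded_linear[OF _ q, of "of_real t" \<omega>] that by (auto simp: Lq_bounded_linear_def)
    moreover have "rescaled_op \<omega> (of_real t) f = P t f" using eq that by auto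
    ultimately show ?thesis by simp
  qed
  have hol: "Lq_op_holomorphic_on q (rescaled_op \<omega>) (sector \<psi>)"
    unfolding Lq_op_holomorphic_on_def
  proof
    fix z assume "z \<in> sector \<psi>"
    then have z: "z \<in> cone" using sub by auto
    obtain S' where S': "Lq_bounded_linear q S'"
      "\<And>\<eta>. \<eta> > 0 \<Longrightarrow> \<forall>\<^sub>F w in at z within cone. \<forall>f\<in>Lq_space q.
        Lq_norm q (\<lambda>x. (rescaled_op \<omega> w f x - rescaled_op \<omega> z f x) / (w - z) - S' f x) \<le> \<eta> * Lq_norm q f"
      using rescaled_op_derivative[OF z q] by blast
    have "at z within sector \<psi> \<le> at z within cone" by (rule at_le[OF sub])
    then show "\<exists>S'. Lq_bounded_linear q S' \<and> (\<forall>\<eta>>0. \<forall>\<^sub>F w in at z within sector \<psi>. \<forall>f\<in>Lq_space q.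
        Lq_norm q (\<lambda>x. (rescaled_op \<omega> w f x - rescaled_op \<omega> z f x) / (w - z) - S' f x) \<le> \<eta> * Lq_norm q f)"
      using S' filter_leD by (intro exI[of _ S']) blast
  qed
  have sc: "((\<lambda>z. Lq_norm q (\<lambda>x. rescaled_op \<omega> z f x - f x)) \<longlongrightarrow> 0) (at 0 within sector \<psi>)" if f: "f \<in> Lq_space q" for f
  proof (rule tendsto_within_subset[OF rescaled_op_strongly_continuous[OF q f \<omega>] sub])
    have "\<forall>\<^sub>F t in at_right 0. Lq_norm q (\<lambda>x. P t f x - f x) = Lq_norm q (\<lambda>x. rescaled_op \<omega> (of_real t) f x - f x)"
      using eventually_at_right_less[of "0::real"] by eventually_elim (simp add: eq)
    then show "((\<lambda>t. Lq_norm q (\<lambda>x. rescaled_op \<omega> (of_real t) f x - f x)) \<longlongrightarrow> 0) (at_right 0)"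
      by (rule Lim_transform_eventually[OF cont[OF f]])
  qed
  show ?thesis
    unfolding analytic_semigroup_on_Lq_def
  proof (intro exI[of _ \<psi>] exI[of _ "rescaled_op \<omega>"] conjI allI impI ballI)
    show "0 < \<psi>" "\<psi> \<le> pi / 2" by (rule \<psi>)+
    show "P t f \<in> Lq_space q" if "0 \<le> t" "f \<in> Lq_space q" for t f using mem that .
    show "AE x in lborel. rescaled_op \<omega> (of_real t) f x = P t f x" if "0 \<le> t" for t f using eq that by simp
    show "Lq_bounded_linear q (rescaled_op \<omega> z)" if "z \<in> insert 0 (sector \<psi>)" for z
      by (rule rescaled_op_bounded_linear[OF sub0[OF that] q])
    show "Lq_op_holomorphic_on q (rescaled_op \<omega>) (sector \<psi>)" by (rule hol)
    show "AE x in lborel. rescaled_op \<omega> 0 f x = f x" for f by (simp add: rescaled_op_def)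
    show "AE x in lborel. rescaled_op \<omega> (z + w) f x = rescaled_op \<omega> z (rescaled_op \<omega> w f) x"
      if "z \<in> insert 0 (sector \<psi>)" "w \<in> insert 0 (sector \<psi>)" "f \<in> Lq_space q" for z w f
      by (rule rescaled_op_compose[OF sub0[OF that(1)] sub0[OF that(2)] q that(3)])
    show "((\<lambda>z. Lq_norm q (\<lambda>x. rescaled_op \<omega> z f x - f x)) \<longlongrightarrow> 0) (at 0 within sector \<psi>)" if "f \<in> Lq_space q" for f
      by (rule sc[OF that])
  qed
qed

end

section \<open>Strong continuity of the heat semigroup on \<open>L\<^sup>q\<close>\<close>

context heat_kernel_setting
begin

definition A0 :: real where "A0 = max 1 (cT 1 * C\<^sub>G)"

lemma A0_ge_1: "A0 \<ge> 1" by (simp add: A0_def)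

lemma schur_bounded_by_G:
  assumes t: "0 < t" and meas: "(\<lambda>xy. K (fst xy) (snd xy)) \<in> borel_measurable (borel \<Otimes>\<^sub>M borel)"
    and le: "\<And>x y. x \<noteq> y \<Longrightarrow> norm (K x y) \<le> c * G t (x - y)" and c: "0 \<le> c" "c * C\<^sub>G / t \<le> m" "0 < m"
  shows "schur_bounded K m"
  unfolding schur_bounded_def
proof (intro conjI allI)
  have le': "ennreal (norm (K x y)) \<le> ennreal c * ennreal (G t (x - y))" if "x \<noteq> y" for x y
    using ennreal_leI[OF le[OF that]] c G_nonneg[OF t, of "x - y"] by (simp add: ennreal_mult)
  have tot: "ennreal c * ennreal (C\<^sub>G / t) \<le> ennreal m"
    using t c C\<^sub>G_pos by (subst ennreal_mult[symmetric]) (auto intro: ennreal_leI)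
  show "(\<integral>\<^sup>+y. ennreal (norm (K x y)) \<partial>lborel) \<le> ennreal m" for x
  proof -
    have "AE y in lborel. ennreal (norm (K x y)) \<le> ennreal c * ennreal (G t (x - y))"
      using AE_lborel_singleton[of x] by eventually_elim (rule le', simp)
    then have "(\<integral>\<^sup>+y. ennreal (norm (K x y)) \<partial>lborel) \<le> (\<integral>\<^sup>+y. ennreal c * ennreal (G t (x - y)) \<partial>lborel)"
      by (rule nn_integral_mono_AE)
    also have "\<dots> = ennreal c * (\<integral>\<^sup>+y. ennreal (G t (x - y)) \<partial>lborel)" by (intro nn_integral_cmult) measurable
    also have "\<dots> \<le> ennreal c * ennreal (C\<^sub>G / t)" by (intro mult_left_mono nn_integral_G_row t) auto
    finally show ?thesis using tot by (rule order_trans)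
  qed
  show "(\<integral>\<^sup>+x. ennreal (norm (K x y)) \<partial>lborel) \<le> ennreal m" for y
  proof -
    have "AE x in lborel. ennreal (norm (K x y)) \<le> ennreal c * ennreal (G t (x - y))"
      using AE_lborel_singleton[of y] by eventually_elim (rule le')
    then have "(\<integral>\<^sup>+x. ennreal (norm (K x y)) \<partial>lborel) \<le> (\<integral>\<^sup>+x. ennreal c * ennreal (G t (x - y)) \<partial>lborel)"
      by (rule nn_integral_mono_AE)
    also have "\<dots> = ennreal c * (\<integral>\<^sup>+x. ennreal (G t (x - y)) \<partial>lborel)" by (intro nn_integral_cmult) measurable
    also have "\<dots> \<le> ennreal c * ennreal (C\<^sub>G / t)" by (intro mult_left_mono nn_integral_G_column t) auto
    finally show ?thesis using tot by (rule order_trans)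
  qed
qed (fact c(3), fact meas)

lemma p_schur_small:
  assumes t: "0 < t" "t \<le> 1"
  shows "schur_bounded (p t) A0"
proof (rule schur_bounded_by_G[OF t(1) p_measurable[OF t(1)]])
  show "norm (p t x y) \<le> cT 1 * t * G t (x - y)" for x y
    using p_upper[OF t, of x y] p_nonneg[OF t(1), of x y] by simp
qed (use t cT_pos[of 1] in \<open>auto simp: A0_def\<close>)

definition Tt :: "real \<Rightarrow> ('a \<Rightarrow> complex) \<Rightarrow> 'a \<Rightarrow> complex"
  where "Tt t f = kernel_op (\<lambda>x y. complex_of_real (p t x y)) f"

lemma Tt_schur:
  assumes "0 < t" "t \<le> 1" "\<gamma> \<ge> 1" "f \<in> Lq_space \<gamma>"
  shows "Tt t f \<in> Lq_space \<gamma>" "Lq_norm \<gamma> (Tt t f) \<le> A0 * Lq_norm \<gamma> f"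
    "AE x in lborel. integrable lborel (\<lambda>y. complex_of_real (p t x y) * f y)"
  unfolding Tt_def
  using schur_test(2,3)[OF schur_of_real[OF p_schur_small[OF assms(1,2)]] assms(3,4)]
    kernel_op_integrable[OF schur_of_real[OF p_schur_small[OF assms(1,2)]] assms(3,4)] by blast+

definition strongly_continuous :: "real \<Rightarrow> ('a \<Rightarrow> complex) \<Rightarrow> bool"
  where "strongly_continuous \<gamma> f \<longleftrightarrow> ((\<lambda>t. Lq_norm \<gamma> (\<lambda>x. Tt t f x - f x)) \<longlongrightarrow> 0) (at_right 0)"

lemma strongly_continuous_add:
  assumes \<gamma>: "\<gamma> \<ge> 1" and f: "f \<in> Lq_space \<gamma>" "strongly_continuous \<gamma> f" and g: "g \<in> Lq_space \<gamma>" "strongly_continuous \<gamma> g"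
  shows "strongly_continuous \<gamma> (\<lambda>x. f x + g x)"
  unfolding strongly_continuous_def
proof (rule Lim_null_comparison)
  have "((\<lambda>t. 4 * (Lq_norm \<gamma> (\<lambda>x. Tt t f x - f x) + Lq_norm \<gamma> (\<lambda>x. Tt t g x - g x))) \<longlongrightarrow> 4 * (0 + 0)) (at_right 0)"
    using f(2) g(2) unfolding strongly_continuous_def by (intro tendsto_intros)
  then show "((\<lambda>t. 4 * (Lq_norm \<gamma> (\<lambda>x. Tt t f x - f x) + Lq_norm \<gamma> (\<lambda>x. Tt t g x - g x))) \<longlongrightarrow> 0) (at_right 0)" by simp
  show "\<forall>\<^sub>F t in at_right 0. norm (Lq_norm \<gamma> (\<lambda>x. Tt t (\<lambda>x. f x + g x) x - (f x + g x))) \<le>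
      4 * (Lq_norm \<gamma> (\<lambda>x. Tt t f x - f x) + Lq_norm \<gamma> (\<lambda>x. Tt t g x - g x))"
    using eventually_at_right_1
  proof eventually_elim
    case (elim t)
    then have t: "0 < t" "t \<le> 1" by auto
    have df: "(\<lambda>x. Tt t f x - f x) \<in> Lq_space \<gamma>" by (rule Lq_diff(1)[OF Tt_schur(1)[OF t \<gamma> f(1)] f(1) \<gamma>])
    have dg: "(\<lambda>x. Tt t g x - g x) \<in> Lq_space \<gamma>" by (rule Lq_diff(1)[OF Tt_schur(1)[OF t \<gamma> g(1)] g(1) \<gamma>])
    note fg = Lq_add(1)[OF f(1) g(1) \<gamma>]
    have ae: "AE x in lborel. Tt t (\<lambda>x. f x + g x) x - (f x + g x) = (Tt t f x - f x) + (Tt t g x - g x)"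
      using Tt_schur(3)[OF t \<gamma> f(1)] Tt_schur(3)[OF t \<gamma> g(1)]
      by eventually_elim (simp add: Tt_def kernel_op_def distrib_left)
    have "(\<lambda>x. Tt t (\<lambda>x. f x + g x) x - (f x + g x)) \<in> borel_measurable lborel"
      using Lq_diff(1)[OF Tt_schur(1)[OF t \<gamma> fg] fg \<gamma>] by (simp add: Lq_space_def)
    then have "Lq_norm \<gamma> (\<lambda>x. Tt t (\<lambda>x. f x + g x) x - (f x + g x)) = Lq_norm \<gamma> (\<lambda>x. (Tt t f x - f x) + (Tt t g x - g x))"
      by (rule Lq_norm_cong_AE(2)[OF Lq_add(1)[OF df dg \<gamma>] _ ae])
    also have "\<dots> \<le> 4 * (Lq_norm \<gamma> (\<lambda>x. Tt t f x - f x) + Lq_norm \<gamma> (\<lambda>x. Tt t g x - g x))"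
      by (rule Lq_add(2)[OF df dg \<gamma>])
    finally show ?case by (simp add: abs_of_nonneg[OF Lq_norm_nonneg])
  qed
qed

text \<open>Uniform boundedness of the operators makes strong continuity a closed property.\<close>

lemma strongly_continuous_closed:
  assumes \<gamma>: "\<gamma> \<ge> 1" and f: "f \<in> Lq_space \<gamma>"
    and approx: "\<And>e. e > 0 \<Longrightarrow> \<exists>g\<in>Lq_space \<gamma>. Lq_norm \<gamma> (\<lambda>x. f x - g x) < e \<and> strongly_continuous \<gamma> g"
  shows "strongly_continuous \<gamma> f"
  unfolding strongly_continuous_def
proof (rule tendstoI)
  fix e :: real assume e: "e > 0"
  \<comment> \<open>The quasi-triangle inequality is used twice, so the error is at most \<open>36 A0 e1\<close>.\<close>
  define e1 where "e1 = e / (64 * A0)"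
  have e1: "e1 > 0" using e A0_ge_1 by (simp add: e1_def)
  obtain g where g: "g \<in> Lq_space \<gamma>" "Lq_norm \<gamma> (\<lambda>x. f x - g x) < e1" "strongly_continuous \<gamma> g"
    using approx[OF e1] by blast
  define h where "h x = f x - g x" for x
  have h: "h \<in> Lq_space \<gamma>" unfolding h_def by (rule Lq_diff(1)[OF f g(1) \<gamma>])
  have hn: "Lq_norm \<gamma> h < e1" using g(2) by (simp add: h_def[abs_def])
  have "\<forall>\<^sub>F t in at_right 0. Lq_norm \<gamma> (\<lambda>x. Tt t g x - g x) < e1"
    using g(3) e1 unfolding strongly_continuous_def by (rule order_tendstoD(2))
  then show "\<forall>\<^sub>F t in at_right 0. dist (Lq_norm \<gamma> (\<lambda>x. Tt t f x - f x)) 0 < e"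
    using eventually_at_right_1
  proof eventually_elim
    case (elim t)
    then have t: "0 < t" "t \<le> 1" by auto
    have dg: "(\<lambda>x. Tt t g x - g x) \<in> Lq_space \<gamma>" by (rule Lq_diff(1)[OF Tt_schur(1)[OF t \<gamma> g(1)] g(1) \<gamma>])
    have dh: "(\<lambda>x. Tt t h x - h x) \<in> Lq_space \<gamma>" by (rule Lq_diff(1)[OF Tt_schur(1)[OF t \<gamma> h] h \<gamma>])
    have ae: "AE x in lborel. Tt t f x - f x = (Tt t h x - h x) + (Tt t g x - g x)"
      using Tt_schur(3)[OF t \<gamma> f] Tt_schur(3)[OF t \<gamma> g(1)]
      by eventually_elim (simp add: Tt_def kernel_op_def h_def right_diff_distrib)
    have "(\<lambda>x. Tt t f x - f x) \<in> borel_measurable lborel"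
      using Lq_diff(1)[OF Tt_schur(1)[OF t \<gamma> f] f \<gamma>] by (simp add: Lq_space_def)
    then have "Lq_norm \<gamma> (\<lambda>x. Tt t f x - f x) = Lq_norm \<gamma> (\<lambda>x. (Tt t h x - h x) + (Tt t g x - g x))"
      by (rule Lq_norm_cong_AE(2)[OF Lq_add(1)[OF dh dg \<gamma>] _ ae])
    also have "\<dots> \<le> 4 * (Lq_norm \<gamma> (\<lambda>x. Tt t h x - h x) + Lq_norm \<gamma> (\<lambda>x. Tt t g x - g x))"
      by (rule Lq_add(2)[OF dh dg \<gamma>])
    also have "\<dots> \<le> 4 * (4 * (Lq_norm \<gamma> (Tt t h) + Lq_norm \<gamma> h) + Lq_norm \<gamma> (\<lambda>x. Tt t g x - g x))"
      using Lq_diff(2)[OF Tt_schur(1)[OF t \<gamma> h] h \<gamma>] by simp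
    also have "\<dots> \<le> 4 * (4 * (A0 * e1 + e1) + e1)"
    proof -
      have "Lq_norm \<gamma> (Tt t h) \<le> A0 * Lq_norm \<gamma> h" by (rule Tt_schur(2)[OF t \<gamma> h])
      also have "\<dots> \<le> A0 * e1" using hn A0_ge_1 by (intro mult_left_mono) auto
      finally show ?thesis using hn elim(1) by simp
    qed
    also have "\<dots> \<le> 36 * (A0 * e1)"
      using mult_right_mono[OF A0_ge_1, of e1] e1 by simp
    also have "\<dots> < e" using e A0_ge_1 by (simp add: e1_def)
    finally show ?case by (simp add: dist_real_def abs_of_nonneg[OF Lq_norm_nonneg])
  qed
qed

lemma Lq_space_1: "f \<in> Lq_space 1 \<longleftrightarrow> integrable lborel f"
proof
  assume "integrable lborel f"
  then show "f \<in> Lq_space 1"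
    using borel_measurable_integrable[of lborel f] integrable_norm[of lborel f] by (simp add: Lq_space_def)
next
  assume "f \<in> Lq_space 1"
  then have "f \<in> borel_measurable lborel" "integrable lborel (\<lambda>x. norm (f x))" by (auto simp: Lq_space_def)
  then show "integrable lborel f" by (simp add: integrable_norm_iff)
qed

lemma Lq_norm_1: "Lq_norm 1 f = (LINT x|lborel. norm (f x))"
  by (simp add: Lq_norm_def)

text \<open>
  For a continuous function with compact support, uniform convergence on bounded sets is
  complemented by the decay of \<open>P\<^sub>t h\<close> away from the support, which is uniform for small times.
\<close>

lemma strongly_continuous_bump:
  fixes h :: "'a \<Rightarrow> real"
  assumes uc: "uniformly_continuous_on UNIV h" and h1: "\<And>x. \<bar>h x\<bar> \<le> 1"
    and supp: "\<And>x. norm x > R \<Longrightarrow> h x = 0" and R: "R > 0"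
  shows "strongly_continuous 1 (\<lambda>x. complex_of_real (h x))"
proof -
  have hb: "bounded (range h)" using h1 by (auto simp: bounded_iff)
  have hm [measurable]: "h \<in> borel_measurable borel"
    using uc by (intro borel_measurable_continuous_onI uniformly_continuous_imp_continuous)
  have eq: "Lq_norm 1 (\<lambda>x. Tt t (\<lambda>x. complex_of_real (h x)) x - complex_of_real (h x)) = (LINT x|lborel. \<bar>Pt t h x - h x\<bar>)" for t
    by (simp add: Lq_norm_1 Tt_def kernel_op_def Pt_def flip: of_real_mult of_real_diff)
  define V where "V = measure lborel (cball (0::'a) R)"
  define c where "c = cT 1 * 2 ^ (DIM('a) + 2) * V"
  have c: "c \<ge> 0" using cT_pos[of 1] by (simp add: c_def V_def)
  \<comment> \<open>An integrable majorant of \<open>|P\<^sub>t h - h|\<close> for \<open>t \<le> 1\<close>.\<close>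
  define w where "w x = 2 * indicator (cball 0 (2 * R)) x + c * (H (norm x) * indicator {z. R < norm z} x)" for x :: 'a
  have at: "at 0 within {0<..1::real} = at_right 0"
    by (rule at_within_nhd[where S="{..<1}"]) auto
  have far: "\<bar>Pt t h x\<bar> \<le> c * H (norm x)" if t: "0 < t" "t \<le> 1" and x: "norm x > 2 * R" for t x
  proof -
    have le: "\<bar>p t x y * h y\<bar> \<le> (cT 1 * H (norm x / 2)) * indicator (cball 0 R) y" for y
    proof (cases "norm y \<le> R")
      case True
      have n: "norm x / 2 \<le> norm (x - y)" using norm_triangle_ineq2[of x y] x True by simp
      then have "x \<noteq> y" using x R by auto
      then have "\<bar>p t x y\<bar> \<le> cT 1 * t * H (norm (x - y))" by (intro p_off_diagonal t)
      also have "\<dots> \<le> cT 1 * 1 * H (norm x / 2)"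
        using t n x R cT_pos[of 1] by (intro mult_mono H_antimono) auto
      finally have "\<bar>p t x y\<bar> * \<bar>h y\<bar> \<le> (cT 1 * H (norm x / 2)) * 1" using h1[of y] cT_pos[of 1] by (intro mult_mono) auto
      then show ?thesis using True by (simp add: abs_mult)
    next
      case False
      then show ?thesis using supp[of y] by simp
    qed
    have "\<bar>Pt t h x\<bar> \<le> (LINT y|lborel. \<bar>p t x y * h y\<bar>)" unfolding Pt_def by (rule integral_abs_bound)
    also have "\<dots> \<le> (LINT y|lborel. (cT 1 * H (norm x / 2)) * indicator (cball (0::'a) R) y)"
      by (intro integral_mono le integrable_abs integrable_mult_right integrable_p_times[OF t(1) hm h1])
        (use R in \<open>auto simp: emeasure_cball\<close>)
    also have "\<dots> = cT 1 * V * H (norm x / 2)" by (simp add: V_def)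
    also have "\<dots> \<le> cT 1 * V * (2 ^ (DIM('a) + 2) * H (norm x))"
      using cT_pos[of 1] x R by (intro mult_left_mono H_half) (auto simp: V_def)
    finally show ?thesis by (simp add: c_def mult_ac)
  qed
  have "((\<lambda>t. LINT x|lborel. \<bar>Pt t h x - h x\<bar>) \<longlongrightarrow> integral\<^sup>L lborel (\<lambda>x::'a. 0::real)) (at 0 within {0<..1})"
  proof (rule tendsto_integral_at_within[where w=w])
    show "(\<lambda>x. \<bar>Pt t h x - h x\<bar>) \<in> borel_measurable lborel" if "t \<in> {0<..1}" for t
      using borel_measurable_continuous_onI[OF Pt_continuous_space[OF _ hm h1, of t]] that by simp
    show "integrable lborel w" unfolding w_def
      by (intro Bochner_Integration.integrable_add integrable_mult_right integrable_H_tail R)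
        (use R in \<open>auto simp: emeasure_cball\<close>)
    show "AE x in lborel. ((\<lambda>t. \<bar>Pt t h x - h x\<bar>) \<longlongrightarrow> 0) (at 0 within {0<..1})"
    proof (rule AE_I2)
      fix x :: 'a
      have "((\<lambda>t. Pt t h x) \<longlongrightarrow> h x) (at_right 0)"
        using tendsto_uniform_limitI[OF initial_condition[OF hb uc], of x] by (simp add: Pt_def)
      then have "((\<lambda>t. \<bar>Pt t h x - h x\<bar>) \<longlongrightarrow> \<bar>h x - h x\<bar>) (at_right 0)" by (intro tendsto_intros)
      then show "((\<lambda>t. \<bar>Pt t h x - h x\<bar>) \<longlongrightarrow> 0) (at 0 within {0<..1})" by (simp add: at)
    qed
    show "AE x in lborel. norm \<bar>Pt t h x - h x\<bar> \<le> w x" if "t \<in> {0<..1}" for t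
    proof (rule AE_I2)
      fix x :: 'a
      have t: "0 < t" "t \<le> 1" using that by auto
      show "norm \<bar>Pt t h x - h x\<bar> \<le> w x"
      proof (cases "norm x > 2 * R")
        case True
        then have "h x = 0" using R by (intro supp) auto
        then show ?thesis using far[OF t True] True R by (simp add: w_def)
      next
        case False
        have "\<bar>Pt t h x\<bar> \<le> 1"
          using Pt_le[OF hb uc _ t(1), of 1 x] Pt_ge[OF hb uc _ t(1), of "- 1" x] h1
          by (auto simp: abs_le_iff minus_le_iff)
        then have "\<bar>Pt t h x - h x\<bar> \<le> 2" using h1[of x] by linarith
        moreover have "0 \<le> c * (H (norm x) * indicator {z. R < norm z} x)" using c by simp
        ultimately show ?thesis using False by (simp add: w_def)
      qed
    qed
  qed auto
  then show ?thesis unfolding strongly_continuous_def eq by (simp add: at)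
qed

lemma strongly_continuous_scale:
  assumes \<gamma>: "\<gamma> \<ge> 1" and f: "f \<in> Lq_space \<gamma>" "strongly_continuous \<gamma> f"
  shows "strongly_continuous \<gamma> (\<lambda>x. c * f x)"
proof -
  have "Lq_norm \<gamma> (\<lambda>x. Tt t (\<lambda>x. c * f x) x - c * f x) = norm c * Lq_norm \<gamma> (\<lambda>x. Tt t f x - f x)" if "t \<in> {0<..1}" for t
  proof -
    have t: "0 < t" "t \<le> 1" using that by auto
    have "(\<lambda>x. Tt t (\<lambda>x. c * f x) x - c * f x) = (\<lambda>x. c * (Tt t f x - f x))"
      by (simp add: Tt_def kernel_op_def right_diff_distrib mult.left_commute[of _ c])
    then show ?thesis using Lq_scale(2)[OF Lq_diff(1)[OF Tt_schur(1)[OF t \<gamma> f(1)] f(1) \<gamma>] \<gamma>, of c] by simp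
  qed
  then have "\<forall>\<^sub>F t in at_right 0. norm c * Lq_norm \<gamma> (\<lambda>x. Tt t f x - f x) = Lq_norm \<gamma> (\<lambda>x. Tt t (\<lambda>x. c * f x) x - c * f x)"
    using eventually_at_right_1 by (auto elim!: eventually_mono)
  moreover have "((\<lambda>t. norm c * Lq_norm \<gamma> (\<lambda>x. Tt t f x - f x)) \<longlongrightarrow> 0) (at_right 0)"
    using f(2) unfolding strongly_continuous_def by (intro tendsto_mult_right_zero)
  ultimately show ?thesis unfolding strongly_continuous_def by (rule Lim_transform_eventually[rotated])
qed

text \<open>
  Approximation from above by the Lipschitz functions \<open>max 0 (1 - (n + 1) dist(x, K))\<close>.
\<close>

lemma strongly_continuous_compact:
  assumes K: "compact K" "K \<noteq> {}"
  shows "strongly_continuous 1 (\<lambda>x. complex_of_real (indicator K x))"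
proof -
  obtain R0 where R0: "\<And>x. x \<in> K \<Longrightarrow> norm x \<le> R0"
    using compact_imp_bounded[OF K(1)] unfolding bounded_iff by blast
  define R where "R = \<bar>R0\<bar> + 1"
  define h :: "nat \<Rightarrow> 'a \<Rightarrow> real" where "h n x = max 0 (1 - real (Suc n) * infdist x K)" for n x
  have uc: "uniformly_continuous_on UNIV (h n)" for n
  proof (rule lipschitz_on_uniformly_continuous[where L="real (Suc n)"], rule lipschitz_onI)
    fix x y
    have "dist (h n x) (h n y) \<le> \<bar>real (Suc n) * infdist x K - real (Suc n) * infdist y K\<bar>"
    proof -
      have "\<bar>max 0 (1 - a) - max 0 (1 - b)\<bar> \<le> \<bar>a - b\<bar>" for a b :: real by (auto simp: max_def abs_if)
      then show ?thesis unfolding h_def dist_real_def .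
    qed
    also have "\<dots> = real (Suc n) * \<bar>infdist x K - infdist y K\<bar>" by (simp add: abs_mult flip: right_diff_distrib)
    also have "\<dots> \<le> real (Suc n) * dist x y" by (intro mult_left_mono infdist_triangle_abs) auto
    finally show "dist (h n x) (h n y) \<le> real (Suc n) * dist x y" .
  qed simp
  have R: "R > 0" unfolding R_def using abs_ge_zero[of R0] by linarith
  have h1: "\<bar>h n x\<bar> \<le> 1" for n x using infdist_nonneg[of x K] by (simp add: h_def)
  have supp: "h n x = 0" if "norm x > R" for n x
  proof -
    have "infdist x K \<ge> 1"
      unfolding infdist_notempty[OF K(2)]
    proof (rule cINF_greatest[OF K(2)])
      fix k assume "k \<in> K"
      then have "norm k \<le> \<bar>R0\<bar>" using R0[of k] by simp
      then show "1 \<le> dist x k" using that norm_triangle_ineq2[of x k] by (simp add: R_def dist_norm)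
    qed
    then have "1 * 1 \<le> real (Suc n) * infdist x K" by (intro mult_mono) auto
    then show ?thesis by (simp add: h_def)
  qed
  have on: "h n x = 1" if "x \<in> K" for n x using that by (simp add: h_def)
  have lim: "(\<lambda>n. h n x) \<longlonglongrightarrow> indicator K x" for x
  proof (cases "x \<in> K")
    case False
    have cl: "closed K" using K(1) by (rule compact_imp_closed)
    then have pos: "infdist x K > 0" using False K(2) in_closed_iff_infdist_zero[OF cl K(2), of x] infdist_nonneg[of x K] by linarith
    obtain N where N: "1 / infdist x K < real N" using reals_Archimedean2 by blast
    have "h n x = 0" if "n \<ge> N" for n
    proof -
      have "1 / infdist x K \<le> real (Suc n)" using N that by simp
      then have "1 \<le> real (Suc n) * infdist x K" using pos by (simp add: field_simps)
      then show ?thesis by (simp add: h_def)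
    qed
    then have "eventually (\<lambda>n. 0 = h n x) sequentially" by (auto simp: eventually_sequentially intro!: exI[of _ N])
    then have "(\<lambda>n. h n x) \<longlonglongrightarrow> 0" by (rule Lim_transform_eventually[OF tendsto_const])
    then show ?thesis using False by simp
  qed (simp add: on)
  have hm: "h n \<in> borel_measurable borel" for n
    by (intro borel_measurable_continuous_onI uniformly_continuous_imp_continuous[OF uc])
  have Km: "K \<in> sets borel" using K(1) by (simp add: compact_imp_closed borel_closed)
  have bound: "\<bar>h n x\<bar> \<le> indicator (cball 0 R) x" for n x
    using h1[of n x] supp[of x n] by (cases "norm x \<le> R") auto
  have iR: "integrable lborel (\<lambda>x::'a. 2 * indicator (cball 0 R) x :: real)"
    by (intro integrable_mult_right) (auto simp: emeasure_cball R_def)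
  have KR: "indicator K x \<le> (indicator (cball 0 R) x :: real)" for x
    using R0[of x] by (auto simp: indicator_def R_def)
  have ih: "integrable lborel (h n)" for n
  proof (rule Bochner_Integration.integrable_bound[OF iR])
    show "AE x in lborel. norm (h n x) \<le> norm (2 * indicator (cball 0 R) x :: real)"
    proof (rule AE_I2)
      fix x :: 'a
      show "norm (h n x) \<le> norm (2 * indicator (cball 0 R) x :: real)"
        using bound[of n x] by (simp add: indicator_def split: if_splits)
    qed
  qed (use hm in simp)
  have iK: "integrable lborel (indicator K :: 'a \<Rightarrow> real)"
  proof (rule Bochner_Integration.integrable_bound[OF iR])
    show "AE x in lborel. norm (indicator K x :: real) \<le> norm (2 * indicator (cball 0 R) x :: real)"
    proof (rule AE_I2)
      fix x :: 'a
      show "norm (indicator K x :: real) \<le> norm (2 * indicator (cball 0 R) x :: real)"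
        using KR[of x] by (simp add: indicator_def split: if_splits)
    qed
  qed (use Km in simp)
  have "(\<lambda>n. LINT x|lborel. \<bar>indicator K x - h n x\<bar>) \<longlonglongrightarrow> integral\<^sup>L lborel (\<lambda>x::'a. 0::real)"
  proof (rule integral_dominated_convergence[OF _ _ iR])
    show "AE x in lborel. (\<lambda>n. \<bar>indicator K x - h n x\<bar>) \<longlonglongrightarrow> 0"
    proof (rule AE_I2)
      fix x :: 'a
      have "(\<lambda>n. \<bar>indicator K x - h n x\<bar>) \<longlonglongrightarrow> \<bar>indicator K x - indicator K x\<bar>" by (intro tendsto_intros lim)
      then show "(\<lambda>n. \<bar>indicator K x - h n x\<bar>) \<longlonglongrightarrow> 0" by simp
    qed
    show "AE x in lborel. norm \<bar>indicator K x - h n x\<bar> \<le> 2 * indicator (cball 0 R) x" for n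
    proof (rule AE_I2)
      fix x :: 'a
      have "0 \<le> (indicator K x :: real)" by simp
      then show "norm \<bar>indicator K x - h n x\<bar> \<le> 2 * indicator (cball 0 R) x"
        using bound[of n x] KR[of x] unfolding real_norm_def by linarith
    qed
  qed (use Km hm in auto)
  then have L: "(\<lambda>n. LINT x|lborel. \<bar>indicator K x - h n x\<bar>) \<longlonglongrightarrow> 0" by simp
  show ?thesis
  proof (rule strongly_continuous_closed)
    show "(\<lambda>x. complex_of_real (indicator K x)) \<in> Lq_space 1"
      using iK unfolding Lq_space_1 by (rule integrable_of_real)
    fix e :: real assume "e > 0"
    then have "eventually (\<lambda>n. (LINT x|lborel. \<bar>indicator K x - h n x\<bar>) < e) sequentially"
      using L by (intro order_tendstoD(2))
    then obtain n where n: "(LINT x|lborel. \<bar>indicator K x - h n x\<bar>) < e"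
      by (auto simp: eventually_sequentially)
    have "Lq_norm 1 (\<lambda>x. complex_of_real (indicator K x) - complex_of_real (h n x)) < e"
      using n by (simp add: Lq_norm_1 flip: of_real_diff)
    moreover have "strongly_continuous 1 (\<lambda>x. complex_of_real (h n x))"
      by (rule strongly_continuous_bump[OF uc h1 supp R])
    moreover have "(\<lambda>x. complex_of_real (h n x)) \<in> Lq_space 1" using ih unfolding Lq_space_1 by (rule integrable_of_real)
    ultimately show "\<exists>g\<in>Lq_space 1. Lq_norm 1 (\<lambda>x. complex_of_real (indicator K x) - g x) < e \<and> strongly_continuous 1 g"
      by (intro bexI[of _ "\<lambda>x. complex_of_real (h n x)"] conjI)
  qed simp
qed

lemma strongly_continuous_zero: "strongly_continuous \<gamma> (\<lambda>x. 0)"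
  by (simp add: strongly_continuous_def Tt_def kernel_op_def Lq_norm_def)

text \<open>
  Inner regularity of Lebesgue measure: from a closed subset of almost full measure, and its
  intersections with balls.
\<close>

lemma strongly_continuous_indicator:
  assumes A: "A \<in> sets borel" "emeasure lborel A < \<infinity>"
  shows "strongly_continuous 1 (\<lambda>x. complex_of_real (indicator A x))"
proof (rule strongly_continuous_closed)
  have iA: "integrable lborel (indicator A :: 'a \<Rightarrow> real)" using A by (simp add: integrable_indicator_iff)
  then show "(\<lambda>x. complex_of_real (indicator A x)) \<in> Lq_space 1" unfolding Lq_space_1 by (rule integrable_of_real)
  fix e :: real assume e: "e > 0"
  have "A \<in> sets lebesgue" using A(1) by (intro sets_completionI_sets) simp
  moreover have "e / 2 > 0" using e by simp
  ultimately obtain T where T: "closed T" "T \<subseteq> A" "A - T \<in> lmeasurable" "emeasure lebesgue (A - T) < ennreal (e / 2)"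
    by (rule sets_lebesgue_inner_closed)
  have Tm: "T \<in> sets borel" using T(1) by simp
  have iT: "integrable lborel (indicator T :: 'a \<Rightarrow> real)"
    using iA by (rule Bochner_Integration.integrable_bound) (use Tm T(2) in \<open>auto simp: indicator_def\<close>)
  have AT: "(LINT x|lborel. \<bar>indicator A x - indicator T x :: real\<bar>) < e / 2"
  proof -
    have "(LINT x|lborel. \<bar>indicator A x - indicator T x :: real\<bar>) = (LINT x|lborel. indicator (A - T) x)"
      using T(2) by (intro Bochner_Integration.integral_cong) (auto simp: indicator_def)
    also have "\<dots> = measure lborel (A - T)" using A Tm by simp
    also have "\<dots> < e / 2"
    proof -
      have "ennreal (measure lebesgue (A - T)) < ennreal (e / 2)"
        using T(4) emeasure_eq_measure2[OF T(3)] by simp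
      moreover have "measure lebesgue (A - T) = measure lborel (A - T)"
        using A(1) Tm by (intro measure_completion) auto
      ultimately show ?thesis by (simp add: ennreal_less_iff)
    qed
    finally show ?thesis .
  qed
  define K where "K n = T \<inter> cball 0 (real n)" for n
  have Kc: "compact (K n)" for n unfolding K_def using T(1) by (intro closed_Int_compact) auto
  have Km: "K n \<in> sets borel" for n using Kc by (simp add: compact_imp_closed borel_closed)
  have "(\<lambda>n. LINT x|lborel. \<bar>indicator T x - indicator (K n) x\<bar>) \<longlonglongrightarrow> integral\<^sup>L lborel (\<lambda>x::'a. 0::real)"
  proof (rule integral_dominated_convergence[OF _ _ iT])
    show "AE x in lborel. (\<lambda>n. \<bar>indicator T x - indicator (K n) x\<bar> :: real) \<longlonglongrightarrow> 0"
    proof (rule AE_I2)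
      fix x :: 'a
      obtain N where "norm x \<le> real N" using real_arch_simple by blast
      then have "eventually (\<lambda>n. (0::real) = \<bar>indicator T x - indicator (K n) x\<bar>) sequentially"
        by (auto simp: eventually_sequentially K_def indicator_def intro!: exI[of _ N])
      then show "(\<lambda>n. \<bar>indicator T x - indicator (K n) x\<bar> :: real) \<longlonglongrightarrow> 0"
        by (rule Lim_transform_eventually[OF tendsto_const])
    qed
    show "AE x in lborel. norm (\<bar>indicator T x - indicator (K n) x\<bar> :: real) \<le> indicator T x" for n
      by (auto simp: indicator_def K_def)
  qed (use Km Tm in auto)
  then have "eventually (\<lambda>n. (LINT x|lborel. \<bar>indicator T x - indicator (K n) x :: real\<bar>) < e / 2) sequentially"
    using e by (intro order_tendstoD(2)[where y=0]) auto
  then obtain n where n: "(LINT x|lborel. \<bar>indicator T x - indicator (K n) x :: real\<bar>) < e / 2"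
    by (auto simp: eventually_sequentially)
  have iK: "integrable lborel (indicator (K n) :: 'a \<Rightarrow> real)"
    using iT by (rule Bochner_Integration.integrable_bound) (use Km in \<open>auto simp: indicator_def K_def\<close>)
  have "(LINT x|lborel. \<bar>indicator A x - indicator (K n) x :: real\<bar>) \<le>
      (LINT x|lborel. \<bar>indicator A x - indicator T x :: real\<bar> + \<bar>indicator T x - indicator (K n) x\<bar>)"
    by (intro integral_mono integrable_abs Bochner_Integration.integrable_add Bochner_Integration.integrable_diff iA iT iK) linarith
  also have "\<dots> = (LINT x|lborel. \<bar>indicator A x - indicator T x :: real\<bar>) + (LINT x|lborel. \<bar>indicator T x - indicator (K n) x\<bar>)"
    by (intro Bochner_Integration.integral_add integrable_abs Bochner_Integration.integrable_diff iA iT iK)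
  finally have "(LINT x|lborel. \<bar>indicator A x - indicator (K n) x :: real\<bar>) < e" using AT n by simp
  then have "Lq_norm 1 (\<lambda>x. complex_of_real (indicator A x) - complex_of_real (indicator (K n) x)) < e"
    by (simp add: Lq_norm_1 flip: of_real_diff)
  moreover have "strongly_continuous 1 (\<lambda>x. complex_of_real (indicator (K n) x))"
  proof (cases "K n = {}")
    case True
    then show ?thesis using strongly_continuous_zero by simp
  qed (use strongly_continuous_compact[OF Kc] in auto)
  moreover have "(\<lambda>x. complex_of_real (indicator (K n) x)) \<in> Lq_space 1" using iK unfolding Lq_space_1 by (rule integrable_of_real)
  ultimately show "\<exists>g\<in>Lq_space 1. Lq_norm 1 (\<lambda>x. complex_of_real (indicator A x) - g x) < e \<and> strongly_continuous 1 g"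
    by (intro bexI[of _ "\<lambda>x. complex_of_real (indicator (K n) x)"] conjI)
qed simp

lemma strongly_continuous_L1:
  assumes "integrable lborel f"
  shows "strongly_continuous 1 f"
  using assms
proof (induction rule: integrable_induct)
  case (base A c)
  then have A: "A \<in> sets borel" "emeasure lborel A < \<infinity>" by auto
  have "integrable lborel (indicator A :: 'a \<Rightarrow> real)" using A by (simp add: integrable_indicator_iff)
  then have "(\<lambda>x. complex_of_real (indicator A x)) \<in> Lq_space 1" unfolding Lq_space_1 by (rule integrable_of_real)
  from strongly_continuous_scale[OF _ this strongly_continuous_indicator[OF A], of c]
  show ?case by (simp add: scaleR_conv_of_real mult.commute)
next
  case (add f g)
  then show ?case by (intro strongly_continuous_add) (auto simp: Lq_space_1)
next
  case (lim f s)
  show ?case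
  proof (rule strongly_continuous_closed)
    show "f \<in> Lq_space 1" using lim by (simp add: Lq_space_1)
    fix e :: real assume e: "e > 0"
    have "(\<lambda>i. LINT x|lborel. norm (f x - s i x)) \<longlonglongrightarrow> integral\<^sup>L lborel (\<lambda>x::'a. 0::real)"
    proof (rule integral_dominated_convergence)
      show "integrable lborel (\<lambda>x. 3 * norm (f x))" using lim by (intro integrable_mult_right integrable_norm)
      show "AE x in lborel. (\<lambda>i. norm (f x - s i x)) \<longlonglongrightarrow> 0"
      proof (rule AE_I2)
        fix x :: 'a
        have "(\<lambda>i. norm (f x - s i x)) \<longlonglongrightarrow> norm (f x - f x)" using lim.hyps(2)[of x] by (intro tendsto_intros) auto
        then show "(\<lambda>i. norm (f x - s i x)) \<longlonglongrightarrow> 0" by simp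
      qed
      show "AE x in lborel. norm (norm (f x - s i x)) \<le> 3 * norm (f x)" for i
      proof (rule AE_I2)
        fix x :: 'a
        show "norm (norm (f x - s i x)) \<le> 3 * norm (f x)"
          using lim.hyps(3)[of x i] norm_triangle_ineq4[of "f x" "s i x"] by simp
      qed
    qed (use lim in \<open>auto intro: borel_measurable_integrable\<close>)
    then have "eventually (\<lambda>i. (LINT x|lborel. norm (f x - s i x)) < e) sequentially"
      using e by (intro order_tendstoD(2)[where y=0]) auto
    then obtain i where "(LINT x|lborel. norm (f x - s i x)) < e" by (auto simp: eventually_sequentially)
    then show "\<exists>g\<in>Lq_space 1. Lq_norm 1 (\<lambda>x. f x - g x) < e \<and> strongly_continuous 1 g"
      using lim.hyps(1) lim.IH by (auto simp: Lq_norm_1 Lq_space_1)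
  qed simp
qed

text \<open>
  On bounded functions the \<open>L\<^sup>q\<close> norm is controlled by the \<open>L\<^sup>1\<close> norm; bounded functions with
  bounded support are dense in \<open>L\<^sup>q\<close>.
\<close>

lemma strongly_continuous_bounded:
  assumes \<gamma>: "\<gamma> \<ge> 1" and f: "integrable lborel f" and B: "\<And>x. norm (f x) \<le> B" "B > 0"
  shows "strongly_continuous \<gamma> f"
proof -
  have fm [measurable]: "f \<in> borel_measurable borel" using f by auto
  have f1: "f \<in> Lq_space 1" using f by (simp add: Lq_space_1)
  define N where "N t = (LINT x|lborel. norm (Tt t f x - f x))" for t
  have N: "(N \<longlongrightarrow> 0) (at_right 0)"
    using strongly_continuous_L1[OF f] by (simp add: strongly_continuous_def Lq_norm_1 N_def[abs_def])
  have le: "Lq_norm \<gamma> (\<lambda>x. Tt t f x - f x) \<le> ((2 * B) powr (\<gamma> - 1) * N t) powr (1 / \<gamma>)" if t: "0 < t" "t \<le> 1" for t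
  proof -
    have T: "norm (Tt t f x) \<le> B" for x
    proof -
      have i: "integrable lborel (\<lambda>y. B * p t x y)" using t by (intro integrable_mult_right integrable_p)
      have pw: "norm (complex_of_real (p t x y) * f y) \<le> B * p t x y" for y
        using mult_right_mono[OF B(1)[of y] p_nonneg[OF t(1), of x y]] p_nonneg[OF t(1), of x y]
        by (simp add: norm_mult mult.commute)
      have pm: "(\<lambda>y. p t x y) \<in> borel_measurable borel"
        using borel_measurable_integrable[OF integrable_p[OF t(1), of x]] by simp
      have "integrable lborel (\<lambda>y. complex_of_real (p t x y) * f y)"
      proof (rule Bochner_Integration.integrable_bound[OF i])
        show "(\<lambda>y. complex_of_real (p t x y) * f y) \<in> borel_measurable lborel" using pm by simp
        show "AE y in lborel. norm (complex_of_real (p t x y) * f y) \<le> norm (B * p t x y)"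
          using order_trans[OF pw abs_ge_self] unfolding real_norm_def by (rule AE_I2)
      qed
      then have i': "integrable lborel (\<lambda>y. norm (complex_of_real (p t x y) * f y))" by (rule integrable_norm)
      have "norm (Tt t f x) \<le> (LINT y|lborel. norm (complex_of_real (p t x y) * f y))"
        unfolding Tt_def kernel_op_def by (rule integral_norm_bound)
      also have "\<dots> \<le> (LINT y|lborel. B * p t x y)" by (rule integral_mono[OF i' i pw])
      also have "\<dots> = B" using p_mass[OF t(1), of x] by simp
      finally show ?thesis .
    qed
    define d where "d x = Tt t f x - f x" for x
    have d1: "d \<in> Lq_space 1" unfolding d_def by (rule Lq_diff(1)[OF Tt_schur(1)[OF t _ f1] f1]) simp_all
    have dm [measurable]: "d \<in> borel_measurable borel" using d1 by (simp add: Lq_space_def)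
    have di: "integrable lborel (\<lambda>x. (2 * B) powr (\<gamma> - 1) * norm (d x))"
      using d1 by (intro integrable_mult_right integrable_norm) (simp add: Lq_space_1)
    have dB: "norm (d x) \<le> 2 * B" for x unfolding d_def using norm_triangle_ineq4[of "Tt t f x" "f x"] T[of x] B(1)[of x] by simp
    have dq: "norm (d x) powr \<gamma> \<le> (2 * B) powr (\<gamma> - 1) * norm (d x)" for x
    proof (cases "d x = 0")
      case False
      have "norm (d x) powr \<gamma> = norm (d x) powr (\<gamma> - 1) * norm (d x)" using False by (simp add: powr_diff)
      also have "\<dots> \<le> (2 * B) powr (\<gamma> - 1) * norm (d x)" using dB[of x] \<gamma> by (intro mult_right_mono powr_mono2) auto
      finally show ?thesis .
    qed (use \<gamma> in simp)
    have i: "integrable lborel (\<lambda>x. norm (d x) powr \<gamma>)"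
      by (rule Bochner_Integration.integrable_bound[OF di]) (measurable, use order_trans[OF dq abs_ge_self] in auto)
    have "(LINT x|lborel. norm (d x) powr \<gamma>) \<le> (LINT x|lborel. (2 * B) powr (\<gamma> - 1) * norm (d x))"
      by (intro integral_mono i di dq)
    then have "(LINT x|lborel. norm (d x) powr \<gamma>) \<le> (2 * B) powr (\<gamma> - 1) * N t" by (simp add: N_def d_def)
    then have "Lq_norm \<gamma> d \<le> ((2 * B) powr (\<gamma> - 1) * N t) powr (1 / \<gamma>)"
      unfolding Lq_norm_def using \<gamma> by (intro powr_mono2) auto
    then show ?thesis by (simp add: d_def[abs_def])
  qed
  show ?thesis unfolding strongly_continuous_def
  proof (rule Lim_null_comparison)
    show "\<forall>\<^sub>F t in at_right 0. norm (Lq_norm \<gamma> (\<lambda>x. Tt t f x - f x)) \<le> ((2 * B) powr (\<gamma> - 1) * N t) powr (1 / \<gamma>)"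
      using eventually_at_right_1 by eventually_elim (use le in \<open>auto simp: abs_of_nonneg[OF Lq_norm_nonneg]\<close>)
    have "((\<lambda>t. (2 * B) powr (\<gamma> - 1) * N t) \<longlongrightarrow> 0) (at_right 0)" using N by (rule tendsto_mult_right_zero)
    then show "((\<lambda>t. ((2 * B) powr (\<gamma> - 1) * N t) powr (1 / \<gamma>)) \<longlongrightarrow> 0) (at_right 0)"
      using \<gamma> by (intro tendsto_zero_powrI[OF _ tendsto_const]) (auto simp: N_def)
  qed
qed

lemma strongly_continuous_Lq:
  assumes \<gamma>: "\<gamma> \<ge> 1" and f: "f \<in> Lq_space \<gamma>"
  shows "strongly_continuous \<gamma> f"
proof (rule strongly_continuous_closed[OF \<gamma> f])
  fix e :: real assume e: "e > 0"
  have fm [measurable]: "f \<in> borel_measurable borel" and fi: "integrable lborel (\<lambda>x. norm (f x) powr \<gamma>)"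
    using f by (auto simp: Lq_space_def)
  define S where "S n = {x. norm (f x) \<le> real n \<and> norm x \<le> real n}" for n
  have Sm [measurable]: "S n \<in> sets borel" for n unfolding S_def by measurable
  define g where "g n x = indicator (S n) x *\<^sub>R f x" for n x
  have gm [measurable]: "g n \<in> borel_measurable borel" for n unfolding g_def by measurable
  have "(\<lambda>n. LINT x|lborel. norm (f x - g n x) powr \<gamma>) \<longlonglongrightarrow> integral\<^sup>L lborel (\<lambda>x::'a. 0::real)"
  proof (rule integral_dominated_convergence[OF _ _ fi])
    show "AE x in lborel. (\<lambda>n. norm (f x - g n x) powr \<gamma>) \<longlonglongrightarrow> 0"
    proof (rule AE_I2)
      fix x :: 'a
      obtain N where "max (norm (f x)) (norm x) \<le> real N" using real_arch_simple by blast
      then have "eventually (\<lambda>n. 0 = norm (f x - g n x) powr \<gamma>) sequentially"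
        using \<gamma> by (auto simp: eventually_sequentially g_def S_def intro!: exI[of _ N])
      then show "(\<lambda>n. norm (f x - g n x) powr \<gamma>) \<longlonglongrightarrow> 0"
        by (rule Lim_transform_eventually[OF tendsto_const])
    qed
    show "AE x in lborel. norm (norm (f x - g n x) powr \<gamma>) \<le> norm (f x) powr \<gamma>" for n
      by (auto simp: g_def indicator_def)
  qed auto
  then have "(\<lambda>n. LINT x|lborel. norm (f x - g n x) powr \<gamma>) \<longlonglongrightarrow> 0" by simp
  then have "(\<lambda>n. (LINT x|lborel. norm (f x - g n x) powr \<gamma>) powr (1 / \<gamma>)) \<longlonglongrightarrow> 0"
    using \<gamma> by (intro tendsto_zero_powrI[OF _ tendsto_const]) auto
  then have "(\<lambda>n. Lq_norm \<gamma> (\<lambda>x. f x - g n x)) \<longlonglongrightarrow> 0" by (simp add: Lq_norm_def)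
  then have "eventually (\<lambda>n. Lq_norm \<gamma> (\<lambda>x. f x - g n x) < e) sequentially" using e by (rule order_tendstoD(2))
  then obtain n where n: "Lq_norm \<gamma> (\<lambda>x. f x - g n x) < e" by (auto simp: eventually_sequentially)
  have gB: "norm (g n x) \<le> real n + 1" for x by (auto simp: g_def S_def indicator_def)
  have gi: "integrable lborel (g n)"
  proof (rule Bochner_Integration.integrable_bound)
    show "integrable lborel (\<lambda>x::'a. (real n + 1) * indicator (cball 0 (real n)) x)"
      by (intro integrable_mult_right) (auto simp: emeasure_cball)
    show "AE x in lborel. norm (g n x) \<le> norm ((real n + 1) * indicator (cball 0 (real n)) x)"
      by (auto simp: g_def S_def indicator_def)
  qed simp
  have "g n \<in> Lq_space \<gamma>"
    unfolding Lq_space_def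
  proof (intro CollectI conjI)
    show "integrable lborel (\<lambda>x. norm (g n x) powr \<gamma>)"
      by (rule Bochner_Integration.integrable_bound[OF fi]) (measurable, use \<gamma> in \<open>auto simp: g_def indicator_def\<close>)
  qed simp
  moreover have "strongly_continuous \<gamma> (g n)" by (rule strongly_continuous_bounded[OF \<gamma> gi gB]) simp
  ultimately show "\<exists>g\<in>Lq_space \<gamma>. Lq_norm \<gamma> (\<lambda>x. f x - g x) < e \<and> strongly_continuous \<gamma> g" using n by blast
qed

end

section \<open>Schur bounds for the heat kernel and its time derivative\<close>

context heat_kernel_setting
begin

text \<open>
  Schur norms are submultiplicative, so the bound on \<open>(0,1]\<close> propagates to all times at an
  exponential rate.
\<close>

lemma p_schur_iterated:
  assumes "0 < t" "t \<le> real (Suc n)"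
  shows "schur_bounded (p t) (A0 ^ Suc n)"
  using assms
proof (induction n arbitrary: t)
  case 0
  then show ?case using p_schur_small[of t] by simp
next
  case (Suc n)
  show ?case
  proof (cases "t \<le> 1")
    case True
    have "A0 ^ 1 \<le> A0 ^ Suc (Suc n)" by (rule power_increasing) (use A0_ge_1 in auto)
    then have "A0 \<le> A0 ^ Suc (Suc n)" by (simp only: power_one_right)
    then show ?thesis by (rule schur_bounded_mono[OF p_schur_small[OF Suc.prems(1) True]])
  next
    case False
    have "schur_bounded (p (t - 1)) (A0 ^ Suc n)" using False Suc.prems by (intro Suc.IH) auto
    from schur_compose_bound[OF p_schur_small[of 1] this]
    have "schur_bounded (\<lambda>x y. LINT w|lborel. p 1 x w * p (t - 1) w y) (A0 * A0 ^ Suc n)" by simp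
    moreover have "(\<lambda>x y. LINT w|lborel. p 1 x w * p (t - 1) w y) = p t"
      using chapman_kolmogorov[of 1 "t - 1"] False by (intro ext) simp
    ultimately show ?thesis by simp
  qed
qed

definition \<omega>0 :: real where "\<omega>0 = ln A0"

lemma \<omega>0_nonneg: "\<omega>0 \<ge> 0" using A0_ge_1 by (simp add: \<omega>0_def)

lemma p_schur:
  assumes t: "0 < t"
  shows "schur_bounded (p t) (A0 * exp (\<omega>0 * t))"
proof -
  \<comment> \<open>So \<open>n \<le> t \<le> n + 1\<close>.\<close>
  define n where "n = nat \<lfloor>t\<rfloor>"
  have n: "real n \<le> t" "t \<le> real (Suc n)" using t by (auto simp: n_def) linarith
  have "A0 ^ Suc n = A0 * exp (\<omega>0 * real n)"
    using A0_ge_1 exp_of_nat_mult[of n "ln A0"] by (simp add: \<omega>0_def mult.commute)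
  also have "\<dots> \<le> A0 * exp (\<omega>0 * t)" using n \<omega>0_nonneg A0_ge_1 by (auto intro!: mult_left_mono)
  finally show ?thesis by (rule schur_bounded_mono[OF p_schur_iterated[OF t n(2)]])
qed

lemma p_derivative_p1: "0 < t \<Longrightarrow> ((\<lambda>s. p s x y) has_real_derivative p1 t x y) (at t)"
  using p_derivative_everywhere[of "t / 2" "t / 2" x y] by simp

lemma p1_measurable:
  assumes t: "0 < t"
  shows "(\<lambda>xy. p1 t (fst xy) (snd xy)) \<in> borel_measurable (borel \<Otimes>\<^sub>M borel)"
proof (rule borel_measurable_LIMSEQ_real)
  fix xy :: "'a \<times> 'a"
  have "((\<lambda>h. (p (t + h) (fst xy) (snd xy) - p t (fst xy) (snd xy)) / h) \<longlongrightarrow> p1 t (fst xy) (snd xy)) (at 0)"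
    using p_derivative_p1[OF t] unfolding DERIV_def .
  moreover have "filterlim (\<lambda>n. inverse (real (Suc n))) (at 0) sequentially"
    using LIMSEQ_inverse_real_of_nat by (simp add: filterlim_at del: of_nat_Suc)
  ultimately show "(\<lambda>n. (p (t + inverse (real (Suc n))) (fst xy) (snd xy) - p t (fst xy) (snd xy)) / inverse (real (Suc n)))
      \<longlonglongrightarrow> p1 t (fst xy) (snd xy)"
    by (rule filterlim_compose)
next
  fix n
  have "t + inverse (real (Suc n)) > 0" using t by (simp add: add_pos_pos)
  from p_measurable[OF this] p_measurable[OF t]
  show "(\<lambda>xy. (p (t + inverse (real (Suc n))) (fst xy) (snd xy) - p t (fst xy) (snd xy)) / inverse (real (Suc n)))
      \<in> borel_measurable (borel \<Otimes>\<^sub>M borel)"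
    by (intro borel_measurable_divide borel_measurable_diff borel_measurable_const)
qed

lemma p1_schur_small:
  assumes t: "0 < t" "t \<le> 1"
  shows "schur_bounded (p1 t) (A0 / t)"
proof (rule schur_bounded_by_G[OF t(1) p1_measurable[OF t(1)]])
  show "norm (p1 t x y) \<le> cT 1 * G t (x - y)" if "x \<noteq> y" for x y
    using q_bound[OF t, of x y] p1_eq_q[OF t(1) that] by simp
  show "cT 1 * C\<^sub>G / t \<le> A0 / t" using t by (intro divide_right_mono) (auto simp: A0_def)
qed (use t cT_pos[of 1] A0_ge_1 in auto)

text \<open>
  Up to time \<open>1\<close> this is the bound on the operator; later \<open>p1 t\<close> is \<open>p1 (1/2)\<close> composed with \<open>p (t - 1/2)\<close>.
\<close>

lemma p1_schur:
  assumes t: "0 < t"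
  shows "schur_bounded (p1 t) (2 * A0\<^sup>2 * exp (\<omega>0 * t) * (1 + 1 / t))"
proof (cases "t \<le> 1")
  case True
  have "A0 * 1 \<le> A0 * A0" using A0_ge_1 by (intro mult_left_mono) auto
  then have "A0 \<le> 2 * A0\<^sup>2" using A0_ge_1 unfolding power2_eq_square by linarith
  then have "A0 * 1 \<le> 2 * A0\<^sup>2 * exp (\<omega>0 * t)" using A0_ge_1 \<omega>0_nonneg t by (intro mult_mono) auto
  then have "A0 * (1 / t) \<le> 2 * A0\<^sup>2 * exp (\<omega>0 * t) * (1 + 1 / t)" using t A0_ge_1 by (intro mult_mono) auto
  then have "A0 / t \<le> 2 * A0\<^sup>2 * exp (\<omega>0 * t) * (1 + 1 / t)" by (simp only: times_divide_eq_right mult_1_right)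
  then show ?thesis by (rule schur_bounded_mono[OF p1_schur_small[OF t True]])
next
  case False
  then have s: "t - 1 / 2 > 0" by simp
  from schur_compose_bound[OF p1_schur_small[of "1/2"] p_schur[OF s]]
  have "schur_bounded (\<lambda>x y. LINT w|lborel. p1 (1 / 2) x w * p (t - 1 / 2) w y) (A0 / (1 / 2) * (A0 * exp (\<omega>0 * (t - 1 / 2))))"
    by simp
  moreover have "(\<lambda>x y. LINT w|lborel. p1 (1 / 2) x w * p (t - 1 / 2) w y) = p1 t"
    using chapman_kolmogorov_derivative[OF _ s, of "1/2"] by (intro ext) simp
  ultimately have *: "schur_bounded (p1 t) (A0 / (1 / 2) * (A0 * exp (\<omega>0 * (t - 1 / 2))))" by simp
  have "A0 / (1 / 2) * (A0 * exp (\<omega>0 * (t - 1 / 2))) = 2 * A0\<^sup>2 * exp (\<omega>0 * (t - 1 / 2)) * 1"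
    by (simp add: power2_eq_square)
  also have "\<dots> \<le> 2 * A0\<^sup>2 * exp (\<omega>0 * t) * (1 + 1 / t)"
    using t \<omega>0_nonneg by (intro mult_mono mult_left_mono) (auto intro!: mult_left_mono)
  finally show ?thesis by (rule schur_bounded_mono[OF *])
qed

text \<open>
  Averaging \<open>p(t\<^sub>0/2, \<cdot>, y)\<close> against a probability density does not increase its supremum.
\<close>

lemma p_sup_uniform:
  assumes "0 < t0" "t0 \<le> t"
  shows "\<bar>p t x y\<bar> \<le> cT (t0 / 2) / Phi_inv \<phi> (t0 / 2) ^ DIM('a)" (is "_ \<le> ?B")
proof -
  define s where "s = t - t0 / 2"
  have s: "0 < s" and h: "0 < t0 / 2" and st: "t = s + t0 / 2" using assms by (auto simp: s_def)
  have i: "integrable lborel (\<lambda>w. ?B * p s x w)" by (intro integrable_mult_right integrable_p s)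
  have le: "norm (p s x w * p (t0 / 2) w y) \<le> ?B * p s x w" for w
    using mult_left_mono[OF abs_p_le[OF h, of w y] p_nonneg[OF s, of x w]] p_nonneg[OF s, of x w]
    by (simp add: abs_mult mult.commute)
  have "(\<lambda>w. p s x w * p (t0 / 2) w y) \<in> borel_measurable lborel" using s h by measurable
  then have "integrable lborel (\<lambda>w. p s x w * p (t0 / 2) w y)"
    by (rule Bochner_Integration.integrable_bound[OF i _ AE_I2]) (rule order_trans[OF le], simp only: real_norm_def abs_ge_self)
  from Bochner_Integration.integral_norm_bound_integral[OF this i le]
  have "norm (p t x y) \<le> (LINT w|lborel. ?B * p s x w)" unfolding st chapman_kolmogorov[OF s h] .
  then show ?thesis using p_mass[OF s, of x] by simp
qed

end

section \<open>Analyticity of the heat semigroup\<close>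

context heat_kernel_setting
begin

text \<open>
  The kernel \<open>exp (- \<omega> t) p(t)\<close> has uniform Schur bounds when \<open>\<omega>\<close> exceeds the growth rate of
  \<open>p\<close> by one; the surplus factor \<open>exp (- t) \<le> 1/t\<close> turns the bounds on \<open>p\<close> and on its time
  derivative for large times into the required \<open>C/t\<close>.
\<close>

theorem heat_semigroup_analytic:
  assumes \<gamma>: "\<gamma> \<ge> 1"
  shows "analytic_semigroup_on_Lq \<gamma> (heat_semigroup p)"
proof -
  define \<omega> where "\<omega> = \<omega>0 + 1"
  have \<omega>: "\<omega> \<ge> 1" using \<omega>0_nonneg by (simp add: \<omega>_def)
  define k where "k t x y = exp (- (\<omega> * t)) * p t x y" for t x y
  define k1 where "k1 t x y = exp (- (\<omega> * t)) * (p1 t x y - \<omega> * p t x y)" for t x y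
  define C where "C = 4 * A0\<^sup>2 + \<omega> * A0"
  have e: "exp (- (\<omega> * t)) * exp (\<omega>0 * t) = exp (- t)" for t
    by (simp add: \<omega>_def algebra_simps flip: exp_add)
  have et: "exp (- t) \<le> 1 / t" if "t > 0" for t :: real
  proof -
    have "1 / exp t \<le> 1 / t" using that exp_ge_add_one_self[of t] by (intro divide_left_mono mult_pos_pos) linarith+
    then show ?thesis by (simp add: exp_minus inverse_eq_divide)
  qed
  have kS: "schur_bounded (k t) A0" if t: "t > 0" for t
    unfolding k_def
  proof (rule schur_scale[OF p_schur[OF t]])
    have "norm (exp (- (\<omega> * t))) * (A0 * exp (\<omega>0 * t)) = A0 * exp (- t)" using e[of t] by simp
    also have "\<dots> \<le> A0 * 1" using t A0_ge_1 by (intro mult_left_mono) auto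
    finally show "norm (exp (- (\<omega> * t))) * (A0 * exp (\<omega>0 * t)) \<le> A0" by simp
  qed (use A0_ge_1 in simp)
  interpret smooth_kernel_semigroup k k1 A0 C
  proof
    have "1 * 1 \<le> \<omega> * A0" using \<omega> A0_ge_1 by (intro mult_mono) auto
    then show "C \<ge> 1" by (simp add: C_def add_increasing)
    show "schur_bounded (k t) A0" if "t > 0" for t using kS[OF that] .
    show "schur_bounded (k1 t) (C / t)" if t: "t > 0" for t
    proof -
      have 1: "schur_bounded (\<lambda>x y. exp (- (\<omega> * t)) * p1 t x y) (4 * A0\<^sup>2 / t)"
      proof (rule schur_scale[OF p1_schur[OF t]])
        have "norm (exp (- (\<omega> * t))) * (2 * A0\<^sup>2 * exp (\<omega>0 * t) * (1 + 1 / t)) =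
            2 * A0\<^sup>2 * ((exp (- (\<omega> * t)) * exp (\<omega>0 * t)) * (1 + 1 / t))"
          by simp
        also have "\<dots> = 2 * A0\<^sup>2 * (exp (- t) + exp (- t) * (1 / t))" unfolding e by (simp only: distrib_left mult_1_right)
        also have "\<dots> \<le> 2 * A0\<^sup>2 * (1 / t + 1 * (1 / t))"
          using et[OF t] t by (intro mult_left_mono add_mono mult_right_mono) auto
        finally show "norm (exp (- (\<omega> * t))) * (2 * A0\<^sup>2 * exp (\<omega>0 * t) * (1 + 1 / t)) \<le> 4 * A0\<^sup>2 / t" by simp
      qed (use A0_ge_1 t in simp)
      have 2: "schur_bounded (\<lambda>x y. - (\<omega> * exp (- (\<omega> * t))) * p t x y) (\<omega> * A0 / t)"
      proof (rule schur_scale[OF p_schur[OF t]])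
        have "norm (- (\<omega> * exp (- (\<omega> * t)))) * (A0 * exp (\<omega>0 * t)) = \<omega> * A0 * exp (- t)"
          using \<omega> e[of t] by (simp add: abs_mult)
        also have "\<dots> \<le> \<omega> * A0 * (1 / t)" using et[OF t] \<omega> A0_ge_1 by (intro mult_left_mono) auto
        finally show "norm (- (\<omega> * exp (- (\<omega> * t)))) * (A0 * exp (\<omega>0 * t)) \<le> \<omega> * A0 / t" by simp
      qed (use A0_ge_1 t \<omega> in simp)
      have "k1 t = (\<lambda>x y. exp (- (\<omega> * t)) * p1 t x y + - (\<omega> * exp (- (\<omega> * t))) * p t x y)"
        by (intro ext) (simp add: k1_def algebra_simps)
      then show ?thesis using schur_add[OF 1 2] by (simp add: C_def add_divide_distrib)
    qed
    show "\<exists>B. \<forall>t\<ge>t0. \<forall>x y. \<bar>k t x y\<bar> \<le> B" if t0: "t0 > 0" for t0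
    proof (intro exI allI impI)
      fix t x y assume t: "t0 \<le> t"
      have "\<bar>k t x y\<bar> \<le> 1 * \<bar>p t x y\<bar>"
        using t t0 \<omega> unfolding k_def abs_mult by (intro mult_right_mono) auto
      then show "\<bar>k t x y\<bar> \<le> cT (t0 / 2) / Phi_inv \<phi> (t0 / 2) ^ DIM('a)" using p_sup_uniform[OF t0 t, of x y] by simp
    qed
    fix t :: real and x y
    assume t: "t > 0"
    show "((\<lambda>s. k s x y) has_real_derivative k1 t x y) (at t)"
      unfolding k_def k1_def
      by (auto intro!: derivative_eq_intros p_derivative_p1[OF t] simp: algebra_simps)
    fix s :: real assume s: "s > 0"
    have E: "exp (- (\<omega> * (t + s))) = exp (- (\<omega> * t)) * exp (- (\<omega> * s))" by (simp add: algebra_simps flip: exp_add)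
    have "(LINT w|lborel. k t x w * k s w y) = (LINT w|lborel. exp (- (\<omega> * (t + s))) * (p t x w * p s w y))"
      unfolding k_def E by (simp add: ac_simps)
    then show "k (t + s) x y = (LINT w|lborel. k t x w * k s w y)"
      unfolding k_def[of "t + s"] chapman_kolmogorov[OF t s] by simp
    have sm: "(\<lambda>w. p s w y) \<in> borel_measurable borel" using s by measurable
    have bounded_mult: "integrable lborel (\<lambda>w. f w * p s w y)" if f: "integrable lborel f" for f :: "'a \<Rightarrow> real"
    proof (rule Bochner_Integration.integrable_bound)
      define B where "B = cT s / Phi_inv \<phi> s ^ DIM('a)"
      show "integrable lborel (\<lambda>w. norm (f w) * B)" using f by (intro integrable_mult_left integrable_norm)
      show "(\<lambda>w. f w * p s w y) \<in> borel_measurable lborel" using f sm by simp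
      show "AE w in lborel. norm (f w * p s w y) \<le> norm (norm (f w) * B)"
      proof (rule AE_I2)
        fix w
        have "norm (f w * p s w y) \<le> norm (f w) * B"
          unfolding norm_mult B_def by (intro mult_left_mono) (use abs_p_le[OF s, of w y] in auto)
        then show "norm (f w * p s w y) \<le> norm (norm (f w) * B)" by (rule order_trans) simp
      qed
    qed
    have i1: "integrable lborel (\<lambda>w. p1 t x w * p s w y)" by (intro bounded_mult schur_integrable_row(1)[OF p1_schur[OF t]])
    have i0: "integrable lborel (\<lambda>w. p t x w * p s w y)" by (intro bounded_mult schur_integrable_row(1)[OF p_schur[OF t]])
    have "(LINT w|lborel. k1 t x w * k s w y) =
        (LINT w|lborel. exp (- (\<omega> * (t + s))) * (p1 t x w * p s w y - \<omega> * (p t x w * p s w y)))"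
      unfolding k_def k1_def E by (intro Bochner_Integration.integral_cong refl) (simp add: algebra_simps)
    also have "\<dots> = exp (- (\<omega> * (t + s))) * (p1 (t + s) x y - \<omega> * p (t + s) x y)"
      using i1 i0 by (simp add: chapman_kolmogorov[OF t s] chapman_kolmogorov_derivative[OF t s])
    finally show "k1 (t + s) x y = (LINT w|lborel. k1 t x w * k s w y)" by (simp add: k1_def)
  qed
  have heat: "heat_semigroup p t f = Tt t f" if "t > 0" for t and f :: "'a \<Rightarrow> complex"
    using that by (intro ext) (simp add: heat_semigroup_def Tt_def kernel_op_def scaleR_conv_of_real)
  show ?thesis
  proof (rule analytic_semigroup[OF \<gamma>, of \<omega>])
    show "\<omega> \<ge> 0" using \<omega> by simp
    show "heat_semigroup p 0 f x = f x" for f :: "'a \<Rightarrow> complex" and x by (simp add: heat_semigroup_def)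
    show "heat_semigroup p t f x = kernel_op (\<lambda>x y. of_real (exp (\<omega> * t) * k t x y)) f x"
      if "t > 0" for t x and f :: "'a \<Rightarrow> complex"
    proof -
      have "exp (\<omega> * t) * k t x y = p t x y" for x y by (simp add: k_def exp_minus)
      then show ?thesis unfolding heat[OF that] Tt_def by simp
    qed
    show "((\<lambda>t. Lq_norm \<gamma> (\<lambda>x. heat_semigroup p t f x - f x)) \<longlongrightarrow> 0) (at_right 0)" if f: "f \<in> Lq_space \<gamma>" for f
    proof (rule Lim_transform_eventually)
      show "((\<lambda>t. Lq_norm \<gamma> (\<lambda>x. Tt t f x - f x)) \<longlongrightarrow> 0) (at_right 0)"
        using strongly_continuous_Lq[OF \<gamma> f] by (simp add: strongly_continuous_def)
      show "eventually (\<lambda>t. Lq_norm \<gamma> (\<lambda>x. Tt t f x - f x) = Lq_norm \<gamma> (\<lambda>x. heat_semigroup p t f x - f x)) (at_right 0)"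
        using eventually_at_right_less[of "0::real"] by eventually_elim (simp add: heat)
    qed
  qed
qed

theorem heat_semigroup_generator:
  assumes f: "quadratic_differences f B L C"
  shows "uniform_limit UNIV (\<lambda>t x. (1 / t) * (heat_semigroup p t f x - f x)) (jump_op \<kappa> J f) (at_right 0)"
proof (rule uniform_limit_cong[THEN iffD1, OF _ _ generator[OF f]])
  show "eventually (\<lambda>t. \<forall>x\<in>UNIV. (1 / t) * (Pt t f x - f x) = (1 / t) * (heat_semigroup p t f x - f x)) (at_right 0)"
    using eventually_at_right_less[of "0::real"] by eventually_elim (simp add: heat_semigroup_def Pt_def)
qed simp

end

theorem theorem1p4:
  fixes J \<phi> :: "real \<Rightarrow> real"
    and a b \<beta> \<alpha>1 a1 \<kappa>0 \<kappa>1 \<kappa>2 \<delta> :: real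
    and \<kappa> :: "'a::euclidean_space \<Rightarrow> 'a \<Rightarrow> real"
    and p :: "real \<Rightarrow> 'a \<Rightarrow> 'a \<Rightarrow> real"
  assumes "jump_kernel_assms DIM('a) J \<phi> a b \<beta> \<alpha>1 a1"
    and "coefficient_assms \<kappa> \<kappa>0 \<kappa>1 \<kappa>2 \<delta>"
    and "heat_kernel J \<phi> b \<beta> \<kappa> p"
  shows "(\<forall>\<epsilon>>0. \<forall>f\<in>Cb2_holder \<epsilon>.
           (\<forall>x. jump_op_exists \<kappa> J f x) \<and>
           uniform_limit UNIV (\<lambda>t x. (1 / t) * (heat_semigroup p t f x - f x)) (jump_op \<kappa> J f)
             (at_right 0)) \<and>
         (\<forall>q\<ge>1. analytic_semigroup_on_Lq q (heat_semigroup p))"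
proof (intro conjI allI impI ballI)
  interpret heat_kernel_setting J \<phi> a b \<beta> \<alpha>1 a1 \<kappa>0 \<kappa>1 \<kappa>2 \<delta> \<kappa> p
    by unfold_locales (fact assms)+
  show "analytic_semigroup_on_Lq q (heat_semigroup p)" if "q \<ge> 1" for q
    by (rule heat_semigroup_analytic[OF that])
  fix \<epsilon> :: real and f :: "'a \<Rightarrow> real" assume "\<epsilon> > 0" "f \<in> Cb2_holder \<epsilon>"
  then obtain B L C where f: "quadratic_differences f B L C" using Cb2_holder_quadratic_differences by blast
  show "jump_op_exists \<kappa> J f x" for x by (rule jump_op_eq(1)[OF f])
  show "uniform_limit UNIV (\<lambda>t x. (1 / t) * (heat_semigroup p t f x - f x)) (jump_op \<kappa> J f) (at_right 0)"
    by (rule heat_semigroup_generator[OF f])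
qed

end
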